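(* Let $R$ be a unital full subring of $\mathcal A^+$, let $S:=\mathcal A$ with the involution $F^*(iy)=\overline{F(iy)}$ ($y\in\mathbb R$), let $G:=\mathbb R\times\mathbb Z$, and let $\iota:=W:\mathrm{inv}\,\mathcal A\to\mathbb R\times\mathbb Z$ (all defined in the context). Then the following hold: (A1) $R$ is a commutative integral domain with identity. (A2) $S$ is a unital commutative complex semisimple Banach algebra with involution $\cdot^*$, and $R\subset S$ (identifying $F\in\mathcal A^+$ with its restriction to $i\mathbb R$). (A3) (I1) $\iota(ab)=\iota(a)+\iota(b)$ for all $a,b\in\mathrm{inv}\,S$; (I2) $\iota(a^* )=-\iota(a)$ for all $a\in\mathrm{inv}\,S$; (I3) $\iota$ is locally constant, i.e. continuous when $G$ is given the discrete topology. (A4) An element $x\in R\cap\mathrm{inv}\,S$ is invertible as an element of $R$ if and only if $\iota(x)=(0,0)$.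
   Context: Let $\mathbb C_+=\{s\in\mathbb C:\mathrm{Re}(s)\ge0\}$. $\mathcal A^+$ is the Banach algebra (pointwise operations) of functions $F(s)=\widehat{f_a}(s)+\sum_{k=0}^\infty f_ke^{-st_k}$, $s\in\mathbb C_+$, where $f_a\in L^1(0,\infty)$, $(f_k)_{k\ge0}\in\ell^1$, $t_0=0$ and $t_k>0$ for $k\ge1$ are distinct; $\widehat{f_a}(s)=\int_0^\infty e^{-st}f_a(t)\,dt$; the norm is $\|f_a\|_{L^1}+\|(f_k)\|_{\ell^1}$. $\mathcal A$ is the Banach algebra (pointwise operations) of functions on $i\mathbb R$ of the form $F(iy)=\widehat{f_a}(iy)+F_{AP}(iy)$, $F_{AP}(iy)=\sum_{k=-\infty}^\infty f_ke^{-iyt_k}$, $y\in\mathbb R$, where $f_a\in L^1(\mathbb R)$, $(f_k)_{k\in\mathbb Z}\in\ell^1$, the $t_k$ are distinct reals with $t_0=0$, $t_k>0$ for $k\geq 1$ and $t_k<0$ for $k\leq -1$; $\widehat{f_a}(iy)=\int_{-\infty}^\infty e^{-iyt}f_a(t)\,dt$; the norm is $\|f_a\|_{L^1}+\|(f_k)\|_{\ell^1}$. $\mathrm{inv}\,S$ is the set of invertible elements of $S$. If $F=\widehat{f_a}+F_{AP}\in\mathrm{inv}\,\mathcal A$, then $y\mapsto F_{AP}(iy)$ is bounded away from $0$ and $F_{AP}^{-1}\widehat{f_a}$ is the Fourier transform of an $L^1(\mathbb R)$ function, and one defines $$W(F)=\big(w(F_{AP}),\ \mathtt w(1+F_{AP}^{-1}\widehat{f_a})\big)\in\mathbb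 R\times\mathbb Z,$$ where $w(F_{AP})=\lim_{\rho\to\infty}\frac1{2\rho}\big(\arg F_{AP}(i\rho)-\arg F_{AP}(-i\rho)\big)$ and $\mathtt w(1+F_{AP}^{-1}\widehat{f_a})=\frac1{2\pi}\arg\big(1+F_{AP}(iy)^{-1}\widehat{f_a}(iy)\big)\Big|_{y=-\infty}^{y=+\infty}$, with $\arg$ denoting a continuous argument along $y\in\mathbb R$. A subring $R_1$ of a commutative unital ring $R_2$ is full if every $x\in R_1$ that is invertible in $R_2$ is invertible in $R_1$. *)

theory Defs
  imports "HOL-Analysis.Analysis" "HOL-Algebra.Algebra" "HOL-Algebra.Algebraic_Closure_Type"
begin

section \<open>Full subrings, semisimplicity, Banach algebras with involution\<close>

definition full_subring :: "'a set \<Rightarrow> ('a, 'b) ring_scheme \<Rightarrow> bool" where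
  "full_subring R A \<longleftrightarrow>
     subring R A \<and> (\<forall>x\<in>R. x \<in> Units A \<longrightarrow> x \<in> Units (A\<lparr>carrier := R\<rparr>))"

text \<open>For commutative rings: the Jacobson radical is the intersection of all maximal ideals.\<close>

definition jacobson_radical :: "('a, 'b) ring_scheme \<Rightarrow> 'a set" where
  "jacobson_radical S = carrier S \<inter> \<Inter> {I. maximalideal I S}"

definition semisimple_cring :: "('a, 'b) ring_scheme \<Rightarrow> bool" where
  "semisimple_cring S \<longleftrightarrow> jacobson_radical S = {\<zero>\<^bsub>S\<^esub>}"

text \<open>The value \<open>0\<close> off the carrier is irrelevant: the locale \<open>Metric_space\<close> demands
  nonnegativity and symmetry of the distance on the whole type.\<close>

definition norm_dist :: "('a, 'b) ring_scheme \<Rightarrow> ('a \<Rightarrow> real) \<Rightarrow> 'a \<Rightarrow> 'a \<Rightarrow> real" where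
  "norm_dist S nrm x y =
     (if x \<in> carrier S \<and> y \<in> carrier S then nrm (x \<ominus>\<^bsub>S\<^esub> y) else 0)"

text \<open>\<open>Module.algebra\<close> already comprises that \<open>S\<close> is a commutative ring with identity.\<close>

locale comm_complex_banach_algebra =
  Module.algebra "ring_of_type_algebra :: complex ring" S
  for S :: "(complex, 'a, 'm) module_scheme" (structure) +
  fixes nrm :: "'a \<Rightarrow> real"
  assumes norm_nonneg: "x \<in> carrier S \<Longrightarrow> 0 \<le> nrm x"
    and norm_eq_zero: "x \<in> carrier S \<Longrightarrow> nrm x = 0 \<longleftrightarrow> x = \<zero>"
    and norm_triangle: "\<lbrakk>x \<in> carrier S; y \<in> carrier S\<rbrakk> \<Longrightarrow> nrm (x \<oplus> y) \<le> nrm x + nrm y"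
    and norm_smult: "x \<in> carrier S \<Longrightarrow> nrm (a \<odot> x) = cmod a * nrm x"
    and norm_mult: "\<lbrakk>x \<in> carrier S; y \<in> carrier S\<rbrakk> \<Longrightarrow> nrm (x \<otimes> y) \<le> nrm x * nrm y"
    and norm_one: "nrm \<one> = 1"
    and complete: "Metric_space.mcomplete (carrier S) (norm_dist S nrm)"

definition algebra_involution ::
    "(complex, 'a, 'm) module_scheme \<Rightarrow> ('a \<Rightarrow> 'a) \<Rightarrow> bool" where
  "algebra_involution S st \<longleftrightarrow>
     st \<in> carrier S \<rightarrow> carrier S \<and>
     (\<forall>x\<in>carrier S. st (st x) = x) \<and>
     (\<forall>x\<in>carrier S. \<forall>y\<in>carrier S. st (x \<oplus>\<^bsub>S\<^esub> y) = st x \<oplus>\<^bsub>S\<^esub> st y) \<and>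
     (\<forall>a. \<forall>x\<in>carrier S. st (a \<odot>\<^bsub>S\<^esub> x) = cnj a \<odot>\<^bsub>S\<^esub> st x) \<and>
     (\<forall>x\<in>carrier S. \<forall>y\<in>carrier S. st (x \<otimes>\<^bsub>S\<^esub> y) = st y \<otimes>\<^bsub>S\<^esub> st x)"


section \<open>The algebras \<open>\<A>\<^sup>+\<close> and \<open>\<A>\<close>\<close>

text \<open>A function on a subset \<open>D\<close> of the complex plane is represented by an extensional function
  (value \<open>undefined\<close> outside \<open>D\<close>), so that equality means equality on \<open>D\<close>.\<close>

definition pointwise_algebra ::
    "complex set \<Rightarrow> (complex \<Rightarrow> complex) set \<Rightarrow> (complex, complex \<Rightarrow> complex) module" where
  "pointwise_algebra D \<F> =
     \<lparr>carrier = \<F>,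
      monoid.mult = (\<lambda>F G. \<lambda>s\<in>D. F s * G s),
      monoid.one = (\<lambda>s\<in>D. 1),
      ring.zero = (\<lambda>s\<in>D. 0),
      ring.add = (\<lambda>F G. \<lambda>s\<in>D. F s + G s),
      module.smult = (\<lambda>a F. \<lambda>s\<in>D. a * F s)\<rparr>"

definition right_half_plane :: "complex set" where
  "right_half_plane = {s. 0 \<le> Re s}"

definition imag_axis :: "complex set" where
  "imag_axis = {s. Re s = 0}"

definition Aplus_fun :: "(complex \<Rightarrow> complex) set" where
  "Aplus_fun =
     {F. \<exists>(fa :: real \<Rightarrow> complex) (f :: nat \<Rightarrow> complex) (t :: nat \<Rightarrow> real).
        set_integrable lborel {0<..} fa \<and>
        (\<lambda>k. norm (f k)) summable_on UNIV \<and>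
        inj t \<and> t 0 = 0 \<and> (\<forall>k\<ge>1. 0 < t k) \<and>
        F = (\<lambda>s\<in>right_half_plane.
               (LINT \<tau>:{0<..}|lborel. exp (- (s * of_real \<tau>)) * fa \<tau>)
               + (\<Sum>\<^sub>\<infinity>k. f k * exp (- (s * of_real (t k)))))}"

definition Aplus :: "(complex, complex \<Rightarrow> complex) module" where
  "Aplus = pointwise_algebra right_half_plane Aplus_fun"

definition fourier :: "(real \<Rightarrow> complex) \<Rightarrow> complex \<Rightarrow> complex" where
  "fourier fa s = (LINT \<tau>|lborel. exp (- (s * of_real \<tau>)) * fa \<tau>)"

definition ap_series :: "(int \<Rightarrow> complex) \<Rightarrow> (int \<Rightarrow> real) \<Rightarrow> complex \<Rightarrow> complex" where
  "ap_series f t s = (\<Sum>\<^sub>\<infinity>k. f k * exp (- (s * of_real (t k))))"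

definition A_repr ::
    "(real \<Rightarrow> complex) \<Rightarrow> (int \<Rightarrow> complex) \<Rightarrow> (int \<Rightarrow> real) \<Rightarrow> (complex \<Rightarrow> complex) \<Rightarrow> bool" where
  "A_repr fa f t F \<longleftrightarrow>
     integrable lborel fa \<and>
     (\<lambda>k. norm (f k)) summable_on UNIV \<and>
     inj t \<and> t 0 = 0 \<and> (\<forall>k\<ge>1. 0 < t k) \<and> (\<forall>k\<le>-1. t k < 0) \<and>
     F = (\<lambda>s\<in>imag_axis. fourier fa s + ap_series f t s)"

definition A_fun :: "(complex \<Rightarrow> complex) set" where
  "A_fun = {F. \<exists>fa f t. A_repr fa f t F}"

definition A_alg :: "(complex, complex \<Rightarrow> complex) module" where
  "A_alg = pointwise_algebra imag_axis A_fun"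

text \<open>The norm does not depend on the representation, since \<open>F\<close> determines \<open>fa\<close> almost everywhere
  and the measure \<open>\<Sum>k. f k \<delta>\<^bsub>t k\<^esub>\<close>.\<close>

definition A_norm :: "(complex \<Rightarrow> complex) \<Rightarrow> real" where
  "A_norm F = (THE r. \<exists>fa f t. A_repr fa f t F \<and>
     r = (LINT \<tau>|lborel. norm (fa \<tau>)) + (\<Sum>\<^sub>\<infinity>k. norm (f k)))"

definition A_star :: "(complex \<Rightarrow> complex) \<Rightarrow> complex \<Rightarrow> complex" where
  "A_star F = (\<lambda>s\<in>imag_axis. cnj (F s))"

text \<open>The map along which \<open>\<A>\<^sup>+\<close> is identified with a subset of \<open>\<A>\<close>.\<close>

definition boundary :: "(complex \<Rightarrow> complex) \<Rightarrow> complex \<Rightarrow> complex" where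
  "boundary F = restrict F imag_axis"


section \<open>The index \<open>W\<close>\<close>

definition continuous_arg :: "(real \<Rightarrow> complex) \<Rightarrow> (real \<Rightarrow> real) \<Rightarrow> bool" where
  "continuous_arg g \<theta> \<longleftrightarrow>
     continuous_on UNIV \<theta> \<and> (\<forall>y. g y \<noteq> 0 \<and> g y = rcis (cmod (g y)) (\<theta> y))"

text \<open>Two continuous arguments of the same function differ by a constant, so neither of the
  following two numbers depends on the choice of \<open>\<theta>\<close>.\<close>

definition average_winding :: "(real \<Rightarrow> complex) \<Rightarrow> real" where
  "average_winding g = (THE w. \<exists>\<theta>. continuous_arg g \<theta> \<and>
     ((\<lambda>\<rho>. 1 / (2 * \<rho>) * (\<theta> \<rho> - \<theta> (- \<rho>))) \<longlongrightarrow> w) at_top)"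

definition winding_index :: "(real \<Rightarrow> complex) \<Rightarrow> int" where
  "winding_index g = (THE n. \<exists>\<theta> a b. continuous_arg g \<theta> \<and>
     (\<theta> \<longlongrightarrow> a) at_bot \<and> (\<theta> \<longlongrightarrow> b) at_top \<and> real_of_int n = 1 / (2 * pi) * (b - a))"

definition W :: "(complex \<Rightarrow> complex) \<Rightarrow> real \<times> int" where
  "W F = (THE p. \<exists>fa f t. A_repr fa f t F \<and>
     p = (average_winding (\<lambda>y. ap_series f t (\<i> * of_real y)),
          winding_index (\<lambda>y. 1 + inverse (ap_series f t (\<i> * of_real y))
                                  * fourier fa (\<i> * of_real y))))"

end

theory Submission
  imports Defs "HOL-Probability.Levy" "HOL-Complex_Analysis.Conformal_Mappings"
    "HOL-Real_Asymp.Real_Asymp"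
begin

text \<open>
  An element of either algebra is the transform of an integrable function \<open>f\<close> plus an absolutely
  summable family \<open>\<phi>\<close> of point masses, and \<open>(f, \<phi>)\<close> is determined by the values on the imaginary axis:
  \<open>\<phi>\<close> by mean values (Riemann--Lebesgue removes \<open>f\<close>), then \<open>f\<close> by Fourier uniqueness. The algebraic
  assertions and the properties of the index follow from this and from the stability of a continuous
  argument under small relative perturbations.

  If \<open>F\<close> is invertible over the half-plane, then the translates \<open>F (s + \<sigma>)\<close> connect it to a nonzero
  constant, so its index vanishes. Conversely, let the index vanish. Replace the almost periodic part
  by a nearby trigonometric polynomial \<open>P\<close> with frequencies in \<open>{0..}\<close>. Zero mean winding makes \<open>P\<close> the
  exponential of a transform \<open>p + q\<close> with frequencies of \<open>p\<close> in \<open>{0..}\<close> and of \<open>q\<close> in \<open>{..0}\<close>; then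
  \<open>P * exp (- p) = exp q\<close> has frequencies in \<open>{0..}\<close> and in \<open>{..0}\<close>, so it is constant, and \<open>exp (- p)\<close>
  inverts \<open>P\<close> up to a constant. The remaining factor \<open>1 + k\<close> is
  approximated by a rational function with poles at negative integers, whose winding counts its
  zeros in the open right half-plane; there are none, so its linear factors can be inverted.
\<close>

text \<open>Elements are handled as pairs with an explicit norm bound because each approximation has
  to be undone in the algebra norm, not just uniformly. Two gaps between norms must be bridged. A
  function uniformly close to \<open>1\<close> need not be close to \<open>1\<close> in norm, so its
  logarithmic series is available only after the powers of an almost periodic element are shown to
  decay in norm as soon as its supremum is below \<open>1\<close>; this rests on counting
  frequencies. Moreover a perturbation has to be small against the inverse in the causal algebra,
  whereas the hypothesis bounds the inverse over the whole line only; uniqueness of the pair shows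
  that the two bounds agree. Finally, zero mean winding by itself says only that the argument grows
  sublinearly. That the logarithm is bounded comes from almost periods: a nonzero multiple of
  \<open>2 * pi\<close> gained over one almost period would be gained again at each repetition and
  so produce linear growth.\<close>

section \<open>Convolution and series in L^1\<close>

text \<open>The measure \<open>M\<close> and the shift \<open>\<tau>\<close> are left general
  because one Fubini argument serves two products: Lebesgue measure gives function times function,
  counting measure on a countable set of frequencies gives point masses times function.\<close>

lemma conv_integral:
  fixes u :: "'a \<Rightarrow> complex" and g :: "real \<Rightarrow> complex"
  assumes M: "sigma_finite_measure M" and \<tau>[measurable]: "\<tau> \<in> borel_measurable M"
    and u: "integrable M u" and g: "integrable lborel g"
  shows "integrable lborel (\<lambda>t. LINT x|M. u x * g (t - \<tau> x))"
    and "(LINT t|lborel. LINT x|M. u x * g (t - \<tau> x)) = (LINT x|M. u x) * (LINT t|lborel. g t)"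
    and "(LINT t|lborel. norm (LINT x|M. u x * g (t - \<tau> x)))
           \<le> (LINT x|M. norm (u x)) * (LINT t|lborel. norm (g t))"
proof -
  interpret M: sigma_finite_measure M by fact
  interpret pair_sigma_finite M lborel ..
  have [measurable]: "u \<in> borel_measurable M" "g \<in> borel_measurable borel"
    using u g by auto
  have tr: "integrable lborel (\<lambda>t. g (t - c))" "(LINT t|lborel. g (t - c)) = (LINT t|lborel. g t)"
      "(LINT t|lborel. norm (g (t - c))) = (LINT t|lborel. norm (g t))" for c
    using lborel_integrable_real_affine[OF g, of 1 "-c"] lborel_integral_real_affine[of 1 g "-c"]
       lborel_integral_real_affine[of 1 "\<lambda>x. norm (g x)" "-c"]
    by (simp_all add: algebra_simps)
  let ?f = "\<lambda>x t. u x * g (t - \<tau> x)"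
  have int: "integrable (M \<Otimes>\<^sub>M lborel) (\<lambda>(x, t). ?f x t)"
  proof (rule Fubini_integrable)
    show "(\<lambda>(x, t). ?f x t) \<in> borel_measurable (M \<Otimes>\<^sub>M lborel)" by measurable
    show "integrable M (\<lambda>x. LINT t|lborel. norm (case (x, t) of (x, t) \<Rightarrow> ?f x t))"
      using u by (simp add: norm_mult tr)
    show "AE x in M. integrable lborel (\<lambda>t. case (x, t) of (x, t) \<Rightarrow> ?f x t)"
      using tr by simp
  qed
  then show i: "integrable lborel (\<lambda>t. LINT x|M. ?f x t)"
    by (rule integrable_snd)
  show "(LINT t|lborel. LINT x|M. ?f x t) = (LINT x|M. u x) * (LINT t|lborel. g t)"
    using Fubini_integral[OF int] by (simp add: tr)
  have int': "integrable (M \<Otimes>\<^sub>M lborel) (\<lambda>(x, t). norm (?f x t))"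
    using integrable_norm[OF int] by (simp add: case_prod_unfold)
  have "(LINT t|lborel. norm (LINT x|M. ?f x t)) \<le> (LINT t|lborel. LINT x|M. norm (?f x t))"
    using i integrable_snd[OF int'] by (intro integral_mono) (auto intro: integral_norm_bound)
  also have "\<dots> = (LINT x|M. LINT t|lborel. norm (?f x t))"
    by (rule Fubini_integral[OF int'])
  also have "\<dots> = (LINT x|M. norm (u x)) * (LINT t|lborel. norm (g t))"
    by (simp add: norm_mult tr)
  finally show "(LINT t|lborel. norm (LINT x|M. ?f x t)) \<le> (LINT x|M. norm (u x)) * (LINT t|lborel. norm (g t))" .
qed

text \<open>Completeness of L^1 in series form, over any measure, so that it applies to functions
  and, through counting measure, to point masses. A majorant \<open>r\<close> is assumed because for
  pairs only the sum of the two norms is bounded.\<close>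

lemma suminf_L1:
  fixes f :: "nat \<Rightarrow> 'a \<Rightarrow> complex"
  assumes f: "\<And>n. integrable M (f n)" and r: "\<And>n. (LINT x|M. norm (f n x)) \<le> r n" and "summable r"
  shows "integrable M (\<lambda>x. suminf (\<lambda>n. f n x))"
    and "(\<lambda>n. LINT x|M. f n x) sums (LINT x|M. suminf (\<lambda>n. f n x))"
    and "(LINT x|M. norm (suminf (\<lambda>n. f n x))) \<le> suminf (\<lambda>n. LINT x|M. norm (f n x))"
    and "AE x in M. summable (\<lambda>n. norm (f n x))"
proof -
  have [measurable]: "\<And>n. f n \<in> borel_measurable M" using f by auto
  have su: "summable (\<lambda>n. LINT x|M. norm (f n x))"
    by (rule summable_comparison_test'[OF \<open>summable r\<close>, of 0]) (use r in auto)
  have "(\<integral>\<^sup>+x. suminf (\<lambda>n. ennreal (norm (f n x))) \<partial>M) = suminf (\<lambda>n. \<integral>\<^sup>+x. ennreal (norm (f n x)) \<partial>M)"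
    by (rule nn_integral_suminf) auto
  also have "\<dots> = suminf (\<lambda>n. ennreal (LINT x|M. norm (f n x)))"
    using f by (intro suminf_cong nn_integral_eq_integral) auto
  also have "\<dots> < \<infinity>" using su by (subst suminf_ennreal2) auto
  finally have "AE x in M. suminf (\<lambda>n. ennreal (norm (f n x))) \<noteq> \<infinity>"
    by (intro nn_integral_noteq_infinite) auto
  then show ae: "AE x in M. summable (\<lambda>n. norm (f n x))"
    by eventually_elim (auto intro: summable_suminf_not_top)
  show "integrable M (\<lambda>x. suminf (\<lambda>n. f n x))"
    by (rule integrable_suminf[OF f ae su])
  show "(\<lambda>n. LINT x|M. f n x) sums (LINT x|M. suminf (\<lambda>n. f n x))"
    by (rule sums_integral[OF f ae su])
  have "(LINT x|M. norm (suminf (\<lambda>n. f n x))) \<le> (LINT x|M. suminf (\<lambda>n. norm (f n x)))"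
  proof (rule integral_mono_AE)
    show "integrable M (\<lambda>x. norm (suminf (\<lambda>n. f n x)))"
      using integrable_suminf[OF f ae su] by simp
    show "integrable M (\<lambda>x. suminf (\<lambda>n. norm (f n x)))"
      using integrable_suminf[of M "\<lambda>n x. norm (f n x)"] f ae su by auto
    show "AE x in M. norm (suminf (\<lambda>n. f n x)) \<le> suminf (\<lambda>n. norm (f n x))"
      using ae by eventually_elim (rule summable_norm)
  qed
  also have "\<dots> = suminf (\<lambda>n. LINT x|M. norm (f n x))"
    using integral_suminf[of M "\<lambda>n x. norm (f n x)"] f ae su by auto
  finally show "(LINT x|M. norm (suminf (\<lambda>n. f n x))) \<le> suminf (\<lambda>n. LINT x|M. norm (f n x))" .
qed

lemma abs_summable_iff_integrable:
  fixes \<phi> :: "'a \<Rightarrow> complex"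
  shows "(\<lambda>x. norm (\<phi> x)) summable_on A \<longleftrightarrow> integrable (count_space A) \<phi>"
  using abs_summable_equivalent[of \<phi> A] by (simp add: Infinite_Set_Sum.abs_summable_on_def)

lemma infsum_eq_integral:
  fixes \<phi> :: "'a \<Rightarrow> 'b::{banach, second_countable_topology}"
  assumes "(\<lambda>x. norm (\<phi> x)) summable_on A"
  shows "infsum \<phi> A = integral\<^sup>L (count_space A) \<phi>"
  using infsetsum_infsum[of \<phi> A] assms by (simp add: infsetsum_def abs_summable_equivalent)

lemma infsum_norm_eq_integral:
  fixes \<phi> :: "'a \<Rightarrow> complex"
  assumes "(\<lambda>x. norm (\<phi> x)) summable_on A"
  shows "(\<Sum>\<^sub>\<infinity>x\<in>A. norm (\<phi> x)) = (LINT x|count_space A. norm (\<phi> x))"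
  by (rule infsum_eq_integral) (use assms in simp)

lemma countable_support:
  fixes \<phi> :: "'a \<Rightarrow> complex"
  assumes "(\<lambda>x. norm (\<phi> x)) summable_on UNIV"
  shows "countable {x. \<phi> x \<noteq> 0}"
  using abs_summable_countable[OF assms] by simp

section \<open>Transforms of a function plus point masses\<close>

text \<open>\<open>conv_integral\<close> asks for a Lebesgue integrable factor and so does not cover
  two families of point masses. Absolute summability over the sheared pairs \<open>(x, z)\<close>
  permits exchanging the unordered sums.\<close>

lemma conv_infsum:
  fixes \<phi> \<psi> :: "real \<Rightarrow> complex"
  assumes \<phi>: "(\<lambda>x. norm (\<phi> x)) summable_on UNIV" and \<psi>: "(\<lambda>x. norm (\<psi> x)) summable_on UNIV"
  shows "(\<lambda>z. norm (\<Sum>\<^sub>\<infinity>x. \<phi> x * \<psi> (z - x))) summable_on UNIV"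
    and "(\<Sum>\<^sub>\<infinity>z. \<Sum>\<^sub>\<infinity>x. \<phi> x * \<psi> (z - x)) = (\<Sum>\<^sub>\<infinity>x. \<phi> x) * (\<Sum>\<^sub>\<infinity>x. \<psi> x)"
    and "(\<Sum>\<^sub>\<infinity>z. norm (\<Sum>\<^sub>\<infinity>x. \<phi> x * \<psi> (z - x))) \<le> (\<Sum>\<^sub>\<infinity>x. norm (\<phi> x)) * (\<Sum>\<^sub>\<infinity>x. norm (\<psi> x))"
proof -
  define g where "g = (\<lambda>(x, z). \<phi> x * \<psi> (z - x))"
  have bij: "bij_betw (\<lambda>z. z - x) UNIV UNIV" for x :: real
    by (rule bij_betwI[where g="\<lambda>z. z + x"]) auto
  have shift: "(\<lambda>z. h (z - x)) summable_on UNIV \<longleftrightarrow> h summable_on UNIV"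
    "(\<Sum>\<^sub>\<infinity>z. h (z - x)) = (\<Sum>\<^sub>\<infinity>z. h z)" for h :: "real \<Rightarrow> 'b::{banach}" and x
    by (rule summable_on_reindex_bij_betw[OF bij], rule infsum_reindex_bij_betw[OF bij])
  have inner: "(\<Sum>\<^sub>\<infinity>z. norm (g (x, z))) = norm (\<phi> x) * (\<Sum>\<^sub>\<infinity>x. norm (\<psi> x))" for x
    unfolding g_def by (simp add: norm_mult infsum_cmult_right' shift(2)[of "\<lambda>z. norm (\<psi> z)"])
  have "(\<lambda>p. norm (g p)) summable_on (UNIV \<times> UNIV)"
  proof (subst Infinite_Sum.abs_summable_on_Sigma_iff, intro conjI ballI)
    fix x
    show "(\<lambda>z. norm (g (x, z))) summable_on UNIV"
      using shift(1)[of "\<lambda>z. norm (\<psi> z)" x] \<psi>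
      by (auto simp: g_def norm_mult intro: summable_on_cmult_right)
    show "(\<lambda>x. norm (\<Sum>\<^sub>\<infinity>z. norm (g (x, z)))) summable_on UNIV"
      unfolding inner using \<phi> by (simp add: abs_mult infsum_nonneg summable_on_cmult_left)
  qed
  then have g: "(\<lambda>(x,z). norm (g (x,z))) summable_on (UNIV \<times> UNIV)" by (simp add: case_prod_unfold)
  then have g': "(\<lambda>(x,z). g (x,z)) summable_on (UNIV \<times> UNIV)"
    using abs_summable_summable[of g "UNIV \<times> UNIV"] by (simp add: case_prod_unfold)
  have gs: "(\<lambda>p. norm (case p of (z, x) \<Rightarrow> g (x, z))) summable_on (UNIV \<times> UNIV)"
    using g summable_on_swap[of "\<lambda>(x,z). norm (g (x,z))" UNIV UNIV] by (simp add: case_prod_unfold)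
  note ss = gs[THEN iffD1[OF Infinite_Sum.abs_summable_on_Sigma_iff]]
  have i: "(\<lambda>x. norm (g (x, z))) summable_on UNIV" for z
    using ss by simp
  have s2: "(\<lambda>z. \<Sum>\<^sub>\<infinity>x. norm (g (x, z))) summable_on UNIV"
    using ss by (simp add: infsum_nonneg)
  have le: "norm (\<Sum>\<^sub>\<infinity>x. g (x, z)) \<le> (\<Sum>\<^sub>\<infinity>x. norm (g (x, z)))" for z
    by (rule norm_infsum_bound) (rule i)
  have s3: "(\<lambda>z. norm (\<Sum>\<^sub>\<infinity>x. g (x, z))) summable_on UNIV"
    by (rule Infinite_Sum.summable_on_comparison_test[OF s2]) (auto intro: le)
  then show "(\<lambda>z. norm (\<Sum>\<^sub>\<infinity>x. \<phi> x * \<psi> (z - x))) summable_on UNIV"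
    by (simp add: g_def)
  have "(\<Sum>\<^sub>\<infinity>z. \<Sum>\<^sub>\<infinity>x. g (x, z)) = (\<Sum>\<^sub>\<infinity>x. \<Sum>\<^sub>\<infinity>z. g (x, z))"
    by (rule infsum_swap_banach[OF g', symmetric])
  also have "\<dots> = (\<Sum>\<^sub>\<infinity>x. \<phi> x * (\<Sum>\<^sub>\<infinity>x. \<psi> x))"
    by (simp add: g_def infsum_cmult_right' shift(2)[of "\<psi>"])
  finally show "(\<Sum>\<^sub>\<infinity>z. \<Sum>\<^sub>\<infinity>x. \<phi> x * \<psi> (z - x)) = (\<Sum>\<^sub>\<infinity>x. \<phi> x) * (\<Sum>\<^sub>\<infinity>x. \<psi> x)"
    by (simp add: g_def infsum_cmult_left')
  have "(\<Sum>\<^sub>\<infinity>z. norm (\<Sum>\<^sub>\<infinity>x. g (x, z))) \<le> (\<Sum>\<^sub>\<infinity>z. \<Sum>\<^sub>\<infinity>x. norm (g (x, z)))"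
    by (rule infsum_mono[OF s3 s2 le])
  also have "\<dots> = (\<Sum>\<^sub>\<infinity>x. \<Sum>\<^sub>\<infinity>z. norm (g (x, z)))"
    by (rule infsum_swap_banach[OF g, symmetric])
  also have "\<dots> = (\<Sum>\<^sub>\<infinity>x. norm (\<phi> x)) * (\<Sum>\<^sub>\<infinity>x. norm (\<psi> x))"
    by (simp add: inner infsum_cmult_left')
  finally show "(\<Sum>\<^sub>\<infinity>z. norm (\<Sum>\<^sub>\<infinity>x. \<phi> x * \<psi> (z - x))) \<le> (\<Sum>\<^sub>\<infinity>x. norm (\<phi> x)) * (\<Sum>\<^sub>\<infinity>x. norm (\<psi> x))"
    by (simp add: g_def)
qed

text \<open>Coefficients are indexed by the frequency itself, not by a position in an enumeration:
  products become convolutions, and uniqueness becomes equality of functions.\<close>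

definition trig :: "(real \<Rightarrow> complex) \<Rightarrow> complex \<Rightarrow> complex" where
  "trig \<phi> s = (\<Sum>\<^sub>\<infinity>x. \<phi> x * exp (- (s * of_real x)))"

text \<open>The region in which \<open>exp (- s * x)\<close> is bounded by \<open>1\<close> for every \<open>x\<close> in \<open>L\<close>: the closed right
  half-plane for \<open>L = {0..}\<close>, the imaginary axis for \<open>L = UNIV\<close>.\<close>

definition kernel_dom :: "real set \<Rightarrow> complex set" where
  "kernel_dom L = {s. \<forall>x\<in>L. 0 \<le> Re s * x}"

text \<open>With \<open>K = L = UNIV\<close> the transforms of these pairs form \<open>\<A>\<close>, with \<open>K = {0<..}\<close> and \<open>L = {0..}\<close> they
  form \<open>\<A>\<^sup>+\<close>, with \<open>K = {}\<close> their almost periodic parts.\<close>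

definition wpair :: "real set \<Rightarrow> real set \<Rightarrow> (real \<Rightarrow> complex) \<Rightarrow> (real \<Rightarrow> complex) \<Rightarrow> bool" where
  "wpair K L f \<phi> \<longleftrightarrow> integrable lborel f \<and> (\<forall>x. x \<notin> K \<longrightarrow> f x = 0) \<and>
     (\<lambda>x. norm (\<phi> x)) summable_on UNIV \<and> (\<forall>x. x \<notin> L \<longrightarrow> \<phi> x = 0)"

definition wnorm :: "(real \<Rightarrow> complex) \<Rightarrow> (real \<Rightarrow> complex) \<Rightarrow> real" where
  "wnorm f \<phi> = (LINT x|lborel. norm (f x)) + (\<Sum>\<^sub>\<infinity>x. norm (\<phi> x))"

definition wev :: "(real \<Rightarrow> complex) \<Rightarrow> (real \<Rightarrow> complex) \<Rightarrow> complex \<Rightarrow> complex" where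
  "wev f \<phi> s = fourier f s + trig \<phi> s"

text \<open>A bound \<open>r\<close> takes the place of a norm: bounds pass through sums, products
  and series without any choice of representation. \<open>F\<close> is constrained only on
  \<open>kernel_dom L\<close>.\<close>

definition wien :: "real set \<Rightarrow> real set \<Rightarrow> (complex \<Rightarrow> complex) \<Rightarrow> real \<Rightarrow> bool" where
  "wien K L F r \<longleftrightarrow> (\<exists>f \<phi>. wpair K L f \<phi> \<and> (\<forall>s\<in>kernel_dom L. F s = wev f \<phi> s) \<and> wnorm f \<phi> \<le> r)"

text \<open>The sign condition is demanded only where the coefficient is nonzero; this is how the
  supports \<open>K\<close> and \<open>L\<close> enter all estimates.\<close>

lemma kernel_bound:
  "(c \<noteq> 0 \<Longrightarrow> 0 \<le> Re s * x) \<Longrightarrow> norm (exp (- (s * of_real x)) * c) \<le> norm c"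
  by (cases "c = 0") (auto simp: norm_mult mult_left_le_one_le)

lemma kernel_add: fixes s :: complex shows "exp (- (s * of_real (x + y))) = exp (- (s * of_real x)) * exp (- (s * of_real y))"
proof -
  have "- (s * of_real (x + y)) = - (s * of_real x) + - (s * complex_of_real y)"
    by (simp add: algebra_simps)
  then show ?thesis by (simp only: exp_add)
qed

lemma kernel_measurable [measurable]: "(\<lambda>x. exp (- (s * complex_of_real x))) \<in> borel_measurable borel"
  by (intro borel_measurable_continuous_onI continuous_intros)

lemma kernel_integrable:
  assumes f: "integrable M f" and [measurable]: "\<tau> \<in> borel_measurable M" and s: "\<And>x. f x \<noteq> 0 \<Longrightarrow> 0 \<le> Re s * \<tau> x"
  shows "integrable M (\<lambda>x. exp (- (s * complex_of_real (\<tau> x))) * f x)"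
    "(LINT x|M. norm (exp (- (s * complex_of_real (\<tau> x))) * f x)) \<le> (LINT x|M. norm (f x))"
proof -
  have [measurable]: "f \<in> borel_measurable M" using f by auto
  have [measurable]: "(\<lambda>x. exp (- (s * complex_of_real (\<tau> x)))) \<in> borel_measurable M"
    using measurable_compose[OF \<open>\<tau> \<in> borel_measurable M\<close> kernel_measurable] .
  show i: "integrable M (\<lambda>x. exp (- (s * complex_of_real (\<tau> x))) * f x)"
    by (rule Bochner_Integration.integrable_bound[OF f]) (measurable, use s kernel_bound in auto)
  show "(LINT x|M. norm (exp (- (s * complex_of_real (\<tau> x))) * f x)) \<le> (LINT x|M. norm (f x))"
    using i f s kernel_bound by (intro integral_mono) auto
qed

lemma kernel_summable:
  assumes \<phi>: "(\<lambda>x. norm (\<phi> x)) summable_on UNIV" and s: "\<And>x. \<phi> x \<noteq> 0 \<Longrightarrow> 0 \<le> Re s * x"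
  shows "(\<lambda>x. norm (\<phi> x * exp (- (s * of_real x)))) summable_on UNIV"
    "(\<Sum>\<^sub>\<infinity>x. norm (\<phi> x * exp (- (s * of_real x)))) \<le> (\<Sum>\<^sub>\<infinity>x. norm (\<phi> x))"
proof -
  have le: "norm (\<phi> x * exp (- (s * of_real x))) \<le> norm (\<phi> x)" for x
    using kernel_bound[OF s] by (simp add: mult.commute)
  show 1: "(\<lambda>x. norm (\<phi> x * exp (- (s * of_real x)))) summable_on UNIV"
    by (rule Infinite_Sum.summable_on_comparison_test[OF \<phi>]) (use le in auto)
  show "(\<Sum>\<^sub>\<infinity>x. norm (\<phi> x * exp (- (s * of_real x)))) \<le> (\<Sum>\<^sub>\<infinity>x. norm (\<phi> x))"
    by (rule infsum_mono[OF 1 \<phi> le])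
qed

lemma norm_fourier_le:
  assumes "integrable lborel f" "\<And>x. f x \<noteq> 0 \<Longrightarrow> 0 \<le> Re s * x"
  shows "norm (fourier f s) \<le> (LINT x|lborel. norm (f x))"
proof -
  have "norm (fourier f s) \<le> (LINT x|lborel. norm (exp (- (s * complex_of_real x)) * f x))"
    unfolding fourier_def by (rule integral_norm_bound)
  also have "\<dots> \<le> (LINT x|lborel. norm (f x))"
    by (rule kernel_integrable(2)[OF assms(1) _ assms(2)]) auto
  finally show ?thesis .
qed

lemma norm_trig_le:
  assumes "(\<lambda>x. norm (\<phi> x)) summable_on UNIV" "\<And>x. \<phi> x \<noteq> 0 \<Longrightarrow> 0 \<le> Re s * x"
  shows "norm (trig \<phi> s) \<le> (\<Sum>\<^sub>\<infinity>x. norm (\<phi> x))"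
proof -
  have "norm (trig \<phi> s) \<le> (\<Sum>\<^sub>\<infinity>x. norm (\<phi> x * exp (- (s * of_real x))))"
    unfolding trig_def by (rule norm_infsum_bound[OF kernel_summable(1)[OF assms]])
  also have "\<dots> \<le> (\<Sum>\<^sub>\<infinity>x. norm (\<phi> x))"
    by (rule kernel_summable(2)[OF assms])
  finally show ?thesis .
qed

lemma fourier_add:
  assumes "integrable lborel f" "integrable lborel g"
    and "\<And>x. f x \<noteq> 0 \<Longrightarrow> 0 \<le> Re s * x" "\<And>x. g x \<noteq> 0 \<Longrightarrow> 0 \<le> Re s * x"
  shows "fourier (\<lambda>x. f x + g x) s = fourier f s + fourier g s"
  unfolding fourier_def
  using kernel_integrable(1)[of lborel f "\<lambda>x. x" s] kernel_integrable(1)[of lborel g "\<lambda>x. x" s] assms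
  by (simp add: algebra_simps)

lemma fourier_cmult: "fourier (\<lambda>x. c * f x) s = c * fourier f s"
  unfolding fourier_def by (simp add: mult.left_commute)

lemma trig_cmult: "trig (\<lambda>x. c * f x) s = c * trig f s"
  unfolding trig_def by (simp add: mult.assoc infsum_cmult_right')

lemma trig_add:
  assumes "(\<lambda>x. norm (f x)) summable_on UNIV" "(\<lambda>x. norm (g x)) summable_on UNIV"
    and "\<And>x. f x \<noteq> 0 \<Longrightarrow> 0 \<le> Re s * x" "\<And>x. g x \<noteq> 0 \<Longrightarrow> 0 \<le> Re s * x"
  shows "trig (\<lambda>x. f x + g x) s = trig f s + trig g s"
  unfolding trig_def
  using kernel_summable(1)[of f s, THEN abs_summable_summable] kernel_summable(1)[of g s, THEN abs_summable_summable] assms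
  by (simp add: distrib_right infsum_add)

lemma norm_add_summable:
  fixes f g :: "'a \<Rightarrow> complex"
  assumes "(\<lambda>x. norm (f x)) summable_on A" "(\<lambda>x. norm (g x)) summable_on A"
  shows "(\<lambda>x. norm (f x + g x)) summable_on A"
    "(\<Sum>\<^sub>\<infinity>x\<in>A. norm (f x + g x)) \<le> (\<Sum>\<^sub>\<infinity>x\<in>A. norm (f x)) + (\<Sum>\<^sub>\<infinity>x\<in>A. norm (g x))"
proof -
  have s: "(\<lambda>x. norm (f x) + norm (g x)) summable_on A"
    using assms by (rule summable_on_add)
  show 1: "(\<lambda>x. norm (f x + g x)) summable_on A"
    by (rule Infinite_Sum.summable_on_comparison_test[OF s]) (auto intro: norm_triangle_ineq)
  show "(\<Sum>\<^sub>\<infinity>x\<in>A. norm (f x + g x)) \<le> (\<Sum>\<^sub>\<infinity>x\<in>A. norm (f x)) + (\<Sum>\<^sub>\<infinity>x\<in>A. norm (g x))"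
    unfolding infsum_add[OF assms, symmetric]
    by (rule infsum_mono[OF 1 s]) (rule norm_triangle_ineq)
qed

lemma wpair_dom:
  assumes "wpair K L f \<phi>" "K \<subseteq> L" "s \<in> kernel_dom L"
  shows "f x \<noteq> 0 \<Longrightarrow> 0 \<le> Re s * x" "\<phi> x \<noteq> 0 \<Longrightarrow> 0 \<le> Re s * x"
  using assms by (auto simp: wpair_def kernel_dom_def)

text \<open>The kernel is multiplicative in time, so it can be distributed over the two factors; the
  transform of the convolution is then the total integral of a convolution of weighted
  factors.\<close>

lemma fourier_transform_conv:
  assumes M: "sigma_finite_measure M" and \<tau>: "\<tau> \<in> borel_measurable M"
    and u: "integrable M u" and g: "integrable lborel g"
    and "\<And>x. u x \<noteq> 0 \<Longrightarrow> 0 \<le> Re s * \<tau> x" "\<And>x. g x \<noteq> 0 \<Longrightarrow> 0 \<le> Re s * x"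
  shows "fourier (\<lambda>t. LINT x|M. u x * g (t - \<tau> x)) s
           = (LINT x|M. exp (- (s * of_real (\<tau> x))) * u x) * fourier g s"
proof -
  let ?e = "\<lambda>x::real. exp (- (s * of_real x))"
  have "?e t * (u x * g (t - \<tau> x)) = (?e (\<tau> x) * u x) * (?e (t - \<tau> x) * g (t - \<tau> x))" for t x
    using kernel_add[of s "\<tau> x" "t - \<tau> x"] by (simp add: algebra_simps)
  then have "?e t * (LINT x|M. u x * g (t - \<tau> x))
      = (LINT x|M. (?e (\<tau> x) * u x) * (?e (t - \<tau> x) * g (t - \<tau> x)))" for t
    by (simp only: integral_mult_right_zero[symmetric])
  then show ?thesis
    unfolding fourier_def
    using conv_integral(2)[OF M \<tau> kernel_integrable(1)[OF u \<tau>] kernel_integrable(1)[OF g, of "\<lambda>x. x"], of s s] assms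
    by simp
qed

lemma fourier_mult:
  assumes f: "integrable lborel f" "\<And>x. x \<notin> K \<Longrightarrow> f x = 0"
    and g: "integrable lborel g" "\<And>x. x \<notin> K' \<Longrightarrow> g x = 0"
    and K: "\<And>x y. x \<in> K \<Longrightarrow> y \<in> K' \<Longrightarrow> x + y \<in> K''"
  obtains h where "integrable lborel h" "\<And>x. x \<notin> K'' \<Longrightarrow> h x = 0"
    "(LINT x|lborel. norm (h x)) \<le> (LINT x|lborel. norm (f x)) * (LINT x|lborel. norm (g x))"
    "\<And>s. s \<in> kernel_dom K \<Longrightarrow> s \<in> kernel_dom K' \<Longrightarrow> fourier h s = fourier f s * fourier g s"
proof
  let ?h = "\<lambda>t. LINT x|lborel. f x * g (t - x)"
  have sf: "sigma_finite_measure (lborel::real measure)" ..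
  note c = conv_integral[OF sf _ f(1) g(1), of "\<lambda>x. x"]
  show "integrable lborel ?h" using c(1) by simp
  show "(LINT x|lborel. norm (?h x)) \<le> (LINT x|lborel. norm (f x)) * (LINT x|lborel. norm (g x))"
    using c(3) by simp
  have "f x * g (t - x) = 0" if "t \<notin> K''" for t x
    using that K[of x "t - x"] f(2)[of x] g(2)[of "t - x"] by fastforce
  then show "?h t = 0" if "t \<notin> K''" for t using that by (simp only: Bochner_Integration.integral_zero infsum_0 simp_thms)
  show "fourier ?h s = fourier f s * fourier g s" if "s \<in> kernel_dom K" "s \<in> kernel_dom K'" for s
    using that fourier_transform_conv[OF sf _ f(1) g(1), of "\<lambda>x. x" s] f(2) g(2)
    by (force simp: kernel_dom_def fourier_def)
qed

lemma trig_fourier_mult: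
  assumes \<phi>: "(\<lambda>x. norm (\<phi> x)) summable_on UNIV" "\<And>x. x \<notin> L \<Longrightarrow> \<phi> x = 0"
    and g: "integrable lborel g" "\<And>x. x \<notin> K \<Longrightarrow> g x = 0"
    and K: "\<And>x y. x \<in> L \<Longrightarrow> y \<in> K \<Longrightarrow> x + y \<in> K''"
  obtains h where "integrable lborel h" "\<And>x. x \<notin> K'' \<Longrightarrow> h x = 0"
    "(LINT x|lborel. norm (h x)) \<le> (\<Sum>\<^sub>\<infinity>x. norm (\<phi> x)) * (LINT x|lborel. norm (g x))"
    "\<And>s. s \<in> kernel_dom L \<Longrightarrow> s \<in> kernel_dom K \<Longrightarrow> fourier h s = trig \<phi> s * fourier g s"
proof
  \<comment> \<open>Counting measure on the whole line is not sigma-finite; on the countable support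
    it is, and \<open>conv_integral\<close> applies.\<close>
  define C where "C = {x. \<phi> x \<noteq> 0}"
  have "countable C" unfolding C_def by (rule countable_support[OF \<phi>(1)])
  let ?M = "count_space C"
  have sf: "sigma_finite_measure ?M"
    by (rule sigma_finite_measure_count_space_countable) fact
  let ?h = "\<lambda>t. LINT x|?M. \<phi> x * g (t - x)"
  have sC: "(\<lambda>x. norm (\<phi> x)) summable_on C"
    using \<phi>(1) summable_on_subset_banach by blast
  then have iC: "integrable ?M \<phi>" by (simp add: abs_summable_iff_integrable)
  have m: "(\<lambda>x. x) \<in> borel_measurable ?M" by simp
  note c = conv_integral[OF sf m iC g(1)]
  show "integrable lborel ?h" using c(1) by simp
  have "(\<Sum>\<^sub>\<infinity>x. norm (\<phi> x)) = (\<Sum>\<^sub>\<infinity>x\<in>C. norm (\<phi> x))"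
    by (rule infsum_cong_neutral) (auto simp: C_def)
  then show "(LINT x|lborel. norm (?h x)) \<le> (\<Sum>\<^sub>\<infinity>x. norm (\<phi> x)) * (LINT x|lborel. norm (g x))"
    using c(3) by (simp add: infsum_norm_eq_integral[OF sC])
  have "\<phi> x * g (t - x) = 0" if "t \<notin> K''" for t x
    using that K[of x "t - x"] \<phi>(2)[of x] g(2)[of "t - x"] by fastforce
  then show "?h t = 0" if "t \<notin> K''" for t using that by (simp only: Bochner_Integration.integral_zero infsum_0 simp_thms)
  fix s assume s: "s \<in> kernel_dom L" "s \<in> kernel_dom K"
  have pos: "\<phi> x \<noteq> 0 \<Longrightarrow> 0 \<le> Re s * x" for x
    using s(1) \<phi>(2) by (auto simp: kernel_dom_def)
  have "(\<lambda>x. norm (\<phi> x * exp (- (s * of_real x)))) summable_on C"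
    using kernel_summable(1)[OF \<phi>(1) pos] summable_on_subset_banach by blast
  then have "(\<Sum>\<^sub>\<infinity>x\<in>C. \<phi> x * exp (- (s * of_real x))) = (LINT x|?M. \<phi> x * exp (- (s * of_real x)))"
    by (rule infsum_eq_integral)
  moreover have "trig \<phi> s = (\<Sum>\<^sub>\<infinity>x\<in>C. \<phi> x * exp (- (s * of_real x)))"
    unfolding trig_def by (rule infsum_cong_neutral) (auto simp: C_def)
  ultimately have "trig \<phi> s = (LINT x|?M. exp (- (s * of_real x)) * \<phi> x)"
    by (simp add: mult.commute)
  then show "fourier ?h s = trig \<phi> s * fourier g s"
    using fourier_transform_conv[OF sf m iC g(1), of s] pos s(2) g(2)
    by (force simp: kernel_dom_def)
qed

lemma trig_mult:
  assumes \<phi>: "(\<lambda>x. norm (\<phi> x)) summable_on UNIV" "\<And>x. x \<notin> L \<Longrightarrow> \<phi> x = 0"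
    and \<psi>: "(\<lambda>x. norm (\<psi> x)) summable_on UNIV" "\<And>x. x \<notin> L' \<Longrightarrow> \<psi> x = 0"
    and K: "\<And>x y. x \<in> L \<Longrightarrow> y \<in> L' \<Longrightarrow> x + y \<in> L''"
  obtains ch where "(\<lambda>x. norm (ch x)) summable_on UNIV" "\<And>x. x \<notin> L'' \<Longrightarrow> ch x = 0"
    "(\<Sum>\<^sub>\<infinity>x. norm (ch x)) \<le> (\<Sum>\<^sub>\<infinity>x. norm (\<phi> x)) * (\<Sum>\<^sub>\<infinity>x. norm (\<psi> x))"
    "\<And>s. s \<in> kernel_dom L \<Longrightarrow> s \<in> kernel_dom L' \<Longrightarrow> trig ch s = trig \<phi> s * trig \<psi> s"
proof
  let ?ch = "\<lambda>z. \<Sum>\<^sub>\<infinity>x. \<phi> x * \<psi> (z - x)"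
  note c = conv_infsum[OF \<phi>(1) \<psi>(1)]
  show "(\<lambda>x. norm (?ch x)) summable_on UNIV" by (rule c)
  show "(\<Sum>\<^sub>\<infinity>x. norm (?ch x)) \<le> (\<Sum>\<^sub>\<infinity>x. norm (\<phi> x)) * (\<Sum>\<^sub>\<infinity>x. norm (\<psi> x))" by (rule c)
  have "\<phi> x * \<psi> (t - x) = 0" if "t \<notin> L''" for t x
    using that K[of x "t - x"] \<phi>(2)[of x] \<psi>(2)[of "t - x"] by fastforce
  then show "?ch t = 0" if "t \<notin> L''" for t using that by (simp only: Bochner_Integration.integral_zero infsum_0 simp_thms)
  fix s assume s: "s \<in> kernel_dom L" "s \<in> kernel_dom L'"
  let ?e = "\<lambda>x::real. exp (- (s * of_real x))"
  have 1: "(\<lambda>x. norm (\<phi> x * ?e x)) summable_on UNIV"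
    by (rule kernel_summable(1)[OF \<phi>(1)]) (use s \<phi>(2) in \<open>auto simp: kernel_dom_def\<close>)
  have 2: "(\<lambda>x. norm (\<psi> x * ?e x)) summable_on UNIV"
    by (rule kernel_summable(1)[OF \<psi>(1)]) (use s \<psi>(2) in \<open>auto simp: kernel_dom_def\<close>)
  have "\<phi> x * \<psi> (z - x) * ?e z = (\<phi> x * ?e x) * (\<psi> (z - x) * ?e (z - x))" for x z
    using kernel_add[of s "x" "z - x"] by (simp add: algebra_simps)
  then have "?ch z * ?e z = (\<Sum>\<^sub>\<infinity>x. (\<phi> x * ?e x) * (\<psi> (z - x) * ?e (z - x)))" for z
    by (simp only: infsum_cmult_left'[symmetric])
  then show "trig ?ch s = trig \<phi> s * trig \<psi> s"
    unfolding trig_def using conv_infsum(2)[OF 1 2] by simp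
qed

text \<open>The conditions under which the pairs are closed under multiplication. Since
  \<open>K\<close> absorbs translations by \<open>L\<close>, the function parts form an
  ideal.\<close>

definition wadm :: "real set \<Rightarrow> real set \<Rightarrow> bool" where
  "wadm K L \<longleftrightarrow> K \<subseteq> L \<and> 0 \<in> L \<and> (\<forall>x\<in>L. \<forall>y\<in>K. x + y \<in> K) \<and> (\<forall>x\<in>L. \<forall>y\<in>L. x + y \<in> L)"

lemma wadm_UNIV [simp]: "wadm UNIV UNIV" by (simp add: wadm_def)

lemma wadm_nonneg [simp]: "wadm {0<..} {0..}" by (auto simp: wadm_def)

lemma wadm_empty [simp]: "wadm {} UNIV" "wadm {} {0..}" "wadm {} {..0}" by (auto simp: wadm_def)

lemma kernel_dom_UNIV: "kernel_dom UNIV = imag_axis"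
proof -
  have "Re s = 0" if "\<forall>x. 0 \<le> Re s * x" for s
    using that[rule_format, of 1] that[rule_format, of "-1"] by simp
  then show ?thesis by (auto simp: kernel_dom_def imag_axis_def)
qed

lemma kernel_dom_nonneg: "kernel_dom {0..} = right_half_plane"
proof -
  have "0 \<le> Re s" if "\<forall>x\<in>{0..}. 0 \<le> Re s * x" for s
    using that[rule_format, of 1] by simp
  then show ?thesis by (auto simp: kernel_dom_def right_half_plane_def)
qed

lemma imag_axis_kernel_dom: "s \<in> imag_axis \<Longrightarrow> s \<in> kernel_dom L"
  by (auto simp: kernel_dom_def imag_axis_def)

lemma kernel_dom_mono: "L \<subseteq> L' \<Longrightarrow> kernel_dom L' \<subseteq> kernel_dom L"
  by (auto simp: kernel_dom_def)

lemma norm_infsum_nonneg: "0 \<le> (\<Sum>\<^sub>\<infinity>x. norm (\<phi> x))"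
  by (rule infsum_nonneg) simp

lemma wnorm_nonneg: "0 \<le> wnorm f \<phi>"
  by (simp add: wnorm_def norm_infsum_nonneg)

lemma norm_wev_le:
  assumes "wpair K L f \<phi>" "K \<subseteq> L" "s \<in> kernel_dom L"
  shows "norm (wev f \<phi> s) \<le> wnorm f \<phi>"
proof -
  have "norm (fourier f s) \<le> (LINT x|lborel. norm (f x))"
    by (rule norm_fourier_le) (use assms in \<open>auto simp: wpair_def kernel_dom_def\<close>)
  moreover have "norm (trig \<phi> s) \<le> (\<Sum>\<^sub>\<infinity>x. norm (\<phi> x))"
    by (rule norm_trig_le) (use assms in \<open>auto simp: wpair_def kernel_dom_def\<close>)
  ultimately show ?thesis
    unfolding wev_def wnorm_def by (intro norm_triangle_mono)
qed

lemma wpair_add: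
  assumes "wpair K L f \<phi>" "wpair K L g \<psi>" "K \<subseteq> L"
  shows "wpair K L (\<lambda>x. f x + g x) (\<lambda>x. \<phi> x + \<psi> x)"
    "wnorm (\<lambda>x. f x + g x) (\<lambda>x. \<phi> x + \<psi> x) \<le> wnorm f \<phi> + wnorm g \<psi>"
    "s \<in> kernel_dom L \<Longrightarrow> wev (\<lambda>x. f x + g x) (\<lambda>x. \<phi> x + \<psi> x) s = wev f \<phi> s + wev g \<psi> s"
proof -
  note a = assms(1,2)[unfolded wpair_def]
  note s = norm_add_summable[of \<phi> UNIV \<psi>]
  show "wpair K L (\<lambda>x. f x + g x) (\<lambda>x. \<phi> x + \<psi> x)"
    using a s by (auto simp: wpair_def)
  have "(LINT x|lborel. norm (f x + g x)) \<le> (LINT x|lborel. norm (f x) + norm (g x))"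
    using a by (intro integral_mono) (auto intro: norm_triangle_ineq)
  also have "\<dots> = (LINT x|lborel. norm (f x)) + (LINT x|lborel. norm (g x))"
    using a by (intro Bochner_Integration.integral_add) auto
  finally show "wnorm (\<lambda>x. f x + g x) (\<lambda>x. \<phi> x + \<psi> x) \<le> wnorm f \<phi> + wnorm g \<psi>"
    using a s unfolding wnorm_def by linarith
  show "wev (\<lambda>x. f x + g x) (\<lambda>x. \<phi> x + \<psi> x) s = wev f \<phi> s + wev g \<psi> s" if d: "s \<in> kernel_dom L"
  proof -
    have "fourier (\<lambda>x. f x + g x) s = fourier f s + fourier g s"
      using a by (intro fourier_add wpair_dom(1)[OF assms(1,3) d] wpair_dom(1)[OF assms(2,3) d]) auto
    moreover have "trig (\<lambda>x. \<phi> x + \<psi> x) s = trig \<phi> s + trig \<psi> s"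
      using a by (intro trig_add wpair_dom(2)[OF assms(1,3) d] wpair_dom(2)[OF assms(2,3) d]) auto
    ultimately show ?thesis by (simp add: wev_def)
  qed
qed

lemma wpair_cmult:
  assumes "wpair K L f \<phi>"
  shows "wpair K L (\<lambda>x. c * f x) (\<lambda>x. c * \<phi> x)"
    "wnorm (\<lambda>x. c * f x) (\<lambda>x. c * \<phi> x) = norm c * wnorm f \<phi>"
    "wev (\<lambda>x. c * f x) (\<lambda>x. c * \<phi> x) s = c * wev f \<phi> s"
  using assms
  by (auto simp: wpair_def norm_mult wnorm_def wev_def infsum_cmult_right' distrib_left fourier_cmult trig_cmult
           intro: summable_on_cmult_right)

lemma wpair_diff:
  assumes "wpair K L f \<phi>" "wpair K L g \<psi>" "K \<subseteq> L"
  shows "wpair K L (\<lambda>x. f x - g x) (\<lambda>x. \<phi> x - \<psi> x)"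
    "s \<in> kernel_dom L \<Longrightarrow> wev (\<lambda>x. f x - g x) (\<lambda>x. \<phi> x - \<psi> x) s = wev f \<phi> s - wev g \<psi> s"
    "s \<in> kernel_dom L \<Longrightarrow> trig (\<lambda>x. \<phi> x - \<psi> x) s = trig \<phi> s - trig \<psi> s"
proof -
  have eq: "(\<lambda>x. f x - g x) = (\<lambda>x. f x + (-1) * g x)" "(\<lambda>x. \<phi> x - \<psi> x) = (\<lambda>x. \<phi> x + (-1) * \<psi> x)"
    by (simp_all add: fun_eq_iff)
  note c = wpair_cmult[OF assms(2), of "-1"]
  note a = wpair_add[OF assms(1) c(1) assms(3), folded eq]
  show "wpair K L (\<lambda>x. f x - g x) (\<lambda>x. \<phi> x - \<psi> x)" by (rule a)
  show "wev (\<lambda>x. f x - g x) (\<lambda>x. \<phi> x - \<psi> x) s = wev f \<phi> s - wev g \<psi> s" if "s \<in> kernel_dom L"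
    using a(3)[OF that] c(3) by simp
  show "trig (\<lambda>x. \<phi> x - \<psi> x) s = trig \<phi> s - trig \<psi> s" if d: "s \<in> kernel_dom L"
  proof -
    have "trig (\<lambda>x. \<phi> x + (-1) * \<psi> x) s = trig \<phi> s + trig (\<lambda>x. (-1) * \<psi> x) s"
      using assms(1) c(1) unfolding wpair_def
      by (intro trig_add wpair_dom(2)[OF assms(1,3) d] wpair_dom(2)[OF c(1) assms(3) d]) auto
    then show ?thesis unfolding eq trig_cmult by simp
  qed
qed

text \<open>Of the four products, the three with a function factor are again functions supported in
  \<open>K\<close>; only the product of the point masses contributes point masses. Hence taking the
  almost periodic part is multiplicative, which is the last conclusion.\<close>

lemma wpair_mult:
  assumes p: "wpair K L f \<phi>" and q: "wpair K L g \<psi>" and adm: "wadm K L"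
  obtains h ch where "wpair K L h ch" "wnorm h ch \<le> wnorm f \<phi> * wnorm g \<psi>"
    "\<And>s. s \<in> kernel_dom L \<Longrightarrow> wev h ch s = wev f \<phi> s * wev g \<psi> s"
    "\<And>s. s \<in> kernel_dom L \<Longrightarrow> trig ch s = trig \<phi> s * trig \<psi> s"
proof -
  note p' = p[unfolded wpair_def] and q' = q[unfolded wpair_def]
  have KL: "K \<subseteq> L" and LK: "\<And>x y. x \<in> L \<Longrightarrow> y \<in> K \<Longrightarrow> x + y \<in> K"
    and KK: "\<And>x y. x \<in> K \<Longrightarrow> y \<in> K \<Longrightarrow> x + y \<in> K"
    and LL: "\<And>x y. x \<in> L \<Longrightarrow> y \<in> L \<Longrightarrow> x + y \<in> L"
    using adm by (auto simp: wadm_def)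
  have dom: "s \<in> kernel_dom K" if "s \<in> kernel_dom L" for s
    using that kernel_dom_mono[OF KL] by auto
  obtain h1 where h1: "integrable lborel h1" "\<And>x. x \<notin> K \<Longrightarrow> h1 x = 0"
    "(LINT x|lborel. norm (h1 x)) \<le> (LINT x|lborel. norm (f x)) * (LINT x|lborel. norm (g x))"
    "\<And>s. s \<in> kernel_dom K \<Longrightarrow> s \<in> kernel_dom K \<Longrightarrow> fourier h1 s = fourier f s * fourier g s"
    by (rule fourier_mult[of f K g K K]) (use p' q' KK in auto)
  obtain h2 where h2: "integrable lborel h2" "\<And>x. x \<notin> K \<Longrightarrow> h2 x = 0"
    "(LINT x|lborel. norm (h2 x)) \<le> (\<Sum>\<^sub>\<infinity>x. norm (\<phi> x)) * (LINT x|lborel. norm (g x))"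
    "\<And>s. s \<in> kernel_dom L \<Longrightarrow> s \<in> kernel_dom K \<Longrightarrow> fourier h2 s = trig \<phi> s * fourier g s"
    by (rule trig_fourier_mult[of \<phi> L g K K]) (use p' q' LK in auto)
  obtain h3 where h3: "integrable lborel h3" "\<And>x. x \<notin> K \<Longrightarrow> h3 x = 0"
    "(LINT x|lborel. norm (h3 x)) \<le> (\<Sum>\<^sub>\<infinity>x. norm (\<psi> x)) * (LINT x|lborel. norm (f x))"
    "\<And>s. s \<in> kernel_dom L \<Longrightarrow> s \<in> kernel_dom K \<Longrightarrow> fourier h3 s = trig \<psi> s * fourier f s"
    by (rule trig_fourier_mult[of \<psi> L f K K]) (use p' q' LK in auto)
  obtain ch where ch: "(\<lambda>x. norm (ch x)) summable_on UNIV" "\<And>x. x \<notin> L \<Longrightarrow> ch x = 0"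
    "(\<Sum>\<^sub>\<infinity>x. norm (ch x)) \<le> (\<Sum>\<^sub>\<infinity>x. norm (\<phi> x)) * (\<Sum>\<^sub>\<infinity>x. norm (\<psi> x))"
    "\<And>s. s \<in> kernel_dom L \<Longrightarrow> s \<in> kernel_dom L \<Longrightarrow> trig ch s = trig \<phi> s * trig \<psi> s"
    by (rule trig_mult[of \<phi> L \<psi> L L]) (use p' q' LL in auto)
  have w1: "wpair K L h1 (\<lambda>x. 0)" and w2: "wpair K L h2 (\<lambda>x. 0)" and w3: "wpair K L h3 ch"
    using h1 h2 h3 ch by (auto simp: wpair_def)
  note a1 = wpair_add[OF w1 w2 KL]
  note a2 = wpair_add[OF a1(1) w3 KL]
  let ?h = "\<lambda>x. h1 x + h2 x + h3 x" and ?ch = "\<lambda>x. 0 + 0 + ch x"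
  show ?thesis
  proof
    show "wpair K L ?h ?ch" using a2(1) .
    have "wnorm ?h ?ch \<le> wnorm h1 (\<lambda>x. 0) + wnorm h2 (\<lambda>x. 0) + wnorm h3 ch"
      using a1(2) a2(2) by linarith
    also have "\<dots> \<le> wnorm f \<phi> * wnorm g \<psi>"
      using h1(3) h2(3) h3(3) ch(3) unfolding wnorm_def by (simp add: algebra_simps)
    finally show "wnorm ?h ?ch \<le> wnorm f \<phi> * wnorm g \<psi>" .
    fix s assume s: "s \<in> kernel_dom L"
    have "wev ?h ?ch s = wev h1 (\<lambda>x. 0) s + wev h2 (\<lambda>x. 0) s + wev h3 ch s"
      using a1(3)[OF s] a2(3)[OF s] by simp
    also have "\<dots> = wev f \<phi> s * wev g \<psi> s"
      unfolding wev_def using h1(4) h2(4) h3(4) ch(4) s dom[OF s] by (simp add: trig_def algebra_simps)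
    finally show "wev ?h ?ch s = wev f \<phi> s * wev g \<psi> s" .
    show "trig ?ch s = trig \<phi> s * trig \<psi> s" using ch(4) s by simp
  qed
qed

lemma suminf_fourier:
  assumes f: "\<And>n. integrable lborel (f n)" and r: "\<And>n. (LINT x|lborel. norm (f n x)) \<le> r n" and "summable r"
    and s: "\<And>n x. f n x \<noteq> 0 \<Longrightarrow> 0 \<le> Re s * x"
  shows "(\<lambda>n. fourier (f n) s) sums fourier (\<lambda>x. suminf (\<lambda>n. f n x)) s"
proof -
  let ?e = "\<lambda>x::real. exp (- (s * of_real x))"
  note S = suminf_L1[OF f r \<open>summable r\<close>]
  have i: "integrable lborel (\<lambda>x. ?e x * f n x)" for n
    by (rule kernel_integrable(1)[OF f]) (use s in auto)
  have i2: "(LINT x|lborel. norm (?e x * f n x)) \<le> r n" for n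
    by (rule order_trans[OF kernel_integrable(2)[OF f _ s] r]) auto
  note T = suminf_L1[OF i i2 \<open>summable r\<close>]
  have [measurable]: "\<And>n. f n \<in> borel_measurable lborel" using f by auto
  have "AE x in lborel. suminf (\<lambda>n. ?e x * f n x) = ?e x * suminf (\<lambda>n. f n x)"
    using S(4) by eventually_elim (rule suminf_mult[OF summable_norm_cancel])
  then have "(LINT x|lborel. suminf (\<lambda>n. ?e x * f n x)) = (LINT x|lborel. ?e x * suminf (\<lambda>n. f n x))"
    by (intro integral_cong_AE) auto
  then show ?thesis using T(2) unfolding fourier_def by simp
qed

lemma trig_eq_integral:
  assumes "(\<lambda>x. norm (\<phi> x)) summable_on UNIV" "\<And>x. \<phi> x \<noteq> 0 \<Longrightarrow> 0 \<le> Re s * x"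
  shows "trig \<phi> s = (LINT x|count_space UNIV. exp (- (s * of_real x)) * \<phi> x)"
proof -
  have "trig \<phi> s = (LINT x|count_space UNIV. \<phi> x * exp (- (s * of_real x)))"
    unfolding trig_def by (rule infsum_eq_integral[OF kernel_summable(1)[OF assms]])
  then show ?thesis by (simp add: mult.commute)
qed

lemma suminf_trig:
  assumes f: "\<And>n. (\<lambda>x. norm (f n x)) summable_on UNIV" and r: "\<And>n. (\<Sum>\<^sub>\<infinity>x. norm (f n x)) \<le> r n" and "summable r"
  shows "(\<lambda>x. norm (suminf (\<lambda>n. f n x))) summable_on UNIV"
    "(\<Sum>\<^sub>\<infinity>x. norm (suminf (\<lambda>n. f n x))) \<le> suminf (\<lambda>n. \<Sum>\<^sub>\<infinity>x. norm (f n x))"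
    "(\<And>n x. f n x \<noteq> 0 \<Longrightarrow> 0 \<le> Re s * x) \<Longrightarrow> (\<lambda>n. trig (f n) s) sums trig (\<lambda>x. suminf (\<lambda>n. f n x)) s"
proof -
  have i: "integrable (count_space UNIV) (f n)" for n
    using f by (simp add: abs_summable_iff_integrable)
  have i2: "(LINT x|count_space UNIV. norm (f n x)) \<le> r n" for n
    using r infsum_norm_eq_integral[OF f] by simp
  note S = suminf_L1[OF i i2 \<open>summable r\<close>]
  have su: "summable (\<lambda>n. f n x)" for x
    using S(4) by (auto simp: AE_count_space intro: summable_norm_cancel)
  show 1: "(\<lambda>x. norm (suminf (\<lambda>n. f n x))) summable_on UNIV"
    using S(1) by (simp add: abs_summable_iff_integrable)
  show "(\<Sum>\<^sub>\<infinity>x. norm (suminf (\<lambda>n. f n x))) \<le> suminf (\<lambda>n. \<Sum>\<^sub>\<infinity>x. norm (f n x))"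
    using S(3) by (simp add: infsum_norm_eq_integral[OF f] infsum_norm_eq_integral[OF 1])
  assume s: "\<And>n x. f n x \<noteq> 0 \<Longrightarrow> 0 \<le> Re s * x"
  let ?e = "\<lambda>x::real. exp (- (s * of_real x))"
  have i: "integrable (count_space UNIV) (\<lambda>x. ?e x * f n x)" for n
    by (rule kernel_integrable(1)[OF i]) (use s in auto)
  have i2: "(LINT x|count_space UNIV. norm (?e x * f n x)) \<le> r n" for n
    by (rule order_trans[OF kernel_integrable(2)[OF \<open>\<And>n. integrable (count_space UNIV) (f n)\<close> _ s]
        \<open>\<And>n. (LINT x|count_space UNIV. norm (f n x)) \<le> r n\<close>]) auto
  note T = suminf_L1[OF i i2 \<open>summable r\<close>]
  have s': "0 \<le> Re s * x" if "suminf (\<lambda>n. f n x) \<noteq> 0" for x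
  proof (rule ccontr)
    assume "\<not> 0 \<le> Re s * x"
    then have "f n x = 0" for n using s by blast
    then show False using that by simp
  qed
  then show "(\<lambda>n. trig (f n) s) sums trig (\<lambda>x. suminf (\<lambda>n. f n x)) s"
    using T(2) by (simp add: trig_eq_integral[OF f s] trig_eq_integral[OF 1 s'] suminf_mult[OF su])
qed

text \<open>Completeness in the form used throughout: it yields exponentials, Neumann series,
  logarithmic series and finally the completeness of the Banach algebra.\<close>

lemma wpair_suminf:
  assumes p: "\<And>n. wpair K L (f n) (\<phi> n)" and r: "\<And>n. wnorm (f n) (\<phi> n) \<le> r n" and sr: "summable r"
    and KL: "K \<subseteq> L"
  obtains g \<psi> where "wpair K L g \<psi>" "wnorm g \<psi> \<le> suminf r"
    "\<And>s. s \<in> kernel_dom L \<Longrightarrow> (\<lambda>n. wev (f n) (\<phi> n) s) sums wev g \<psi> s"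
proof
  note p' = p[unfolded wpair_def]
  have 1: "(LINT x|lborel. norm (f n x)) \<le> r n" for n
    using r[of n] norm_infsum_nonneg[of "\<phi> n"] by (simp add: wnorm_def)
  have 2: "(\<Sum>\<^sub>\<infinity>x. norm (\<phi> n x)) \<le> r n" for n
  proof -
    have "0 \<le> (LINT x|lborel. norm (f n x))" by simp
    then show ?thesis using r[of n] unfolding wnorm_def by linarith
  qed
  have fi: "\<And>n. integrable lborel (f n)" and si: "\<And>n. (\<lambda>x. norm (\<phi> n x)) summable_on UNIV"
    using p' by auto
  let ?g = "\<lambda>x. suminf (\<lambda>n. f n x)" and ?\<psi> = "\<lambda>x. suminf (\<lambda>n. \<phi> n x)"
  note S = suminf_L1[OF fi 1 sr] and T = suminf_trig[OF si 2 sr]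
  show "wpair K L ?g ?\<psi>"
    unfolding wpair_def using S(1) T(1) p' by auto
  have s1: "summable (\<lambda>n. LINT x|lborel. norm (f n x))"
    by (rule summable_comparison_test'[OF sr, of 0]) (use 1 in auto)
  have s2: "summable (\<lambda>n. \<Sum>\<^sub>\<infinity>x. norm (\<phi> n x))"
    by (rule summable_comparison_test'[OF sr, of 0]) (use 2 norm_infsum_nonneg[where ?'a=real and ?'b=complex] in \<open>auto simp: abs_of_nonneg infsum_nonneg\<close>)
  have "wnorm ?g ?\<psi> \<le> suminf (\<lambda>n. wnorm (f n) (\<phi> n))"
    unfolding wnorm_def using S(3) T(2) by (simp add: suminf_add[OF s1 s2, symmetric])
  also have "\<dots> \<le> suminf r"
    using r sr summable_add[OF s1 s2] by (intro suminf_le) (auto simp: wnorm_def)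
  finally show "wnorm ?g ?\<psi> \<le> suminf r" .
  fix s assume s: "s \<in> kernel_dom L"
  have "(\<lambda>n. fourier (f n) s) sums fourier ?g s"
    by (rule suminf_fourier[OF fi 1 sr]) (rule wpair_dom(1)[OF p KL s])
  moreover have "(\<lambda>n. trig (\<phi> n) s) sums trig ?\<psi> s"
    by (rule T(3)) (rule wpair_dom(2)[OF p KL s])
  ultimately show "(\<lambda>n. wev (f n) (\<phi> n) s) sums wev ?g ?\<psi> s"
    unfolding wev_def by (rule sums_add)
qed

lemma wienI: "wpair K L f \<phi> \<Longrightarrow> wnorm f \<phi> \<le> r \<Longrightarrow> (\<And>s. s \<in> kernel_dom L \<Longrightarrow> F s = wev f \<phi> s) \<Longrightarrow> wien K L F r"
  by (auto simp: wien_def)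

lemma wienE:
  assumes "wien K L F r"
  obtains f \<phi> where "wpair K L f \<phi>" "wnorm f \<phi> \<le> r" "\<And>s. s \<in> kernel_dom L \<Longrightarrow> F s = wev f \<phi> s"
  using assms by (auto simp: wien_def)

lemma wien_cong: "wien K L F r \<Longrightarrow> (\<And>s. s \<in> kernel_dom L \<Longrightarrow> G s = F s) \<Longrightarrow> wien K L G r"
  by (auto simp: wien_def)

lemma wien_le: "wien K L F r \<Longrightarrow> r \<le> r' \<Longrightarrow> wien K L F r'"
  unfolding wien_def by fastforce

lemma wien_nonneg: "wien K L F r \<Longrightarrow> 0 \<le> r"
  unfolding wien_def using wnorm_nonneg order_trans by blast

lemma wien_mono: "wien K L F r \<Longrightarrow> K \<subseteq> K' \<Longrightarrow> L \<subseteq> L' \<Longrightarrow> wien K' L' F r"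
  using kernel_dom_mono[of L L'] by (erule_tac wienE, rule_tac f=f and \<phi>=\<phi> in wienI) (auto simp: wpair_def)

lemma wien_norm_le: "wien K L F r \<Longrightarrow> K \<subseteq> L \<Longrightarrow> s \<in> kernel_dom L \<Longrightarrow> norm (F s) \<le> r"
  by (erule wienE) (auto dest: norm_wev_le)

lemma wien_add: "wien K L F r \<Longrightarrow> wien K L G r' \<Longrightarrow> K \<subseteq> L \<Longrightarrow> wien K L (\<lambda>s. F s + G s) (r + r')"
proof -
  assume "wien K L F r" "wien K L G r'" and KL: "K \<subseteq> L"
  then obtain f \<phi> g \<psi> where fg: "wpair K L f \<phi>" "wnorm f \<phi> \<le> r" "\<And>s. s \<in> kernel_dom L \<Longrightarrow> F s = wev f \<phi> s"
     "wpair K L g \<psi>" "wnorm g \<psi> \<le> r'" "\<And>s. s \<in> kernel_dom L \<Longrightarrow> G s = wev g \<psi> s"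
    by (metis wienE)
  note a = wpair_add[OF fg(1) fg(4) KL]
  show ?thesis by (rule wienI[OF a(1)]) (use a(2,3) fg in auto)
qed

lemma wien_cmult: "wien K L F r \<Longrightarrow> wien K L (\<lambda>s. c * F s) (norm c * r)"
proof -
  assume "wien K L F r"
  then obtain f \<phi> where fg: "wpair K L f \<phi>" "wnorm f \<phi> \<le> r" "\<And>s. s \<in> kernel_dom L \<Longrightarrow> F s = wev f \<phi> s"
    by (metis wienE)
  note a = wpair_cmult[OF fg(1), of c]
  show ?thesis by (rule wienI[OF a(1)]) (use a(2,3) fg in \<open>auto intro: mult_left_mono\<close>)
qed

lemma wien_diff: "wien K L F r \<Longrightarrow> wien K L G r' \<Longrightarrow> K \<subseteq> L \<Longrightarrow> wien K L (\<lambda>s. F s - G s) (r + r')"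
  using wien_add[of K L F r "\<lambda>s. (-1) * G s" "norm (-1::complex) * r'"] wien_cmult[of K L G r' "-1"] by simp

lemma wien_mult: "wien K L F r \<Longrightarrow> wien K L G r' \<Longrightarrow> wadm K L \<Longrightarrow> wien K L (\<lambda>s. F s * G s) (r * r')"
proof -
  assume "wien K L F r" "wien K L G r'" and adm: "wadm K L"
  then obtain f \<phi> g \<psi> where fg: "wpair K L f \<phi>" "wnorm f \<phi> \<le> r" "\<And>s. s \<in> kernel_dom L \<Longrightarrow> F s = wev f \<phi> s"
     "wpair K L g \<psi>" "wnorm g \<psi> \<le> r'" "\<And>s. s \<in> kernel_dom L \<Longrightarrow> G s = wev g \<psi> s"
    by (metis wienE)
  obtain h ch where h: "wpair K L h ch" "wnorm h ch \<le> wnorm f \<phi> * wnorm g \<psi>"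
    "\<And>s. s \<in> kernel_dom L \<Longrightarrow> wev h ch s = wev f \<phi> s * wev g \<psi> s"
    using wpair_mult[OF fg(1,4) adm] by metis
  have "wnorm f \<phi> * wnorm g \<psi> \<le> r * r'"
    using fg(2,5) wnorm_nonneg[of f \<phi>] wnorm_nonneg[of g \<psi>] by (intro mult_mono) auto
  then show ?thesis by (intro wienI[OF h(1)]) (use h fg in auto)
qed

lemma wien_suminf:
  assumes F: "\<And>n. wien K L (F n) (r n)" and r: "summable r" and KL: "K \<subseteq> L"
  shows "wien K L (\<lambda>s. suminf (\<lambda>n. F n s)) (suminf r)"
    and "s \<in> kernel_dom L \<Longrightarrow> summable (\<lambda>n. F n s)"
proof -
  obtain f \<phi> where p: "\<And>n. wpair K L (f n) (\<phi> n)" "\<And>n. wnorm (f n) (\<phi> n) \<le> r n"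
    "\<And>n s. s \<in> kernel_dom L \<Longrightarrow> F n s = wev (f n) (\<phi> n) s"
    using F unfolding wien_def by metis
  obtain g \<psi> where g: "wpair K L g \<psi>" "wnorm g \<psi> \<le> suminf r"
    "\<And>s. s \<in> kernel_dom L \<Longrightarrow> (\<lambda>n. wev (f n) (\<phi> n) s) sums wev g \<psi> s"
    using wpair_suminf[OF p(1,2) r KL] by metis
  show "wien K L (\<lambda>s. suminf (\<lambda>n. F n s)) (suminf r)"
    by (rule wienI[OF g(1,2)]) (use g(3) p(3) in \<open>auto simp: sums_iff\<close>)
  show "s \<in> kernel_dom L \<Longrightarrow> summable (\<lambda>n. F n s)"
    using g(3) p(3) by (auto dest: sums_summable)
qed

lemma wien_trig:
  assumes "(\<lambda>x. norm (\<phi> x)) summable_on UNIV" "\<And>x. x \<notin> L \<Longrightarrow> \<phi> x = 0"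
  shows "wien K L (trig \<phi>) (\<Sum>\<^sub>\<infinity>x. norm (\<phi> x))"
  by (rule wienI[of _ _ "\<lambda>x. 0" \<phi>]) (use assms in \<open>auto simp: wpair_def wnorm_def wev_def fourier_def\<close>)

lemma wien_fourier:
  assumes "integrable lborel f" "\<And>x. x \<notin> K \<Longrightarrow> f x = 0"
  shows "wien K L (fourier f) (LINT x|lborel. norm (f x))"
  by (rule wienI[of _ _ f "\<lambda>x. 0"]) (use assms in \<open>auto simp: wpair_def wnorm_def wev_def trig_def\<close>)

lemma infsum_single:
  fixes f :: "'a \<Rightarrow> 'b::{comm_monoid_add, t2_space}"
  assumes "\<And>x. x \<noteq> a \<Longrightarrow> f x = 0"
  shows "infsum f UNIV = f a" "f summable_on UNIV"
proof -
  have "infsum f UNIV = infsum f {a}"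
    by (rule infsum_cong_neutral) (use assms in auto)
  then show "infsum f UNIV = f a" by simp
  have "f summable_on UNIV \<longleftrightarrow> f summable_on {a}"
    by (rule summable_on_cong_neutral) (use assms in auto)
  then show "f summable_on UNIV" by simp
qed

lemma wien_exp:
  assumes "a \<in> L" shows "wien K L (\<lambda>s. c * exp (- (s * of_real a))) (norm c)"
proof -
  define \<phi> where "\<phi> = (\<lambda>x. if x = a then c else 0)"
  have z: "\<phi> x = 0" if "x \<noteq> a" for x using that by (simp add: \<phi>_def)
  have a: "\<phi> a = c" by (simp add: \<phi>_def)
  have "trig \<phi> s = c * exp (- (s * of_real a))" for s
    unfolding trig_def by (subst infsum_single[of a]) (auto simp: z a)
  moreover have "wien K L (trig \<phi>) (\<Sum>\<^sub>\<infinity>x. norm (\<phi> x))"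
    by (rule wien_trig) (use infsum_single(2)[of a "\<lambda>x. norm (\<phi> x)"] assms in \<open>auto simp: \<phi>_def\<close>)
  moreover have "(\<Sum>\<^sub>\<infinity>x. norm (\<phi> x)) = norm c"
    by (subst infsum_single[of a]) (auto simp: z a)
  ultimately show ?thesis by (auto intro: wien_cong)
qed

lemma wien_const: "0 \<in> L \<Longrightarrow> wien K L (\<lambda>s. c) (norm c)"
  using wien_exp[of 0 L K c] by simp

lemma wien_power:
  assumes "wien K L F r" "wadm K L" shows "wien K L (\<lambda>s. F s ^ n) (r ^ n)"
proof (induction n)
  case 0 then show ?case using wien_const[of L K 1] assms by (simp add: wadm_def)
next
  case (Suc n) then show ?case using wien_mult[OF assms(1) Suc assms(2)] by simp
qed

lemma wien_sum:
  assumes "\<And>i. i \<in> I \<Longrightarrow> wien K L (F i) (r i)" "wadm K L" 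
  shows "wien K L (\<lambda>s. \<Sum>i\<in>I. F i s) (\<Sum>i\<in>I. r i)"
  using assms(1)
proof (induction I rule: infinite_finite_induct)
  case (insert x I) then show ?case using assms(2) wien_add[of K L "F x" "r x"] by (auto simp: wadm_def)
qed (use wien_const[of L K 0] assms(2) in \<open>auto simp: wadm_def\<close>)

lemma wien_prod:
  assumes "\<And>i. i \<in> I \<Longrightarrow> wien K L (F i) (r i)" "wadm K L"
  shows "wien K L (\<lambda>s. \<Prod>i\<in>I. F i s) (\<Prod>i\<in>I. r i)"
  using assms(1)
proof (induction I rule: infinite_finite_induct)
  case (insert x I) then show ?case using assms(2) wien_mult[of K L "F x" "r x"] by auto
qed (use wien_const[of L K 1] assms(2) in \<open>auto simp: wadm_def\<close>)

text \<open>The powers have their own bounds \<open>r n\<close> instead of a common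
  \<open>r ^ n\<close>, so that the logarithmic series can be summed when only the spectral radius
  of \<open>F\<close> is below \<open>1\<close>.\<close>

lemma wien_powser:
  assumes F: "\<And>n. wien K L (\<lambda>s. F s ^ n) (r n)" and "summable (\<lambda>n. norm (c n) * r n)" and KL: "K \<subseteq> L"
  shows "wien K L (\<lambda>s. suminf (\<lambda>n. c n * F s ^ n)) (suminf (\<lambda>n. norm (c n) * r n))"
  using wien_suminf(1)[of K L "\<lambda>n s. c n * F s ^ n" "\<lambda>n. norm (c n) * r n"] wien_cmult[OF F] assms by auto

lemma wien_exp_comp:
  assumes F: "wien K L F r" and adm: "wadm K L"
  shows "wien K L (\<lambda>s. exp (F s)) (exp r)"
proof -
  have "summable (\<lambda>n. norm (1 / fact n :: complex) * r ^ n)"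
    using summable_exp[of r] by (simp add: norm_divide inverse_eq_divide)
  from wien_powser[OF wien_power[OF F adm] this]
  have "wien K L (\<lambda>s. suminf (\<lambda>n. 1 / fact n * F s ^ n)) (suminf (\<lambda>n. norm (1 / fact n :: complex) * r ^ n))"
    using adm by (auto simp: wadm_def)
  moreover have "norm (1 / fact n :: complex) * r ^ n = r ^ n /\<^sub>R fact n" for n
    by (simp add: norm_divide divide_inverse mult.commute norm_inverse)
  moreover have "1 / fact n * F s ^ n = F s ^ n /\<^sub>R fact n" for n s
    by (simp add: scaleR_conv_of_real divide_inverse)
  ultimately show ?thesis
    by (simp only: exp_def)
qed

lemma wien_inverse_one_minus:
  assumes F: "wien K L F r" and adm: "wadm K L" and r: "r < 1"
  shows "wien K L (\<lambda>s. inverse (1 - F s)) (1 / (1 - r))"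
proof -
  have r0: "0 \<le> r" using wien_nonneg[OF F] .
  have "wien K L (\<lambda>s. suminf (\<lambda>n. 1 * F s ^ n)) (suminf (\<lambda>n. norm (1::complex) * r ^ n))"
    using wien_powser[OF wien_power[OF F adm], of "\<lambda>n. 1"] r r0 adm by (auto simp: wadm_def)
  then have "wien K L (\<lambda>s. suminf (\<lambda>n. F s ^ n)) (1 / (1 - r))"
    using r r0 by (simp add: suminf_geometric)
  then show ?thesis
  proof (rule wien_cong)
    fix s assume "s \<in> kernel_dom L"
    then have "norm (F s) < 1" using wien_norm_le[OF F] adm r by (force simp: wadm_def)
    then show "inverse (1 - F s) = suminf (\<lambda>n. F s ^ n)" by (simp add: suminf_geometric inverse_eq_divide)
  qed
qed

section \<open>Density of step functions in L^1\<close>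

lemma L1_tendsto_dominated:
  fixes f :: "real \<Rightarrow> complex"
  assumes "\<And>n. integrable lborel (s n)" "integrable lborel f" "integrable lborel w"
    and "\<And>x. (\<lambda>n. s n x) \<longlonglongrightarrow> f x" "\<And>n x. norm (s n x) \<le> w x"
  shows "(\<lambda>n. LINT x|lborel. norm (s n x - f x)) \<longlonglongrightarrow> 0"
proof -
  have [measurable]: "\<And>n. s n \<in> borel_measurable lborel" "f \<in> borel_measurable lborel"
    using assms by auto
  have fw: "norm (f x) \<le> w x" for x
    by (rule LIMSEQ_le_const2[OF tendsto_norm[OF assms(4)]]) (use assms(5) in auto)
  have "(\<lambda>n. LINT x|lborel. norm (s n x - f x)) \<longlonglongrightarrow> (LINT (x::real)|lborel. 0)"
  proof (rule integral_dominated_convergence[where w="\<lambda>x. 2 * w x"])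
    show "AE x in lborel. (\<lambda>n. norm (s n x - f x)) \<longlonglongrightarrow> 0"
      using tendsto_norm_zero[OF LIM_zero[OF assms(4)]] by simp
    show "AE x in lborel. norm (norm (s n x - f x)) \<le> 2 * w x" for n
    proof (rule AE_I2)
      fix x
      show "norm (norm (s n x - f x)) \<le> 2 * w x"
        using norm_triangle_ineq4[of "s n x" "f x"] fw[of x] assms(5)[of n x] by simp
    qed
  qed (use assms(3) in auto)
  then show ?thesis by simp
qed

text \<open>Density as an induction rule. Half-lines generate the Borel sets and are stable under
  intersection, so Dynkin's theorem applies; every set is cut to \<open>{-m..m}\<close> to keep
  complements and disjoint unions integrable. Monotone exhaustion and simple functions do the
  rest.\<close>

lemma L1_induct_intervals [consumes 1, case_names add cmult lim interval]:
  fixes P :: "(real \<Rightarrow> complex) \<Rightarrow> bool"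
  assumes f: "integrable lborel f"
    and add: "\<And>f g. integrable lborel f \<Longrightarrow> integrable lborel g \<Longrightarrow> P f \<Longrightarrow> P g \<Longrightarrow> P (\<lambda>x. f x + g x)"
    and cmult: "\<And>f c. integrable lborel f \<Longrightarrow> P f \<Longrightarrow> P (\<lambda>x. c * f x)"
    and lim: "\<And>f s. (\<And>n. integrable lborel (s n)) \<Longrightarrow> (\<And>n. P (s n)) \<Longrightarrow> integrable lborel f \<Longrightarrow>
        (\<lambda>n. LINT x|lborel. norm (s n x - f x)) \<longlonglongrightarrow> 0 \<Longrightarrow> P f"
    and interval: "\<And>a b. a \<le> b \<Longrightarrow> P (\<lambda>x. indicator {a..b} x)"
  shows "P f"
proof -
  let ?I = "\<lambda>A. (\<lambda>x::real. indicator A x :: complex)"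
  have int: "integrable lborel (?I A)" if "A \<in> sets borel" "emeasure lborel A < \<infinity>" for A
  proof -
    have "integrable lborel (\<lambda>x. of_real (indicator A x) :: complex)"
      using that by (intro integrable_of_real integrable_real_indicator) auto
    then show ?thesis by (simp add: of_real_indicator)
  qed
  have intn: "integrable lborel (?I (A \<inter> {-m..m}))" if [measurable]: "A \<in> sets borel" for A m
  proof (rule int)
    have "emeasure lborel (A \<inter> {-m..m}) \<le> emeasure lborel {-m..m}" by (intro emeasure_mono) auto
    also have "\<dots> < \<infinity>" by (simp add: emeasure_lborel_Icc_eq)
    finally show "emeasure lborel (A \<inter> {-m..m}) < \<infinity>" .
  qed simp
  have zero: "P (\<lambda>x. 0)"
    using cmult[OF _ interval[of 0 0], of 0] intn[of "{0}" 0] by simp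
  have bnd: "P (?I (A \<inter> {-m..m}))" if A: "A \<in> sets borel" and m: "0 \<le> m" for A and m :: real
  proof -
    have "A \<in> sigma_sets UNIV (range (\<lambda>a::real. {..a}))"
      using A by (simp add: borel_eq_atMost sets_measure_of)
    note As = this
    have st: "Int_stable (range (\<lambda>a::real. {..a}))" by (auto simp: Int_stable_def)
    have pw: "range (\<lambda>a::real. {..a}) \<subseteq> Pow UNIV" by simp
    from As show ?thesis
    proof (induction rule: sigma_sets_induct_disjoint[OF st pw, consumes 1, case_names basic empty compl union])
      case (basic A)
      then obtain a where a: "A = {..a}" by auto
      show ?case
      proof (cases "-m \<le> a")
        case True
        then have "A \<inter> {-m..m} = {-m..min a m}" using a by auto
        then show ?thesis using interval[of "-m" "min a m"] True m by simp
      next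
        case False
        then have "A \<inter> {-m..m} = {}" using a by auto
        then show ?thesis using zero by simp
      qed
    next
      case empty then show ?case using zero by simp
    next
      case (compl A)
      then have Ab: "A \<in> sets borel" by (simp add: borel_eq_atMost)
      have "?I ((UNIV - A) \<inter> {-m..m}) = (\<lambda>x. ?I {-m..m} x + (-1) * ?I (A \<inter> {-m..m}) x)"
        by (auto simp: fun_eq_iff split: split_indicator)
      moreover have "P \<dots>"
        using intn[OF Ab, of m] intn[of UNIV m] m
        by (intro add cmult compl interval integrable_mult_right) auto
      ultimately show ?case by simp
    next
      case (union A)
      have Ab[measurable]: "A i \<in> sets borel" for i using union by (auto simp: borel_eq_atMost)
      have Psum: "P (\<lambda>x. \<Sum>i<n. ?I (A i \<inter> {-m..m}) x) \<and> integrable lborel (\<lambda>x. \<Sum>i<n. ?I (A i \<inter> {-m..m}) x)" for n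
      proof (induction n)
        case (Suc n)
        then show ?case using add[of "\<lambda>x. \<Sum>i<n. ?I (A i \<inter> {-m..m}) x" "?I (A n \<inter> {-m..m})"]
            union(3)[of n] intn[OF Ab] by simp
      qed (use zero in simp)
      have eq: "(\<Sum>i<n. ?I (A i \<inter> {-m..m}) x) = ?I ((\<Union>i<n. A i) \<inter> {-m..m}) x" for n x
      proof (induction n)
        case (Suc n)
        have "A i \<inter> A n = {}" if "i < n" for i
          using union(1) that unfolding disjoint_family_on_def by (metis UNIV_I nat_neq_iff)
        then have "(\<Union>i<n. A i) \<inter> A n = {}" by blast
        moreover have "(\<Union>i<Suc n. A i) = (\<Union>i<n. A i) \<union> A n"
          by (simp add: lessThan_Suc Un_commute)
        ultimately show ?case using Suc by (auto split: split_indicator)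
      qed simp
      have "(\<lambda>n. \<Sum>i<n. ?I (A i \<inter> {-m..m}) x) \<longlonglongrightarrow> ?I ((\<Union>i. A i) \<inter> {-m..m}) x" for x
      proof (rule tendsto_eventually, cases "x \<in> (\<Union>i. A i)")
        case True
        then obtain i where "x \<in> A i" by auto
        then show "\<forall>\<^sub>F n in sequentially. (\<Sum>i<n. ?I (A i \<inter> {-m..m}) x) = ?I ((\<Union>i. A i) \<inter> {-m..m}) x"
          unfolding eq eventually_sequentially by (intro exI[of _ "Suc i"]) (auto split: split_indicator)
      next
        case False
        then show "\<forall>\<^sub>F n in sequentially. (\<Sum>i<n. ?I (A i \<inter> {-m..m}) x) = ?I ((\<Union>i. A i) \<inter> {-m..m}) x"
          unfolding eq by (intro always_eventually) (auto split: split_indicator)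
      qed
      note conv = this
      have iU: "integrable lborel (?I ((\<Union>i. A i) \<inter> {-m..m}))"
        by (rule intn) auto
      have w: "integrable lborel (indicator {-m..m} :: real \<Rightarrow> real)"
        by (rule integrable_real_indicator) (auto simp: emeasure_lborel_Icc_eq)
      have le: "norm (\<Sum>i<n. ?I (A i \<inter> {-m..m}) x) \<le> indicator {-m..m} x" for n x
        unfolding eq by (auto split: split_indicator)
      show ?case
        by (rule lim[OF conjunct2[OF Psum] conjunct1[OF Psum] iU
              L1_tendsto_dominated[OF conjunct2[OF Psum] iU w conv le]])
    qed
  qed
  have fin: "P (?I A)" if A[measurable]: "A \<in> sets borel" and "emeasure lborel A < \<infinity>" for A
  proof (rule lim[OF _ _ int[OF that] L1_tendsto_dominated[where w="indicator A"]])
    show "P (?I (A \<inter> {-real n..real n}))" for n by (rule bnd) auto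
    show "integrable lborel (?I (A \<inter> {-real n..real n}))" for n by (rule intn) auto
    then show "integrable lborel (?I (A \<inter> {-real n..real n}))" for n .
    show "integrable lborel (indicator A :: real \<Rightarrow> real)" using that by (auto intro: integrable_real_indicator)
    show "norm (?I (A \<inter> {-real n..real n}) x) \<le> indicator A x" for n x by (auto split: split_indicator)
    show "(\<lambda>n. ?I (A \<inter> {-real n..real n}) x) \<longlonglongrightarrow> ?I A x" for x
    proof (rule tendsto_eventually)
      obtain N :: nat where N: "\<bar>x\<bar> \<le> real N" using real_arch_simple by blast
      show "\<forall>\<^sub>F n in sequentially. ?I (A \<inter> {-real n..real n}) x = ?I A x"
        unfolding eventually_sequentially
        by (intro exI[of _ N]) (use N in \<open>auto split: split_indicator\<close>)
    qed
  qed (use int[OF that] in auto)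
  from f show ?thesis
  proof (induction rule: integrable_induct)
    case (base A c)
    then have "P (\<lambda>x. c * ?I A x)" by (intro cmult fin int) auto
    moreover have "(\<lambda>x. indicator A x *\<^sub>R c) = (\<lambda>x. c * ?I A x)" by (auto simp: fun_eq_iff split: split_indicator)
    ultimately show ?case by simp
  next
    case (add f g) then show ?case by (intro assms(2))
  next
    case (lim f s)
    show ?case
      by (rule assms(4)[of s]) (use lim L1_tendsto_dominated[of s f "\<lambda>x. 2 * norm (f x)"] in auto)
  qed
qed

section \<open>Continuity of transforms and the Riemann-Lebesgue lemma\<close>

lemma kernel_continuous:
  assumes u: "integrable M u" and [measurable]: "\<tau> \<in> borel_measurable M"
    and D: "\<And>s x. s \<in> D \<Longrightarrow> u x \<noteq> 0 \<Longrightarrow> 0 \<le> Re s * \<tau> x"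
  shows "continuous_on D (\<lambda>s. LINT x|M. exp (- (s * complex_of_real (\<tau> x))) * u x)"
  unfolding continuous_on_sequentially
proof (safe, simp add: o_def)
  fix z a assume z: "z \<longlonglongrightarrow> a" "a \<in> D" "\<forall>n. z n \<in> D"
  have [measurable]: "u \<in> borel_measurable M" using u by auto
  have [measurable]: "(\<lambda>x. exp (- (s * complex_of_real (\<tau> x)))) \<in> borel_measurable M" for s
    using measurable_compose[OF \<open>\<tau> \<in> borel_measurable M\<close> kernel_measurable] .
  show "(\<lambda>n. LINT x|M. exp (- (z n * complex_of_real (\<tau> x))) * u x)
      \<longlonglongrightarrow> (LINT x|M. exp (- (a * complex_of_real (\<tau> x))) * u x)"
  proof (rule integral_dominated_convergence[where w="\<lambda>x. norm (u x)"])
    show "AE x in M. (\<lambda>n. exp (- (z n * complex_of_real (\<tau> x))) * u x)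
        \<longlonglongrightarrow> exp (- (a * complex_of_real (\<tau> x))) * u x"
      by (intro AE_I2 tendsto_intros z)
    show "AE x in M. norm (exp (- (z n * complex_of_real (\<tau> x))) * u x) \<le> norm (u x)" for n
      using z D by (intro AE_I2 kernel_bound) auto
  qed (use u in auto)
qed

lemma fourier_continuous:
  assumes "integrable lborel f" "\<And>s x. s \<in> D \<Longrightarrow> f x \<noteq> 0 \<Longrightarrow> 0 \<le> Re s * x"
  shows "continuous_on D (fourier f)"
  unfolding fourier_def[abs_def] by (rule kernel_continuous) (use assms in auto)

lemma trig_continuous:
  assumes "(\<lambda>x. norm (\<phi> x)) summable_on UNIV" "\<And>s x. s \<in> D \<Longrightarrow> \<phi> x \<noteq> 0 \<Longrightarrow> 0 \<le> Re s * x"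
  shows "continuous_on D (trig \<phi>)"
proof -
  have "continuous_on D (\<lambda>s. LINT x|count_space UNIV. exp (- (s * of_real x)) * \<phi> x)"
    by (rule kernel_continuous) (use assms in \<open>auto simp: abs_summable_iff_integrable\<close>)
  then show ?thesis
    by (rule continuous_on_eq) (use trig_eq_integral[OF assms(1)] assms(2) in auto)
qed

lemma wev_continuous:
  assumes "wpair K L f \<phi>" "K \<subseteq> L"
  shows "continuous_on (kernel_dom L) (wev f \<phi>)"
  unfolding wev_def[abs_def]
  using assms wpair_dom[OF assms]
  by (intro continuous_on_add fourier_continuous trig_continuous) (auto simp: wpair_def)

text \<open>Uniform closeness of transforms follows from closeness in L^1, so it suffices to treat
  intervals, where an explicit antiderivative gives the decay \<open>2 / norm y\<close>.\<close>

lemma riemann_lebesgue: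
  assumes "integrable lborel f"
  shows "((\<lambda>y. fourier f (\<i> * of_real y)) \<longlongrightarrow> 0) at_infinity"
  using assms
proof (induction rule: L1_induct_intervals)
  case (add f g)
  then show ?case
    using tendsto_add[OF add(3,4)] by (subst fourier_add) auto
next
  case (cmult f c)
  then show ?case
    using tendsto_mult_left[OF cmult(2), of c] by (simp add: fourier_cmult)
next
  case (lim f s)
  show ?case
  proof (rule tendstoI)
    fix e :: real assume e: "e > 0"
    then obtain n where n: "(LINT x|lborel. norm (s n x - f x)) < e / 2"
      using order_tendstoD(2)[OF lim(3), of "e/2"] by (auto simp: eventually_sequentially)
    have "norm (fourier f (\<i> * of_real y)) < norm (fourier (s n) (\<i> * of_real y)) + e / 2" for y
    proof -
      have "fourier (\<lambda>x. s n x + (-1) * f x) (\<i> * of_real y)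
          = fourier (s n) (\<i> * of_real y) + fourier (\<lambda>x. (-1) * f x) (\<i> * of_real y)"
        using lim by (intro fourier_add) auto
      then have eq: "fourier (\<lambda>x. s n x - f x) (\<i> * of_real y) = fourier (s n) (\<i> * of_real y) - fourier f (\<i> * of_real y)"
        using fourier_cmult[of "-1" f "\<i> * of_real y"] by simp
      have "norm (fourier (\<lambda>x. s n x - f x) (\<i> * of_real y)) \<le> (LINT x|lborel. norm (s n x - f x))"
        using lim by (intro norm_fourier_le) auto
      then show ?thesis using n norm_triangle_ineq3[of "fourier f (\<i> * of_real y)" "fourier (s n) (\<i> * of_real y)"]
        unfolding eq by (simp add: norm_minus_commute)
    qed
    moreover have "\<forall>\<^sub>F y in at_infinity. norm (fourier (s n) (\<i> * of_real y)) < e / 2"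
      using tendstoD[OF lim(4), of "e/2" n] e by simp
    ultimately show "\<forall>\<^sub>F y in at_infinity. dist (fourier f (\<i> * of_real y)) 0 < e"
      by (auto elim!: eventually_mono simp: ) (smt (verit, best) field_sum_of_halves)
  qed
next
  case (interval a b)
  have eq: "fourier (\<lambda>x. indicator {a..b} x) (\<i> * of_real y)
      = (exp (- (\<i> * of_real y * of_real a)) - exp (- (\<i> * of_real y * of_real b))) / (\<i> * of_real y)" if "y \<noteq> 0" for y
  proof -
    let ?c = "\<i> * complex_of_real y"
    have c: "?c \<noteq> 0" using that by simp
    have "(LINT x|lborel. indicator {a..b} x *\<^sub>R exp (- (?c * of_real x))) =
        (- exp (- (?c * of_real b)) / ?c) - (- exp (- (?c * of_real a)) / ?c)"
    proof (rule integral_FTC_Icc[OF interval])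
      fix x
      have "((\<lambda>z. - exp (- (?c * z)) / ?c) has_field_derivative exp (- (?c * of_real x))) (at (of_real x))"
        using c by (auto intro!: derivative_eq_intros)
      then show "((\<lambda>x. - exp (- (?c * of_real x)) / ?c) has_vector_derivative exp (- (?c * of_real x))) (at x within {a..b})"
        by (rule has_vector_derivative_real_field)
    qed (auto intro!: continuous_intros)
    moreover have "fourier (\<lambda>x. indicator {a..b} x) ?c = (LINT x|lborel. indicator {a..b} x *\<^sub>R exp (- (?c * of_real x)))"
      unfolding fourier_def by (intro Bochner_Integration.integral_cong) (auto split: split_indicator)
    ultimately show ?thesis by (simp add: diff_divide_distrib)
  qed
  have "((\<lambda>y. 2 / norm (y::real)) \<longlongrightarrow> 0) at_infinity"
    by (intro tendsto_divide_0[OF tendsto_const] filterlim_at_top_imp_at_infinity filterlim_norm_at_top)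
  then show ?case
  proof (rule Lim_null_comparison[rotated])
    have "norm (fourier (\<lambda>x. indicator {a..b} x) (\<i> * of_real y)) \<le> 2 / norm y" if "y \<noteq> 0" for y
      unfolding eq[OF that] norm_divide
      using norm_triangle_ineq4[of "exp (- (\<i> * of_real y * of_real a))" "exp (- (\<i> * of_real y * of_real b))"]
      by (simp add: norm_mult divide_right_mono)
    then show "\<forall>\<^sub>F y in at_infinity. norm (fourier (\<lambda>x. indicator {a..b} x) (\<i> * of_real y)) \<le> 2 / norm y"
      unfolding eventually_at_infinity by (intro exI[of _ 1]) auto
  qed
qed

section \<open>Mean values and uniqueness of the representation\<close>

text \<open>The Bohr mean value. It is a relation because existence of the limit is part of what has
  to be shown.\<close>

definition has_mean :: "(real \<Rightarrow> complex) \<Rightarrow> complex \<Rightarrow> bool" where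
  "has_mean f m \<longleftrightarrow> ((\<lambda>T. (1 / (2 * T)) *\<^sub>R integral {-T..T} f) \<longlongrightarrow> m) at_top"

lemma has_mean_add:
  assumes "has_mean f m" "has_mean g m'" "continuous_on UNIV f" "continuous_on UNIV g"
  shows "has_mean (\<lambda>y. f y + g y) (m + m')"
proof -
  have "integral {-T..T} (\<lambda>y. f y + g y) = integral {-T..T} f + integral {-T..T} g" for T
    using assms(3,4) by (intro integral_add integrable_continuous_interval) (auto intro: continuous_on_subset)
  then show ?thesis using tendsto_add[OF assms(1,2)[unfolded has_mean_def]]
    by (simp add: has_mean_def scaleR_add_right)
qed

lemma has_mean_cmult: "has_mean f m \<Longrightarrow> has_mean (\<lambda>y. c * f y) (c * m)"
  using tendsto_mult_left[of "\<lambda>T. (1 / (2 * T)) *\<^sub>R integral {-T..T} f" m at_top c]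
  by (simp add: has_mean_def)

lemma has_mean_sum:
  assumes "finite S" "\<And>i. i \<in> S \<Longrightarrow> has_mean (f i) (m i)" "\<And>i. i \<in> S \<Longrightarrow> continuous_on UNIV (f i)"
  shows "has_mean (\<lambda>y. \<Sum>i\<in>S. f i y) (\<Sum>i\<in>S. m i)"
  using assms
proof (induction S rule: finite_induct)
  case empty then show ?case by (simp add: has_mean_def)
next
  case (insert x F)
  then show ?case by (auto intro!: has_mean_add continuous_on_sum)
qed

lemma has_mean_unique: "has_mean f m \<Longrightarrow> has_mean f m' \<Longrightarrow> m = m'"
  unfolding has_mean_def by (rule tendsto_unique[rotated]) auto

lemma has_mean_exp: "has_mean (\<lambda>y. exp (- (\<i> * of_real y * of_real x))) (if x = 0 then 1 else 0)"
proof (cases "x = 0")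
  case True
  have "\<forall>\<^sub>F T in at_top. (1 / (2 * T)) *\<^sub>R integral {-T..T} (\<lambda>y. exp (- (\<i> * of_real y * of_real x))) = 1"
    using eventually_gt_at_top[of 0] by eventually_elim (simp add: True scaleR_conv_of_real)
  then show ?thesis unfolding has_mean_def using True by (simp add: tendsto_eventually)
next
  case False
  let ?c = "\<i> * complex_of_real x"
  have c: "?c \<noteq> 0" using False by simp
  have eq: "integral {-T..T} (\<lambda>y. exp (- (\<i> * of_real y * of_real x)))
      = (- exp (- (?c * of_real T)) / ?c) - (- exp (- (?c * of_real (-T))) / ?c)" if "T > 0" for T
  proof (rule integral_unique, rule fundamental_theorem_of_calculus)
    fix y
    have "((\<lambda>z. - exp (- (?c * z)) / ?c) has_field_derivative exp (- (?c * of_real y))) (at (of_real y))"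
      using c by (auto intro!: derivative_eq_intros)
    then show "((\<lambda>y. - exp (- (?c * of_real y)) / ?c) has_vector_derivative exp (- (\<i> * of_real y * of_real x))) (at y within {-T..T})"
      by (intro has_vector_derivative_real_field) (simp add: mult_ac)
  qed (use that in simp)
  have "norm (exp (- (?c * of_real T)) :: complex) = 1" for T by simp
  then have b: "norm (integral {-T..T} (\<lambda>y. exp (- (\<i> * of_real y * of_real x)))) \<le> 2 / \<bar>x\<bar>" if "T > 0" for T
    unfolding eq[OF that]
    using norm_triangle_ineq4[of "- exp (- (?c * of_real T)) / ?c" "- exp (- (?c * of_real (-T))) / ?c"]
    by (simp add: norm_divide norm_mult)
  have "((\<lambda>T. (1 / (2 * T)) * (2 / \<bar>x\<bar>)) \<longlongrightarrow> 0 * (2 / \<bar>x\<bar>)) at_top"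
    by (intro tendsto_mult_right) real_asymp
  then have "((\<lambda>T. (1 / (2 * T)) * (2 / \<bar>x\<bar>)) \<longlongrightarrow> 0) at_top" by simp
  then have "((\<lambda>T. (1 / (2 * T)) *\<^sub>R integral {-T..T} (\<lambda>y. exp (- (\<i> * of_real y * of_real x)))) \<longlongrightarrow> 0) at_top"
  proof (rule Lim_null_comparison[rotated])
    show "\<forall>\<^sub>F T in at_top. norm ((1 / (2 * T)) *\<^sub>R integral {-T..T} (\<lambda>y. exp (- (\<i> * of_real y * of_real x)))) \<le> (1 / (2 * T)) * (2 / \<bar>x\<bar>)"
      using eventually_gt_at_top[of 0]
    proof eventually_elim
      case (elim T)
      then show ?case using mult_left_mono[OF b[OF elim], of "1 / (2 * T)"] by simp
    qed
  qed
  then show ?thesis using False by (simp add: has_mean_def)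
qed

lemma has_mean_approx:
  assumes f: "continuous_on UNIV f"
    and ap: "\<And>e. e > 0 \<Longrightarrow> \<exists>g m'. continuous_on UNIV g \<and> has_mean g m' \<and> (\<forall>y. norm (f y - g y) \<le> e) \<and> norm (m' - m) \<le> e"
  shows "has_mean f m"
  unfolding has_mean_def
proof (rule tendstoI)
  fix e :: real assume "e > 0"
  then obtain g m' where g: "continuous_on UNIV g" "has_mean g m'" "\<And>y. norm (f y - g y) \<le> e/4" "norm (m' - m) \<le> e/4"
    using ap[of "e/4"] by auto
  have "\<forall>\<^sub>F T in at_top. dist ((1 / (2 * T)) *\<^sub>R integral {-T..T} g) m' < e / 4"
    using tendstoD[OF g(2)[unfolded has_mean_def], of "e/4"] \<open>e > 0\<close> by simp
  then show "\<forall>\<^sub>F T in at_top. dist ((1 / (2 * T)) *\<^sub>R integral {-T..T} f) m < e"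
    using eventually_gt_at_top[of 0]
  proof eventually_elim
    case (elim T)
    have "norm (integral {-T..T} (\<lambda>y. f y - g y)) \<le> e/4 * (T - (-T))"
      using f g elim by (intro integral_bound) (auto intro!: continuous_on_diff intro: continuous_on_subset)
    then have "norm (integral {-T..T} f - integral {-T..T} g) \<le> e/4 * (2 * T)"
      using f g by (subst (asm) integral_diff) (auto intro!: integrable_continuous_interval intro: continuous_on_subset)
    then have "(1 / (2 * T)) * norm (integral {-T..T} f - integral {-T..T} g) \<le> (1 / (2 * T)) * (e/4 * (2 * T))"
      by (rule mult_left_mono) (use elim in simp)
    then have "norm ((1 / (2 * T)) *\<^sub>R integral {-T..T} f - (1 / (2 * T)) *\<^sub>R integral {-T..T} g) \<le> e / 4"
      using elim by (simp flip: scaleR_diff_right)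
    moreover have "dist ((1 / (2 * T)) *\<^sub>R integral {-T..T} f) m
        \<le> dist ((1 / (2 * T)) *\<^sub>R integral {-T..T} f) ((1 / (2 * T)) *\<^sub>R integral {-T..T} g)
          + (dist ((1 / (2 * T)) *\<^sub>R integral {-T..T} g) m' + dist m' m)"
      using dist_triangle[of "(1 / (2 * T)) *\<^sub>R integral {-T..T} f" m "(1 / (2 * T)) *\<^sub>R integral {-T..T} g"]
        dist_triangle[of "(1 / (2 * T)) *\<^sub>R integral {-T..T} g" m m'] by linarith
    ultimately show ?case
      using elim g(4) \<open>e > 0\<close> by (simp add: dist_norm)
  qed
qed

lemma has_mean_tendsto_0:
  assumes f: "continuous_on UNIV f" and lim: "(f \<longlongrightarrow> 0) at_infinity"
  shows "has_mean f 0"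
  unfolding has_mean_def
proof (rule tendstoI)
  fix e :: real assume e: "e > 0"
  then obtain B where B: "\<And>y. norm y \<ge> B \<Longrightarrow> norm (f y) < e / 2"
    using tendstoD[OF lim, of "e/2"] by (auto simp: eventually_at_infinity)
  define C where "C = max B 1"
  have C: "C > 0" "\<And>y. \<bar>y\<bar> \<ge> C \<Longrightarrow> norm (f y) \<le> e / 2" using B by (force simp: C_def)+
  have int: "f integrable_on {a..b}" for a b
    by (intro integrable_continuous_interval continuous_on_subset[OF f]) auto
  have "((\<lambda>T. c / (2 * T)) \<longlongrightarrow> 0) at_top" for c :: real
    by real_asymp
  then have "\<forall>\<^sub>F T in at_top. norm (integral {-C..C} f) / (2 * T) < e / 2"
    by (rule order_tendstoD(2)) (use e in simp)
  then show "\<forall>\<^sub>F T in at_top. dist ((1 / (2 * T)) *\<^sub>R integral {-T..T} f) 0 < e"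
    using eventually_ge_at_top[of C]
  proof eventually_elim
    case (elim T)
    have i0: "integral {-T..T} f = integral {-T..-C} f + integral {-C..C} f + integral {C..T} f"
      using elim C int Henstock_Kurzweil_Integration.integral_combine[of "-T" "-C" T f]
        Henstock_Kurzweil_Integration.integral_combine[of "-C" C T f]
      by (simp add: add.assoc)
    have i1: "norm (integral {-T..-C} f) \<le> e/2 * (T - C)"
      using C elim integral_bound[of "-T" "-C" f "e/2"] by (auto intro!: continuous_on_subset[OF f])
    have i2: "norm (integral {C..T} f) \<le> e/2 * (T - C)"
      using C elim by (intro integral_bound) (auto intro!: continuous_on_subset[OF f])
    have "norm (integral {-T..T} f) \<le> norm (integral {-T..-C} f) + norm (integral {-C..C} f) + norm (integral {C..T} f)"
      unfolding i0 by (rule norm_triangle_le) (simp add: norm_triangle_ineq)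
    also have "\<dots> \<le> e/2 * (T - C) + norm (integral {-C..C} f) + e/2 * (T - C)"
      by (intro add_mono i1 i2 order_refl)
    also have "\<dots> \<le> e/2 * T + norm (integral {-C..C} f) + e/2 * T"
      using e C by (intro add_mono mult_left_mono) auto
    finally have "norm (integral {-T..T} f) / (2 * T) \<le> (e * T + norm (integral {-C..C} f)) / (2 * T)"
      using elim C by (intro divide_right_mono) (auto simp: mult.commute)
    also have "\<dots> = e / 2 + norm (integral {-C..C} f) / (2 * T)"
      using elim C by (simp add: field_simps)
    finally have "norm (integral {-T..T} f) / (2 * T) < e" using elim(1) by linarith
    then show ?case using elim C by simp
  qed
qed

text \<open>The approximant keeps the original coefficients on \<open>S\<close>, so truncation never
  introduces a new frequency; nonnegative frequencies stay nonnegative.\<close>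

lemma infsum_finite_approx:
  fixes \<phi> :: "'a \<Rightarrow> complex"
  assumes \<phi>: "(\<lambda>x. norm (\<phi> x)) summable_on UNIV" and "e > 0"
  obtains S where "finite S" "(\<Sum>\<^sub>\<infinity>x. norm (\<phi> x - (if x \<in> S then \<phi> x else 0))) \<le> e"
proof -
  let ?n = "\<lambda>x. norm (\<phi> x)"
  have "(?n has_sum infsum ?n UNIV) UNIV" using \<phi> by simp
  then have "(sum ?n \<longlongrightarrow> infsum ?n UNIV) (finite_subsets_at_top UNIV)" by (simp add: has_sum_def)
  then have "\<forall>\<^sub>F S in finite_subsets_at_top UNIV. dist (sum ?n S) (infsum ?n UNIV) < e"
    by (rule tendstoD) fact
  then obtain S where S: "finite S" "\<bar>sum ?n S - infsum ?n UNIV\<bar> < e"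
    unfolding eventually_finite_subsets_at_top dist_real_def by (meson order_refl)
  have "(\<Sum>\<^sub>\<infinity>x. norm (\<phi> x - (if x \<in> S then \<phi> x else 0))) = infsum ?n (UNIV - S)"
    by (rule infsum_cong_neutral) auto
  also have "\<dots> = infsum ?n UNIV - infsum ?n S"
    using \<phi> S by (intro infsum_Diff) auto
  also have "\<dots> \<le> e" using S by simp
  finally show ?thesis using S that by blast
qed

lemma trig_finite:
  assumes "finite S"
  shows "trig (\<lambda>x. if x \<in> S then \<phi> x else 0) s = (\<Sum>x\<in>S. \<phi> x * exp (- (s * of_real x)))"
    and "(\<lambda>x. norm (if x \<in> S then \<phi> x else (0::complex))) summable_on UNIV"
    and "(\<Sum>\<^sub>\<infinity>x. norm (if x \<in> S then \<phi> x else 0)) = (\<Sum>x\<in>S. norm (\<phi> x))"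
proof -
  have "trig (\<lambda>x. if x \<in> S then \<phi> x else 0) s = infsum (\<lambda>x. \<phi> x * exp (- (s * of_real x))) S"
    unfolding trig_def by (rule infsum_cong_neutral) auto
  then show "trig (\<lambda>x. if x \<in> S then \<phi> x else 0) s = (\<Sum>x\<in>S. \<phi> x * exp (- (s * of_real x)))"
    using assms by simp
  have "(\<lambda>x. norm (if x \<in> S then \<phi> x else (0::complex))) summable_on UNIV \<longleftrightarrow> (\<lambda>x. norm (\<phi> x)) summable_on S"
    by (rule summable_on_cong_neutral) auto
  then show "(\<lambda>x. norm (if x \<in> S then \<phi> x else (0::complex))) summable_on UNIV" using assms by simp
  have "(\<Sum>\<^sub>\<infinity>x. norm (if x \<in> S then \<phi> x else 0)) = infsum (\<lambda>x. norm (\<phi> x)) S"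
    by (rule infsum_cong_neutral) auto
  then show "(\<Sum>\<^sub>\<infinity>x. norm (if x \<in> S then \<phi> x else 0)) = (\<Sum>x\<in>S. norm (\<phi> x))" using assms by simp
qed

lemma norm_diff_summable:
  fixes f g :: "'a \<Rightarrow> complex"
  assumes "(\<lambda>x. norm (f x)) summable_on A" "(\<lambda>x. norm (g x)) summable_on A"
  shows "(\<lambda>x. norm (f x - g x)) summable_on A"
  using norm_add_summable(1)[of f A "\<lambda>x. - g x"] assms by simp

lemma trig_diff:
  assumes "(\<lambda>x. norm (f x)) summable_on UNIV" "(\<lambda>x. norm (g x)) summable_on UNIV" "s \<in> imag_axis"
  shows "trig (\<lambda>x. f x - g x) s = trig f s - trig g s"
  using trig_add[of f "\<lambda>x. (-1) * g x" s] trig_cmult[of "-1" g s] assms by (simp add: imag_axis_def)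

lemma norm_trig_diff_le:
  assumes "(\<lambda>x. norm (f x)) summable_on UNIV" "(\<lambda>x. norm (g x)) summable_on UNIV" "s \<in> imag_axis"
  shows "norm (trig f s - trig g s) \<le> (\<Sum>\<^sub>\<infinity>x. norm (f x - g x))"
  using norm_trig_le[OF norm_diff_summable[OF assms(1,2)], of s] trig_diff[OF assms] assms(3)
  by (simp add: imag_axis_def)

lemma imag_axis_i [simp]: "\<i> * of_real y \<in> imag_axis"
  by (simp add: imag_axis_def)

lemma continuous_imag:
  assumes "continuous_on imag_axis F"
  shows "continuous_on UNIV (\<lambda>y. F (\<i> * of_real y))"
  by (rule continuous_on_compose2[OF assms]) (auto intro!: continuous_intros)

lemma trig_continuous_imag:
  assumes "(\<lambda>x. norm (\<phi> x)) summable_on UNIV"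
  shows "continuous_on UNIV (\<lambda>y. trig \<phi> (\<i> * of_real y))"
  by (intro continuous_imag trig_continuous[OF assms]) (auto simp: imag_axis_def)

lemma fourier_continuous_imag:
  assumes "integrable lborel f"
  shows "continuous_on UNIV (\<lambda>y. fourier f (\<i> * of_real y))"
  by (intro continuous_imag fourier_continuous[OF assms]) (auto simp: imag_axis_def)

text \<open>For a finite sum this is the orthogonality of characters. Truncation changes both the
  function and the coefficient by no more than the norm of the tail.\<close>

lemma has_mean_trig:
  assumes \<phi>: "(\<lambda>x. norm (\<phi> x)) summable_on UNIV"
  shows "has_mean (\<lambda>y. trig \<phi> (\<i> * of_real y) * exp (\<i> * of_real y * of_real a)) (\<phi> a)"
proof (rule has_mean_approx)
  show "continuous_on UNIV (\<lambda>y. trig \<phi> (\<i> * of_real y) * exp (\<i> * of_real y * of_real a))"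
    by (intro continuous_intros trig_continuous_imag[OF \<phi>])
  fix e :: real assume "e > 0"
  then obtain S where S: "finite S" "(\<Sum>\<^sub>\<infinity>x. norm (\<phi> x - (if x \<in> S then \<phi> x else 0))) \<le> e"
    using infsum_finite_approx[OF \<phi>] by blast
  define \<psi> where "\<psi> = (\<lambda>x. if x \<in> S then \<phi> x else 0)"
  have \<psi>: "(\<lambda>x. norm (\<psi> x)) summable_on UNIV" unfolding \<psi>_def by (rule trig_finite(2)[OF S(1)])
  let ?g = "\<lambda>y. trig \<psi> (\<i> * of_real y) * exp (\<i> * of_real y * of_real a)"
  have "exp (- (\<i> * of_real y * of_real x)) * exp (\<i> * of_real y * of_real a)
      = exp (- (\<i> * of_real y * of_real (x - a)))" for x y
    by (simp flip: exp_add add: algebra_simps)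
  then have geq: "?g = (\<lambda>y. \<Sum>x\<in>S. \<phi> x * exp (- (\<i> * of_real y * of_real (x - a))))"
    unfolding \<psi>_def trig_finite(1)[OF S(1)] by (simp add: sum_distrib_right mult.assoc)
  have "has_mean ?g (\<Sum>x\<in>S. \<phi> x * (if x - a = 0 then 1 else 0))"
    unfolding geq using S(1) by (intro has_mean_sum has_mean_cmult has_mean_exp continuous_intros)
  also have "(\<Sum>x\<in>S. \<phi> x * (if x - a = 0 then 1 else 0)) = \<psi> a"
    unfolding \<psi>_def using S(1) by (simp add: if_distrib cong: if_cong)
  finally have m: "has_mean ?g (\<psi> a)" .
  have d: "(\<lambda>x. norm (\<phi> x - \<psi> x)) summable_on UNIV" by (rule norm_diff_summable[OF \<phi> \<psi>])
  have "norm (\<phi> a - \<psi> a) = infsum (\<lambda>x. norm (\<phi> x - \<psi> x)) {a}" by simp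
  also have "\<dots> \<le> (\<Sum>\<^sub>\<infinity>x. norm (\<phi> x - \<psi> x))"
    by (rule infsum_mono2) (use d in auto)
  also have "\<dots> \<le> e" using S(2) by (simp add: \<psi>_def)
  finally have "norm (\<psi> a - \<phi> a) \<le> e" by (simp add: norm_minus_commute)
  moreover have "norm (trig \<phi> (\<i> * of_real y) * exp (\<i> * of_real y * of_real a) - ?g y) \<le> e" for y
    using norm_trig_diff_le[OF \<phi> \<psi> imag_axis_i, of y] S(2)
    by (simp flip: left_diff_distrib add: norm_mult \<psi>_def)
  moreover have "continuous_on UNIV ?g"
    by (intro continuous_intros trig_continuous_imag[OF \<psi>])
  ultimately show "\<exists>g m'. continuous_on UNIV g \<and> has_mean g m' \<and>
      (\<forall>y. norm (trig \<phi> (\<i> * of_real y) * exp (\<i> * of_real y * of_real a) - g y) \<le> e) \<and> norm (m' - \<phi> a) \<le> e"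
    using m by blast
qed

lemma has_mean_fourier:
  assumes "integrable lborel f"
  shows "has_mean (\<lambda>y. fourier f (\<i> * of_real y) * exp (\<i> * of_real y * of_real a)) 0"
proof (rule has_mean_tendsto_0)
  show "continuous_on UNIV (\<lambda>y. fourier f (\<i> * of_real y) * exp (\<i> * of_real y * of_real a))"
    by (intro continuous_intros fourier_continuous_imag[OF assms])
  show "((\<lambda>y. fourier f (\<i> * of_real y) * exp (\<i> * of_real y * of_real a)) \<longlongrightarrow> 0) at_infinity"
    by (rule Lim_null_comparison[OF _ tendsto_norm_zero[OF riemann_lebesgue[OF assms]]])
      (simp add: norm_mult)
qed

lemma has_mean_wev:
  assumes "wpair K L f \<phi>"
  shows "has_mean (\<lambda>y. wev f \<phi> (\<i> * of_real y) * exp (\<i> * of_real y * of_real a)) (\<phi> a)"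
proof -
  have 1: "integrable lborel f" "(\<lambda>x. norm (\<phi> x)) summable_on UNIV" using assms by (auto simp: wpair_def)
  show ?thesis
    using has_mean_add[OF has_mean_fourier[OF 1(1)] has_mean_trig[OF 1(2)], of a a]
      fourier_continuous_imag[OF 1(1)] trig_continuous_imag[OF 1(2)]
    by (simp add: wev_def distrib_right continuous_intros)
qed

text \<open>Positive and negative part have the same transform, in particular the same integral
  \<open>m\<close>. Divided by \<open>m\<close> they are probability densities with equal
  characteristic functions, and Levy's uniqueness theorem applies; for \<open>m = 0\<close> both
  vanish almost everywhere.\<close>

lemma fourier_unique_real:
  fixes g :: "real \<Rightarrow> real"
  assumes g: "integrable lborel g" and z: "\<And>y. (LINT x|lborel. iexp (y * x) * of_real (g x)) = 0"
  shows "AE x in lborel. g x = 0"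
proof -
  define p where "p = (\<lambda>x. max 0 (g x))"
  define q where "q = (\<lambda>x. max 0 (- g x))"
  have [measurable]: "g \<in> borel_measurable borel" using g by auto
  have [measurable]: "p \<in> borel_measurable borel" "q \<in> borel_measurable borel"
    unfolding p_def q_def by auto
  have p: "integrable lborel p" and q: "integrable lborel q"
    unfolding p_def q_def using g by (auto intro!: integrable_max)
  have nn: "0 \<le> p x" "0 \<le> q x" "g x = p x - q x" for x by (auto simp: p_def q_def)
  have ei: "integrable lborel (\<lambda>x. iexp (y * x) * of_real (h x))" if "integrable lborel h" for h y
  proof (rule Bochner_Integration.integrable_bound[OF that])
    show "(\<lambda>x. iexp (y * x) * of_real (h x)) \<in> borel_measurable lborel"
      using that by (intro borel_measurable_times borel_measurable_of_real) (auto intro!: borel_measurable_continuous_onI continuous_intros)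
  qed (simp add: norm_mult)
  have eq: "(LINT x|lborel. iexp (y * x) * of_real (p x)) = (LINT x|lborel. iexp (y * x) * of_real (q x))" for y
    using z[of y] ei[OF p, of y] ei[OF q, of y] by (simp add: nn(3) right_diff_distrib)
  define m where "m = (LINT x|lborel. p x)"
  have "(LINT x|lborel. complex_of_real (p x)) = (LINT x|lborel. complex_of_real (q x))"
    using eq[of 0] by simp
  then have mq: "m = (LINT x|lborel. q x)" unfolding m_def integral_complex_of_real by simp
  have m0: "0 \<le> m" unfolding m_def using nn by (intro integral_nonneg_AE) auto
  show ?thesis
  proof (cases "m = 0")
    case True
    have "AE x in lborel. p x = 0"
      using integral_nonneg_eq_0_iff_AE[OF p] nn True by (simp add: m_def)
    moreover have "AE x in lborel. q x = 0"
      using integral_nonneg_eq_0_iff_AE[OF q] nn True mq by simp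
    ultimately show ?thesis by eventually_elim (simp add: nn)
  next
    case False
    then have m: "m > 0" using m0 by simp
    have rd: "real_distribution (density lborel (\<lambda>x. ennreal (h x / m)))"
      if [measurable]: "h \<in> borel_measurable borel" and h: "integrable lborel h" "\<And>x. 0 \<le> h x" "(LINT x|lborel. h x) = m" for h
    proof -
      have "emeasure (density lborel (\<lambda>x. ennreal (h x / m))) UNIV = (\<integral>\<^sup>+x. ennreal (h x / m) \<partial>lborel)"
        by (simp add: emeasure_density)
      also have "\<dots> = ennreal (LINT x|lborel. h x / m)"
        using h m by (intro nn_integral_eq_integral) auto
      also have "\<dots> = 1" using h m by simp
      finally have "prob_space (density lborel (\<lambda>x. ennreal (h x / m)))"
        by (intro prob_spaceI) simp
      then show ?thesis by (simp add: real_distribution_def real_distribution_axioms_def)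
    qed
    have ch: "char (density lborel (\<lambda>x. ennreal (h x / m))) y = (1 / m) *\<^sub>R (LINT x|lborel. iexp (y * x) * of_real (h x))"
      if [measurable]: "h \<in> borel_measurable borel" and h: "\<And>x. 0 \<le> h x" for h y
    proof -
      have "char (density lborel (\<lambda>x. ennreal (h x / m))) y = (LINT x|lborel. (h x / m) *\<^sub>R iexp (y * x))"
        unfolding char_def using h m by (subst integral_density) (auto intro!: borel_measurable_continuous_onI continuous_intros)
      also have "\<dots> = (LINT x|lborel. (1 / m) *\<^sub>R (iexp (y * x) * of_real (h x)))"
        by (intro Bochner_Integration.integral_cong) (auto simp: scaleR_conv_of_real)
      finally show ?thesis by simp
    qed
    have "density lborel (\<lambda>x. ennreal (p x / m)) = density lborel (\<lambda>x. ennreal (q x / m))"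
      by (rule Levy_uniqueness) (use rd[of p] rd[of q] ch[of p] ch[of q] p q nn mq m_def eq in \<open>auto simp: fun_eq_iff\<close>)
    then have "AE x in lborel. ennreal (p x / m) = ennreal (q x / m)"
      by (intro sigma_finite_measure.density_unique[OF sigma_finite_lborel]) auto
    then show ?thesis
      by eventually_elim (use nn m in \<open>simp add: ennreal_inj\<close>)
  qed
qed

lemma fourier_unique:
  assumes f: "integrable lborel f" and z: "\<And>y. fourier f (\<i> * of_real y) = 0"
  shows "AE x in lborel. f x = 0"
proof -
  let ?e = "\<lambda>y x. iexp (y * x)"
  have [measurable]: "f \<in> borel_measurable borel" using f by auto
  have em [measurable]: "?e y \<in> borel_measurable borel" for y
    by (auto intro!: borel_measurable_continuous_onI continuous_intros)
  have int: "integrable lborel (\<lambda>x. ?e y x * g x)" if "integrable lborel g" for g y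
  proof (rule Bochner_Integration.integrable_bound[OF that])
    show "(\<lambda>x. ?e y x * g x) \<in> borel_measurable lborel"
      using that em by (intro borel_measurable_times) auto
  qed (simp add: norm_mult)
  have 1: "(LINT x|lborel. ?e y x * f x) = 0" for y
    using z[of "-y"] by (simp add: fourier_def mult.assoc)
  \<comment> \<open>Conjugating the integral reverses the sign of the frequency, so the transform of
    \<open>cnj f\<close> vanishes as well; real and imaginary parts are combinations of
    \<open>f\<close> and \<open>cnj f\<close>.\<close>
  have 2: "(LINT x|lborel. ?e y x * cnj (f x)) = 0" for y
  proof -
    have "cnj (fourier f (\<i> * of_real y)) = (LINT x|lborel. cnj (exp (- (\<i> * of_real y * of_real x)) * f x))"
      unfolding fourier_def by (rule Bochner_Integration.integral_cnj[symmetric])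
    also have "\<dots> = (LINT x|lborel. ?e y x * cnj (f x))"
      by (simp add: exp_cnj mult.assoc)
    finally show ?thesis using z[of y] by simp
  qed
  have c: "integrable lborel (\<lambda>x. cnj (f x))" using f by simp
  have "(LINT x|lborel. ?e y x * of_real (Re (f x))) = 0" for y
  proof -
    have "(LINT x|lborel. ?e y x * of_real (Re (f x)))
        = (LINT x|lborel. (1/2) * (?e y x * f x + ?e y x * cnj (f x)))"
      by (intro Bochner_Integration.integral_cong) (auto simp: complex_eq_iff field_simps)
    also have "\<dots> = 0" using int[OF f, of y] int[OF c, of y] 1[of y] 2[of y] by simp
    finally show ?thesis .
  qed
  then have re: "AE x in lborel. Re (f x) = 0" using f by (intro fourier_unique_real) auto
  have "(LINT x|lborel. ?e y x * of_real (Im (f x))) = 0" for y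
  proof -
    have "(LINT x|lborel. ?e y x * of_real (Im (f x)))
        = (LINT x|lborel. (-\<i>/2) * (?e y x * f x - ?e y x * cnj (f x)))"
      by (intro Bochner_Integration.integral_cong) (auto simp: complex_eq_iff field_simps)
    also have "\<dots> = 0" using int[OF f, of y] int[OF c, of y] 1[of y] 2[of y] by simp
    finally show ?thesis .
  qed
  then have im: "AE x in lborel. Im (f x) = 0" using f by (intro fourier_unique_real) auto
  from re im show ?thesis by eventually_elim (simp add: complex_eq_iff)
qed

text \<open>Mean values recover \<open>\<phi>\<close>, and Fourier uniqueness then recovers
  \<open>f\<close>. The supports on the two sides may differ: this is what allows a causal
  representation to be compared, in values and in norm, with one over the whole line.\<close>

lemma wev_unique:
  assumes p: "wpair K L f \<phi>" and q: "wpair K' L' g \<psi>"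
    and eq: "\<And>y. wev f \<phi> (\<i> * of_real y) = wev g \<psi> (\<i> * of_real y)"
  shows "\<phi> = \<psi>" "AE x in lborel. f x = g x" "fourier f = fourier g" "wnorm f \<phi> = wnorm g \<psi>"
proof -
  show \<phi>\<psi>: "\<phi> = \<psi>"
  proof
    fix a show "\<phi> a = \<psi> a"
      using has_mean_unique[OF has_mean_wev[OF p, of a]] has_mean_wev[OF q, of a] eq by simp
  qed
  have fg: "integrable lborel f" "integrable lborel g" using p q by (auto simp: wpair_def)
  then have [measurable]: "f \<in> borel_measurable borel" "g \<in> borel_measurable borel" by auto
  have "fourier (\<lambda>x. f x - g x) (\<i> * of_real y) = 0" for y
    using fourier_add[of f "\<lambda>x. (-1) * g x" "\<i> * of_real y"] fourier_cmult[of "-1" g "\<i> * of_real y"] fg eq[of y]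
    by (simp add: wev_def \<phi>\<psi>)
  then have "AE x in lborel. f x - g x = 0" using fg by (intro fourier_unique) auto
  then show ae: "AE x in lborel. f x = g x" by eventually_elim simp
  show "fourier f = fourier g"
    unfolding fourier_def[abs_def]
    by (intro ext integral_cong_AE) (use ae in auto)
  have "(LINT x|lborel. norm (f x)) = (LINT x|lborel. norm (g x))"
    by (intro integral_cong_AE) (use ae in auto)
  then show "wnorm f \<phi> = wnorm g \<psi>" by (simp add: wnorm_def \<phi>\<psi>)
qed

lemma infsum_reindex_support:
  fixes g :: "'b \<Rightarrow> 'c::{comm_monoid_add,t2_space}"
  assumes "inj t" "\<And>x. x \<notin> range t \<Longrightarrow> g x = 0"
  shows "infsum g UNIV = infsum (\<lambda>k. g (t k)) UNIV"
    and "g summable_on UNIV \<longleftrightarrow> (\<lambda>k. g (t k)) summable_on UNIV"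
proof -
  have "infsum g UNIV = infsum g (range t)"
    by (rule infsum_cong_neutral) (use assms in auto)
  also have "\<dots> = infsum (g \<circ> t) UNIV" by (rule infsum_reindex) fact
  finally show "infsum g UNIV = infsum (\<lambda>k. g (t k)) UNIV" by (simp add: o_def)
  have "g summable_on UNIV \<longleftrightarrow> g summable_on (range t)"
    by (rule summable_on_cong_neutral) (use assms in auto)
  also have "\<dots> \<longleftrightarrow> (g \<circ> t) summable_on UNIV" by (rule summable_on_reindex) fact
  finally show "g summable_on UNIV \<longleftrightarrow> (\<lambda>k. g (t k)) summable_on UNIV" by (simp add: o_def)
qed

text \<open>The coefficients \<open>f\<close> at the frequencies \<open>t\<close>, as a function of the frequency.\<close>

definition spread :: "('i \<Rightarrow> complex) \<Rightarrow> ('i \<Rightarrow> real) \<Rightarrow> real \<Rightarrow> complex" where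
  "spread f t x = (if x \<in> range t then f (inv_into UNIV t x) else 0)"

lemma spread_apply: "inj t \<Longrightarrow> spread f t (t k) = f k"
  by (simp add: spread_def)

lemma spread_outside: "x \<notin> range t \<Longrightarrow> spread f t x = 0"
  by (simp add: spread_def)

lemma spread_props:
  assumes t: "inj t"
  shows "(\<lambda>x. norm (spread f t x)) summable_on UNIV \<longleftrightarrow> (\<lambda>k. norm (f k)) summable_on UNIV"
    and "(\<Sum>\<^sub>\<infinity>x. norm (spread f t x)) = (\<Sum>\<^sub>\<infinity>k. norm (f k))"
    and "trig (spread f t) s = (\<Sum>\<^sub>\<infinity>k. f k * exp (- (s * of_real (t k))))"
  using infsum_reindex_support[OF t, of "\<lambda>x. norm (spread f t x)"]
    infsum_reindex_support[OF t, of "\<lambda>x. spread f t x * exp (- (s * of_real x))"]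
  by (simp_all add: spread_apply[OF t] spread_outside trig_def)

lemma spread_of:
  assumes t: "inj t" and "\<And>x. \<phi> x \<noteq> 0 \<Longrightarrow> x \<in> range t"
  shows "spread (\<lambda>k. \<phi> (t k)) t = \<phi>"
proof
  fix x show "spread (\<lambda>k. \<phi> (t k)) t x = \<phi> x"
    using assms by (cases "x \<in> range t") (auto simp: spread_apply spread_outside)
qed

lemma enumerate_positive:
  fixes S :: "real set"
  assumes "countable S" "S \<subseteq> {0<..}"
  obtains e :: "nat \<Rightarrow> real" where "inj e" "S \<subseteq> range e" "\<And>n. 0 < e n"
proof -
  define T where "T = S \<union> range (\<lambda>n. real (Suc n))"
  have T: "countable T" "infinite T"
    unfolding T_def using assms(1) by (auto simp: range_inj_infinite inj_on_def)
  then have "bij_betw (from_nat_into T) UNIV T" by (rule bij_betw_from_nat_into)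
  then have b: "inj (from_nat_into T)" "range (from_nat_into T) = T" by (auto simp: bij_betw_def)
  have "0 < from_nat_into T n" for n
  proof -
    have "from_nat_into T n \<in> T" using b by blast
    then show ?thesis using assms(2) by (auto simp: T_def)
  qed
  then show ?thesis using that b by (auto simp: T_def)
qed

section \<open>Sequences of frequencies versus pairs\<close>

lemma A_repr_imp_wpair:
  assumes "A_repr fa f t F"
  obtains \<phi> where "wpair UNIV UNIV fa \<phi>" "F = restrict (wev fa \<phi>) imag_axis"
    "ap_series f t = trig \<phi>" "wnorm fa \<phi> = (LINT x|lborel. norm (fa x)) + (\<Sum>\<^sub>\<infinity>k. norm (f k))"
proof
  have t: "inj t" and *: "integrable lborel fa" "(\<lambda>k. norm (f k)) summable_on UNIV"
    "F = (\<lambda>s\<in>imag_axis. fourier fa s + ap_series f t s)"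
    using assms by (auto simp: A_repr_def)
  let ?\<phi> = "spread f t"
  show "wpair UNIV UNIV fa ?\<phi>" using * spread_props(1)[OF t, of f] by (simp add: wpair_def)
  show ap: "ap_series f t = trig ?\<phi>"
    by (simp add: fun_eq_iff ap_series_def spread_props(3)[OF t])
  show "F = restrict (wev fa ?\<phi>) imag_axis" using * by (simp add: ap wev_def[abs_def])
  show "wnorm fa ?\<phi> = (LINT x|lborel. norm (fa x)) + (\<Sum>\<^sub>\<infinity>k. norm (f k))"
    by (simp add: wnorm_def spread_props(2)[OF t])
qed

lemma wpair_imp_A_repr:
  assumes p: "wpair UNIV UNIV fa \<phi>"
  obtains f t where "A_repr fa f t (restrict (wev fa \<phi>) imag_axis)" "ap_series f t = trig \<phi>"
    "wnorm fa \<phi> = (LINT x|lborel. norm (fa x)) + (\<Sum>\<^sub>\<infinity>k. norm (f k))"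
proof -
  have \<phi>: "(\<lambda>x. norm (\<phi> x)) summable_on UNIV" and fa: "integrable lborel fa" using p by (auto simp: wpair_def)
  note c = countable_support[OF \<phi>]
  have sub_pos: "{x. \<phi> x \<noteq> 0} \<inter> {0<..} \<subseteq> {0<..}" by auto
  obtain p :: "nat \<Rightarrow> real" where p: "inj p" "{x. \<phi> x \<noteq> 0} \<inter> {0<..} \<subseteq> range p" "\<And>n. 0 < p n"
    using enumerate_positive[OF countable_Int1[OF c] sub_pos] by metis
  have neg_pos: "uminus ` ({x. \<phi> x \<noteq> 0} \<inter> {..<0}) \<subseteq> {0<..}" by auto
  obtain q :: "nat \<Rightarrow> real" where q: "inj q" "uminus ` ({x. \<phi> x \<noteq> 0} \<inter> {..<0}) \<subseteq> range q" "\<And>n. 0 < q n"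
    using enumerate_positive[OF countable_image[OF countable_Int1[OF c]] neg_pos] by metis
  \<comment> \<open>\<open>p\<close> and \<open>q\<close> start at \<open>0\<close> while the index
    \<open>0\<close> is reserved for the frequency \<open>0\<close>; hence the shift by one on
    either side.\<close>
  define t where "t k = (if k = 0 then 0 else if 0 < k then p (nat k - 1) else - q (nat (-k) - 1))" for k :: int
  have pos: "0 < t k" if "k \<ge> 1" for k using that p(3) by (simp add: t_def)
  have neg: "t k < 0" if "k \<le> -1" for k using that q(3) by (simp add: t_def)
  have t0: "t 0 = 0" by (simp add: t_def)
  have inj: "inj t"
  proof (rule injI)
    fix j k assume eq: "t j = t k"
    consider "j = 0" | "j \<ge> 1" | "j \<le> -1" by linarith
    then show "j = k"
    proof cases
      case 1 then show ?thesis using eq t0 pos[of k] neg[of k] by (cases "k = 0"; cases "k \<ge> 1") auto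
    next
      case 2
      then have "k \<ge> 1" using eq t0 pos[of j] neg[of k] by (cases "k = 0") force+
      then have "p (nat j - 1) = p (nat k - 1)" using 2 eq by (simp add: t_def)
      then have "nat j - 1 = nat k - 1" using p(1) by (simp add: inj_eq)
      then show ?thesis using 2 \<open>k \<ge> 1\<close> by linarith
    next
      case 3
      then have "k \<le> -1" using eq t0 neg[of j] pos[of k] by (cases "k = 0") force+
      then have "q (nat (-j) - 1) = q (nat (-k) - 1)" using 3 eq by (simp add: t_def)
      then have "nat (-j) - 1 = nat (-k) - 1" using q(1) by (simp add: inj_eq)
      then show ?thesis using 3 \<open>k \<le> -1\<close> by linarith
    qed
  qed
  have range: "x \<in> range t" if nz: "\<phi> x \<noteq> 0" for x
  proof -
    consider "x = 0" | "x > 0" | "x < 0" by linarith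
    then show ?thesis
    proof cases
      case 1 then show ?thesis using t0 by (metis rangeI)
    next
      case 2
      then obtain n where "x = p n" using p(2) nz by auto
      then have "x = t (int n + 1)" by (simp add: t_def nat_add_distrib)
      then show ?thesis by simp
    next
      case 3
      then obtain n where "- x = q n" using q(2) nz by fastforce
      then have "x = t (- int n - 1)" by (simp add: t_def nat_add_distrib)
      then show ?thesis by simp
    qed
  qed
  let ?f = "\<lambda>k. \<phi> (t k)"
  have s: "spread ?f t = \<phi>" by (rule spread_of[OF inj range])
  have ap: "ap_series ?f t = trig \<phi>"
    using spread_props(3)[OF inj, of ?f] by (simp add: fun_eq_iff ap_series_def s)
  have "A_repr fa ?f t (restrict (wev fa \<phi>) imag_axis)"
    unfolding A_repr_def using fa spread_props(1)[OF inj, of ?f] \<phi> s inj t0 pos neg ap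
    by (simp add: wev_def[abs_def])
  moreover have "wnorm fa \<phi> = (LINT x|lborel. norm (fa x)) + (\<Sum>\<^sub>\<infinity>k. norm (?f k))"
    using spread_props(2)[OF inj, of ?f] by (simp add: s wnorm_def)
  ultimately show ?thesis using that ap by blast
qed

lemma A_fun_iff: "F \<in> A_fun \<longleftrightarrow> (\<exists>f \<phi>. wpair UNIV UNIV f \<phi> \<and> F = restrict (wev f \<phi>) imag_axis)"
proof
  assume "F \<in> A_fun" then show "\<exists>f \<phi>. wpair UNIV UNIV f \<phi> \<and> F = restrict (wev f \<phi>) imag_axis"
    unfolding A_fun_def mem_Collect_eq by (elim exE) (erule A_repr_imp_wpair, blast)
next
  assume "\<exists>f \<phi>. wpair UNIV UNIV f \<phi> \<and> F = restrict (wev f \<phi>) imag_axis"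
  then show "F \<in> A_fun" unfolding A_fun_def mem_Collect_eq by (elim exE conjE) (erule wpair_imp_A_repr, blast)
qed

lemma restrict_wev_eqD:
  assumes "restrict (wev f \<phi>) imag_axis = restrict (wev g \<psi>) imag_axis"
  shows "wev f \<phi> (\<i> * of_real y) = wev g \<psi> (\<i> * of_real y)"
  using fun_cong[OF assms, of "\<i> * of_real y"] by simp

lemma A_norm_eq:
  assumes p: "wpair UNIV UNIV f \<phi>"
  shows "A_norm (restrict (wev f \<phi>) imag_axis) = wnorm f \<phi>"
  unfolding A_norm_def
proof (rule the_equality)
  show "\<exists>fa c t. A_repr fa c t (restrict (wev f \<phi>) imag_axis) \<and>
      wnorm f \<phi> = (LINT \<tau>|lborel. norm (fa \<tau>)) + (\<Sum>\<^sub>\<infinity>k. norm (c k))"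
    by (rule wpair_imp_A_repr[OF p]) blast
next
  fix r assume "\<exists>fa c t. A_repr fa c t (restrict (wev f \<phi>) imag_axis) \<and>
      r = (LINT \<tau>|lborel. norm (fa \<tau>)) + (\<Sum>\<^sub>\<infinity>k. norm (c k))"
  then obtain fa c t where *: "A_repr fa c t (restrict (wev f \<phi>) imag_axis)"
    "r = (LINT \<tau>|lborel. norm (fa \<tau>)) + (\<Sum>\<^sub>\<infinity>k. norm (c k))" by blast
  from A_repr_imp_wpair[OF *(1)] obtain \<psi> where \<psi>: "wpair UNIV UNIV fa \<psi>"
    "restrict (wev f \<phi>) imag_axis = restrict (wev fa \<psi>) imag_axis" "wnorm fa \<psi> = r"
    using *(2) by metis
  show "r = wnorm f \<phi>"
    using wev_unique(4)[OF p \<psi>(1)] restrict_wev_eqD[OF \<psi>(2)] \<psi>(3) by simp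
qed

text \<open>The description is well defined because \<open>fourier f\<close> and
  \<open>trig \<phi>\<close> are the same for all representations of the element, and nothing else
  enters the two components.\<close>

lemma W_eq:
  assumes p: "wpair UNIV UNIV f \<phi>"
  shows "W (restrict (wev f \<phi>) imag_axis) =
    (average_winding (\<lambda>y. trig \<phi> (\<i> * of_real y)),
     winding_index (\<lambda>y. 1 + inverse (trig \<phi> (\<i> * of_real y)) * fourier f (\<i> * of_real y)))"
  (is "_ = ?w")
  unfolding W_def
proof (rule the_equality)
  show "\<exists>fa c t. A_repr fa c t (restrict (wev f \<phi>) imag_axis) \<and>
      ?w = (average_winding (\<lambda>y. ap_series c t (\<i> * of_real y)),
          winding_index (\<lambda>y. 1 + inverse (ap_series c t (\<i> * of_real y)) * fourier fa (\<i> * of_real y)))"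
  proof (rule wpair_imp_A_repr[OF p], goal_cases)
    case (1 c t)
    then show ?case by (intro exI[of _ f] exI[of _ c] exI[of _ t]) simp
  qed
next
  fix r assume "\<exists>fa c t. A_repr fa c t (restrict (wev f \<phi>) imag_axis) \<and>
      r = (average_winding (\<lambda>y. ap_series c t (\<i> * of_real y)),
          winding_index (\<lambda>y. 1 + inverse (ap_series c t (\<i> * of_real y)) * fourier fa (\<i> * of_real y)))"
  then obtain fa c t where *: "A_repr fa c t (restrict (wev f \<phi>) imag_axis)"
    "r = (average_winding (\<lambda>y. ap_series c t (\<i> * of_real y)),
          winding_index (\<lambda>y. 1 + inverse (ap_series c t (\<i> * of_real y)) * fourier fa (\<i> * of_real y)))" by blast
  from A_repr_imp_wpair[OF *(1)] obtain \<psi> where \<psi>: "wpair UNIV UNIV fa \<psi>"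
    "restrict (wev f \<phi>) imag_axis = restrict (wev fa \<psi>) imag_axis" "ap_series c t = trig \<psi>"
    by metis
  show "r = ?w"
    using wev_unique(1,3)[OF p \<psi>(1)] restrict_wev_eqD[OF \<psi>(2)] \<psi>(3) *(2) by simp
qed

lemma A_funI:
  assumes "wien UNIV UNIV F r"
  shows "restrict F imag_axis \<in> A_fun" "A_norm (restrict F imag_axis) \<le> r"
proof -
  obtain f \<phi> where p: "wpair UNIV UNIV f \<phi>" "wnorm f \<phi> \<le> r" "\<And>s. s \<in> imag_axis \<Longrightarrow> F s = wev f \<phi> s"
    using wienE[OF assms] by (metis kernel_dom_UNIV)
  have "restrict F imag_axis = restrict (wev f \<phi>) imag_axis" using p(3) by auto
  then show "restrict F imag_axis \<in> A_fun" "A_norm (restrict F imag_axis) \<le> r"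
    using A_fun_iff A_norm_eq[OF p(1)] p(1,2) by auto
qed

lemma A_funD:
  assumes "F \<in> A_fun" shows "wien UNIV UNIV F (A_norm F)" "F \<in> extensional imag_axis"
proof -
  obtain f \<phi> where p: "wpair UNIV UNIV f \<phi>" "F = restrict (wev f \<phi>) imag_axis"
    using assms A_fun_iff by metis
  show "wien UNIV UNIV F (A_norm F)"
    by (rule wienI[OF p(1)]) (auto simp: p(2) A_norm_eq[OF p(1)] kernel_dom_UNIV)
  show "F \<in> extensional imag_axis" using p(2) by simp
qed

lemma Aplus_fun_iff:
  "F \<in> Aplus_fun \<longleftrightarrow> (\<exists>f \<phi>. wpair {0<..} {0..} f \<phi> \<and> F = restrict (wev f \<phi>) right_half_plane)"
proof
  assume "F \<in> Aplus_fun"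
  then obtain fa f t where *: "set_integrable lborel {0<..} fa" "(\<lambda>k. norm (f k)) summable_on UNIV"
    "inj t" "t 0 = 0" "\<forall>k\<ge>1. 0 < t k"
    "F = (\<lambda>s\<in>right_half_plane. (LINT \<tau>:{0<..}|lborel. exp (- (s * of_real \<tau>)) * fa \<tau>)
               + (\<Sum>\<^sub>\<infinity>k::nat. f k * exp (- (s * of_real (t k)))))"
    unfolding Aplus_fun_def by blast
  let ?g = "\<lambda>x. indicator {0<..} x *\<^sub>R fa x"
  have "t k \<ge> 0" for k using *(4,5) by (cases k) (auto intro: less_imp_le)
  then have "wpair {0<..} {0..} ?g (spread f t)"
    using * spread_props(1)[OF *(3), of f]
    by (auto simp: wpair_def set_integrable_def spread_def)
  moreover have "fourier ?g s = (LINT \<tau>:{0<..}|lborel. exp (- (s * of_real \<tau>)) * fa \<tau>)" for s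
    unfolding fourier_def set_lebesgue_integral_def by simp
  then have "F = restrict (wev ?g (spread f t)) right_half_plane"
    using *(6) by (simp add: wev_def[abs_def] spread_props(3)[OF *(3)])
  ultimately show "\<exists>f \<phi>. wpair {0<..} {0..} f \<phi> \<and> F = restrict (wev f \<phi>) right_half_plane" by blast
next
  assume "\<exists>f \<phi>. wpair {0<..} {0..} f \<phi> \<and> F = restrict (wev f \<phi>) right_half_plane"
  then obtain fa \<phi> where p: "wpair {0<..} {0..} fa \<phi>" "F = restrict (wev fa \<phi>) right_half_plane" by blast
  have \<phi>: "(\<lambda>x. norm (\<phi> x)) summable_on UNIV" "\<And>x. x < 0 \<Longrightarrow> \<phi> x = 0"
    and fa: "integrable lborel fa" "\<And>x. x \<le> 0 \<Longrightarrow> fa x = 0"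
    using p by (auto simp: wpair_def)
  note c = countable_support[OF \<phi>(1)]
  have sub_pos: "{x. \<phi> x \<noteq> 0} \<inter> {0<..} \<subseteq> {0<..}" by auto
  obtain p :: "nat \<Rightarrow> real" where e: "inj p" "{x. \<phi> x \<noteq> 0} \<inter> {0<..} \<subseteq> range p" "\<And>n. 0 < p n"
    using enumerate_positive[OF countable_Int1[OF c] sub_pos] by metis
  define t where "t k = (if k = 0 then 0 else p (k - 1))" for k :: nat
  have pos: "0 < t k" if "k \<ge> 1" for k using that e(3) by (simp add: t_def)
  have inj: "inj t"
  proof (rule injI)
    fix j k assume eq: "t j = t k"
    show "j = k"
      using eq e(3)[of "j - 1"] e(3)[of "k - 1"] e(1)
      by (cases "j = 0"; cases "k = 0") (auto simp: t_def inj_eq)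
  qed
  have range: "x \<in> range t" if nz: "\<phi> x \<noteq> 0" for x
  proof (cases "x = 0")
    case True then show ?thesis by (metis (full_types) rangeI t_def)
  next
    case False
    then have "x > 0" using \<phi>(2)[of x] nz by linarith
    then obtain n where "x = p n" using e(2) nz by auto
    then have "x = t (Suc n)" by (simp add: t_def)
    then show ?thesis by simp
  qed
  let ?f = "\<lambda>k. \<phi> (t k)"
  have s: "spread ?f t = \<phi>" by (rule spread_of[OF inj range])
  have ind: "indicator {0<..} x *\<^sub>R fa x = fa x" for x using fa(2)[of x] by (auto split: split_indicator)
  have "indicator {0<..} x *\<^sub>R (c * fa x) = c * fa x" for x c using fa(2)[of x] by (auto split: split_indicator)
  then have "fourier fa s = (LINT \<tau>:{0<..}|lborel. exp (- (s * of_real \<tau>)) * fa \<tau>)" for s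
    unfolding fourier_def set_lebesgue_integral_def by simp
  then have "F = (\<lambda>s\<in>right_half_plane. (LINT \<tau>:{0<..}|lborel. exp (- (s * of_real \<tau>)) * fa \<tau>)
               + (\<Sum>\<^sub>\<infinity>k::nat. ?f k * exp (- (s * of_real (t k)))))"
    using p(2) spread_props(3)[OF inj, of ?f] by (simp add: wev_def[abs_def] s)
  moreover have "set_integrable lborel {0<..} fa" unfolding set_integrable_def ind by (rule fa)
  moreover have "(\<lambda>k. norm (?f k)) summable_on UNIV" using spread_props(1)[OF inj, of ?f] \<phi> s by simp
  ultimately show "F \<in> Aplus_fun"
    unfolding Aplus_fun_def using inj pos
    by (intro CollectI exI[of _ fa] exI[of _ ?f] exI[of _ t]) (simp add: t_def)
qed

lemma Aplus_funI:
  assumes "wien {0<..} {0..} F r" shows "restrict F right_half_plane \<in> Aplus_fun"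
proof -
  obtain f \<phi> where p: "wpair {0<..} {0..} f \<phi>" "\<And>s. s \<in> right_half_plane \<Longrightarrow> F s = wev f \<phi> s"
    using wienE[OF assms] by (metis kernel_dom_nonneg)
  have "restrict F right_half_plane = restrict (wev f \<phi>) right_half_plane" using p(2) by auto
  then show ?thesis using Aplus_fun_iff p(1) by auto
qed

lemma Aplus_funD:
  assumes "F \<in> Aplus_fun"
  obtains r where "wien {0<..} {0..} F r" "F \<in> extensional right_half_plane"
proof -
  obtain f \<phi> where p: "wpair {0<..} {0..} f \<phi>" "F = restrict (wev f \<phi>) right_half_plane"
    using assms Aplus_fun_iff by metis
  have "wien {0<..} {0..} F (wnorm f \<phi>)"
    by (rule wienI[OF p(1)]) (auto simp: p(2) kernel_dom_nonneg)
  then show ?thesis using that p(2) by auto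
qed

section \<open>The Banach algebras\<close>

lemma pointwise_algebra_simps [simp]:
  "carrier (pointwise_algebra D \<F>) = \<F>"
  "F \<otimes>\<^bsub>pointwise_algebra D \<F>\<^esub> G = (\<lambda>s\<in>D. F s * G s)"
  "\<one>\<^bsub>pointwise_algebra D \<F>\<^esub> = (\<lambda>s\<in>D. 1)"
  "\<zero>\<^bsub>pointwise_algebra D \<F>\<^esub> = (\<lambda>s\<in>D. 0)"
  "F \<oplus>\<^bsub>pointwise_algebra D \<F>\<^esub> G = (\<lambda>s\<in>D. F s + G s)"
  "c \<odot>\<^bsub>pointwise_algebra D \<F>\<^esub> F = (\<lambda>s\<in>D. c * F s)"
  by (simp_all add: pointwise_algebra_def)

text \<open>The ring laws hold pointwise, so each algebra has to supply closure only. Scalar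
  multiples and negatives arise as products with constants; extensionality makes equality on
  \<open>D\<close> an equality of functions.\<close>

locale pointwise =
  fixes D :: "complex set" and \<F> :: "(complex \<Rightarrow> complex) set"
  assumes ext: "F \<in> \<F> \<Longrightarrow> F \<in> extensional D"
    and add_cl: "F \<in> \<F> \<Longrightarrow> G \<in> \<F> \<Longrightarrow> (\<lambda>s\<in>D. F s + G s) \<in> \<F>"
    and mult_cl: "F \<in> \<F> \<Longrightarrow> G \<in> \<F> \<Longrightarrow> (\<lambda>s\<in>D. F s * G s) \<in> \<F>"
    and const_cl: "(\<lambda>s\<in>D. c) \<in> \<F>"
begin

lemma smult_cl: "F \<in> \<F> \<Longrightarrow> (\<lambda>s\<in>D. c * F s) \<in> \<F>"
  using mult_cl[OF const_cl[of c], of F] by (simp cong: restrict_cong)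

lemma restrict_id: "F \<in> \<F> \<Longrightarrow> (\<lambda>s\<in>D. F s) = F"
  using ext extensional_restrict by metis

lemma is_cring: "cring (pointwise_algebra D \<F>)"
proof (rule cringI)
  show "abelian_group (pointwise_algebra D \<F>)"
  proof (rule abelian_groupI)
    fix x assume "x \<in> carrier (pointwise_algebra D \<F>)"
    then show "\<exists>y\<in>carrier (pointwise_algebra D \<F>). y \<oplus>\<^bsub>pointwise_algebra D \<F>\<^esub> x = \<zero>\<^bsub>pointwise_algebra D \<F>\<^esub>"
      using smult_cl[of x "-1"] by (intro bexI[of _ "\<lambda>s\<in>D. -1 * x s"]) (auto cong: restrict_cong)
  qed (auto simp: add_cl const_cl algebra_simps restrict_id cong: restrict_cong)
  show "comm_monoid (pointwise_algebra D \<F>)"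
    by (rule comm_monoidI) (auto simp: mult_cl const_cl algebra_simps restrict_id cong: restrict_cong)
qed (auto simp: algebra_simps cong: restrict_cong)

lemma a_inv_eq: "F \<in> \<F> \<Longrightarrow> \<ominus>\<^bsub>pointwise_algebra D \<F>\<^esub> F = (\<lambda>s\<in>D. - F s)"
proof -
  assume F: "F \<in> \<F>"
  interpret cring "pointwise_algebra D \<F>" by (rule is_cring)
  show ?thesis
    using F smult_cl[OF F, of "-1"] by (intro minus_equality) (auto cong: restrict_cong)
qed

lemma a_minus_eq: "F \<in> \<F> \<Longrightarrow> G \<in> \<F> \<Longrightarrow> F \<ominus>\<^bsub>pointwise_algebra D \<F>\<^esub> G = (\<lambda>s\<in>D. F s - G s)"
  by (simp add: a_minus_def a_inv_eq cong: restrict_cong)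

end

lemma restrict_cong': "(\<And>s. s \<in> D \<Longrightarrow> F s = G s) \<Longrightarrow> restrict F D = restrict G D"
  by auto

lemma A_fun_ops:
  assumes "F \<in> A_fun" "G \<in> A_fun"
  shows "(\<lambda>s\<in>imag_axis. F s + G s) \<in> A_fun" "A_norm (\<lambda>s\<in>imag_axis. F s + G s) \<le> A_norm F + A_norm G"
    "(\<lambda>s\<in>imag_axis. F s * G s) \<in> A_fun" "A_norm (\<lambda>s\<in>imag_axis. F s * G s) \<le> A_norm F * A_norm G"
    "(\<lambda>s\<in>imag_axis. c * F s) \<in> A_fun" "A_norm (\<lambda>s\<in>imag_axis. c * F s) \<le> norm c * A_norm F"
  using A_funI[OF wien_add[OF A_funD(1)[OF assms(1)] A_funD(1)[OF assms(2)]]]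
    A_funI[OF wien_mult[OF A_funD(1)[OF assms(1)] A_funD(1)[OF assms(2)]]]
    A_funI[OF wien_cmult[OF A_funD(1)[OF assms(1)]], of c] by auto

lemma A_fun_const: "(\<lambda>s\<in>imag_axis. c) \<in> A_fun" "A_norm (\<lambda>s\<in>imag_axis. c) \<le> norm c"
  using A_funI[OF wien_const[of UNIV UNIV c]] by auto

lemma A_norm_nonneg: "F \<in> A_fun \<Longrightarrow> 0 \<le> A_norm F"
  using wien_nonneg A_funD(1) by blast

lemma norm_le_A_norm: "F \<in> A_fun \<Longrightarrow> s \<in> imag_axis \<Longrightarrow> norm (F s) \<le> A_norm F"
  using wien_norm_le[OF A_funD(1)] by (simp add: kernel_dom_UNIV)

interpretation A: pointwise imag_axis A_fun
  by unfold_locales (auto simp: A_fun_ops A_fun_const A_funD)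

interpretation Aplus: pointwise right_half_plane Aplus_fun
proof
  fix F G :: "complex \<Rightarrow> complex" and c :: complex
  assume F: "F \<in> Aplus_fun"
  obtain r where r: "wien {0<..} {0..} F r" "F \<in> extensional right_half_plane" using Aplus_funD[OF F] by metis
  show "F \<in> extensional right_half_plane" by (rule r)
  assume G: "G \<in> Aplus_fun"
  obtain r' where r': "wien {0<..} {0..} G r'" using Aplus_funD[OF G] by metis
  show "(\<lambda>s\<in>right_half_plane. F s + G s) \<in> Aplus_fun"
    by (rule Aplus_funI[OF wien_add[OF r(1) r']]) auto
  show "(\<lambda>s\<in>right_half_plane. F s * G s) \<in> Aplus_fun"
    by (rule Aplus_funI[OF wien_mult[OF r(1) r']]) auto
next
  show "(\<lambda>s\<in>right_half_plane. c) \<in> Aplus_fun" for c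
    by (rule Aplus_funI[OF wien_const]) auto
qed

lemma A_alg_simps [simp]:
  "carrier A_alg = A_fun" "F \<otimes>\<^bsub>A_alg\<^esub> G = (\<lambda>s\<in>imag_axis. F s * G s)" "\<one>\<^bsub>A_alg\<^esub> = (\<lambda>s\<in>imag_axis. 1)"
  "\<zero>\<^bsub>A_alg\<^esub> = (\<lambda>s\<in>imag_axis. 0)" "F \<oplus>\<^bsub>A_alg\<^esub> G = (\<lambda>s\<in>imag_axis. F s + G s)"
  "c \<odot>\<^bsub>A_alg\<^esub> F = (\<lambda>s\<in>imag_axis. c * F s)"
  by (simp_all add: A_alg_def)

lemma Aplus_simps [simp]:
  "carrier Aplus = Aplus_fun" "F \<otimes>\<^bsub>Aplus\<^esub> G = (\<lambda>s\<in>right_half_plane. F s * G s)" "\<one>\<^bsub>Aplus\<^esub> = (\<lambda>s\<in>right_half_plane. 1)"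
  "\<zero>\<^bsub>Aplus\<^esub> = (\<lambda>s\<in>right_half_plane. 0)" "F \<oplus>\<^bsub>Aplus\<^esub> G = (\<lambda>s\<in>right_half_plane. F s + G s)"
  by (simp_all add: Aplus_def)

lemma A_cring: "cring A_alg" unfolding A_alg_def by (rule A.is_cring)

lemma Aplus_cring: "cring Aplus" unfolding Aplus_def by (rule Aplus.is_cring)

lemma norm_dist_A: "F \<in> A_fun \<Longrightarrow> G \<in> A_fun \<Longrightarrow> norm_dist A_alg A_norm F G = A_norm (\<lambda>s\<in>imag_axis. F s - G s)"
  by (simp add: norm_dist_def) (simp add: A_alg_def A.a_minus_eq)

lemma A_fun_diff:
  assumes "F \<in> A_fun" "G \<in> A_fun"
  shows "(\<lambda>s\<in>imag_axis. F s - G s) \<in> A_fun"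
  using A_funI[OF wien_diff[OF A_funD(1)[OF assms(1)] A_funD(1)[OF assms(2)]]] by auto

lemma A_norm_eq_zero:
  assumes F: "F \<in> A_fun"
  shows "A_norm F = 0 \<longleftrightarrow> F = (\<lambda>s\<in>imag_axis. 0)"
proof
  assume "A_norm F = 0"
  then have "F s = 0" if "s \<in> imag_axis" for s using norm_le_A_norm[OF F that] by simp
  then have "restrict F imag_axis = (\<lambda>s\<in>imag_axis. 0)" by auto
  then show "F = (\<lambda>s\<in>imag_axis. 0)" using A.restrict_id[OF F] by simp
next
  assume "F = (\<lambda>s\<in>imag_axis. 0)"
  then show "A_norm F = 0" using A_fun_const[of 0] A_norm_nonneg[OF F] by simp
qed

lemma A_norm_uminus:
  assumes F: "F \<in> A_fun" shows "A_norm (\<lambda>s\<in>imag_axis. - F s) = A_norm F"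
proof -
  let ?G = "\<lambda>s\<in>imag_axis. - F s"
  have G: "?G \<in> A_fun" "A_norm ?G \<le> A_norm F" using A_fun_ops(5,6)[OF F F, of "-1"] by simp_all
  have "(\<lambda>s\<in>imag_axis. -1 * ?G s) = (\<lambda>s\<in>imag_axis. F s)" by (rule restrict_cong') simp
  then have "A_norm F \<le> A_norm ?G"
    using A_fun_ops(6)[OF G(1) G(1), of "-1"] A.restrict_id[OF F] by simp
  then show ?thesis using G(2) by simp
qed

lemma A_metric: "Metric_space A_fun (norm_dist A_alg A_norm)"
proof
  fix x y z
  show "0 \<le> norm_dist A_alg A_norm x y"
    by (cases "x \<in> A_fun \<and> y \<in> A_fun") (auto simp: norm_dist_A A_norm_nonneg A_fun_diff, auto simp: norm_dist_def)
  show "norm_dist A_alg A_norm x y = norm_dist A_alg A_norm y x"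
  proof (cases "x \<in> A_fun \<and> y \<in> A_fun")
    case True
    have "(\<lambda>s\<in>imag_axis. - (\<lambda>s\<in>imag_axis. x s - y s) s) = (\<lambda>s\<in>imag_axis. y s - x s)"
      by (rule restrict_cong') simp
    then show ?thesis using True A_norm_uminus[OF A_fun_diff[of x y]] by (simp add: norm_dist_A)
  qed (auto simp: norm_dist_def)
  assume x: "x \<in> A_fun" and y: "y \<in> A_fun"
  show "norm_dist A_alg A_norm x y = 0 \<longleftrightarrow> x = y"
  proof -
    have "norm_dist A_alg A_norm x y = 0 \<longleftrightarrow> (\<lambda>s\<in>imag_axis. x s - y s) = (\<lambda>s\<in>imag_axis. 0)"
      by (simp add: norm_dist_A x y A_norm_eq_zero A_fun_diff)
    also have "\<dots> \<longleftrightarrow> (\<forall>s\<in>imag_axis. x s = y s)"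
      by (auto simp: fun_eq_iff restrict_def)
    also have "\<dots> \<longleftrightarrow> x = y" using A.ext[OF x] A.ext[OF y] by (metis extensionalityI)
    finally show ?thesis .
  qed
  assume z: "z \<in> A_fun"
  have "(\<lambda>s\<in>imag_axis. (\<lambda>s\<in>imag_axis. x s - y s) s + (\<lambda>s\<in>imag_axis. y s - z s) s) = (\<lambda>s\<in>imag_axis. x s - z s)"
    by (rule restrict_cong') simp
  then show "norm_dist A_alg A_norm x z \<le> norm_dist A_alg A_norm x y + norm_dist A_alg A_norm y z"
    using A_fun_ops(2)[OF A_fun_diff[OF x y] A_fun_diff[OF y z]] by (simp add: norm_dist_A x y z)
qed

lemma wien_diff_A_norm:
  assumes "F \<in> A_fun" "G \<in> A_fun"
  shows "wien UNIV UNIV (\<lambda>s. F s - G s) (norm_dist A_alg A_norm F G)"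
  using wien_cong[OF A_funD(1)[OF A_fun_diff[OF assms]], of "\<lambda>s. F s - G s"]
  by (simp add: norm_dist_A[OF assms] kernel_dom_UNIV)

text \<open>A rapidly converging subsequence is written as a telescoping series, which
  \<open>wien_suminf\<close> sums in norm.\<close>

lemma A_complete: "Metric_space.mcomplete A_fun (norm_dist A_alg A_norm)"
proof -
  interpret Metric_space A_fun "norm_dist A_alg A_norm" by (rule A_metric)
  let ?d = "norm_dist A_alg A_norm"
  show ?thesis unfolding mcomplete_def
  proof (intro allI impI)
    fix \<sigma> assume "MCauchy \<sigma>"
    then have \<sigma>: "\<And>n. \<sigma> n \<in> A_fun" and C: "\<And>e. e > 0 \<Longrightarrow> \<exists>N. \<forall>n n'. N \<le> n \<longrightarrow> N \<le> n' \<longrightarrow> ?d (\<sigma> n) (\<sigma> n') < e"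
      unfolding MCauchy_def by auto
    have "\<forall>k. \<exists>N. \<forall>n n'. N \<le> n \<longrightarrow> N \<le> n' \<longrightarrow> ?d (\<sigma> n) (\<sigma> n') < (1/2)^k"
      using C by simp
    then obtain N where N: "\<And>k n n'. N k \<le> n \<Longrightarrow> N k \<le> n' \<Longrightarrow> ?d (\<sigma> n) (\<sigma> n') < (1/2)^k"
      by metis
    \<comment> \<open>Summing the thresholds gives indices that are monotone and still beyond
      \<open>N k\<close>.\<close>
    define r where "r k = (\<Sum>i\<le>k. N i)" for k
    have rN: "N k \<le> r k" "r k \<le> r (Suc k)" for k
      unfolding r_def by (auto intro: member_le_sum)
    define G where "G k s = \<sigma> (r (Suc k)) s - \<sigma> (r k) s" for k s
    have G: "wien UNIV UNIV (G k) ((1/2)^k)" for k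
      unfolding G_def
    proof (rule wien_le[OF wien_diff_A_norm[OF \<sigma> \<sigma>]])
      show "?d (\<sigma> (r (Suc k))) (\<sigma> (r k)) \<le> (1/2)^k"
        using N[of k "r (Suc k)" "r k"] rN[of k] by simp
    qed
    define H where "H m s = suminf (\<lambda>k. G (k + m) s)" for m s
    have sumG: "summable (\<lambda>k. G k s)" if "s \<in> imag_axis" for s
      using wien_suminf(2)[OF G] that by (simp add: kernel_dom_UNIV summable_geometric)
    have H: "wien UNIV UNIV (H m) (2 * (1/2)^m)" for m
    proof -
      have "summable (\<lambda>k. (1/2::real)^(k + m))"
        by (subst summable_iff_shift) (simp add: summable_geometric)
      then have "wien UNIV UNIV (H m) (suminf (\<lambda>k. (1/2::real)^(k + m)))"
        unfolding H_def using wien_suminf(1)[of UNIV UNIV "\<lambda>k. G (k + m)", OF G] by simp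
      moreover have "suminf (\<lambda>k. (1/2::real)^(k + m)) = 2 * (1/2)^m"
        using suminf_mult2[of "\<lambda>k. (1/2::real)^k" "(1/2)^m"] by (simp add: power_add summable_geometric suminf_geometric)
      ultimately show ?thesis by simp
    qed
    define F where "F s = \<sigma> (r 0) s + H 0 s" for s
    have F: "wien UNIV UNIV F (A_norm (\<sigma> (r 0)) + 2 * (1/2)^0)"
      unfolding F_def by (rule wien_add[OF A_funD(1)[OF \<sigma>] H]) simp
    have tail: "F s - \<sigma> (r m) s = H m s" if s: "s \<in> imag_axis" for m s
    proof -
      have "H 0 s = H m s + (\<Sum>k<m. G k s)"
        unfolding H_def using suminf_split_initial_segment[OF sumG[OF s], of m] by simp
      moreover have "(\<Sum>k<m. G k s) = \<sigma> (r m) s - \<sigma> (r 0) s"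
        unfolding G_def by (rule sum_lessThan_telescope)
      ultimately show ?thesis by (simp add: F_def)
    qed
    let ?F = "restrict F imag_axis"
    have FA: "?F \<in> A_fun" by (rule A_funI[OF F])
    \<comment> \<open>One unit is the distance from \<open>\<sigma> n\<close> to
      \<open>\<sigma> (r m)\<close>, two units bound the tail \<open>H m\<close>.\<close>
    have d: "?d (\<sigma> n) ?F \<le> 3 * (1/2)^m" if n: "n \<ge> r m" for n m
    proof -
      have "wien UNIV UNIV (\<lambda>s. (\<sigma> n s - \<sigma> (r m) s) + (-1) * H m s) (?d (\<sigma> n) (\<sigma> (r m)) + norm (-1::complex) * (2 * (1/2)^m))"
        by (rule wien_add[OF wien_diff_A_norm[OF \<sigma> \<sigma>] wien_cmult[OF H]]) simp
      from A_funI(2)[OF this]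
      have "A_norm (\<lambda>s\<in>imag_axis. (\<sigma> n s - \<sigma> (r m) s) + (-1) * H m s) \<le> ?d (\<sigma> n) (\<sigma> (r m)) + 2 * (1/2)^m" by simp
      moreover have "(\<lambda>s\<in>imag_axis. (\<sigma> n s - \<sigma> (r m) s) + (-1) * H m s) = (\<lambda>s\<in>imag_axis. \<sigma> n s - ?F s)"
        by (rule restrict_cong') (simp add: tail[symmetric])
      moreover have "?d (\<sigma> n) (\<sigma> (r m)) < (1/2)^m" by (rule N) (use rN n in \<open>auto intro: order_trans\<close>)
      ultimately show ?thesis by (simp add: norm_dist_A[OF \<sigma> FA])
    qed
    have "limitin mtopology \<sigma> ?F sequentially"
      unfolding limitin_metric eventually_sequentially
    proof (intro conjI allI impI FA)
      fix e :: real assume "e > 0"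
      then have "0 < e / 3" by simp
      then obtain m where "(1/2::real)^m < e / 3" using real_arch_pow_inv[of "e/3" "1/2"] by auto
      then show "\<exists>M. \<forall>n\<ge>M. \<sigma> n \<in> A_fun \<and> ?d (\<sigma> n) ?F < e"
        using \<sigma> d[of m] by (intro exI[of _ "r m"]) (fastforce intro: le_less_trans)
    qed
    then show "\<exists>x. limitin mtopology \<sigma> x sequentially" by blast
  qed
qed

lemma A_norm_smult:
  assumes F: "F \<in> A_fun" shows "A_norm (\<lambda>s\<in>imag_axis. c * F s) = norm c * A_norm F"
proof (cases "c = 0")
  case True
  then show ?thesis using A_fun_const[of 0] A_norm_nonneg[of "\<lambda>s\<in>imag_axis. 0"] by simp
next
  case False
  let ?G = "\<lambda>s\<in>imag_axis. c * F s"
  have G: "?G \<in> A_fun" "A_norm ?G \<le> norm c * A_norm F" using A_fun_ops(5,6)[OF F F] by auto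
  have "(\<lambda>s\<in>imag_axis. inverse c * ?G s) = (\<lambda>s\<in>imag_axis. F s)"
    by (rule restrict_cong') (use False in simp)
  then have "A_norm F \<le> norm (inverse c) * A_norm ?G"
    using A_fun_ops(6)[OF G(1) G(1), of "inverse c"] A.restrict_id[OF F] by simp
  then have "norm c * A_norm F \<le> norm c * (norm (inverse c) * A_norm ?G)"
    by (rule mult_left_mono) simp
  also have "\<dots> = A_norm ?G" using False by (simp add: norm_inverse)
  finally show ?thesis using G(2) by simp
qed

lemma A_banach: "comm_complex_banach_algebra A_alg A_norm"
proof (intro comm_complex_banach_algebra.intro comm_complex_banach_algebra_axioms.intro)
  show "algebra (ring_of_type_algebra :: complex ring) A_alg"
  proof (rule algebraI)
    show "cring (ring_of_type_algebra :: complex ring)" by (rule cring_from_type_algebra)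
    show "cring A_alg" by (rule A_cring)
  qed (auto simp: ring_of_type_algebra_def A_fun_ops algebra_simps A.restrict_id cong: restrict_cong)
  show "A_norm \<one>\<^bsub>A_alg\<^esub> = 1"
    using A_fun_const[of 1] norm_le_A_norm[OF A_fun_const(1)[of 1], of 0] by (simp add: imag_axis_def)
  show "Metric_space.mcomplete (carrier A_alg) (norm_dist A_alg A_norm)"
    using A_complete by simp
qed (auto simp: A_norm_nonneg A_norm_eq_zero A_fun_ops A_norm_smult)

text \<open>Kernels of point evaluations. They already suffice for semisimplicity, because an
  element lying in all of them vanishes on the whole axis.\<close>

lemma A_maximalideal:
  assumes s: "s \<in> imag_axis"
  shows "maximalideal {F \<in> A_fun. F s = 0} A_alg"
proof (rule maximalidealI)
  interpret A_alg: cring A_alg by (rule A_cring)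
  let ?I = "{F \<in> A_fun. F s = 0}"
  show "ideal ?I A_alg"
  proof (rule idealI)
    show "ring A_alg" by (rule A_alg.ring_axioms)
    show "subgroup ?I (add_monoid A_alg)"
    proof (rule A_alg.add.subgroupI)
      have "(\<lambda>s\<in>imag_axis. 0) \<in> ?I" using A_fun_const(1)[of 0] s by simp
      then show "?I \<noteq> {}" by blast
      show "\<ominus>\<^bsub>A_alg\<^esub> a \<in> ?I" if "a \<in> ?I" for a
        using that s A_fun_ops(5)[of a a "-1"] by (auto simp: A_alg_def A.a_inv_eq)
    qed (use s in \<open>auto simp: A_fun_ops\<close>)
  qed (use s in \<open>auto simp: A_fun_ops\<close>)
  show "carrier A_alg \<noteq> ?I"
  proof
    assume "carrier A_alg = ?I"
    then have "(\<lambda>s\<in>imag_axis. 1) \<in> ?I" using A_fun_const(1)[of 1] by simp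
    then show False using s by simp
  qed
  fix J assume J: "ideal J A_alg" "?I \<subseteq> J" "J \<subseteq> carrier A_alg"
  interpret J: ideal J A_alg by (rule J)
  show "J = ?I \<or> J = carrier A_alg"
  proof (rule disjCI)
    assume "J \<noteq> carrier A_alg"
    show "J = ?I"
    proof (rule ccontr)
      assume "J \<noteq> ?I"
      then obtain G where G: "G \<in> J" "G s \<noteq> 0" "G \<in> A_fun" using J by auto
      have "F \<in> J" if F: "F \<in> A_fun" for F
      proof -
        let ?c = "\<lambda>z\<in>imag_axis. F s / G s"
        \<comment> \<open>Subtracting the right multiple of \<open>G\<close> makes \<open>F\<close>
          vanish at \<open>s\<close>, so every \<open>F\<close> is in \<open>?I\<close> modulo
          \<open>J\<close>.\<close>
        let ?H = "\<lambda>z\<in>imag_axis. F z - (F s / G s) * G z"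
        have "?H \<in> A_fun"
          using A_fun_diff[OF F A_fun_ops(5)[OF G(3) G(3), of "F s / G s"]] by (simp cong: restrict_cong)
        moreover have "?H s = 0" using G s by simp
        ultimately have "?H \<in> J" using J(2) by blast
        moreover have "?c \<otimes>\<^bsub>A_alg\<^esub> G \<in> J" by (rule J.I_l_closed[OF G(1)]) (simp add: A_fun_const)
        ultimately have "?H \<oplus>\<^bsub>A_alg\<^esub> (?c \<otimes>\<^bsub>A_alg\<^esub> G) \<in> J" by (rule J.a_closed)
        moreover have "?H \<oplus>\<^bsub>A_alg\<^esub> (?c \<otimes>\<^bsub>A_alg\<^esub> G) = (\<lambda>z\<in>imag_axis. F z)"
          by (simp cong: restrict_cong)
        ultimately show ?thesis using A.restrict_id[OF F] by simp
      qed
      then show False using J \<open>J \<noteq> carrier A_alg\<close> by auto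
    qed
  qed
qed

lemma A_semisimple: "semisimple_cring A_alg"
  unfolding semisimple_cring_def
proof
  show "jacobson_radical A_alg \<subseteq> {\<zero>\<^bsub>A_alg\<^esub>}"
  proof
    fix F assume F: "F \<in> jacobson_radical A_alg"
    then have FA: "F \<in> A_fun" by (simp add: jacobson_radical_def)
    have "F s = 0" if "s \<in> imag_axis" for s
      using F A_maximalideal[OF that] by (auto simp: jacobson_radical_def)
    then have "(\<lambda>s\<in>imag_axis. F s) = (\<lambda>s\<in>imag_axis. 0)" by (intro restrict_cong') simp
    then show "F \<in> {\<zero>\<^bsub>A_alg\<^esub>}" using A.restrict_id[OF FA] by simp
  qed
  show "{\<zero>\<^bsub>A_alg\<^esub>} \<subseteq> jacobson_radical A_alg"
    unfolding jacobson_radical_def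
    using A_fun_const[of 0] additive_subgroup.zero_closed[of _ A_alg] 
    by (auto simp: maximalideal_def ideal_def)
qed

section \<open>The involution and the embedding by boundary values\<close>

text \<open>On the imaginary axis, conjugating the kernel amounts to reversing time; so conjugation
  of values corresponds to reflecting and conjugating the pair.\<close>

lemma wpair_reflect:
  assumes p: "wpair UNIV UNIV f \<phi>"
  shows "wpair UNIV UNIV (\<lambda>x. cnj (f (- x))) (\<lambda>x. cnj (\<phi> (- x)))"
    and "s \<in> imag_axis \<Longrightarrow> fourier (\<lambda>x. cnj (f (- x))) s = cnj (fourier f s)"
    and "s \<in> imag_axis \<Longrightarrow> trig (\<lambda>x. cnj (\<phi> (- x))) s = cnj (trig \<phi> s)"
proof -
  have f: "integrable lborel f" and \<phi>: "(\<lambda>x. norm (\<phi> x)) summable_on UNIV" using p by (auto simp: wpair_def)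
  have bij: "bij_betw uminus (UNIV :: real set) UNIV"
    by (rule bij_betwI[where g=uminus]) auto
  have "integrable lborel (\<lambda>x. f (- x))"
    using lborel_integrable_real_affine[OF f, of "-1" 0] by simp
  then show "wpair UNIV UNIV (\<lambda>x. cnj (f (- x))) (\<lambda>x. cnj (\<phi> (- x)))"
    using \<phi> summable_on_reindex_bij_betw[OF bij, of "\<lambda>x. norm (\<phi> x)"] by (simp add: wpair_def)
  assume s: "s \<in> imag_axis"
  have e: "exp (- (s * of_real (- x))) = cnj (exp (- (s * of_real x)))" for x :: real
  proof -
    have "- (s * of_real (- x)) = cnj (- (s * of_real x))"
      using s by (simp add: imag_axis_def complex_eq_iff)
    then show ?thesis by (simp only: exp_cnj)
  qed
  have "fourier (\<lambda>x. cnj (f (- x))) s = (LINT x|lborel. exp (- (s * of_real (- (-x)))) * cnj (f (- x)))"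
    by (simp add: fourier_def)
  also have "\<dots> = (LINT x|lborel. exp (- (s * of_real (- x))) * cnj (f x))"
    using lborel_integral_real_affine[of "-1" "\<lambda>x. exp (- (s * of_real (- x))) * cnj (f x)" 0] by simp
  also have "\<dots> = (LINT x|lborel. cnj (exp (- (s * of_real x)) * f x))"
    by (simp only: e complex_cnj_mult)
  finally show "fourier (\<lambda>x. cnj (f (- x))) s = cnj (fourier f s)"
    unfolding fourier_def by (simp only: Bochner_Integration.integral_cnj)
  have "trig (\<lambda>x. cnj (\<phi> (- x))) s = (\<Sum>\<^sub>\<infinity>x. cnj (\<phi> (- x)) * exp (- (s * of_real (- (- x)))))"
    by (simp add: trig_def)
  also have "\<dots> = (\<Sum>\<^sub>\<infinity>x. cnj (\<phi> x) * exp (- (s * of_real (- x))))"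
    by (rule infsum_reindex_bij_betw[OF bij, of "\<lambda>x. cnj (\<phi> x) * exp (- (s * of_real (- x)))"])
  also have "\<dots> = (\<Sum>\<^sub>\<infinity>x. cnj (\<phi> x * exp (- (s * of_real x))))"
    by (simp only: e complex_cnj_mult)
  finally show "trig (\<lambda>x. cnj (\<phi> (- x))) s = cnj (trig \<phi> s)"
    unfolding trig_def by (simp only: infsum_cnj)
qed

lemma A_star_fun: "F \<in> A_fun \<Longrightarrow> A_star F \<in> A_fun"
proof -
  assume "F \<in> A_fun"
  then obtain f \<phi> where p: "wpair UNIV UNIV f \<phi>" "F = restrict (wev f \<phi>) imag_axis" using A_fun_iff by metis
  have "A_star F = restrict (wev (\<lambda>x. cnj (f (- x))) (\<lambda>x. cnj (\<phi> (- x)))) imag_axis"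
    unfolding A_star_def p(2) by (rule restrict_cong') (simp add: wev_def wpair_reflect(2,3)[OF p(1)])
  then show ?thesis using wpair_reflect(1)[OF p(1)] A_fun_iff by metis
qed

lemma A_star_involution: "algebra_involution A_alg A_star"
  unfolding algebra_involution_def
  by (auto simp: A_star_fun) (auto simp: A_star_def A.restrict_id mult.commute cong: restrict_cong)

lemma imag_axis_subset: "imag_axis \<subseteq> right_half_plane"
  by (auto simp: imag_axis_def right_half_plane_def)

lemma boundary_Aplus: "F \<in> Aplus_fun \<Longrightarrow> boundary F \<in> A_fun"
  unfolding boundary_def by (erule Aplus_funD) (rule A_funI, erule wien_mono, auto)

lemma boundary_hom: "R \<subseteq> Aplus_fun \<Longrightarrow> boundary \<in> ring_hom (Aplus\<lparr>carrier := R\<rparr>) A_alg"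
proof (rule ring_hom_memI)
  show "boundary x \<in> carrier A_alg" if "R \<subseteq> Aplus_fun" "x \<in> carrier (Aplus\<lparr>carrier := R\<rparr>)" for x
    using that boundary_Aplus by auto
qed (use imag_axis_subset in \<open>auto simp: boundary_def fun_eq_iff restrict_def\<close>)

text \<open>Agreement on the axis forces the pairs to agree up to a null set, and then the
  transforms agree at every \<open>s\<close>. It serves as the identity principle for boundary
  values.\<close>

lemma wev_eq_if_eq_imag:
  assumes p: "wpair K L f \<phi>" and q: "wpair K' L' g \<psi>"
    and eq: "\<And>s. s \<in> imag_axis \<Longrightarrow> wev f \<phi> s = wev g \<psi> s"
  shows "wev f \<phi> s = wev g \<psi> s"
  using wev_unique(1,3)[OF p q] eq imag_axis_i by (simp add: wev_def)

lemma boundary_inj: "inj_on boundary Aplus_fun"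
proof (rule inj_onI)
  fix F G assume F: "F \<in> Aplus_fun" and G: "G \<in> Aplus_fun" and eq: "boundary F = boundary G"
  obtain f \<phi> where p: "wpair {0<..} {0..} f \<phi>" "F = restrict (wev f \<phi>) right_half_plane"
    using F Aplus_fun_iff by metis
  obtain g \<psi> where q: "wpair {0<..} {0..} g \<psi>" "G = restrict (wev g \<psi>) right_half_plane"
    using G Aplus_fun_iff by metis
  have "wev f \<phi> s = wev g \<psi> s" if "s \<in> imag_axis" for s
    using fun_cong[OF eq, of s] that imag_axis_subset p(2) q(2) by (auto simp: boundary_def)
  from wev_eq_if_eq_imag[OF p(1) q(1) this] have "wev f \<phi> = wev g \<psi>" by blast
  then show "F = G" unfolding p(2) q(2) by simp
qed

section \<open>Holomorphy and absence of zero divisors\<close>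

text \<open>Differentiation under the integral. For \<open>Re z > \<delta>\<close> the derivative of
  the kernel is bounded by \<open>1 / \<delta>\<close> uniformly in time, as
  \<open>\<delta> * t \<le> exp (\<delta> * t)\<close>; hence
  \<open>1 / \<delta> * norm (u x)\<close> dominates the difference quotients.\<close>

lemma kernel_holomorphic:
  assumes u: "integrable M u" and [measurable]: "\<tau> \<in> borel_measurable M"
    and pos: "\<And>x. u x \<noteq> 0 \<Longrightarrow> 0 \<le> \<tau> x"
  shows "(\<lambda>s. LINT x|M. exp (- (s * complex_of_real (\<tau> x))) * u x) holomorphic_on {s. 0 < Re s}"
  unfolding holomorphic_on_def
proof
  fix s :: complex assume "s \<in> {s. 0 < Re s}"
  define \<delta> where "\<delta> = Re s / 2"
  have \<delta>: "0 < \<delta>" "\<delta> < Re s" using \<open>s \<in> _\<close> by (auto simp: \<delta>_def)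
  let ?S = "{z. \<delta> < Re z}"
  have [measurable]: "u \<in> borel_measurable M" using u by auto
  have [measurable]: "(\<lambda>x. exp (- (z * complex_of_real (\<tau> x)))) \<in> borel_measurable M" for z
    using measurable_compose[OF \<open>\<tau> \<in> borel_measurable M\<close> kernel_measurable] .
  let ?F = "\<lambda>s. LINT x|M. exp (- (s * complex_of_real (\<tau> x))) * u x"
  let ?D = "LINT x|M. (- complex_of_real (\<tau> x) * exp (- (s * complex_of_real (\<tau> x)))) * u x"
  have int: "integrable M (\<lambda>x. exp (- (z * complex_of_real (\<tau> x))) * u x)" if "z \<in> ?S" for z
    by (rule kernel_integrable(1)[OF u]) (use that \<delta> pos in auto)
  have bd: "norm (exp (- (z * complex_of_real t)) - exp (- (s * complex_of_real t))) \<le> 1 / \<delta> * norm (z - s)"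
    if "0 \<le> t" "z \<in> ?S" for z t
  proof (rule field_differentiable_bound[of ?S])
    show "convex ?S" by (rule convex_halfspace_Re_gt)
    fix w assume w: "w \<in> ?S"
    show "((\<lambda>z. exp (- (z * complex_of_real t))) has_field_derivative (- complex_of_real t * exp (- (w * complex_of_real t)))) (at w within ?S)"
      by (auto intro!: derivative_eq_intros)
    have "\<delta> * t \<le> exp (\<delta> * t)" using exp_ge_add_one_self[of "\<delta> * t"] by linarith
    then have "\<delta> * t * exp (- (\<delta> * t)) \<le> 1" by (simp add: exp_minus field_simps)
    moreover have "exp (- (Re w * t)) \<le> exp (- (\<delta> * t))" using w that by (auto intro: mult_right_mono)
    then have "\<delta> * t * exp (- (Re w * t)) \<le> \<delta> * t * exp (- (\<delta> * t))" using \<delta> that by (intro mult_left_mono) auto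
    ultimately have "\<delta> * (t * exp (- (Re w * t))) \<le> 1" by (simp only: mult.assoc)
    then have "t * exp (- (Re w * t)) \<le> 1 / \<delta>" using \<delta> by (simp add: pos_le_divide_eq mult.commute)
    then show "norm (- complex_of_real t * exp (- (w * complex_of_real t))) \<le> 1 / \<delta>"
      using that by (simp add: norm_mult)
  qed (use that \<delta> in auto)
  have "(?F has_field_derivative ?D) (at s within ?S)"
    unfolding has_field_derivative_iff tendsto_at_iff_sequentially
  proof (intro allI impI)
    fix z assume z: "\<forall>i. z i \<in> ?S - {s}" "z \<longlonglongrightarrow> s"
    let ?q = "\<lambda>i x. (exp (- (z i * complex_of_real (\<tau> x))) - exp (- (s * complex_of_real (\<tau> x)))) / (z i - s) * u x"
    have "(\<lambda>i. LINT x|M. ?q i x) \<longlonglongrightarrow> ?D"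
    proof (rule integral_dominated_convergence[where w="\<lambda>x. 1 / \<delta> * norm (u x)"])
      show "AE x in M. (\<lambda>i. ?q i x) \<longlonglongrightarrow> (- complex_of_real (\<tau> x) * exp (- (s * complex_of_real (\<tau> x)))) * u x"
      proof (intro AE_I2 tendsto_mult_right)
        fix x
        have "((\<lambda>z. exp (- (z * complex_of_real (\<tau> x)))) has_field_derivative (- complex_of_real (\<tau> x) * exp (- (s * complex_of_real (\<tau> x))))) (at s within ?S)"
          by (auto intro!: derivative_eq_intros)
        then show "(\<lambda>i. (exp (- (z i * complex_of_real (\<tau> x))) - exp (- (s * complex_of_real (\<tau> x)))) / (z i - s)) \<longlonglongrightarrow> - complex_of_real (\<tau> x) * exp (- (s * complex_of_real (\<tau> x)))"
          unfolding has_field_derivative_iff tendsto_at_iff_sequentially using z by (auto simp: o_def)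
      qed
      show "AE x in M. norm (?q i x) \<le> 1 / \<delta> * norm (u x)" for i
      proof (rule AE_I2)
        fix x
        show "norm (?q i x) \<le> 1 / \<delta> * norm (u x)"
        proof (cases "u x = 0")
          case False
          have zi: "z i \<in> ?S" "0 < norm (z i - s)" using z(1) by auto
          have "norm (exp (- (z i * complex_of_real (\<tau> x))) - exp (- (s * complex_of_real (\<tau> x)))) / norm (z i - s) \<le> 1 / \<delta>"
            using bd[OF pos[OF False] zi(1)] zi(2) by (simp only: pos_divide_le_eq)
          then show ?thesis unfolding norm_mult norm_divide by (rule mult_right_mono) simp
        qed simp
      qed
    qed (use u in auto)
    moreover have "(LINT x|M. ?q i x) = (?F (z i) - ?F s) / (z i - s)" for i
    proof -
      have "(LINT x|M. ?q i x) = (LINT x|M. (exp (- (z i * complex_of_real (\<tau> x))) * u x - exp (- (s * complex_of_real (\<tau> x))) * u x) / (z i - s))"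
        by (simp add: left_diff_distrib)
      also have "\<dots> = (?F (z i) - ?F s) / (z i - s)"
        using int[of "z i"] int[of s] z(1) \<delta> by (subst integral_divide_zero, subst Bochner_Integration.integral_diff) auto
      finally show ?thesis .
    qed
    ultimately show "((\<lambda>w. (?F w - ?F s) / (w - s)) \<circ> z) \<longlonglongrightarrow> ?D" by (simp only: o_def)
  qed
  moreover have "open ?S" by (rule open_halfspace_Re_gt)
  ultimately have "(?F has_field_derivative ?D) (at s)"
    using \<delta> by (simp add: at_within_open[of s ?S])
  then show "?F field_differentiable at s within {s. 0 < Re s}"
    using field_differentiable_at_within field_differentiable_def by blast
qed

lemma wev_holomorphic:
  assumes p: "wpair {0<..} {0..} f \<phi>" shows "wev f \<phi> holomorphic_on {s. 0 < Re s}"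
proof -
  have f: "integrable lborel f" and \<phi>: "(\<lambda>x. norm (\<phi> x)) summable_on UNIV"
    using p by (auto simp: wpair_def)
  have f0: "0 \<le> x" if "f x \<noteq> 0" for x using p that by (cases "0 < x") (auto simp: wpair_def)
  have \<phi>0: "0 \<le> x" if "\<phi> x \<noteq> 0" for x using p that by (cases "0 \<le> x") (auto simp: wpair_def)
  have "(\<lambda>s. LINT x|lborel. exp (- (s * complex_of_real x)) * f x) holomorphic_on {s. 0 < Re s}"
    by (rule kernel_holomorphic) (use f f0 in auto)
  moreover have "(\<lambda>s. LINT x|count_space UNIV. exp (- (s * complex_of_real x)) * \<phi> x) holomorphic_on {s. 0 < Re s}"
    by (rule kernel_holomorphic) (use \<phi> \<phi>0 in \<open>auto simp: abs_summable_iff_integrable\<close>)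
  ultimately have "(\<lambda>s. (LINT x|lborel. exp (- (s * complex_of_real x)) * f x) +
      (LINT x|count_space UNIV. exp (- (s * complex_of_real x)) * \<phi> x)) holomorphic_on {s. 0 < Re s}"
    by (rule holomorphic_on_add)
  then show ?thesis
  proof (rule holomorphic_transform)
    fix s :: complex assume "s \<in> {s. 0 < Re s}"
    then show "(LINT x|lborel. exp (- (s * complex_of_real x)) * f x) +
      (LINT x|count_space UNIV. exp (- (s * complex_of_real x)) * \<phi> x) = wev f \<phi> s"
      unfolding wev_def fourier_def using \<phi> \<phi>0 by (subst trig_eq_integral) auto
  qed
qed

lemma wev_tendsto_right:
  assumes p: "wpair {0<..} {0..} f \<phi>" and s: "0 \<le> Re s"
  shows "(\<lambda>n. wev f \<phi> (s + of_real (inverse (real (Suc n))))) \<longlonglongrightarrow> wev f \<phi> s"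
proof -
  have c: "continuous_on right_half_plane (wev f \<phi>)"
    using wev_continuous[OF p Ioi_le_Ico] by (simp add: kernel_dom_nonneg)
  have "(\<lambda>n. s + of_real (inverse (real (Suc n)))) \<longlonglongrightarrow> s + of_real 0"
    by (intro tendsto_add tendsto_const tendsto_of_real LIMSEQ_inverse_real_of_nat)
  then have "(\<lambda>n. s + of_real (inverse (real (Suc n)))) \<longlonglongrightarrow> s" by simp
  then show ?thesis
    using c[unfolded continuous_on_sequentially, rule_format, of s "\<lambda>n. s + of_real (inverse (real (Suc n)))"] s
    by (auto simp: right_half_plane_def o_def)
qed

text \<open>Where one factor is nonzero, on an open set, the other must vanish; analytic
  continuation spreads this over the open half-plane, and continuity from the right carries it to
  the axis.\<close>

lemma Aplus_domain: "domain Aplus"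
proof (intro domain.intro domain_axioms.intro Aplus_cring)
  show "\<one>\<^bsub>Aplus\<^esub> \<noteq> \<zero>\<^bsub>Aplus\<^esub>"
  proof
    assume "\<one>\<^bsub>Aplus\<^esub> = \<zero>\<^bsub>Aplus\<^esub>"
    from fun_cong[OF this, of 0] show False by (simp add: right_half_plane_def)
  qed
  fix F G assume FG: "F \<otimes>\<^bsub>Aplus\<^esub> G = \<zero>\<^bsub>Aplus\<^esub>" and F: "F \<in> carrier Aplus" and G: "G \<in> carrier Aplus"
  obtain f \<phi> where p: "wpair {0<..} {0..} f \<phi>" "F = restrict (wev f \<phi>) right_half_plane"
    using F Aplus_fun_iff by (metis Aplus_simps(1))
  obtain g \<psi> where q: "wpair {0<..} {0..} g \<psi>" "G = restrict (wev g \<psi>) right_half_plane"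
    using G Aplus_fun_iff by (metis Aplus_simps(1))
  have prod: "wev f \<phi> s * wev g \<psi> s = 0" if "0 \<le> Re s" for s
    using fun_cong[OF FG, of s] that p(2) q(2) by (simp add: right_half_plane_def)
  let ?H = "{s. 0 < Re s}"
  show "F = \<zero>\<^bsub>Aplus\<^esub> \<or> G = \<zero>\<^bsub>Aplus\<^esub>"
  proof (cases "\<exists>s\<in>?H. wev f \<phi> s \<noteq> 0")
    case False
    have "wev f \<phi> s = 0" if "0 \<le> Re s" for s
    proof -
      have "(\<lambda>n. wev f \<phi> (s + of_real (inverse (real (Suc n))))) = (\<lambda>n. 0)"
        using False that by (auto simp: add_nonneg_pos)
      then show ?thesis using wev_tendsto_right[OF p(1) that] by (simp add: LIMSEQ_const_iff)
    qed
    then have "F = \<zero>\<^bsub>Aplus\<^esub>" unfolding p(2) by (auto simp: right_half_plane_def restrict_def)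
    then show ?thesis by simp
  next
    case True
    then obtain s0 where s0: "s0 \<in> ?H" "wev f \<phi> s0 \<noteq> 0" by blast
    define U where "U = {s \<in> ?H. wev f \<phi> s \<noteq> 0}"
    have oH: "open ?H" by (rule open_halfspace_Re_gt)
    have "U = ?H \<inter> wev f \<phi> -` (- {0})" by (auto simp: U_def)
    then have "open U"
      using continuous_open_preimage[OF holomorphic_on_imp_continuous_on[OF wev_holomorphic[OF p(1)]] oH open_Compl[OF closed_singleton]] by simp
    have z: "wev g \<psi> s = 0" if "s \<in> ?H" for s
    proof (rule analytic_continuation_open[of U ?H "wev g \<psi>" "\<lambda>_. 0"])
      show "connected ?H" by (intro convex_connected convex_halfspace_Re_gt)
      show "wev g \<psi> z = 0" if "z \<in> U" for z using prod[of z] that by (auto simp: U_def)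
    qed (use \<open>open U\<close> oH s0 that wev_holomorphic[OF q(1)] in \<open>auto simp: U_def\<close>)
    have "wev g \<psi> s = 0" if "0 \<le> Re s" for s
    proof -
      have "(\<lambda>n. wev g \<psi> (s + of_real (inverse (real (Suc n))))) = (\<lambda>n. 0)"
        using z that by (auto simp: add_nonneg_pos)
      then show ?thesis using wev_tendsto_right[OF q(1) that] by (simp add: LIMSEQ_const_iff)
    qed
    then have "G = \<zero>\<^bsub>Aplus\<^esub>" unfolding q(2) by (auto simp: right_half_plane_def restrict_def)
    then show ?thesis by simp
  qed
qed

section \<open>Mean winding and winding numbers\<close>

lemma cis_eq_1D: "cis x = 1 \<Longrightarrow> \<exists>n::int. x = 2 * pi * of_int n"
  using cos_one_2pi_int[of x] by (auto simp: complex_eq_iff mult_ac)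

lemma continuous_2pi_int_constant:
  fixes d :: "real \<Rightarrow> real"
  assumes S: "connected S" and d: "continuous_on S d" and e: "\<And>y. y \<in> S \<Longrightarrow> cis (d y) = 1"
  obtains n :: int where "\<And>y. y \<in> S \<Longrightarrow> d y = 2 * pi * of_int n"
proof -
  have "d constant_on S"
  proof (rule continuous_discrete_range_constant[OF S d])
    fix x assume x: "x \<in> S"
    have "2 * pi \<le> norm (d y - d x)" if y: "y \<in> S" "d y \<noteq> d x" for y
    proof -
      obtain n m :: int where "d x = 2 * pi * of_int n" "d y = 2 * pi * of_int m"
        using cis_eq_1D[OF e[OF x]] cis_eq_1D[OF e[OF y(1)]] by blast
      then have eq: "d y - d x = 2 * pi * of_int (m - n)" by (simp add: algebra_simps)
      then have "m - n \<noteq> 0" using y by auto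
      then have "1 \<le> \<bar>real_of_int (m - n)\<bar>" by linarith
      then have "2 * pi * 1 \<le> 2 * pi * \<bar>real_of_int (m - n)\<bar>" by (intro mult_left_mono) auto
      then show ?thesis unfolding eq by (simp add: abs_mult)
    qed
    then show "\<exists>e>0. \<forall>y. y \<in> S \<and> d y \<noteq> d x \<longrightarrow> e \<le> norm (d y - d x)"
      by (intro exI[of _ "2 * pi"]) auto
  qed
  then obtain c where c: "\<And>y. y \<in> S \<Longrightarrow> d y = c" by (auto simp: constant_on_def)
  show ?thesis
  proof (cases "S = {}")
    case False
    then obtain x where "x \<in> S" by blast
    then show ?thesis using cis_eq_1D[OF e[of x]] c that by metis
  qed (use that in auto)
qed

lemma continuous_arg_cis:
  "continuous_arg g \<theta> \<longleftrightarrow> continuous_on UNIV \<theta> \<and> (\<forall>y. g y \<noteq> 0 \<and> cis (\<theta> y) = g y / of_real (cmod (g y)))"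
proof -
  have "z = of_real (cmod z) * cis t \<longleftrightarrow> cis t = z / of_real (cmod z)" if "z \<noteq> 0" for z t
    using that by (auto simp: field_simps)
  then show ?thesis unfolding continuous_arg_def rcis_def by metis
qed

lemma continuous_arg_exp:
  assumes "continuous_on UNIV h" "\<And>y. g y = exp (h y)"
  shows "continuous_arg g (\<lambda>y. Im (h y))"
  unfolding continuous_arg_def rcis_def using assms
  by (auto intro!: continuous_intros simp: exp_eq_polar[of "h _"] norm_mult)

lemma continuous_arg_ex:
  assumes "continuous_on UNIV g" "\<And>y. g y \<noteq> 0"
  obtains \<theta> where "continuous_arg g \<theta>"
proof -
  obtain h where "continuous_on UNIV h" "\<And>y. g y = exp (h y)"
    using continuous_logarithm_on_contractible[of UNIV g] assms by auto
  then show ?thesis using continuous_arg_exp that by blast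
qed

lemma continuous_arg_unique:
  assumes "continuous_arg g \<theta>" "continuous_arg g \<eta>"
  obtains c where "\<And>y. \<theta> y = \<eta> y + c"
proof -
  have "continuous_on UNIV (\<lambda>y. \<theta> y - \<eta> y)"
    using assms by (auto simp: continuous_arg_def intro: continuous_on_diff)
  moreover have "cis (\<theta> y - \<eta> y) = 1" for y
    using assms by (simp add: continuous_arg_cis flip: cis_divide)
  ultimately obtain n :: int where n: "\<And>y. \<theta> y - \<eta> y = 2 * pi * of_int n"
    using continuous_2pi_int_constant[of UNIV] by auto
  show ?thesis by (rule that[of "2 * pi * of_int n"]) (use n in \<open>simp add: algebra_simps\<close>)
qed

lemma continuous_arg_mult:
  assumes "continuous_arg g \<theta>" "continuous_arg h \<eta>"
  shows "continuous_arg (\<lambda>y. g y * h y) (\<lambda>y. \<theta> y + \<eta> y)"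
  using assms by (auto simp: continuous_arg_cis norm_mult simp flip: cis_mult intro: continuous_on_add)

lemma continuous_arg_inverse:
  assumes "continuous_arg g \<theta>"
  shows "continuous_arg (\<lambda>y. inverse (g y)) (\<lambda>y. - \<theta> y)"
  using assms by (auto simp: continuous_arg_cis norm_inverse divide_inverse simp flip: cis_inverse intro: continuous_on_minus)

lemma continuous_arg_cnj:
  assumes "continuous_arg g \<theta>"
  shows "continuous_arg (\<lambda>y. cnj (g y)) (\<lambda>y. - \<theta> y)"
  using assms by (auto simp: continuous_arg_cis simp flip: cis_cnj intro: continuous_on_minus)

lemma half_disc_not_nonpos: fixes z :: complex shows "norm (z - 1) < 1/2 \<Longrightarrow> z \<notin> \<real>\<^sub>\<le>\<^sub>0"
proof
  assume z: "norm (z - 1) < 1/2" "z \<in> \<real>\<^sub>\<le>\<^sub>0"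
  then have "Re z \<le> 0" by (auto elim!: nonpos_Reals_cases)
  then show False using z(1) abs_Re_le_cmod[of "z - 1"] by simp
qed

lemma Im_Ln_near_1: fixes z :: complex shows "norm (z - 1) < 1/2 \<Longrightarrow> \<bar>Im (Ln z)\<bar> \<le> 1"
  using norm_Ln_le[of "z - 1"] abs_Im_le_cmod[of "Ln z"] by simp

text \<open>The quotient stays in a disc around \<open>1\<close> away from the branch cut, so its
  principal logarithm is a continuous correction of size at most \<open>1\<close>. A bounded
  correction disappears in the mean, and it is too small to change a winding number.\<close>

lemma continuous_arg_perturb:
  assumes \<theta>: "continuous_arg g \<theta>" and g: "continuous_on UNIV g" and h: "continuous_on UNIV h"
    and near: "\<And>y. norm (h y / g y - 1) < 1/2"
  shows "continuous_arg h (\<lambda>y. \<theta> y + Im (Ln (h y / g y)))"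
    and "\<bar>Im (Ln (h y / g y))\<bar> \<le> 1"
proof -
  have g0: "g y \<noteq> 0" for y using \<theta> by (simp add: continuous_arg_def)
  have q: "continuous_on UNIV (\<lambda>y. h y / g y)" using g h g0 by (intro continuous_intros) auto
  have "continuous_on UNIV (\<lambda>y. Ln (h y / g y))"
    by (rule continuous_on_Ln'[OF q]) (rule half_disc_not_nonpos[OF near])
  moreover have "h y / g y = exp (Ln (h y / g y))" for y
    using half_disc_not_nonpos[OF near, of y] by (subst exp_Ln) auto
  ultimately have "continuous_arg (\<lambda>y. h y / g y) (\<lambda>y. Im (Ln (h y / g y)))"
    by (rule continuous_arg_exp)
  from continuous_arg_mult[OF \<theta> this] show "continuous_arg h (\<lambda>y. \<theta> y + Im (Ln (h y / g y)))"
    using g0 by simp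
  show "\<bar>Im (Ln (h y / g y))\<bar> \<le> 1" by (rule Im_Ln_near_1[OF near])
qed

text \<open>The relation under the definite description in \<open>average_winding\<close>, kept
  separate so that existence and value can be proved independently; \<open>wind\<close> plays the
  same role for \<open>winding_index\<close>.\<close>

definition mean_arg :: "(real \<Rightarrow> complex) \<Rightarrow> real \<Rightarrow> bool" where
  "mean_arg g w \<longleftrightarrow> (\<exists>\<theta>. continuous_arg g \<theta> \<and>
     ((\<lambda>\<rho>. 1 / (2 * \<rho>) * (\<theta> \<rho> - \<theta> (- \<rho>))) \<longlongrightarrow> w) at_top)"

lemma mean_arg_imp_lim:
  assumes "mean_arg g w" "continuous_arg g \<theta>"
  shows "((\<lambda>\<rho>. 1 / (2 * \<rho>) * (\<theta> \<rho> - \<theta> (- \<rho>))) \<longlongrightarrow> w) at_top"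
proof -
  obtain \<eta> where \<eta>: "continuous_arg g \<eta>" "((\<lambda>\<rho>. 1 / (2 * \<rho>) * (\<eta> \<rho> - \<eta> (- \<rho>))) \<longlongrightarrow> w) at_top"
    using assms(1) by (auto simp: mean_arg_def)
  obtain c where "\<And>y. \<theta> y = \<eta> y + c" using continuous_arg_unique[OF assms(2) \<eta>(1)] by metis
  then show ?thesis using \<eta>(2) by simp
qed

lemma mean_arg_unique: "mean_arg g w \<Longrightarrow> mean_arg g w' \<Longrightarrow> w = w'"
  using mean_arg_imp_lim tendsto_unique[OF trivial_limit_at_top_linorder] unfolding mean_arg_def by blast

lemma average_winding_eq: "mean_arg g w \<Longrightarrow> average_winding g = w"
  unfolding average_winding_def mean_arg_def[symmetric]
  by (rule the_equality) (auto intro: mean_arg_unique)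

lemma mult_diff_add_swap: "c * ((x + y) - (u + v)) = c * (x - u) + c * (y - v)" for c :: real
  by (simp add: algebra_simps)

lemma mult_diff_minus_swap: "c * (- x - (- u)) = - (c * (x - u))" for c :: real
  by (simp add: algebra_simps)

lemma mean_arg_mult:
  assumes "mean_arg g w" "mean_arg h v" shows "mean_arg (\<lambda>y. g y * h y) (w + v)"
proof -
  obtain \<theta> \<eta> where *: "continuous_arg g \<theta>" "continuous_arg h \<eta>" using assms by (auto simp: mean_arg_def)
  show ?thesis
    unfolding mean_arg_def
    using continuous_arg_mult[OF *] tendsto_add[OF mean_arg_imp_lim[OF assms(1) *(1)] mean_arg_imp_lim[OF assms(2) *(2)]]
    by (intro exI[of _ "\<lambda>y. \<theta> y + \<eta> y"] conjI) (simp_all only: mult_diff_add_swap)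
qed

lemma mean_arg_neg:
  assumes "mean_arg g w" "\<And>\<theta>. continuous_arg g \<theta> \<Longrightarrow> continuous_arg h (\<lambda>y. - \<theta> y)"
  shows "mean_arg h (- w)"
proof -
  obtain \<theta> where *: "continuous_arg g \<theta>" using assms by (auto simp: mean_arg_def)
  show ?thesis
    unfolding mean_arg_def
    using assms(2)[OF *] tendsto_minus[OF mean_arg_imp_lim[OF assms(1) *]]
    by (intro exI[of _ "\<lambda>y. - \<theta> y"] conjI) (simp_all only: mult_diff_minus_swap)
qed

lemma tendsto_bounded_over:
  assumes "\<And>\<rho>. \<bar>f \<rho>\<bar> \<le> C" shows "((\<lambda>\<rho>::real. 1 / (2 * \<rho>) * f \<rho>) \<longlongrightarrow> 0) at_top"
proof (rule Lim_null_comparison)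
  show "\<forall>\<^sub>F \<rho> in at_top. norm (1 / (2 * \<rho>) * f \<rho>) \<le> C / (2 * \<rho>)"
    using eventually_gt_at_top[of 0]
    by eventually_elim (use assms in \<open>auto simp: abs_mult field_simps\<close>)
  show "((\<lambda>\<rho>. C / (2 * \<rho>)) \<longlongrightarrow> 0) at_top" by real_asymp
qed

lemma mean_arg_bounded_arg:
  assumes "continuous_arg g \<theta>" "\<And>y. \<bar>\<theta> y\<bar> \<le> C" shows "mean_arg g 0"
proof -
  have "\<bar>\<theta> \<rho> - \<theta> (- \<rho>)\<bar> \<le> 2 * C" for \<rho> using assms(2)[of \<rho>] assms(2)[of "-\<rho>"] by linarith
  from tendsto_bounded_over[OF this] show ?thesis using assms(1) by (auto simp: mean_arg_def)
qed

lemma mean_arg_perturb: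
  assumes m: "mean_arg g w" and g: "continuous_on UNIV g" and h: "continuous_on UNIV h"
    and near: "\<And>y. norm (h y / g y - 1) < 1/2"
  shows "mean_arg h w"
proof -
  obtain \<theta> where \<theta>: "continuous_arg g \<theta>" using m by (auto simp: mean_arg_def)
  let ?e = "\<lambda>y. Im (Ln (h y / g y))"
  note p = continuous_arg_perturb[OF \<theta> g h near]
  have b: "\<bar>?e \<rho> - ?e (- \<rho>)\<bar> \<le> 2" for \<rho> using p(2)[of \<rho>] p(2)[of "-\<rho>"] by linarith
  have "((\<lambda>\<rho>. 1 / (2 * \<rho>) * (?e \<rho> - ?e (- \<rho>))) \<longlongrightarrow> 0) at_top"
    by (rule tendsto_bounded_over) (rule b)
  from tendsto_add[OF mean_arg_imp_lim[OF m \<theta>] this]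
  show ?thesis unfolding mean_arg_def using p(1)
    by (intro exI[of _ "\<lambda>y. \<theta> y + ?e y"] conjI) (simp_all only: mult_diff_add_swap add_0_right)
qed

definition wind :: "(real \<Rightarrow> complex) \<Rightarrow> int \<Rightarrow> bool" where
  "wind g n \<longleftrightarrow> (\<exists>\<theta> a b. continuous_arg g \<theta> \<and>
     (\<theta> \<longlongrightarrow> a) at_bot \<and> (\<theta> \<longlongrightarrow> b) at_top \<and> real_of_int n = 1 / (2 * pi) * (b - a))"

lemma wind_imp_lim:
  assumes "wind g n" "continuous_arg g \<theta>"
  obtains a where "(\<theta> \<longlongrightarrow> a) at_bot" "(\<theta> \<longlongrightarrow> a + 2 * pi * n) at_top"
proof -
  obtain \<eta> a b where \<eta>: "continuous_arg g \<eta>" "(\<eta> \<longlongrightarrow> a) at_bot" "(\<eta> \<longlongrightarrow> b) at_top" "real_of_int n = 1 / (2 * pi) * (b - a)"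
    using assms(1) by (auto simp: wind_def)
  obtain c where c: "\<And>y. \<theta> y = \<eta> y + c" using continuous_arg_unique[OF assms(2) \<eta>(1)] by metis
  have "b + c = (a + c) + 2 * pi * n" using \<eta>(4) by (simp add: field_simps)
  moreover have "(\<theta> \<longlongrightarrow> a + c) at_bot" "(\<theta> \<longlongrightarrow> b + c) at_top"
    unfolding c by (intro tendsto_add \<eta> tendsto_const)+
  ultimately show ?thesis using that by metis
qed

lemma windI:
  "continuous_arg g \<theta> \<Longrightarrow> (\<theta> \<longlongrightarrow> a) at_bot \<Longrightarrow> (\<theta> \<longlongrightarrow> a + 2 * pi * of_int n) at_top \<Longrightarrow> wind g n"
  unfolding wind_def by (intro exI[of _ \<theta>] exI[of _ a] exI[of _ "a + 2 * pi * of_int n"]) auto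

lemma wind_unique: assumes "wind g n" "wind g m" shows "n = m"
proof -
  obtain \<theta> where \<theta>: "continuous_arg g \<theta>" using assms by (auto simp: wind_def)
  obtain a where a: "(\<theta> \<longlongrightarrow> a) at_bot" "(\<theta> \<longlongrightarrow> a + 2 * pi * n) at_top" by (rule wind_imp_lim[OF assms(1) \<theta>])
  obtain b where b: "(\<theta> \<longlongrightarrow> b) at_bot" "(\<theta> \<longlongrightarrow> b + 2 * pi * m) at_top" by (rule wind_imp_lim[OF assms(2) \<theta>])
  have "a = b" using tendsto_unique[OF trivial_limit_at_bot_linorder a(1) b(1)] .
  moreover have "a + 2 * pi * n = b + 2 * pi * m" using tendsto_unique[OF trivial_limit_at_top_linorder a(2) b(2)] .
  ultimately show ?thesis by simp
qed

lemma winding_index_eq: "wind g n \<Longrightarrow> winding_index g = n"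
  unfolding winding_index_def wind_def[symmetric]
  by (rule the_equality) (auto intro: wind_unique)

lemma wind_mult:
  assumes "wind g n" "wind h m" shows "wind (\<lambda>y. g y * h y) (n + m)"
proof -
  obtain \<theta> \<eta> where *: "continuous_arg g \<theta>" "continuous_arg h \<eta>" using assms by (auto simp: wind_def)
  obtain a where a: "(\<theta> \<longlongrightarrow> a) at_bot" "(\<theta> \<longlongrightarrow> a + 2 * pi * n) at_top" by (rule wind_imp_lim[OF assms(1) *(1)])
  obtain b where b: "(\<eta> \<longlongrightarrow> b) at_bot" "(\<eta> \<longlongrightarrow> b + 2 * pi * m) at_top" by (rule wind_imp_lim[OF assms(2) *(2)])
  show ?thesis
    by (rule windI[OF continuous_arg_mult[OF *] tendsto_add[OF a(1) b(1)]])
      (use tendsto_add[OF a(2) b(2)] in \<open>simp add: algebra_simps\<close>)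
qed

lemma wind_neg:
  assumes "wind g n" "\<And>\<theta>. continuous_arg g \<theta> \<Longrightarrow> continuous_arg h (\<lambda>y. - \<theta> y)" shows "wind h (- n)"
proof -
  obtain \<theta> where *: "continuous_arg g \<theta>" using assms by (auto simp: wind_def)
  obtain a where a: "(\<theta> \<longlongrightarrow> a) at_bot" "(\<theta> \<longlongrightarrow> a + 2 * pi * n) at_top" by (rule wind_imp_lim[OF assms(1) *(1)])
  show ?thesis
    by (rule windI[OF assms(2)[OF *] tendsto_minus[OF a(1)]])
      (use tendsto_minus[OF a(2)] in \<open>simp add: algebra_simps\<close>)
qed

text \<open>On a connected end of the line where \<open>g\<close> is near \<open>1\<close>, the
  argument differs from the principal one by a constant multiple of \<open>2 * pi\<close>, and the
  principal one tends to \<open>0\<close>. This is why the winding number is an integer.\<close>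

lemma continuous_arg_converges:
  assumes \<theta>: "continuous_arg g \<theta>" and g: "continuous_on UNIV g" and S: "connected S"
    and F: "eventually (\<lambda>y. y \<in> S) F" and lim: "(g \<longlongrightarrow> 1) F" and near: "\<And>y. y \<in> S \<Longrightarrow> norm (g y - 1) < 1/2"
  obtains n :: int where "(\<theta> \<longlongrightarrow> 2 * pi * of_int n) F"
proof -
  have g0: "g y \<noteq> 0" for y using \<theta> by (simp add: continuous_arg_def)
  have np: "g y \<notin> \<real>\<^sub>\<le>\<^sub>0" if "y \<in> S" for y by (rule half_disc_not_nonpos[OF near[OF that]])
  have cL: "continuous_on S (\<lambda>y. Ln (g y))"
    by (rule continuous_on_Ln'[OF continuous_on_subset[OF g] np]) auto
  have "continuous_on S (\<lambda>y. \<theta> y - Im (Ln (g y)))"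
    using \<theta> by (intro continuous_on_diff continuous_on_Im cL) (auto simp: continuous_arg_def intro: continuous_on_subset)
  moreover have "cis (\<theta> y - Im (Ln (g y))) = 1" if "y \<in> S" for y
  proof -
    have n: "norm (g y) = exp (Re (Ln (g y)))" using g0 by (simp add: Re_Ln)
    have "exp (Ln (g y)) = complex_of_real (norm (g y)) * cis (Im (Ln (g y)))"
      unfolding n by (rule exp_eq_polar)
    then have "g y = complex_of_real (norm (g y)) * cis (Im (Ln (g y)))"
      unfolding exp_Ln[OF g0] .
    moreover have "complex_of_real (norm (g y)) \<noteq> 0" using g0 by simp
    ultimately have "cis (Im (Ln (g y))) = g y / complex_of_real (cmod (g y))"
      by (metis nonzero_mult_div_cancel_left)
    then show ?thesis using \<theta> by (simp add: continuous_arg_cis flip: cis_divide)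
  qed
  ultimately obtain n :: int where n: "\<And>y. y \<in> S \<Longrightarrow> \<theta> y - Im (Ln (g y)) = 2 * pi * of_int n"
    using continuous_2pi_int_constant[OF S, of "\<lambda>y. \<theta> y - Im (Ln (g y))"] by blast
  have "((\<lambda>y. Im (Ln (g y)) + 2 * pi * of_int n) \<longlongrightarrow> Im (Ln 1) + 2 * pi * of_int n) F"
    by (intro tendsto_add tendsto_Im tendsto_Ln lim tendsto_const) auto
  moreover have "\<forall>\<^sub>F y in F. Im (Ln (g y)) + 2 * pi * of_int n = \<theta> y"
    using F by eventually_elim (use n in \<open>simp add: algebra_simps\<close>)
  ultimately have "(\<theta> \<longlongrightarrow> Im (Ln 1) + 2 * pi * of_int n) F" by (rule Lim_transform_eventually)
  then show ?thesis using that by simp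
qed

lemma wind_ex:
  assumes g: "continuous_on UNIV g" "\<And>y. g y \<noteq> 0" and lim: "(g \<longlongrightarrow> 1) at_infinity"
  obtains n where "wind g n"
proof -
  obtain \<theta> where \<theta>: "continuous_arg g \<theta>" by (rule continuous_arg_ex[OF g])
  obtain B where B: "\<And>y. B \<le> norm y \<Longrightarrow> norm (g y - 1) < 1/2"
    using tendstoD[OF lim, of "1/2"] by (auto simp: eventually_at_infinity dist_norm)
  have l: "(g \<longlongrightarrow> 1) at_top" "(g \<longlongrightarrow> 1) at_bot"
    using tendsto_mono[OF at_top_le_at_infinity lim] tendsto_mono[OF at_bot_le_at_infinity lim] by auto
  obtain n :: int where n: "(\<theta> \<longlongrightarrow> 2 * pi * of_int n) at_top"
  proof (rule continuous_arg_converges[OF \<theta> g(1), of "{B..}" at_top])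
    show "norm (g y - 1) < 1/2" if "y \<in> {B..}" for y using B[of y] that by auto
  qed (use l in \<open>auto simp: eventually_ge_at_top\<close>)
  obtain m :: int where m: "(\<theta> \<longlongrightarrow> 2 * pi * of_int m) at_bot"
  proof (rule continuous_arg_converges[OF \<theta> g(1), of "{..-B}" at_bot])
    show "norm (g y - 1) < 1/2" if "y \<in> {..-B}" for y using B[of y] that by auto
  qed (use l in \<open>auto simp: eventually_le_at_bot\<close>)
  show ?thesis
    by (rule that[of "n - m"], rule windI[OF \<theta> m]) (use n in \<open>simp add: algebra_simps\<close>)
qed

text \<open>The two perturbations change the argument at each end of the line by at most \<open>2\<close> in
  total, so the index, which is an integer multiple of \<open>2 * pi\<close>, cannot change.\<close>

lemma wind_quotient_perturb:
  assumes n: "wind (\<lambda>y. g y / a y) n" and m: "wind (\<lambda>y. g' y / a' y) m"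
    and c: "continuous_on UNIV g" "continuous_on UNIV g'" "continuous_on UNIV a" "continuous_on UNIV a'"
    and nz: "\<And>y. g y \<noteq> 0" "\<And>y. a y \<noteq> 0"
    and near: "\<And>y. norm (g' y / g y - 1) < 1/2" "\<And>y. norm (a' y / a y - 1) < 1/2"
  shows "n = m"
proof -
  obtain \<theta> where \<theta>: "continuous_arg g \<theta>" by (rule continuous_arg_ex[OF c(1) nz(1)])
  obtain \<alpha> where \<alpha>: "continuous_arg a \<alpha>" by (rule continuous_arg_ex[OF c(3) nz(2)])
  let ?e = "\<lambda>y. Im (Ln (g' y / g y))" and ?d = "\<lambda>y. Im (Ln (a' y / a y))"
  note e = continuous_arg_perturb[OF \<theta> c(1,2) near(1)]
  note d = continuous_arg_perturb[OF \<alpha> c(3,4) near(2)]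
  have 1: "continuous_arg (\<lambda>y. g y / a y) (\<lambda>y. \<theta> y - \<alpha> y)"
    using continuous_arg_mult[OF \<theta> continuous_arg_inverse[OF \<alpha>]] by (simp add: divide_inverse)
  have 2: "continuous_arg (\<lambda>y. g' y / a' y) (\<lambda>y. (\<theta> y + ?e y) - (\<alpha> y + ?d y))"
    using continuous_arg_mult[OF e(1) continuous_arg_inverse[OF d(1)]] by (simp only: divide_inverse diff_conv_add_uminus)
  obtain r where r: "((\<lambda>y. \<theta> y - \<alpha> y) \<longlongrightarrow> r) at_bot" "((\<lambda>y. \<theta> y - \<alpha> y) \<longlongrightarrow> r + 2 * pi * n) at_top"
    by (rule wind_imp_lim[OF n 1])
  obtain s where s: "((\<lambda>y. (\<theta> y + ?e y) - (\<alpha> y + ?d y)) \<longlongrightarrow> s) at_bot"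
      "((\<lambda>y. (\<theta> y + ?e y) - (\<alpha> y + ?d y)) \<longlongrightarrow> s + 2 * pi * m) at_top"
    by (rule wind_imp_lim[OF m 2])
  have le: "\<bar>((\<theta> y + ?e y) - (\<alpha> y + ?d y)) - (\<theta> y - \<alpha> y)\<bar> \<le> 2" for y
    using e(2)[of y] d(2)[of y] by linarith
  have "\<bar>s - r\<bar> \<le> 2"
    by (rule tendsto_upperbound[OF tendsto_rabs[OF tendsto_diff[OF s(1) r(1)]]]) (intro trivial_limit_at_bot_linorder trivial_limit_at_top_linorder always_eventually allI le)+
  moreover have "\<bar>(s + 2 * pi * m) - (r + 2 * pi * n)\<bar> \<le> 2"
    by (rule tendsto_upperbound[OF tendsto_rabs[OF tendsto_diff[OF s(2) r(2)]]]) (intro trivial_limit_at_bot_linorder trivial_limit_at_top_linorder always_eventually allI le)+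
  ultimately have "\<bar>2 * pi * m - 2 * pi * n\<bar> \<le> 4" by linarith
  then have "2 * pi * \<bar>real_of_int (m - n)\<bar> \<le> 4" by (simp add: abs_mult flip: right_diff_distrib)
  moreover have "2 * pi > 4" using pi_gt3 by linarith
  ultimately have "\<bar>real_of_int (m - n)\<bar> < 1"
    by (smt (verit, best) mult_left_mono mult_cancel_left1)
  then show ?thesis by linarith
qed

section \<open>Existence of the mean winding for almost periodic parts\<close>

lemma antiderivative_real_line:
  fixes f :: "real \<Rightarrow> complex"
  assumes f: "continuous_on UNIV f"
  obtains F where "\<And>x. (F has_vector_derivative f x) (at x)"
proof
  fix x :: real
  let ?a = "- (\<bar>x\<bar> + 1)" and ?b = "\<bar>x\<bar> + 1"
  have "((\<lambda>u. LBINT y=ereal 0..ereal u. f y) has_vector_derivative f x) (at x within {?a..?b})"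
    by (rule interval_integral_FTC2[OF _ _ continuous_on_subset[OF f subset_UNIV]]) linarith+
  moreover have "at x within {?a..?b} = at x"
    by (rule at_within_Icc_at) linarith+
  ultimately show "((\<lambda>u. LBINT y=ereal 0..ereal u. f y) has_vector_derivative f x) (at x)"
    by (simp only:)
qed

text \<open>The topological logarithm says nothing about derivatives. Here the logarithm is obtained
  by integrating \<open>g' / g\<close>, so that its derivative can be recognised as almost
  periodic.\<close>

lemma log_with_derivative:
  fixes g g' :: "real \<Rightarrow> complex"
  assumes g: "\<And>y. (g has_vector_derivative g' y) (at y)" and g': "continuous_on UNIV g'" and nz: "\<And>y. g y \<noteq> 0"
  obtains h where "\<And>y. g y = exp (h y)" "\<And>y. (h has_vector_derivative g' y / g y) (at y)"
proof -
  have cg: "continuous_on UNIV g"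
    using g by (intro continuous_at_imp_continuous_on) (auto intro: has_vector_derivative_continuous)
  obtain F where F: "\<And>y. (F has_vector_derivative g' y / g y) (at y)"
    by (rule antiderivative_real_line[of "\<lambda>y. g' y / g y"]) (auto intro!: continuous_on_divide g' cg nz)
  have E: "((\<lambda>y. exp (- F y)) has_vector_derivative (- (g' y / g y)) * exp (- F y)) (at y)" for y
    using field_vector_diff_chain_at[OF has_vector_derivative_minus[OF F[of y]], of exp "exp (- F y)"]
    by (simp add: o_def DERIV_exp)
  have "((\<lambda>y. g y * exp (- F y)) has_vector_derivative 0) (at y)" for y
    using has_vector_derivative_mult[OF g[of y] E[of y]] nz[of y] by (simp add: field_simps)
  then obtain c where c: "\<And>y. g y * exp (- F y) = c"
    using has_vector_derivative_zero_constant[of UNIV "\<lambda>y. g y * exp (- F y)"] by auto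
  have "c \<noteq> 0" using c[of 0] nz by auto
  then have gF: "g y = exp (F y + Ln c)" for y
    using c[of y] by (simp add: exp_add exp_minus field_simps)
  show ?thesis
  proof (rule that[of "\<lambda>y. F y + Ln c"])
    show "((\<lambda>y. F y + Ln c) has_vector_derivative g' y / g y) (at y)" for y
      using has_vector_derivative_add[OF F has_vector_derivative_const] by simp
  qed (rule gF)
qed

lemma wien_ap_trig:
  assumes "wien {} L F r"
  obtains b where "(\<lambda>x. norm (b x)) summable_on UNIV" "\<And>x. x \<notin> L \<Longrightarrow> b x = 0"
    "\<And>s. s \<in> kernel_dom L \<Longrightarrow> F s = trig b s" "(\<Sum>\<^sub>\<infinity>x. norm (b x)) \<le> r"
proof -
  obtain f b where p: "wpair {} L f b" "wnorm f b \<le> r" "\<And>s. s \<in> kernel_dom L \<Longrightarrow> F s = wev f b s"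
    by (rule wienE[OF assms]) (rule that; blast)
  have "f = (\<lambda>x. 0)" using p(1) by (auto simp: wpair_def)
  then have "\<And>s. s \<in> kernel_dom L \<Longrightarrow> F s = trig b s" "(\<Sum>\<^sub>\<infinity>x. norm (b x)) \<le> r"
    using p by (auto simp: wev_def fourier_def wnorm_def)
  then show ?thesis using that p(1) by (auto simp: wpair_def)
qed

text \<open>Finitely many frequencies permit termwise differentiation. The logarithmic derivative is
  the derivative times \<open>Q\<close>, a product inside the algebra, and therefore again an
  absolutely summable series \<open>b\<close>.\<close>

lemma finite_trig_log:
  assumes S: "finite S" and P: "P = (\<lambda>x. if x \<in> S then c x else 0)"
    and Q: "wien {} UNIV Q r" and inv: "\<And>s. s \<in> imag_axis \<Longrightarrow> trig P s * Q s = 1"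
  obtains h b where "(\<lambda>x. norm (b x)) summable_on UNIV" "\<And>y. trig P (\<i> * of_real y) = exp (h y)"
    "\<And>y. (h has_vector_derivative trig b (\<i> * of_real y)) (at y)"
proof -
  let ?c' = "\<lambda>x. c x * (- (\<i> * of_real x))"
  let ?P' = "\<lambda>x. if x \<in> S then ?c' x else 0"
  have sP': "(\<lambda>x. norm (?P' x)) summable_on UNIV" by (rule trig_finite(2)[OF S])
  have nz: "trig P (\<i> * of_real y) \<noteq> 0" for y using inv[of "\<i> * of_real y"] by auto
  have d: "((\<lambda>y. trig P (\<i> * of_real y)) has_vector_derivative trig ?P' (\<i> * of_real y)) (at y)" for y
  proof -
    have "((\<lambda>y. \<Sum>x\<in>S. c x * exp (- (\<i> * of_real y * of_real x))) has_vector_derivative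
        (\<Sum>x\<in>S. ?c' x * exp (- (\<i> * of_real y * of_real x)))) (at y)"
    proof (rule has_vector_derivative_sum)
      fix x
      have "((\<lambda>z. c x * exp (- (\<i> * z * of_real x))) has_field_derivative ?c' x * exp (- (\<i> * of_real y * of_real x))) (at (of_real y))"
        by (auto intro!: derivative_eq_intros)
      then show "((\<lambda>y. c x * exp (- (\<i> * of_real y * of_real x))) has_vector_derivative ?c' x * exp (- (\<i> * of_real y * of_real x))) (at y)"
        by (rule has_vector_derivative_real_field)
    qed
    then show ?thesis unfolding P trig_finite(1)[OF S] .
  qed
  obtain h where h: "\<And>y. trig P (\<i> * of_real y) = exp (h y)"
    "\<And>y. (h has_vector_derivative trig ?P' (\<i> * of_real y) / trig P (\<i> * of_real y)) (at y)"
    using log_with_derivative[OF d trig_continuous_imag[OF sP'] nz] by blast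
  have prod: "wien {} UNIV (\<lambda>s. trig ?P' s * Q s) ((\<Sum>\<^sub>\<infinity>x. norm (?P' x)) * r)"
    by (rule wien_mult[OF wien_trig[OF sP'] Q]) auto
  obtain b where b: "(\<lambda>x. norm (b x)) summable_on UNIV" "\<And>s. s \<in> imag_axis \<Longrightarrow> trig ?P' s * Q s = trig b s"
    by (rule wien_ap_trig[OF prod, unfolded kernel_dom_UNIV]) (rule that; blast)
  have "Q s = inverse (trig P s)" if "s \<in> imag_axis" for s
    using inv[OF that] by (metis inverse_unique)
  then have "trig ?P' (\<i> * of_real y) / trig P (\<i> * of_real y) = trig b (\<i> * of_real y)" for y
    using b(2)[of "\<i> * of_real y"] by (simp add: divide_inverse)
  then show ?thesis using that b(1) h by metis
qed

text \<open>The average growth of \<open>h\<close> over \<open>{-T..T}\<close> is the average of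
  \<open>h'\<close>, whose limit is the coefficient of \<open>b\<close> at frequency
  \<open>0\<close>; the argument is the imaginary part of \<open>h\<close>.\<close>

lemma mean_arg_of_log:
  assumes b: "(\<lambda>x. norm (b x)) summable_on UNIV" and g: "\<And>y. g y = exp (h y)"
    and h: "\<And>y. (h has_vector_derivative trig b (\<i> * of_real y)) (at y)"
  shows "mean_arg g (Im (b 0))"
proof -
  have ch: "continuous_on UNIV h"
    using h by (intro continuous_at_imp_continuous_on) (auto intro: has_vector_derivative_continuous)
  have "has_mean (\<lambda>y. trig b (\<i> * of_real y)) (b 0)" using has_mean_trig[OF b, of 0] by simp
  then have "((\<lambda>T. Im ((1 / (2 * T)) *\<^sub>R integral {-T..T} (\<lambda>y. trig b (\<i> * of_real y)))) \<longlongrightarrow> Im (b 0)) at_top"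
    unfolding has_mean_def by (rule tendsto_Im)
  moreover have "\<forall>\<^sub>F T in at_top. Im ((1 / (2 * T)) *\<^sub>R integral {-T..T} (\<lambda>y. trig b (\<i> * of_real y))) = 1 / (2 * T) * (Im (h T) - Im (h (- T)))"
    using eventually_ge_at_top[of 0]
  proof eventually_elim
    case (elim T)
    have "((\<lambda>y. trig b (\<i> * of_real y)) has_integral h T - h (- T)) {-T..T}"
      using elim by (intro fundamental_theorem_of_calculus) (auto intro: has_vector_derivative_at_within h)
    then have "integral {-T..T} (\<lambda>y. trig b (\<i> * of_real y)) = h T - h (- T)" by (rule integral_unique)
    then show ?case by simp
  qed
  ultimately have "((\<lambda>T. 1 / (2 * T) * (Im (h T) - Im (h (- T)))) \<longlongrightarrow> Im (b 0)) at_top"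
    by (rule Lim_transform_eventually)
  then show ?thesis unfolding mean_arg_def using continuous_arg_exp[OF ch g] by blast
qed

text \<open>Neumann series for \<open>G * Q = 1 - Q * (F - G)\<close>. The identities are required
  and delivered on the axis only, while the bound is in the norm of the algebra given by
  \<open>K\<close> and \<open>L\<close>.\<close>

lemma wien_inverse_perturb:
  assumes adm: "wadm K L" and Q: "wien K L Q r" and inv: "\<And>s. s \<in> imag_axis \<Longrightarrow> F s * Q s = 1"
    and D: "wien K L (\<lambda>s. F s - G s) d" and small: "r * d < 1"
  obtains Q' where "wien K L Q' (r / (1 - r * d))" "\<And>s. s \<in> imag_axis \<Longrightarrow> G s * Q' s = 1"
proof
  let ?X = "\<lambda>s. Q s * (F s - G s)"
  have X: "wien K L ?X (r * d)" by (rule wien_mult[OF Q D adm])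
  have KL: "K \<subseteq> L" using adm by (simp add: wadm_def)
  show "wien K L (\<lambda>s. Q s * inverse (1 - ?X s)) (r / (1 - r * d))"
    using wien_mult[OF Q wien_inverse_one_minus[OF X adm small] adm] by simp
  fix s assume s: "s \<in> imag_axis"
  have "norm (?X s) \<le> r * d" by (rule wien_norm_le[OF X KL imag_axis_kernel_dom[OF s]])
  then have "1 - ?X s \<noteq> 0" using small by auto
  moreover have "G s * Q s = 1 - ?X s" using inv[OF s] by (simp add: algebra_simps)
  ultimately show "G s * (Q s * inverse (1 - ?X s)) = 1" by (simp add: mult.assoc[symmetric])
qed

lemma finite_trig_approx:
  assumes \<phi>: "(\<lambda>x. norm (\<phi> x)) summable_on UNIV" and Q: "wien {} UNIV Q r"
    and inv: "\<And>s. s \<in> imag_axis \<Longrightarrow> trig \<phi> s * Q s = 1" and e: "0 < e"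
  obtains S Q' where "finite S" "(\<Sum>\<^sub>\<infinity>x. norm (\<phi> x - (if x \<in> S then \<phi> x else 0))) \<le> e"
    "wien {} UNIV Q' (2 * r)" "\<And>s. s \<in> imag_axis \<Longrightarrow> trig (\<lambda>x. if x \<in> S then \<phi> x else 0) s * Q' s = 1"
    "\<And>y. norm (trig (\<lambda>x. if x \<in> S then \<phi> x else 0) (\<i> * of_real y) / trig \<phi> (\<i> * of_real y) - 1) < 1/2"
proof -
  have r: "0 \<le> r" using wien_nonneg[OF Q] .
  \<comment> \<open>Chosen for \<open>r * e' \<le> 1/4\<close>: the Neumann factor is then at most
    \<open>2\<close>, and the relative change of the values stays below \<open>1/2\<close>.\<close>
  define e' where "e' = min e (1 / (4 * (r + 1)))"
  have e': "0 < e'" "e' \<le> e" "r * e' \<le> 1/4"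
  proof -
    show "0 < e'" "e' \<le> e" using e r by (auto simp: e'_def)
    have "r * e' \<le> (r + 1) * (1 / (4 * (r + 1)))"
      using r e by (intro mult_mono) (auto simp: e'_def)
    also have "\<dots> = 1/4" using r by (simp add: field_simps)
    finally show "r * e' \<le> 1/4" .
  qed
  obtain S where S: "finite S" "(\<Sum>\<^sub>\<infinity>x. norm (\<phi> x - (if x \<in> S then \<phi> x else 0))) \<le> e'"
    using infsum_finite_approx[OF \<phi> e'(1)] by blast
  let ?P = "\<lambda>x. if x \<in> S then \<phi> x else 0"
  have P: "(\<lambda>x. norm (?P x)) summable_on UNIV" by (rule trig_finite(2)[OF S(1)])
  have D: "wien {} UNIV (\<lambda>s. trig \<phi> s - trig ?P s) e'"
    by (rule wien_cong[OF wien_le[OF wien_trig[OF norm_diff_summable[OF \<phi> P]] S(2)]])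
      (auto simp: trig_diff[OF \<phi> P] kernel_dom_UNIV)
  obtain Q' where Q': "wien {} UNIV Q' (r / (1 - r * e'))" "\<And>s. s \<in> imag_axis \<Longrightarrow> trig ?P s * Q' s = 1"
    by (rule wien_inverse_perturb[OF _ Q inv D]) (use e' in auto)
  have "r / (1 - r * e') \<le> r / (1/2)" using e' r by (intro divide_left_mono) auto
  then have "r / (1 - r * e') \<le> 2 * r" by simp
  then have "wien {} UNIV Q' (2 * r)" by (rule wien_le[OF Q'(1)])
  moreover have "norm (trig ?P (\<i> * of_real y) / trig \<phi> (\<i> * of_real y) - 1) < 1/2" for y
  proof -
    let ?s = "\<i> * complex_of_real y"
    have nz: "trig \<phi> ?s \<noteq> 0" using inv[of ?s] by auto
    have "norm (trig \<phi> ?s - trig ?P ?s) \<le> e'" using wien_norm_le[OF D] by (simp add: kernel_dom_UNIV)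
    moreover have "norm (Q ?s) \<le> r" using wien_norm_le[OF Q] by (simp add: kernel_dom_UNIV)
    ultimately have "norm (Q ?s) * norm (trig \<phi> ?s - trig ?P ?s) \<le> r * e'" using r by (intro mult_mono) auto
    moreover have "trig ?P ?s / trig \<phi> ?s - 1 = - (Q ?s * (trig \<phi> ?s - trig ?P ?s))"
      using inv[of ?s] nz by (simp add: field_simps)
    ultimately show ?thesis using e'(3) by (simp only: norm_minus_cancel norm_mult)
  qed
  ultimately show ?thesis using that[of S Q'] S e' Q'(2) by auto
qed

text \<open>A nearby trigonometric polynomial has a mean winding by its logarithm. The closeness is
  relative to \<open>trig \<phi>\<close>, whose mean is still unknown, so the bounded correction of
  the argument is subtracted directly instead of using \<open>mean_arg_perturb\<close>.\<close>

lemma mean_arg_trig_ex: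
  assumes \<phi>: "(\<lambda>x. norm (\<phi> x)) summable_on UNIV" and Q: "wien {} UNIV Q r"
    and inv: "\<And>s. s \<in> imag_axis \<Longrightarrow> trig \<phi> s * Q s = 1"
  obtains w where "mean_arg (\<lambda>y. trig \<phi> (\<i> * of_real y)) w"
proof -
  obtain S Q' where S: "finite S" "wien {} UNIV Q' (2 * r)"
    "\<And>s. s \<in> imag_axis \<Longrightarrow> trig (\<lambda>x. if x \<in> S then \<phi> x else 0) s * Q' s = 1"
    "\<And>y. norm (trig (\<lambda>x. if x \<in> S then \<phi> x else 0) (\<i> * of_real y) / trig \<phi> (\<i> * of_real y) - 1) < 1/2"
    by (rule finite_trig_approx[OF \<phi> Q inv zero_less_one], assumption) (rule that; blast)
  let ?P = "\<lambda>x. if x \<in> S then \<phi> x else 0"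
  let ?g = "\<lambda>y. trig \<phi> (\<i> * of_real y)" and ?h = "\<lambda>y. trig ?P (\<i> * of_real y)"
  obtain h b where "(\<lambda>x. norm (b x)) summable_on UNIV" "\<And>y. ?h y = exp (h y)"
    "\<And>y. (h has_vector_derivative trig b (\<i> * of_real y)) (at y)"
    by (rule finite_trig_log[OF S(1) refl S(2,3)], assumption) (rule that; blast)
  then have m: "mean_arg ?h (Im (b 0))" by (rule mean_arg_of_log)
  have cg: "continuous_on UNIV ?g" by (rule trig_continuous_imag[OF \<phi>])
  have ch: "continuous_on UNIV ?h" by (rule trig_continuous_imag[OF trig_finite(2)[OF S(1)]])
  have g0: "?g y \<noteq> 0" for y using inv[of "\<i> * of_real y"] by auto
  obtain \<theta> where \<theta>: "continuous_arg ?g \<theta>" by (rule continuous_arg_ex[OF cg g0])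
  note p = continuous_arg_perturb[OF \<theta> cg ch S(4)]
  let ?e = "\<lambda>y. Im (Ln (?h y / ?g y))"
  have b: "\<bar>?e \<rho> - ?e (- \<rho>)\<bar> \<le> 2" for \<rho> using p(2)[of \<rho>] p(2)[of "-\<rho>"] by linarith
  have "((\<lambda>\<rho>. 1 / (2 * \<rho>) * (?e \<rho> - ?e (- \<rho>))) \<longlongrightarrow> 0) at_top"
    by (rule tendsto_bounded_over) (rule b)
  from tendsto_diff[OF mean_arg_imp_lim[OF m p(1)] this]
  have "((\<lambda>\<rho>. 1 / (2 * \<rho>) * (\<theta> \<rho> - \<theta> (- \<rho>))) \<longlongrightarrow> Im (b 0)) at_top"
    by (simp only: mult_diff_add_swap add_diff_cancel_right' diff_0_right)
  then show ?thesis using that \<theta> unfolding mean_arg_def by blast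
qed

text \<open>Taking the almost periodic part is multiplicative, and by uniqueness the almost periodic
  part of the constant \<open>1\<close> is \<open>1\<close>.\<close>

lemma trig_inverse:
  assumes p: "wpair UNIV UNIV f \<phi>" and q: "wpair UNIV UNIV g \<psi>"
    and inv: "\<And>s. s \<in> imag_axis \<Longrightarrow> wev f \<phi> s * wev g \<psi> s = 1" and s: "s \<in> imag_axis"
  shows "trig \<phi> s * trig \<psi> s = 1"
proof -
  obtain h ch where h: "wpair UNIV UNIV h ch"
    "\<And>s. s \<in> imag_axis \<Longrightarrow> wev h ch s = wev f \<phi> s * wev g \<psi> s"
    "\<And>s. s \<in> imag_axis \<Longrightarrow> trig ch s = trig \<phi> s * trig \<psi> s"
    by (rule wpair_mult[OF p q wadm_UNIV, unfolded kernel_dom_UNIV]) (rule that; blast)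
  obtain b where b: "(\<lambda>x. norm (b x)) summable_on UNIV" "\<And>s. s \<in> imag_axis \<Longrightarrow> 1 = trig b s"
    by (rule wien_ap_trig[OF wien_const[of UNIV "{}" 1, OF UNIV_I], unfolded kernel_dom_UNIV]) (rule that; blast)
  have q: "wpair UNIV UNIV (\<lambda>x. 0) b" using b by (simp add: wpair_def)
  have "ch = b"
    by (rule wev_unique(1)[OF h(1) q]) (use h(2) inv b(2) in \<open>simp add: wev_def fourier_def\<close>)
  then show ?thesis using h(3)[OF s] b(2)[OF s] by simp
qed

section \<open>The index of invertible elements\<close>

text \<open>The index at the level of pairs. Writing the second function as the quotient of the full
  transform by its almost periodic part makes both components multiplicative and lets numerator and
  denominator be perturbed separately.\<close>

definition windex :: "(real \<Rightarrow> complex) \<Rightarrow> (real \<Rightarrow> complex) \<Rightarrow> real \<Rightarrow> int \<Rightarrow> bool" where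
  "windex f \<phi> w n \<longleftrightarrow> wpair UNIV UNIV f \<phi> \<and> mean_arg (\<lambda>y. trig \<phi> (\<i> * of_real y)) w \<and>
     wind (\<lambda>y. wev f \<phi> (\<i> * of_real y) / trig \<phi> (\<i> * of_real y)) n"

lemma mean_arg_nonzero: "mean_arg g w \<Longrightarrow> g y \<noteq> 0"
  by (auto simp: mean_arg_def continuous_arg_def)

lemma W_windex:
  assumes "windex f \<phi> w n" shows "W (restrict (wev f \<phi>) imag_axis) = (w, n)"
proof -
  have *: "wpair UNIV UNIV f \<phi>" "mean_arg (\<lambda>y. trig \<phi> (\<i> * of_real y)) w"
     "wind (\<lambda>y. wev f \<phi> (\<i> * of_real y) / trig \<phi> (\<i> * of_real y)) n"
    using assms by (auto simp: windex_def)
  have "1 + inverse (trig \<phi> (\<i> * of_real y)) * fourier f (\<i> * of_real y) = wev f \<phi> (\<i> * of_real y) / trig \<phi> (\<i> * of_real y)" for y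
    using mean_arg_nonzero[OF *(2), of y] by (simp add: wev_def field_simps)
  then show ?thesis
    unfolding W_eq[OF *(1)] using average_winding_eq[OF *(2)] winding_index_eq[OF *(3)] by simp
qed

lemma wev_continuous_imag: "wpair UNIV UNIV f \<phi> \<Longrightarrow> continuous_on UNIV (\<lambda>y. wev f \<phi> (\<i> * of_real y))"
  using wev_continuous[of UNIV UNIV f \<phi>] by (intro continuous_imag) (simp add: kernel_dom_UNIV)

lemma wpair_trig_continuous_imag: "wpair UNIV UNIV f \<phi> \<Longrightarrow> continuous_on UNIV (\<lambda>y. trig \<phi> (\<i> * of_real y))"
  by (intro trig_continuous_imag) (simp add: wpair_def)

text \<open>The inverse of the almost periodic part is the bounded function
  \<open>trig \<psi>\<close>, so by Riemann-Lebesgue the quotient tends to \<open>1\<close> at both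
  ends and has a winding number.\<close>

lemma windex_ex:
  assumes p: "wpair UNIV UNIV f \<phi>" and q: "wpair UNIV UNIV g \<psi>"
    and inv: "\<And>s. s \<in> imag_axis \<Longrightarrow> wev f \<phi> s * wev g \<psi> s = 1"
  obtains w n where "windex f \<phi> w n"
proof -
  have \<phi>: "(\<lambda>x. norm (\<phi> x)) summable_on UNIV" and \<psi>: "(\<lambda>x. norm (\<psi> x)) summable_on UNIV"
    and f: "integrable lborel f" using p q by (auto simp: wpair_def)
  note ti = trig_inverse[OF p q inv]
  have Q: "wien {} UNIV (trig \<psi>) (\<Sum>\<^sub>\<infinity>x. norm (\<psi> x))" by (rule wien_trig[OF \<psi>]) auto
  obtain w where w: "mean_arg (\<lambda>y. trig \<phi> (\<i> * of_real y)) w" by (rule mean_arg_trig_ex[OF \<phi> Q ti])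
  let ?a = "\<lambda>y. trig \<phi> (\<i> * of_real y)" and ?F = "\<lambda>y. wev f \<phi> (\<i> * of_real y)"
  have a0: "?a y \<noteq> 0" and F0: "?F y \<noteq> 0" for y
    using ti[of "\<i> * of_real y"] inv[of "\<i> * of_real y"] by auto
  have lim: "((\<lambda>y. trig \<psi> (\<i> * of_real y) * fourier f (\<i> * of_real y)) \<longlongrightarrow> 0) at_infinity"
  proof (rule Lim_null_comparison)
    show "\<forall>\<^sub>F y in at_infinity. norm (trig \<psi> (\<i> * of_real y) * fourier f (\<i> * of_real y))
        \<le> (\<Sum>\<^sub>\<infinity>x. norm (\<psi> x)) * norm (fourier f (\<i> * of_real y))"
      using wien_norm_le[OF Q] by (intro always_eventually allI) (auto simp: norm_mult kernel_dom_UNIV intro!: mult_right_mono)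
    show "((\<lambda>y. (\<Sum>\<^sub>\<infinity>x. norm (\<psi> x)) * norm (fourier f (\<i> * of_real y))) \<longlongrightarrow> 0) at_infinity"
      by (rule tendsto_mult_right_zero[OF tendsto_norm_zero[OF riemann_lebesgue[OF f]]])
  qed
  have eq: "?F y / ?a y = 1 + trig \<psi> (\<i> * of_real y) * fourier f (\<i> * of_real y)" for y
  proof -
    have "trig \<psi> (\<i> * of_real y) = inverse (?a y)" using ti[of "\<i> * of_real y"] by (metis imag_axis_i inverse_unique)
    then show ?thesis using a0[of y] by (simp add: wev_def field_simps)
  qed
  have "((\<lambda>y. ?F y / ?a y) \<longlongrightarrow> 1) at_infinity"
    unfolding eq using tendsto_add[OF tendsto_const lim, of 1] by simp
  moreover have "continuous_on UNIV (\<lambda>y. ?F y / ?a y)"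
    by (intro continuous_on_divide wev_continuous_imag[OF p] wpair_trig_continuous_imag[OF p]) (use a0 in auto)
  ultimately obtain n where "wind (\<lambda>y. ?F y / ?a y) n" using wind_ex[of "\<lambda>y. ?F y / ?a y"] a0 F0 by auto
  then show ?thesis using that w p by (auto simp: windex_def)
qed

lemma windex_mult:
  assumes a: "windex f \<phi> w n" and b: "windex g \<psi> v m"
    and p: "wpair UNIV UNIV h ch" and h: "\<And>s. s \<in> imag_axis \<Longrightarrow> wev h ch s = wev f \<phi> s * wev g \<psi> s"
      "\<And>s. s \<in> imag_axis \<Longrightarrow> trig ch s = trig \<phi> s * trig \<psi> s"
  shows "windex h ch (w + v) (n + m)"
  unfolding windex_def
  using p mean_arg_mult[of "\<lambda>y. trig \<phi> (\<i> * of_real y)" w "\<lambda>y. trig \<psi> (\<i> * of_real y)" v]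
    wind_mult[of "\<lambda>y. wev f \<phi> (\<i> * of_real y) / trig \<phi> (\<i> * of_real y)" n "\<lambda>y. wev g \<psi> (\<i> * of_real y) / trig \<psi> (\<i> * of_real y)" m] a b
  by (simp add: windex_def h)

text \<open>Multiplying the difference by the inverse turns it into a relative perturbation below
  \<open>1/2\<close>. As \<open>wnorm\<close> dominates both the transform and its almost periodic
  part, a single hypothesis controls both components.\<close>

lemma windex_perturb:
  assumes a: "windex f \<phi> w n" and b: "windex f' \<phi>' v m" and q: "wpair UNIV UNIV g \<psi>"
    and inv: "\<And>s. s \<in> imag_axis \<Longrightarrow> wev f \<phi> s * wev g \<psi> s = 1"
    and small: "wnorm (\<lambda>x. f' x - f x) (\<lambda>x. \<phi>' x - \<phi> x) * wnorm g \<psi> < 1/2"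
  shows "w = v \<and> n = m"
proof -
  have p: "wpair UNIV UNIV f \<phi>" "wpair UNIV UNIV f' \<phi>'" using a b by (auto simp: windex_def)
  let ?d = "wnorm (\<lambda>x. f' x - f x) (\<lambda>x. \<phi>' x - \<phi> x)"
  note d = wpair_diff[OF p(2,1) subset_UNIV]
  have trig_le: "norm (trig \<psi> s) \<le> wnorm f \<psi>" if "wpair UNIV UNIV f \<psi>" "s \<in> imag_axis" for f \<psi> s
  proof -
    have "norm (trig \<psi> s) \<le> (\<Sum>\<^sub>\<infinity>x. norm (\<psi> x))"
      by (rule norm_trig_le) (use that in \<open>auto simp: wpair_def imag_axis_def\<close>)
    also have "\<dots> \<le> wnorm f \<psi>" by (simp add: wnorm_def)
    finally show ?thesis .
  qed
  note ti = trig_inverse[OF p(1) q inv]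
  have near: "norm (F' / F - 1) < 1/2" if "norm (F' - F) \<le> ?d" "norm G \<le> wnorm g \<psi>" "F * G = 1" for F F' G :: complex
  proof -
    have "F \<noteq> 0" using that(3) by auto
    then have "F' / F - 1 = (F' - F) * G" using that(3) by (simp add: field_simps)
    then have "norm (F' / F - 1) \<le> ?d * wnorm g \<psi>"
      using that by (simp only: norm_mult) (intro mult_mono, auto simp: wnorm_nonneg)
    then show ?thesis using small by linarith
  qed
  let ?s = "\<lambda>y. \<i> * complex_of_real y"
  have 1: "norm (trig \<phi>' (?s y) / trig \<phi> (?s y) - 1) < 1/2" for y
    using near[OF _ trig_le[OF q, of "?s y"] ti[of "?s y"], of "trig \<phi>' (?s y)"] trig_le[OF d(1), of "?s y"] d(3)[of "?s y"]
    by (simp add: kernel_dom_UNIV)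
  have 2: "norm (wev f' \<phi>' (?s y) / wev f \<phi> (?s y) - 1) < 1/2" for y
    using near[OF _ norm_wev_le[OF q subset_UNIV, of "?s y"] inv[of "?s y"], of "wev f' \<phi>' (?s y)"]
      norm_wev_le[OF d(1) subset_UNIV, of "?s y"] d(2)[of "?s y"]
    by (simp add: kernel_dom_UNIV)
  have nz: "trig \<phi> (?s y) \<noteq> 0" "wev f \<phi> (?s y) \<noteq> 0" for y using ti[of "?s y"] inv[of "?s y"] by auto
  have "mean_arg (\<lambda>y. trig \<phi>' (?s y)) w"
    by (rule mean_arg_perturb[OF _ wpair_trig_continuous_imag[OF p(1)] wpair_trig_continuous_imag[OF p(2)] 1])
      (use a in \<open>simp add: windex_def\<close>)
  then have "w = v" using b by (auto simp: windex_def intro: mean_arg_unique)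
  moreover have "n = m"
    by (rule wind_quotient_perturb[OF _ _ wev_continuous_imag[OF p(1)] wev_continuous_imag[OF p(2)]
          wpair_trig_continuous_imag[OF p(1)] wpair_trig_continuous_imag[OF p(2)] nz(2,1) 2 1])
      (use a b in \<open>auto simp: windex_def\<close>)
  ultimately show ?thesis by blast
qed

section \<open>Additivity, involution and local constancy of the index\<close>

lemma A_unitE:
  assumes "F \<in> Units A_alg"
  obtains f \<phi> g \<psi> where "wpair UNIV UNIV f \<phi>" "F = restrict (wev f \<phi>) imag_axis"
    "wpair UNIV UNIV g \<psi>" "\<And>s. s \<in> imag_axis \<Longrightarrow> wev f \<phi> s * wev g \<psi> s = 1"
proof -
  obtain G where FG: "F \<in> A_fun" "G \<in> A_fun" "(\<lambda>s\<in>imag_axis. F s * G s) = (\<lambda>s\<in>imag_axis. 1)"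
    using assms by (auto simp: Units_def)
  obtain f \<phi> where f: "wpair UNIV UNIV f \<phi>" "F = restrict (wev f \<phi>) imag_axis" using FG A_fun_iff by metis
  obtain g \<psi> where g: "wpair UNIV UNIV g \<psi>" "G = restrict (wev g \<psi>) imag_axis" using FG A_fun_iff by metis
  have "wev f \<phi> s * wev g \<psi> s = 1" if "s \<in> imag_axis" for s
    using fun_cong[OF FG(3), of s] that f(2) g(2) by simp
  then show ?thesis using that f g by blast
qed

lemma W_mult:
  assumes "F \<in> Units A_alg" "G \<in> Units A_alg"
  shows "W (F \<otimes>\<^bsub>A_alg\<^esub> G) = W F + W G"
proof -
  obtain f \<phi> f' \<phi>' where f: "wpair UNIV UNIV f \<phi>" "F = restrict (wev f \<phi>) imag_axis"
    "wpair UNIV UNIV f' \<phi>'" "\<And>s. s \<in> imag_axis \<Longrightarrow> wev f \<phi> s * wev f' \<phi>' s = 1"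
    by (rule A_unitE[OF assms(1)]) (rule that; blast)
  obtain g \<psi> g' \<psi>' where g: "wpair UNIV UNIV g \<psi>" "G = restrict (wev g \<psi>) imag_axis"
    "wpair UNIV UNIV g' \<psi>'" "\<And>s. s \<in> imag_axis \<Longrightarrow> wev g \<psi> s * wev g' \<psi>' s = 1"
    by (rule A_unitE[OF assms(2)]) (rule that; blast)
  obtain w n where w: "windex f \<phi> w n" by (rule windex_ex[OF f(1,3,4)])
  obtain v m where v: "windex g \<psi> v m" by (rule windex_ex[OF g(1,3,4)])
  obtain h ch where h: "wpair UNIV UNIV h ch"
    "\<And>s. s \<in> imag_axis \<Longrightarrow> wev h ch s = wev f \<phi> s * wev g \<psi> s"
    "\<And>s. s \<in> imag_axis \<Longrightarrow> trig ch s = trig \<phi> s * trig \<psi> s"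
    by (rule wpair_mult[OF f(1) g(1) wadm_UNIV, unfolded kernel_dom_UNIV]) (rule that; blast)
  have "F \<otimes>\<^bsub>A_alg\<^esub> G = restrict (wev h ch) imag_axis"
    unfolding f(2) g(2) A_alg_simps by (rule restrict_cong') (simp add: h)
  then show ?thesis
    using W_windex[OF windex_mult[OF w v h]] W_windex[OF w] W_windex[OF v] f(2) g(2) by simp
qed

lemma W_star:
  assumes "F \<in> Units A_alg" shows "W (A_star F) = - W F"
proof -
  obtain f \<phi> g \<psi> where f: "wpair UNIV UNIV f \<phi>" "F = restrict (wev f \<phi>) imag_axis"
    "wpair UNIV UNIV g \<psi>" "\<And>s. s \<in> imag_axis \<Longrightarrow> wev f \<phi> s * wev g \<psi> s = 1"
    by (rule A_unitE[OF assms]) (rule that; blast)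
  obtain w n where w: "windex f \<phi> w n" by (rule windex_ex[OF f(1,3,4)])
  let ?f = "\<lambda>x. cnj (f (- x))" and ?\<phi> = "\<lambda>x. cnj (\<phi> (- x))"
  note r = wpair_reflect[OF f(1)]
  have ev: "wev ?f ?\<phi> s = cnj (wev f \<phi> s)" if "s \<in> imag_axis" for s
    using r(2,3)[OF that] by (simp add: wev_def)
  have "A_star F = restrict (wev ?f ?\<phi>) imag_axis"
    unfolding A_star_def f(2) by (rule restrict_cong') (simp add: ev)
  moreover have "windex ?f ?\<phi> (- w) (- n)"
  proof -
    have w': "mean_arg (\<lambda>y. trig \<phi> (\<i> * of_real y)) w"
      "wind (\<lambda>y. wev f \<phi> (\<i> * of_real y) / trig \<phi> (\<i> * of_real y)) n"
      using w by (auto simp: windex_def)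
    have "mean_arg (\<lambda>y. cnj (trig \<phi> (\<i> * of_real y))) (- w)"
      by (rule mean_arg_neg[OF w'(1) continuous_arg_cnj])
    moreover have "wind (\<lambda>y. cnj (wev f \<phi> (\<i> * of_real y) / trig \<phi> (\<i> * of_real y))) (- n)"
      by (rule wind_neg[OF w'(2) continuous_arg_cnj])
    ultimately show ?thesis using r(1) by (simp add: windex_def r(3) ev)
  qed
  ultimately show ?thesis using W_windex[of ?f ?\<phi>] W_windex[OF w] f(2) by simp
qed

lemma W_locally_constant:
  assumes F: "F \<in> Units A_alg" and F': "F' \<in> A_fun" "\<And>s. s \<in> imag_axis \<Longrightarrow> F s * F' s = 1"
    and G: "G \<in> Units A_alg" and small: "norm_dist A_alg A_norm G F * A_norm F' < 1/2"
  shows "W G = W F"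
proof -
  obtain f \<phi> where f: "wpair UNIV UNIV f \<phi>" "F = restrict (wev f \<phi>) imag_axis"
    using F A_fun_iff by (auto simp: Units_def)
  obtain h ch where h: "wpair UNIV UNIV h ch" "F' = restrict (wev h ch) imag_axis" using F'(1) A_fun_iff by metis
  obtain g \<psi> g' \<psi>' where g: "wpair UNIV UNIV g \<psi>" "G = restrict (wev g \<psi>) imag_axis"
    "wpair UNIV UNIV g' \<psi>'" "\<And>s. s \<in> imag_axis \<Longrightarrow> wev g \<psi> s * wev g' \<psi>' s = 1"
    by (rule A_unitE[OF G]) (rule that; blast)
  have inv: "wev f \<phi> s * wev h ch s = 1" if "s \<in> imag_axis" for s
    using F'(2)[OF that] that f(2) h(2) by simp
  obtain w n where w: "windex f \<phi> w n" by (rule windex_ex[OF f(1) h(1) inv])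
  obtain v m where v: "windex g \<psi> v m" by (rule windex_ex[OF g(1,3,4)])
  note d = wpair_diff[OF g(1) f(1) subset_UNIV]
  have FA: "F \<in> A_fun" "G \<in> A_fun" using F G by (auto simp: Units_def)
  have "(\<lambda>s\<in>imag_axis. G s - F s) = restrict (wev (\<lambda>x. g x - f x) (\<lambda>x. \<psi> x - \<phi> x)) imag_axis"
    unfolding f(2) g(2) by (rule restrict_cong') (simp add: d(2) kernel_dom_UNIV)
  then have "wnorm (\<lambda>x. g x - f x) (\<lambda>x. \<psi> x - \<phi> x) = norm_dist A_alg A_norm G F"
    using A_norm_eq[OF d(1)] by (simp add: norm_dist_A FA)
  then have "wnorm (\<lambda>x. g x - f x) (\<lambda>x. \<psi> x - \<phi> x) * wnorm h ch < 1/2"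
    using small A_norm_eq[OF h(1)] h(2) by simp
  from windex_perturb[OF w v h(1) inv this] show ?thesis
    using W_windex[OF w] W_windex[OF v] f(2) g(2) by simp
qed

lemma W_continuous:
  "continuous_map (subtopology (Metric_space.mtopology (carrier A_alg) (norm_dist A_alg A_norm)) (Units A_alg))
     (discrete_topology UNIV) W"
proof -
  interpret Metric_space A_fun "norm_dist A_alg A_norm" by (rule A_metric)
  show ?thesis
    unfolding continuous_map_def
  proof (intro conjI ballI allI impI)
    fix U :: "(real \<times> int) set"
    have top: "topspace (subtopology mtopology (Units A_alg)) = Units A_alg"
      by (auto simp: Units_def)
    have "\<exists>r>0. \<forall>G\<in>Units A_alg. norm_dist A_alg A_norm F G < r \<longrightarrow> W G = W F" if F: "F \<in> Units A_alg" for F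
    proof -
      obtain F' where F': "F' \<in> A_fun" "(\<lambda>s\<in>imag_axis. F s * F' s) = (\<lambda>s\<in>imag_axis. 1)"
        using F by (auto simp: Units_def)
      have inv: "F s * F' s = 1" if "s \<in> imag_axis" for s using fun_cong[OF F'(2), of s] that by simp
      \<comment> \<open>Inside this radius the distance times the norm of the inverse is below
        \<open>1/2\<close>, as \<open>W_locally_constant\<close> requires.\<close>
      let ?r = "1 / (2 * (A_norm F' + 1))"
      have n: "0 \<le> A_norm F'" by (rule A_norm_nonneg[OF F'(1)])
      have "W G = W F" if G: "G \<in> Units A_alg" "norm_dist A_alg A_norm F G < ?r" for G
      proof (rule W_locally_constant[OF F F'(1) inv G(1)])
        have "norm_dist A_alg A_norm G F * A_norm F' \<le> norm_dist A_alg A_norm F G * (A_norm F' + 1)"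
          using n by (simp add: commute[of G F] mult_left_mono)
        also have "\<dots> < ?r * (A_norm F' + 1)" using G(2) n by (intro mult_strict_right_mono) auto
        also have "\<dots> = 1/2" using n by (simp add: field_simps)
        finally show "norm_dist A_alg A_norm G F * A_norm F' < 1/2" .
      qed
      then show ?thesis using n by (intro exI[of _ ?r]) auto
    qed
    then obtain r where r: "\<And>F. F \<in> Units A_alg \<Longrightarrow> r F > 0"
      "\<And>F G. F \<in> Units A_alg \<Longrightarrow> G \<in> Units A_alg \<Longrightarrow> norm_dist A_alg A_norm F G < r F \<Longrightarrow> W G = W F"
      by metis
    let ?V = "\<Union>F\<in>{F \<in> Units A_alg. W F \<in> U}. mball F (r F)"
    have "openin mtopology ?V" by (intro openin_Union) auto
    moreover have "{F \<in> topspace (subtopology mtopology (Units A_alg)). W F \<in> U} = ?V \<inter> Units A_alg"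
    proof
      show "{F \<in> topspace (subtopology mtopology (Units A_alg)). W F \<in> U} \<subseteq> ?V \<inter> Units A_alg"
        unfolding top using r(1) by (auto simp: Units_def)
      show "?V \<inter> Units A_alg \<subseteq> {F \<in> topspace (subtopology mtopology (Units A_alg)). W F \<in> U}"
        unfolding top using r(2) by auto
    qed
    ultimately have "openin (subtopology mtopology (Units A_alg)) {F \<in> topspace (subtopology mtopology (Units A_alg)). W F \<in> U}"
      unfolding openin_subtopology by blast
    then show "openin (subtopology (Metric_space.mtopology (carrier A_alg) (norm_dist A_alg A_norm)) (Units A_alg))
        {F \<in> topspace (subtopology (Metric_space.mtopology (carrier A_alg) (norm_dist A_alg A_norm)) (Units A_alg)). W F \<in> U}"
      by simp
  qed auto
qed

section \<open>Logarithms of almost periodic elements\<close>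

lemma has_mean_bound:
  assumes m: "has_mean f m" and f: "continuous_on UNIV f" and B: "\<And>y. norm (f y) \<le> B"
  shows "norm m \<le> B"
proof (rule tendsto_upperbound[OF tendsto_norm[OF m[unfolded has_mean_def]]])
  show "\<forall>\<^sub>F T in at_top. norm ((1 / (2 * T)) *\<^sub>R integral {-T..T} f) \<le> B"
    using eventually_gt_at_top[of 0]
  proof eventually_elim
    case (elim T)
    have "norm (integral {-T..T} f) \<le> B * (T - (-T))"
      using elim B by (intro integral_bound) (auto intro: continuous_on_subset[OF f])
    then have "norm (integral {-T..T} f) \<le> B * (2 * T)" by simp
    then have "norm (integral {-T..T} f) / (2 * T) \<le> B" using elim by (subst pos_divide_le_eq) auto
    then show ?case using elim by simp
  qed
qed simp

text \<open>Parseval for the Bohr mean: the mean of the squared modulus of \<open>trig P\<close> is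
  the sum of the squared moduli of the coefficients.\<close>

lemma bessel_finite:
  assumes S: "finite S" and P: "P = (\<lambda>x. if x \<in> S then c x else 0)"
    and B: "\<And>s. s \<in> imag_axis \<Longrightarrow> norm (trig P s) \<le> B"
  shows "(\<Sum>x\<in>S. (norm (c x))\<^sup>2) \<le> B\<^sup>2"
proof -
  have sP: "(\<lambda>x. norm (P x)) summable_on UNIV" unfolding P by (rule trig_finite(2)[OF S])
  let ?p = "\<lambda>y. trig P (\<i> * of_real y)"
  have cp: "continuous_on UNIV ?p" by (rule trig_continuous_imag[OF sP])
  have m: "has_mean (\<lambda>y. \<Sum>x\<in>S. cnj (c x) * (?p y * exp (\<i> * of_real y * of_real x))) (\<Sum>x\<in>S. cnj (c x) * P x)"
    by (intro has_mean_sum S has_mean_cmult has_mean_trig sP continuous_intros cp)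
  have "(\<Sum>x\<in>S. cnj (c x) * (?p y * exp (\<i> * of_real y * of_real x))) = ?p y * cnj (?p y)" for y
  proof -
    have "cnj (?p y) = (\<Sum>x\<in>S. cnj (c x) * exp (\<i> * of_real y * of_real x))"
      unfolding P trig_finite(1)[OF S] by (simp add: exp_cnj)
    then show ?thesis by (simp add: sum_distrib_left mult_ac)
  qed
  then have m': "has_mean (\<lambda>y. ?p y * cnj (?p y)) (\<Sum>x\<in>S. cnj (c x) * P x)" using m by simp
  have "norm (?p y * cnj (?p y)) \<le> B\<^sup>2" for y
    using B[OF imag_axis_i, of y] by (simp add: norm_mult power2_eq_square mult_mono')
  then have "norm (\<Sum>x\<in>S. cnj (c x) * P x) \<le> B\<^sup>2"
    by (intro has_mean_bound[OF m']) (auto intro!: continuous_intros cp)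
  also have "(\<Sum>x\<in>S. cnj (c x) * P x) = of_real (\<Sum>x\<in>S. (norm (c x))\<^sup>2)"
    unfolding P of_real_sum by (rule sum.cong) (auto simp: complex_norm_square mult.commute simp del: of_real_power)
  finally show ?thesis by (simp only: norm_of_real abs_le_iff)
qed

text \<open>Each coefficient is at most \<open>B\<close>. The crude factor \<open>card S\<close>, in
  place of its square root, is harmless because only polynomial growth of the factor
  matters.\<close>

lemma sum_norm_le_sqrt_card:
  fixes c :: "'a \<Rightarrow> complex"
  assumes "(\<Sum>x\<in>S. (norm (c x))\<^sup>2) \<le> B\<^sup>2" "0 \<le> B" "finite S"
  shows "(\<Sum>x\<in>S. norm (c x)) \<le> real (card S) * B"
proof -
  have "norm (c x) \<le> B" if "x \<in> S" for x
  proof (rule power2_le_imp_le)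
    have "(norm (c x))\<^sup>2 \<le> (\<Sum>x\<in>S. (norm (c x))\<^sup>2)" using that assms(3) by (intro member_le_sum) auto
    then show "(norm (c x))\<^sup>2 \<le> B\<^sup>2" using assms(1) by linarith
  qed (rule assms)
  then show ?thesis using sum_bounded_above[of S "\<lambda>x. norm (c x)" B] by simp
qed

text \<open>The coefficients of a trigonometric polynomial are bounded by its supremum norm, and the
  number of frequencies of a \<open>k\<close>-th power grows polynomially in \<open>k\<close>. Hence the spectral radius
  in the \<open>l\<^sup>1\<close> norm is at most the supremum norm.\<close>

lemma wien_finite_trig_power:
  assumes S: "finite S" and P: "P = (\<lambda>x. if x \<in> S then c x else 0)"
    and B: "\<And>s. s \<in> imag_axis \<Longrightarrow> norm (trig P s) \<le> B"
  shows "wien {} UNIV (\<lambda>s. trig P s ^ k) (real (k + 1) ^ card S * B ^ k)"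
proof -
  have B0: "0 \<le> B" using order_trans[OF norm_ge_zero B[of 0]] by (simp add: imag_axis_def)
  \<comment> \<open>All combinations with multiplicities in \<open>{0..k}\<close>: a set containing
    the frequencies of the \<open>k\<close>-th power whose size is polynomial in \<open>k\<close>,
    with exponent \<open>card S\<close>.\<close>
  define T where "T k = (\<lambda>n. \<Sum>x\<in>S. real (n x) * x) ` (PiE S (\<lambda>_. {0..k}))" for k :: nat
  have fT: "finite (T k)" and cT: "card (T k) \<le> (k + 1) ^ card S" for k
  proof -
    have f: "finite (PiE S (\<lambda>_. {0..k}))" using S by (intro finite_PiE) auto
    then show "finite (T k)" unfolding T_def by simp
    have "card (T k) \<le> card (PiE S (\<lambda>_. {0..k}))" unfolding T_def by (rule card_image_le[OF f])
    also have "\<dots> = (k + 1) ^ card S" using S by (simp add: card_PiE)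
    finally show "card (T k) \<le> (k + 1) ^ card S" .
  qed
  have T0: "0 \<in> T 0"
    unfolding T_def by (rule image_eqI[of _ _ "\<lambda>x\<in>S. 0"]) auto
  have TS: "t + x \<in> T (Suc k)" if t: "t \<in> T k" and x: "x \<in> S" for t x k
  proof -
    obtain n where n: "n \<in> PiE S (\<lambda>_. {0..k})" "t = (\<Sum>x\<in>S. real (n x) * x)" using t by (auto simp: T_def)
    let ?m = "n(x := Suc (n x))"
    have mem: "?m \<in> PiE S (\<lambda>_. {0..Suc k})"
      using n(1) x by (auto simp: PiE_iff extensional_def le_Suc_eq)
    have eq: "(\<Sum>z\<in>S. real (?m z) * z) = t + x"
    proof -
      have "(\<Sum>z\<in>S. real (?m z) * z) = (\<Sum>z\<in>S. real (n z) * z + (if z = x then x else 0))"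
        by (rule sum.cong) (auto simp: algebra_simps)
      also have "\<dots> = t + x" using S x by (simp add: sum.distrib n(2))
      finally show ?thesis .
    qed
    show ?thesis unfolding T_def by (rule image_eqI, rule eq[symmetric], rule mem)
  qed
  have sP: "(\<lambda>x. norm (P x)) summable_on UNIV" unfolding P by (rule trig_finite(2)[OF S])
  have "\<exists>d. (\<lambda>x. norm (d x)) summable_on UNIV \<and> (\<forall>x. x \<notin> T k \<longrightarrow> d x = 0) \<and> (\<forall>s\<in>imag_axis. trig d s = trig P s ^ k)"
  proof (induction k)
    case 0
    let ?d = "\<lambda>x::real. if x \<in> {0} then 1 else 0"
    have "trig ?d s = 1" for s by (subst trig_finite(1)) auto
    moreover have "(\<lambda>x. norm (?d x :: complex)) summable_on UNIV" by (rule trig_finite(2)) auto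
    ultimately show ?case using T0 by (intro exI[of _ ?d]) auto
  next
    case (Suc k)
    then obtain d where d: "(\<lambda>x. norm (d x)) summable_on UNIV" "\<And>x. x \<notin> T k \<Longrightarrow> d x = 0"
      "\<And>s. s \<in> imag_axis \<Longrightarrow> trig d s = trig P s ^ k" by auto
    have P0: "\<And>x. x \<notin> S \<Longrightarrow> P x = 0" by (simp add: P)
    obtain e where e: "(\<lambda>x. norm (e x)) summable_on UNIV" "\<And>x. x \<notin> T (Suc k) \<Longrightarrow> e x = 0"
      "\<And>s. s \<in> kernel_dom (T k) \<Longrightarrow> s \<in> kernel_dom S \<Longrightarrow> trig e s = trig d s * trig P s"
      by (rule trig_mult[of d "T k" P S "T (Suc k)"], rule d(1), erule d(2), rule sP, erule P0, erule (1) TS)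
        (rule that; blast)
    then show ?case using d(3) by (intro exI[of _ e]) (auto simp: imag_axis_kernel_dom)
  qed
  then obtain d where d: "(\<lambda>x. norm (d x)) summable_on UNIV" "\<And>x. x \<notin> T k \<Longrightarrow> d x = 0"
      "\<And>s. s \<in> imag_axis \<Longrightarrow> trig d s = trig P s ^ k" by auto
  have deq: "d = (\<lambda>x. if x \<in> T k then d x else 0)" using d(2) by auto
  have "norm (trig d s) \<le> B ^ k" if "s \<in> imag_axis" for s
    using B[OF that] d(3)[OF that] by (simp add: norm_power power_mono)
  from bessel_finite[OF fT deq this] have "(\<Sum>x\<in>T k. (norm (d x))\<^sup>2) \<le> (B ^ k)\<^sup>2" .
  from sum_norm_le_sqrt_card[OF this _ fT] have "(\<Sum>x\<in>T k. norm (d x)) \<le> real (card (T k)) * B ^ k"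
    using B0 by simp
  also have "\<dots> \<le> real (k + 1) ^ card S * B ^ k"
  proof (rule mult_right_mono)
    show "real (card (T k)) \<le> real (k + 1) ^ card S"
      unfolding of_nat_power[symmetric] of_nat_le_iff by (rule cT)
  qed (use B0 in simp)
  finally have "(\<Sum>\<^sub>\<infinity>x. norm (d x)) \<le> real (k + 1) ^ card S * B ^ k"
    using trig_finite(3)[OF fT, of k d] arg_cong[OF deq, of "\<lambda>d. \<Sum>\<^sub>\<infinity>x. norm (d x)"] by linarith
  then have "wien {} UNIV (trig d) (real (k + 1) ^ card S * B ^ k)"
    by (rule wien_le[OF wien_trig[OF d(1)], rotated]) auto
  then show ?thesis by (rule wien_cong) (simp add: d(3) kernel_dom_UNIV)
qed

text \<open>Distributing \<open>t ^ k\<close> over \<open>m + 1\<close> linear factors reduces the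
  claim to \<open>(k + 1) * v ^ k\<close> with \<open>v\<close> the \<open>(m + 1)\<close>-th root
  of \<open>t\<close>; as the powers of \<open>v\<close> decrease, this is at most the full
  geometric series.\<close>

lemma poly_times_geometric_bounded:
  fixes t :: real
  assumes "0 \<le> t" "t < 1"
  obtains C where "0 < C" "\<And>k. real (k + 1) ^ m * t ^ k \<le> C"
proof -
  define v where "v = root (Suc m) t"
  have v: "0 \<le> v" "v < 1" "v ^ Suc m = t"
    using assms by (simp_all add: v_def real_root_pow_pos2 del: power_Suc)
  have b: "real (k + 1) * v ^ k \<le> 1 / (1 - v)" for k
  proof -
    have "real (k + 1) * v ^ k = (\<Sum>j<k+1. v ^ k)" by simp
    also have "\<dots> \<le> (\<Sum>j<k+1. v ^ j)" using v by (intro sum_mono power_decreasing) auto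
    also have "\<dots> \<le> suminf (\<lambda>j. v ^ j)" using v by (intro sum_le_suminf) (auto intro: summable_geometric)
    also have "\<dots> = 1 / (1 - v)" using v by (simp add: suminf_geometric)
    finally show ?thesis .
  qed
  have "real (k + 1) ^ m * t ^ k \<le> (1 / (1 - v)) ^ Suc m" for k
  proof -
    have "real (k + 1) ^ m * t ^ k \<le> real (k + 1) ^ Suc m * t ^ k"
      using assms by (intro mult_right_mono power_increasing) auto
    also have "\<dots> = (real (k + 1) * v ^ k) ^ Suc m"
      unfolding v(3)[symmetric] power_mult_distrib by (simp only: power_mult[symmetric] mult.commute)
    also have "\<dots> \<le> (1 / (1 - v)) ^ Suc m" using b v by (intro power_mono) auto
    finally show ?thesis .
  qed
  then show ?thesis using that[of "(1 / (1 - v)) ^ Suc m"] v by simp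
qed

text \<open>Split \<open>F = Y + Z\<close> with \<open>Y\<close> a trigonometric polynomial and
  \<open>Z\<close> small in norm, and expand binomially: powers of \<open>Y\<close> are governed by
  the supremum up to a polynomial factor, powers of \<open>Z\<close> by the norm.\<close>

lemma wien_power_decay:
  assumes F: "wien {} UNIV F r" and \<rho>: "\<And>s. s \<in> imag_axis \<Longrightarrow> norm (F s) \<le> \<rho>" "\<rho> < 1"
  obtains C q where "0 \<le> q" "q < 1" "0 < C" "\<And>n. wien {} UNIV (\<lambda>s. F s ^ n) (C * q ^ n)"
proof -
  have \<rho>0: "0 \<le> \<rho>" using order_trans[OF norm_ge_zero \<rho>(1)[of 0]] by (simp add: imag_axis_def)
  \<comment> \<open>Three portions of \<open>\<eta>\<close> must fit below
    \<open>1 - \<rho>\<close>: one for passing from \<open>F\<close> to \<open>Y\<close>, one to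
    absorb the polynomial factor, one for the norm of \<open>Z\<close>.\<close>
  define \<eta> where "\<eta> = (1 - \<rho>) / 4"
  have \<eta>: "0 < \<eta>" "\<rho> + 3 * \<eta> < 1" using \<rho>(2) by (auto simp: \<eta>_def field_simps)
  obtain b where b: "(\<lambda>x. norm (b x)) summable_on UNIV" "\<And>s. s \<in> imag_axis \<Longrightarrow> F s = trig b s"
    by (rule wien_ap_trig[OF F, unfolded kernel_dom_UNIV]) (rule that; blast)
  obtain S where S: "finite S" "(\<Sum>\<^sub>\<infinity>x. norm (b x - (if x \<in> S then b x else 0))) \<le> \<eta>"
    using infsum_finite_approx[OF b(1) \<eta>(1)] by blast
  define P where "P = (\<lambda>x. if x \<in> S then b x else 0)"
  have P: "(\<lambda>x. norm (P x)) summable_on UNIV" unfolding P_def by (rule trig_finite(2)[OF S(1)])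
  let ?Y = "trig P" and ?Z = "\<lambda>s. F s - trig P s"
  have Z: "wien {} UNIV ?Z \<eta>"
    by (rule wien_cong[OF wien_le[OF wien_trig[OF norm_diff_summable[OF b(1) P]] S(2)[folded fun_cong[OF P_def]]]])
      (auto simp: trig_diff[OF b(1) P] kernel_dom_UNIV b(2))
  have Yb: "norm (?Y s) \<le> \<rho> + \<eta>" if s: "s \<in> imag_axis" for s
  proof -
    have "norm (?Z s) \<le> \<eta>" using wien_norm_le[OF Z] s by (simp add: kernel_dom_UNIV)
    then show ?thesis using \<rho>(1)[OF s] norm_triangle_sub[of "?Y s" "F s"] by (simp add: norm_minus_commute)
  qed
  let ?B = "\<rho> + \<eta>" and ?B' = "\<rho> + 2 * \<eta>"
  have B: "0 < ?B" "?B < ?B'" using \<rho>0 \<eta> by auto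
  have t: "0 \<le> ?B / ?B'" "?B / ?B' < 1" using B by auto
  obtain C where C: "0 < C" "\<And>k. real (k + 1) ^ card S * (?B / ?B') ^ k \<le> C"
    using poly_times_geometric_bounded[OF t] by metis
  have Y: "wien {} UNIV (\<lambda>s. ?Y s ^ k) (C * ?B' ^ k)" for k
  proof (rule wien_le[OF wien_finite_trig_power[OF S(1) P_def Yb]])
    have "real (k + 1) ^ card S * ?B ^ k = real (k + 1) ^ card S * (?B / ?B') ^ k * ?B' ^ k"
      using B by (simp add: power_divide)
    also have "\<dots> \<le> C * ?B' ^ k" using C(2)[of k] B by (intro mult_right_mono) auto
    finally show "real (k + 1) ^ card S * ?B ^ k \<le> C * ?B' ^ k" .
  qed auto
  have "wien {} UNIV (\<lambda>s. F s ^ n) (C * (?B' + \<eta>) ^ n)" for n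
  proof -
    have "wien {} UNIV (\<lambda>s. \<Sum>k\<le>n. of_nat (n choose k) * (?Y s ^ k * ?Z s ^ (n - k)))
        (\<Sum>k\<le>n. norm (of_nat (n choose k) :: complex) * ((C * ?B' ^ k) * \<eta> ^ (n - k)))"
      by (intro wien_sum wien_cmult wien_mult Y wien_power Z) auto
    moreover have "F s ^ n = (\<Sum>k\<le>n. of_nat (n choose k) * (?Y s ^ k * ?Z s ^ (n - k)))" for s
      using binomial_ring[of "?Y s" "?Z s" n] by (simp add: mult.assoc)
    moreover have "(\<Sum>k\<le>n. norm (of_nat (n choose k) :: complex) * ((C * ?B' ^ k) * \<eta> ^ (n - k))) = C * (?B' + \<eta>) ^ n"
      unfolding binomial_ring[of ?B' \<eta> n] sum_distrib_left by (rule sum.cong) (auto simp only: norm_of_nat mult_ac)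
    ultimately show ?thesis by simp
  qed
  then show ?thesis using that[of "?B' + \<eta>" C] \<eta> \<rho>0 C(1) by (simp add: algebra_simps)
qed

text \<open>The norm of \<open>F\<close> may be large. The decay of its powers makes the logarithmic
  series summable in norm from the bound on the supremum alone.\<close>

lemma wien_log_one_plus:
  assumes F: "wien {} UNIV F r" and \<rho>: "\<And>s. s \<in> imag_axis \<Longrightarrow> norm (F s) \<le> \<rho>" "\<rho> < 1"
  obtains \<eta> where "(\<lambda>x. norm (\<eta> x)) summable_on UNIV" "\<And>s. s \<in> imag_axis \<Longrightarrow> 1 + F s = exp (trig \<eta> s)"
proof -
  obtain C q where q: "0 \<le> q" "q < 1" "0 < C" "\<And>n. wien {} UNIV (\<lambda>s. F s ^ n) (C * q ^ n)"
    using wien_power_decay[OF F \<rho>] by metis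
  let ?c = "\<lambda>n. (-1) ^ Suc n / of_nat n :: complex"
  have "norm (?c n) \<le> 1" for n by (cases n) (auto simp: norm_divide norm_power simp del: of_nat_Suc)
  then have le: "norm (?c n) * (C * q ^ n) \<le> C * q ^ n" for n
    using q mult_right_mono[of "norm (?c n)" 1 "C * q ^ n"] by simp
  have "summable (\<lambda>n. norm (?c n) * (C * q ^ n))"
    by (rule summable_comparison_test'[of "\<lambda>n. C * q ^ n" 0])
      (use q le in \<open>auto simp: abs_mult norm_mult intro!: summable_mult summable_geometric\<close>)
  from wien_powser[OF q(4) this] obtain R where R: "wien {} UNIV (\<lambda>s. suminf (\<lambda>n. ?c n * F s ^ n)) R" by auto
  obtain \<eta> where \<eta>: "(\<lambda>x. norm (\<eta> x)) summable_on UNIV" "\<And>s. s \<in> imag_axis \<Longrightarrow> suminf (\<lambda>n. ?c n * F s ^ n) = trig \<eta> s"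
    by (rule wien_ap_trig[OF R, unfolded kernel_dom_UNIV]) (rule that; blast)
  have "1 + F s = exp (trig \<eta> s)" if s: "s \<in> imag_axis" for s
  proof -
    have n: "norm (F s) < 1" using \<rho>(1)[OF s] \<rho>(2) by simp
    have "trig \<eta> s = Ln (1 + F s)" using sums_unique[OF Ln_series[OF n]] \<eta>(2)[OF s] by simp
    moreover have "1 + F s \<noteq> 0" using n by (metis add_eq_0_iff less_irrefl norm_minus_cancel norm_one)
    ultimately show ?thesis by simp
  qed
  then show ?thesis using that \<eta>(1) by blast
qed

section \<open>Almost periods and the exact logarithm\<close>

text \<open>A translation that nearly fixes all characters multiplies the polynomial by a factor
  near \<open>1\<close>, so it changes the argument by \<open>2 * pi * n\<close> up to
  \<open>\<kappa>\<close>, with \<open>n\<close> independent of \<open>y\<close>. Repeating it would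
  make the argument grow linearly unless \<open>n = 0\<close>, and zero mean winding excludes this
  growth.\<close>

lemma almost_period_log:
  assumes S: "finite S" and P: "P = (\<lambda>x. if x \<in> S then c x else 0)"
    and Q: "wien {} UNIV Q r" and inv: "\<And>s. s \<in> imag_axis \<Longrightarrow> trig P s * Q s = 1"
    and h: "continuous_on UNIV h" "\<And>y. trig P (\<i> * of_real y) = exp (h y)"
    and m: "mean_arg (\<lambda>y. trig P (\<i> * of_real y)) 0" and \<kappa>: "0 < \<kappa>" "\<kappa> < 1"
  obtains \<epsilon> where "0 < \<epsilon>"
    "\<And>\<tau> y. (\<And>x. x \<in> S \<Longrightarrow> norm (exp (- (\<i> * of_real \<tau> * of_real x)) - 1) \<le> \<epsilon>) \<Longrightarrow> norm (h (y + \<tau>) - h y) \<le> \<kappa>"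
proof -
  let ?p = "\<lambda>y. trig P (\<i> * of_real y)"
  have r: "0 \<le> r" using wien_nonneg[OF Q] .
  define A where "A = (\<Sum>x\<in>S. norm (c x))"
  have A: "0 \<le> A" unfolding A_def by (rule sum_nonneg) simp
  \<comment> \<open>\<open>A\<close> converts closeness of the characters into closeness of the
    polynomial, \<open>r\<close> bounds its inverse; the relative change is thus at most
    \<open>\<kappa> / 4\<close>.\<close>
  define \<epsilon> where "\<epsilon> = \<kappa> / (4 * (A + 1) * (r + 1))"
  have \<epsilon>: "0 < \<epsilon>" using \<kappa> A r by (auto simp: \<epsilon>_def)
  have "A * r * \<epsilon> \<le> ((A + 1) * (r + 1)) * \<epsilon>" using A r \<epsilon> by (intro mult_right_mono mult_mono) auto
  also have "\<dots> = \<kappa> / 4"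
  proof -
    have "a * b * (\<kappa> / (4 * a * b)) = \<kappa> / 4" if "a \<noteq> 0" "b \<noteq> 0" for a b :: real
      using that by simp
    from this[of "A + 1" "r + 1"] show ?thesis using A r unfolding \<epsilon>_def by linarith
  qed
  finally have Ar: "A * r * \<epsilon> \<le> \<kappa> / 4" .
  have p0: "?p y \<noteq> 0" for y using inv[OF imag_axis_i, of y] by auto
  have sP: "(\<lambda>x. norm (P x)) summable_on UNIV" unfolding P by (rule trig_finite(2)[OF S])
  have cp: "continuous_on UNIV ?p" by (rule trig_continuous_imag[OF sP])
  have pos: "norm (h (y + \<tau>) - h y) \<le> \<kappa>"
    if \<tau>: "\<And>x. x \<in> S \<Longrightarrow> norm (exp (- (\<i> * of_real \<tau> * of_real x)) - 1) \<le> \<epsilon>" and \<tau>0: "0 < \<tau>" for \<tau> y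
  proof -
    let ?q = "\<lambda>y. ?p (y + \<tau>) / ?p y"
    have q: "norm (?q y - 1) \<le> \<kappa> / 4" for y
    proof -
      have "exp (- (\<i> * of_real (y + \<tau>) * of_real x)) = exp (- (\<i> * of_real y * of_real x)) * exp (- (\<i> * of_real \<tau> * of_real x))" for x
        by (simp flip: exp_add add: algebra_simps)
      then have "?p (y + \<tau>) - ?p y = (\<Sum>x\<in>S. c x * (exp (- (\<i> * of_real y * of_real x)) * (exp (- (\<i> * of_real \<tau> * of_real x)) - 1)))"
        unfolding P trig_finite(1)[OF S] by (simp only: sum_subtractf[symmetric] right_diff_distrib mult_1_right)
      also have "norm \<dots> \<le> (\<Sum>x\<in>S. norm (c x) * \<epsilon>)"
        by (rule sum_norm_le) (use \<tau> in \<open>auto simp: norm_mult intro!: mult_left_mono\<close>)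
      also have "\<dots> = A * \<epsilon>" by (simp add: A_def sum_distrib_right)
      finally have 1: "norm (?p (y + \<tau>) - ?p y) \<le> A * \<epsilon>" .
      have 2: "norm (Q (\<i> * of_real y)) \<le> r" using wien_norm_le[OF Q] by (simp add: kernel_dom_UNIV)
      have "?q y - 1 = (?p (y + \<tau>) - ?p y) * Q (\<i> * of_real y)"
        using inv[OF imag_axis_i, of y] p0[of y] by (simp add: field_simps)
      then have "norm (?q y - 1) \<le> (A * \<epsilon>) * r"
        using 1 2 A \<epsilon> by (simp only: norm_mult) (intro mult_mono, auto)
      then show ?thesis using Ar by (simp add: mult_ac)
    qed
    have q2: "norm (?q y - 1) < 1/2" for y using q[of y] \<kappa> by linarith
    have q0: "?q y \<noteq> 0" for y using p0[of y] p0[of "y + \<tau>"] by simp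
    let ?L = "\<lambda>y. Ln (?q y)"
    have L: "norm (?L y) \<le> \<kappa> / 2" for y using norm_Ln_le[OF q2, of y] q[of y] by simp
    have cq: "continuous_on UNIV ?q"
      by (intro continuous_on_divide continuous_on_compose2[OF cp] cp continuous_intros) (use p0 in auto)
    have cL: "continuous_on UNIV ?L"
      by (rule continuous_on_Ln'[OF cq]) (rule half_disc_not_nonpos[OF q2])
    let ?d = "\<lambda>y. h (y + \<tau>) - h y - ?L y"
    have d1: "exp (?d y) = 1" for y
      using h(2)[of "y + \<tau>"] h(2)[of y] q0[of y] p0[of y] p0[of "y + \<tau>"] by (simp add: exp_diff)
    have "continuous_on UNIV (\<lambda>y. Im (?d y))"
      by (intro continuous_intros cL continuous_on_compose2[OF h(1)] h(1)) auto
    moreover have "cis (Im (?d y)) = 1" for y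
    proof -
      have "Re (?d y) = 0" using d1[of y] by (simp only: exp_eq_1)
      then show ?thesis using exp_eq_polar[of "?d y"] d1[of y] by simp
    qed
    ultimately obtain n :: int where n: "\<And>y. Im (?d y) = 2 * pi * of_int n"
      using continuous_2pi_int_constant[of UNIV "\<lambda>y. Im (?d y)"] by auto
    have step: "\<bar>Im (h (y + \<tau>)) - Im (h y) - 2 * pi * of_int n\<bar> \<le> \<kappa>" for y
      using n[of y] L[of y] abs_Im_le_cmod[of "?L y"] \<kappa> by simp
    have iter: "\<bar>Im (h (y + real k * \<tau>)) - Im (h y) - 2 * pi * of_int n * real k\<bar> \<le> real k * \<kappa>" for y k
    proof (induction k)
      case (Suc k)
      have "y + real (Suc k) * \<tau> = (y + real k * \<tau>) + \<tau>" by (simp add: algebra_simps)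
      then show ?case using Suc step[of "y + real k * \<tau>"] by (simp add: algebra_simps)
    qed simp
    have lim: "((\<lambda>\<rho>. 1 / (2 * \<rho>) * (Im (h \<rho>) - Im (h (- \<rho>)))) \<longlongrightarrow> 0) at_top"
      by (rule mean_arg_imp_lim[OF m]) (rule continuous_arg_exp[OF h])
    have "filterlim (\<lambda>k. real k * \<tau>) at_top sequentially"
      using \<tau>0 by (intro filterlim_at_top_mult_tendsto_pos[OF tendsto_const] filterlim_real_sequentially)
    then have "((\<lambda>k. 1 / (2 * (real k * \<tau>)) * (Im (h (real k * \<tau>)) - Im (h (- (real k * \<tau>))))) \<longlongrightarrow> 0) sequentially"
      by (rule filterlim_compose[OF lim])
    then have l2: "((\<lambda>k. \<bar>1 / (2 * (real k * \<tau>)) * (Im (h (real k * \<tau>)) - Im (h (- (real k * \<tau>)))) - 2 * pi * of_int n / \<tau>\<bar>)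
        \<longlongrightarrow> \<bar>0 - 2 * pi * of_int n / \<tau>\<bar>) sequentially"
      by (intro tendsto_intros)
    have "\<bar>0 - 2 * pi * of_int n / \<tau>\<bar> \<le> \<kappa> / \<tau>"
    proof (rule tendsto_upperbound[OF l2])
      show "\<forall>\<^sub>F k in sequentially. \<bar>1 / (2 * (real k * \<tau>)) * (Im (h (real k * \<tau>)) - Im (h (- (real k * \<tau>)))) - 2 * pi * of_int n / \<tau>\<bar> \<le> \<kappa> / \<tau>"
        using eventually_gt_at_top[of 0]
      proof eventually_elim
        case (elim k)
        let ?D = "Im (h (real k * \<tau>)) - Im (h (- (real k * \<tau>)))"
        \<comment> \<open>The symmetric interval used for the mean winding has length
          \<open>2 * k * \<tau>\<close>, so it is covered by \<open>2 * k\<close> translations from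
          its left end.\<close>
        have e: "- (real k * \<tau>) + real (2 * k) * \<tau> = real k * \<tau>" by (simp add: algebra_simps)
        have "\<bar>?D - 2 * pi * of_int n * real (2 * k)\<bar> \<le> real (2 * k) * \<kappa>"
          using iter[of "- (real k * \<tau>)" "2 * k"] unfolding e .
        then have "\<bar>?D - 2 * pi * of_int n * real (2 * k)\<bar> / (2 * (real k * \<tau>)) \<le> real (2 * k) * \<kappa> / (2 * (real k * \<tau>))"
          using elim \<tau>0 by (intro divide_right_mono) auto
        also have "\<dots> = \<kappa> / \<tau>" using elim \<tau>0 by (simp add: field_simps)
        finally have "\<bar>(?D - 2 * pi * of_int n * real (2 * k)) / (2 * (real k * \<tau>))\<bar> \<le> \<kappa> / \<tau>"
          using \<tau>0 by (simp add: abs_divide abs_mult)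
        moreover have "(?D - 2 * pi * of_int n * real (2 * k)) / (2 * (real k * \<tau>)) = 1 / (2 * (real k * \<tau>)) * ?D - 2 * pi * of_int n / \<tau>"
          using elim \<tau>0 by (simp add: field_simps)
        ultimately show ?case by (simp only:)
      qed
    qed simp
    then have "2 * pi * \<bar>of_int n\<bar> / \<tau> \<le> \<kappa> / \<tau>" using \<tau>0 by (simp add: abs_mult abs_divide)
    then have "2 * pi * \<bar>of_int n\<bar> \<le> \<kappa>" using \<tau>0 by (simp add: divide_le_cancel)
    then have "2 * pi * \<bar>real_of_int n\<bar> < 1" using \<kappa> by linarith
    moreover have "1 * \<bar>real_of_int n\<bar> \<le> 2 * pi * \<bar>real_of_int n\<bar>" using pi_gt3 by (intro mult_right_mono) auto
    ultimately have "n = 0" by linarith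
    then have "?d y = 0" using n[of y] d1[of y] by (simp only: exp_eq_1) (simp add: complex_eq_iff)
    then show ?thesis using L[of y] \<kappa> by simp
  qed
  have "norm (h (y + \<tau>) - h y) \<le> \<kappa>"
    if \<tau>: "\<And>x. x \<in> S \<Longrightarrow> norm (exp (- (\<i> * of_real \<tau> * of_real x)) - 1) \<le> \<epsilon>" for \<tau> y
  proof -
    consider "\<tau> > 0" | "\<tau> = 0" | "\<tau> < 0" by linarith
    then show ?thesis
    proof cases
      case 3
      \<comment> \<open>Conjugation turns the condition on \<open>\<tau>\<close> into that on
        \<open>- \<tau>\<close>; the positive case is then used at
        \<open>y + \<tau>\<close>.\<close>
      have "norm (exp (- (\<i> * of_real (-\<tau>) * of_real x)) - 1) \<le> \<epsilon>" if "x \<in> S" for x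
      proof -
        have "exp (- (\<i> * of_real (-\<tau>) * of_real x)) - 1
            = cnj (exp (- (\<i> * of_real \<tau> * of_real x)) - 1)"
          by (simp add: exp_cnj)
        then show ?thesis using \<tau>[OF that] by (simp only: complex_mod_cnj)
      qed
      from pos[OF this, of "y + \<tau>"] 3 show ?thesis by (simp add: norm_minus_commute)
    qed (use pos[OF \<tau>] \<kappa> in auto)
  qed
  then show ?thesis using that \<epsilon> by blast
qed

text \<open>Pigeonhole: the values of the finitely many characters at \<open>a\<close> fall into
  finitely many cells of side \<open>\<epsilon> / 2\<close>, and \<open>N\<close> takes one
  representative from each occupied cell. So every real is a point of a finite set plus an almost
  period common to \<open>S\<close>.\<close>

lemma almost_period_net:
  fixes S :: "real set"
  assumes S: "finite S" and \<epsilon>: "0 < \<epsilon>"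
  obtains N :: "real set" where "finite N"
    "\<And>a. \<exists>b\<in>N. \<forall>x\<in>S. norm (exp (- (\<i> * of_real (a - b) * of_real x)) - 1) \<le> \<epsilon>"
proof -
  define \<delta> where "\<delta> = \<epsilon> / 2"
  have \<delta>: "0 < \<delta>" using \<epsilon> by (simp add: \<delta>_def)
  define e where "e a x = exp (- (\<i> * complex_of_real a * complex_of_real x))" for a x :: real
  define f where "f a = (\<lambda>x\<in>S. (\<lfloor>Re (e a x) / \<delta>\<rfloor>, \<lfloor>Im (e a x) / \<delta>\<rfloor>))" for a
  let ?I = "{\<lfloor>- 1 / \<delta>\<rfloor>..\<lfloor>1 / \<delta>\<rfloor>}"
  have fl: "\<lfloor>t / \<delta>\<rfloor> \<in> ?I" if "\<bar>t\<bar> \<le> 1" for t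
  proof -
    have "- 1 / \<delta> \<le> t / \<delta>" "t / \<delta> \<le> 1 / \<delta>" using that \<delta> by (intro divide_right_mono; simp)+
    then show ?thesis by (simp only: atLeastAtMost_iff floor_mono)
  qed
  have ne: "norm (e a x) = 1" for a x by (simp add: e_def)
  have re: "\<bar>Re (e a x)\<bar> \<le> 1" "\<bar>Im (e a x)\<bar> \<le> 1" for a x
    using abs_Re_le_cmod[of "e a x"] abs_Im_le_cmod[of "e a x"] by (simp_all only: ne)
  have "f a \<in> PiE S (\<lambda>_. ?I \<times> ?I)" for a
    unfolding f_def by (intro restrict_PiE_iff[THEN iffD2] ballI SigmaI fl re)
  then have "range f \<subseteq> PiE S (\<lambda>_. ?I \<times> ?I)" by blast
  moreover have "finite (PiE S (\<lambda>_. ?I \<times> ?I))" using S by (intro finite_PiE) auto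
  ultimately have "finite (range f)" by (rule finite_subset)
  then obtain N where N: "finite N" "range f = f ` N"
    using finite_subset_image[of "range f" f UNIV] by auto
  have "\<exists>b\<in>N. \<forall>x\<in>S. norm (exp (- (\<i> * of_real (a - b) * of_real x)) - 1) \<le> \<epsilon>" for a
  proof -
    have "f a \<in> f ` N" using N by blast
    then obtain b where b: "b \<in> N" "f a = f b" by blast
    have "norm (exp (- (\<i> * of_real (a - b) * of_real x)) - 1) \<le> \<epsilon>" if x: "x \<in> S" for x
    proof -
      have fx: "\<lfloor>Re (e a x) / \<delta>\<rfloor> = \<lfloor>Re (e b x) / \<delta>\<rfloor>" "\<lfloor>Im (e a x) / \<delta>\<rfloor> = \<lfloor>Im (e b x) / \<delta>\<rfloor>"
        using fun_cong[OF b(2), of x] x by (auto simp: f_def)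
      have cl: "\<bar>u - v\<bar> \<le> \<delta>" if "\<lfloor>u / \<delta>\<rfloor> = \<lfloor>v / \<delta>\<rfloor>" for u v
      proof -
        have "\<bar>u / \<delta> - v / \<delta>\<bar> \<le> 1" using that by linarith
        then have "\<bar>u - v\<bar> / \<delta> \<le> 1" using \<delta> by (simp add: abs_divide flip: diff_divide_distrib)
        then show ?thesis using \<delta> by (simp add: pos_divide_le_eq)
      qed
      have "norm (e a x - e b x) \<le> \<bar>Re (e a x - e b x)\<bar> + \<bar>Im (e a x - e b x)\<bar>" by (rule cmod_le)
      also have "\<dots> \<le> \<delta> + \<delta>" using cl[OF fx(1)] cl[OF fx(2)] by simp
      finally have le: "norm (e a x - e b x) \<le> \<epsilon>" by (simp add: \<delta>_def)
      have "e a x - e b x = (exp (- (\<i> * of_real (a - b) * of_real x)) - 1) * e b x"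
        by (simp add: e_def algebra_simps flip: exp_add)
      then show ?thesis using le ne[of b x] by (simp add: norm_mult)
    qed
    then show ?thesis using b(1) by blast
  qed
  then show ?thesis using that N(1) by blast
qed

lemma vector_derivative_bound:
  fixes f :: "real \<Rightarrow> complex"
  assumes f: "\<And>t. (f has_vector_derivative f' t) (at t)" and B: "\<And>t. t \<in> closed_segment a b \<Longrightarrow> norm (f' t) \<le> B"
  shows "norm (f b - f a) \<le> B * \<bar>b - a\<bar>"
proof -
  have le: "norm (f v - f u) \<le> B * (v - u)" if uv: "u \<le> v" "{u..v} \<subseteq> closed_segment a b" for u v
  proof -
    have i: "(f' has_integral f v - f u) {u..v}"
      using uv by (intro fundamental_theorem_of_calculus) (auto intro: has_vector_derivative_at_within f)
    have "0 \<le> B" using B[of a] norm_ge_zero order_trans by (metis ends_in_segment(1))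
    moreover have "norm (f' x) \<le> B" if "x \<in> {u..v}" for x using B uv(2) that by blast
    ultimately have "norm (f v - f u) \<le> B * measure lborel {u..v}"
      using has_integral_bound_real[OF _ finite.emptyI i, of B] by blast
    then show ?thesis using uv(1) by simp
  qed
  show ?thesis
  proof (cases "a \<le> b")
    case True then show ?thesis using le[of a b] by (simp add: closed_segment_eq_real_ivl)
  next
    case False then show ?thesis using le[of b a] by (simp add: closed_segment_eq_real_ivl norm_minus_commute)
  qed
qed

text \<open>A logarithm of a trigonometric polynomial with zero mean winding is bounded, being almost
  invariant under a relatively dense set of translations. Its averages \<open>m\<close> over long intervals are
  therefore almost constant, while \<open>h - m\<close> is uniformly close to a trigonometric polynomial because
  \<open>h'\<close> is.\<close>

lemma log_approx_by_trig:
  assumes S: "finite S" and P: "P = (\<lambda>x. if x \<in> S then c x else 0)"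
    and Q: "wien {} UNIV Q r" and inv: "\<And>s. s \<in> imag_axis \<Longrightarrow> trig P s * Q s = 1"
    and m0: "mean_arg (\<lambda>y. trig P (\<i> * of_real y)) 0" and \<kappa>: "0 < \<kappa>" "\<kappa> < 1"
  obtains \<eta> d where "(\<lambda>x. norm (\<eta> x)) summable_on UNIV"
    "\<And>y. \<exists>z. norm z \<le> 3 * \<kappa> \<and> trig P (\<i> * of_real y) = exp (z + trig \<eta> (\<i> * of_real y) + d)"
proof -
  obtain h b where b: "(\<lambda>x. norm (b x)) summable_on UNIV" and h: "\<And>y. trig P (\<i> * of_real y) = exp (h y)"
    "\<And>y. (h has_vector_derivative trig b (\<i> * of_real y)) (at y)"
    by (rule finite_trig_log[OF S P Q inv], assumption) (rule that; blast)
  have ch: "continuous_on UNIV h"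
    using h(2) by (intro continuous_at_imp_continuous_on) (auto intro: has_vector_derivative_continuous)
  obtain \<epsilon> where \<epsilon>: "0 < \<epsilon>"
    "\<And>\<tau> y. (\<And>x. x \<in> S \<Longrightarrow> norm (exp (- (\<i> * of_real \<tau> * of_real x)) - 1) \<le> \<epsilon>) \<Longrightarrow> norm (h (y + \<tau>) - h y) \<le> \<kappa>"
    using almost_period_log[OF S P Q inv ch h(1) m0 \<kappa>] by metis
  obtain N where N: "finite N" "\<And>a. \<exists>b\<in>N. \<forall>x\<in>S. norm (exp (- (\<i> * of_real (a - b) * of_real x)) - 1) \<le> \<epsilon>"
    using almost_period_net[OF S \<epsilon>(1)] by metis
  have near: "\<exists>a\<in>N. \<forall>t. norm (h (t + (y - a)) - h t) \<le> \<kappa>" for y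
    using N(2)[of y] \<epsilon>(2) by blast
  define B where "B = (\<Sum>a\<in>N. norm (h a)) + 1"
  have hB: "norm (h y) \<le> B" for y
  proof -
    obtain a where a: "a \<in> N" "norm (h (a + (y - a)) - h a) \<le> \<kappa>" using near[of y] by blast
    have "norm (h a) \<le> (\<Sum>a\<in>N. norm (h a))" using a(1) N(1) by (intro member_le_sum) auto
    moreover have "norm (h y) \<le> norm (h a) + norm (h y - h a)" by (rule norm_triangle_sub)
    ultimately show ?thesis using a(2) \<kappa> by (simp add: B_def)
  qed
  obtain H where H: "\<And>y. (H has_vector_derivative h y) (at y)" using antiderivative_real_line[OF ch] by metis
  define A where "A = (\<Sum>a\<in>N. \<bar>a\<bar>)"
  have A: "0 \<le> A" unfolding A_def by (rule sum_nonneg) simp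
  have AN: "\<bar>a\<bar> \<le> A" if "a \<in> N" for a
    unfolding A_def by (rule member_le_sum[OF that _ N(1)]) simp
  have B0: "1 \<le> B" unfolding B_def by (simp add: sum_nonneg)
  \<comment> \<open>The window is so long that shifting it by at most \<open>A\<close>, a bound for
    the net, changes the average of \<open>h\<close> by at most
    \<open>2 * A * B / T \<le> \<kappa>\<close>; the summand \<open>1\<close> keeps it
    positive.\<close>
  define T where "T = 2 * A * B / \<kappa> + 1"
  have T: "0 < T" "2 * A * B \<le> \<kappa> * T"
  proof -
    have "0 \<le> 2 * A * B / \<kappa>" using A B0 \<kappa> by auto
    then show "0 < T" by (simp add: T_def)
    show "2 * A * B \<le> \<kappa> * T" using \<kappa> by (simp add: T_def field_simps)
  qed
  define m where "m y = (H (y + T) - H y) / of_real T" for y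
  have shift: "((\<lambda>t. f (t + a)) has_vector_derivative f' (t + a)) (at t)"
    if "\<And>y. (f has_vector_derivative f' y) (at y)" for f f' :: "real \<Rightarrow> complex" and a t :: real
    using vector_diff_chain_at[of "\<lambda>t. t + a" 1 t f "f' (t + a)"] that[of "t + a"]
    by (simp add: o_def has_vector_derivative_add[OF has_vector_derivative_id has_vector_derivative_const, simplified])
  have mc: "norm (m y - m 0) \<le> 2 * \<kappa>" for y
  proof -
    obtain a where a: "a \<in> N" "\<And>t. norm (h (t + (y - a)) - h t) \<le> \<kappa>" using near[of y] by blast
    have 1: "norm (m y - m a) \<le> \<kappa>"
    proof -
      let ?f = "\<lambda>t. H (t + (y - a)) - H t"
      have "norm (?f (a + T) - ?f a) \<le> \<kappa> * \<bar>(a + T) - a\<bar>"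
        by (rule vector_derivative_bound[of _ "\<lambda>t. h (t + (y - a)) - h t"])
          (intro has_vector_derivative_diff shift H a(2))+
      then have le: "norm (?f (a + T) - ?f a) \<le> \<kappa> * T" using T by simp
      have "m y - m a = (?f (a + T) - ?f a) / of_real T"
        unfolding m_def by (simp add: add_ac diff_divide_distrib)
      then have "norm (m y - m a) = norm (?f (a + T) - ?f a) / T" using T by (simp add: norm_divide)
      also have "\<dots> \<le> \<kappa>" using le T by (simp add: pos_divide_le_eq)
      finally show ?thesis .
    qed
    have 2: "norm (m a - m 0) \<le> \<kappa>"
    proof -
      have "norm (H (a + T) - H T) \<le> B * \<bar>(a + T) - T\<bar>" by (rule vector_derivative_bound[OF H]) (rule hB)
      moreover have "norm (H a - H 0) \<le> B * \<bar>a - 0\<bar>" by (rule vector_derivative_bound[OF H]) (rule hB)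
      moreover have "B * \<bar>a\<bar> \<le> B * A" using AN[OF a(1)] B0 by (intro mult_left_mono) auto
      moreover have "norm ((H (a + T) - H T) - (H a - H 0)) \<le> norm (H (a + T) - H T) + norm (H a - H 0)"
        by (rule norm_triangle_ineq4)
      ultimately have "norm ((H (a + T) - H T) - (H a - H 0)) \<le> 2 * A * B" by (simp add: mult_ac)
      then have le: "norm ((H (a + T) - H T) - (H a - H 0)) \<le> \<kappa> * T" using T(2) by linarith
      have "m a - m 0 = ((H (a + T) - H T) - (H a - H 0)) / of_real T"
        unfolding m_def by (simp add: diff_divide_distrib)
      then have "norm (m a - m 0) = norm ((H (a + T) - H T) - (H a - H 0)) / T" using T by (simp add: norm_divide)
      also have "\<dots> \<le> \<kappa>" using le T by (simp add: pos_divide_le_eq)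
      finally show ?thesis .
    qed
    show ?thesis using norm_triangle_ineq[of "m y - m a" "m a - m 0"] 1 2 by simp
  qed
  have "0 < \<kappa> / T" using \<kappa> T by simp
  then obtain S' where S': "finite S'" "(\<Sum>\<^sub>\<infinity>x. norm (b x - (if x \<in> S' then b x else 0))) \<le> \<kappa> / T"
    using infsum_finite_approx[OF b] by blast
  \<comment> \<open>First and second antiderivatives of the character of frequency \<open>x\<close>;
    the second serves to average the first. \<open>k x\<close> is the factor by which
    "antiderivative minus its average over \<open>{y..y + T}\<close>" acts on the character. At
    \<open>x = 0\<close> the linear growth cancels and leaves the constant
    \<open>- T / 2\<close>.\<close>
  define E where "E x y = (if x = 0 then of_real y else exp (- (\<i> * of_real y * of_real x)) / (- (\<i> * of_real x)))" for x y :: real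
  define EE where "EE x y = (if x = 0 then (of_real y)\<^sup>2 / 2 else exp (- (\<i> * of_real y * of_real x)) / (- (\<i> * of_real x))\<^sup>2)" for x y :: real
  define k where "k x = (if x = 0 then - of_real T / 2 else
      1 / (- (\<i> * of_real x)) * (1 - (exp (- (\<i> * of_real T * of_real x)) - 1) / (- (\<i> * of_real x) * of_real T)))" for x :: real
  have E': "(E x has_vector_derivative exp (- (\<i> * of_real y * of_real x))) (at y)" for x y
  proof (cases "x = 0")
    case True
    have "((\<lambda>z. z) has_field_derivative 1) (at (complex_of_real y))" by (rule DERIV_ident)
    then show ?thesis using True has_vector_derivative_real_field[of "\<lambda>z. z" 1 y UNIV] by (simp add: E_def[abs_def])
  next
    case False
    have "((\<lambda>z. exp (- (\<i> * z * of_real x)) / (- (\<i> * of_real x))) has_field_derivative exp (- (\<i> * of_real y * of_real x))) (at (of_real y))"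
      using False by (auto intro!: derivative_eq_intros)
    from has_vector_derivative_real_field[OF this] show ?thesis using False by (simp add: E_def[abs_def])
  qed
  have EE': "(EE x has_vector_derivative E x y) (at y)" for x y
  proof (cases "x = 0")
    case True
    have "((\<lambda>z. z\<^sup>2 / 2) has_field_derivative of_real y) (at (complex_of_real y))"
      by (auto intro!: derivative_eq_intros)
    from has_vector_derivative_real_field[OF this] show ?thesis using True by (simp add: E_def EE_def[abs_def])
  next
    case False
    have "((\<lambda>z. exp (- (\<i> * z * of_real x)) / (- (\<i> * of_real x))\<^sup>2) has_field_derivative exp (- (\<i> * of_real y * of_real x)) / (- (\<i> * of_real x))) (at (of_real y))"
      using False by (auto intro!: derivative_eq_intros simp: power2_eq_square)
    from has_vector_derivative_real_field[OF this] show ?thesis using False by (simp add: E_def EE_def[abs_def])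
  qed
  have kE: "E x y - (EE x (y + T) - EE x y) / of_real T = k x * exp (- (\<i> * of_real y * of_real x))" for x y
  proof (cases "x = 0")
    case True
    then show ?thesis using T by (simp add: E_def EE_def k_def field_simps power2_eq_square)
  next
    case False
    define D where "D = - (\<i> * complex_of_real x)"
    have D: "D \<noteq> 0" using False by (simp add: D_def)
    have T0: "complex_of_real T \<noteq> 0" using T by simp
    have sp: "exp (- (\<i> * of_real (y + T) * of_real x)) = exp (- (\<i> * of_real y * of_real x)) * exp (- (\<i> * of_real T * of_real x))"
      by (simp flip: exp_add add: algebra_simps)
    show ?thesis
      using False D T0 unfolding E_def EE_def k_def sp D_def[symmetric]
      by (simp add: field_simps power2_eq_square)
  qed
  \<comment> \<open>An antiderivative of the truncation of \<open>h'\<close>. It may grow linearly,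
    but after subtracting its moving average it is a trigonometric polynomial with coefficients
    \<open>b x * k x\<close>.\<close>
  define hF where "hF y = (\<Sum>x\<in>S'. b x * E x y)" for y
  define HF where "HF y = (\<Sum>x\<in>S'. b x * EE x y)" for y
  let ?\<beta> = "\<lambda>x. if x \<in> S' then b x else 0"
  let ?\<eta> = "\<lambda>x. if x \<in> S' then b x * k x else 0"
  have hF': "(hF has_vector_derivative trig ?\<beta> (\<i> * of_real y)) (at y)" for y
    unfolding hF_def trig_finite(1)[OF S'(1)]
    by (intro has_vector_derivative_sum has_vector_derivative_mult_right E')
  have HF': "(HF has_vector_derivative hF y) (at y)" for y
    unfolding hF_def HF_def by (intro has_vector_derivative_sum has_vector_derivative_mult_right EE')
  have \<eta>eq: "trig ?\<eta> (\<i> * of_real y) = hF y - (HF (y + T) - HF y) / of_real T" for y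
  proof -
    have "trig ?\<eta> (\<i> * of_real y) = (\<Sum>x\<in>S'. b x * (E x y - (EE x (y + T) - EE x y) / of_real T))"
      unfolding trig_finite(1)[OF S'(1)] kE by (simp add: mult.assoc)
    also have "\<dots> = hF y - (HF (y + T) - HF y) / of_real T"
      unfolding hF_def HF_def sum_subtractf[symmetric] sum_divide_distrib
      by (rule sum.cong) (auto simp: right_diff_distrib)
    finally show ?thesis .
  qed
  define \<rho> where "\<rho> y = h y - hF y" for y
  define R where "R y = H y - HF y" for y
  have \<rho>': "(\<rho> has_vector_derivative (trig b (\<i> * of_real y) - trig ?\<beta> (\<i> * of_real y))) (at y)" for y
    unfolding \<rho>_def by (intro has_vector_derivative_diff h hF')
  have R': "(R has_vector_derivative \<rho> y) (at y)" for y
    unfolding \<rho>_def R_def by (intro has_vector_derivative_diff H HF')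
  have db: "norm (trig b (\<i> * of_real y) - trig ?\<beta> (\<i> * of_real y)) \<le> \<kappa> / T" for y
    by (rule order_trans[OF norm_trig_diff_le[OF b trig_finite(2)[OF S'(1)] imag_axis_i] S'(2)])
  \<comment> \<open>The derivative of \<open>\<rho>\<close> is at most \<open>\<kappa> / T\<close>,
    so on a window of length \<open>T\<close> it stays within \<open>\<kappa>\<close> of its value
    at the left end, hence so does its average.\<close>
  have small: "norm (\<rho> y - (R (y + T) - R y) / of_real T) \<le> \<kappa>" for y
  proof -
    have "norm (\<rho> t - \<rho> y) \<le> \<kappa>" if "t \<in> closed_segment y (y + T)" for t
    proof -
      have "norm (\<rho> t - \<rho> y) \<le> \<kappa> / T * \<bar>t - y\<bar>" by (rule vector_derivative_bound[OF \<rho>']) (rule db)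
      also have "\<dots> \<le> \<kappa> / T * T" using that T \<kappa> by (intro mult_left_mono) (auto simp: closed_segment_eq_real_ivl)
      finally show ?thesis using T by simp
    qed
    then have "norm ((R (y + T) - of_real (y + T) * \<rho> y) - (R y - of_real y * \<rho> y)) \<le> \<kappa> * \<bar>(y + T) - y\<bar>"
    proof (intro vector_derivative_bound[of "\<lambda>t. R t - of_real t * \<rho> y" "\<lambda>t. \<rho> t - \<rho> y"])
      show "((\<lambda>t. R t - of_real t * \<rho> y) has_vector_derivative \<rho> t - \<rho> y) (at t)" for t
      proof -
        have "((\<lambda>t. complex_of_real t * \<rho> y) has_vector_derivative \<rho> y) (at t)"
          by (rule has_vector_derivative_real_field[of "\<lambda>z. z * \<rho> y"]) (auto intro!: derivative_eq_intros)
        then show ?thesis by (intro has_vector_derivative_diff R')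
      qed
    qed
    then have le: "norm ((R (y + T) - R y) - of_real T * \<rho> y) \<le> \<kappa> * T" using T by (simp add: algebra_simps)
    have "\<rho> y - (R (y + T) - R y) / of_real T = - (((R (y + T) - R y) - of_real T * \<rho> y) / of_real T)"
      using T by (simp add: diff_divide_distrib)
    then have "norm (\<rho> y - (R (y + T) - R y) / of_real T) = norm ((R (y + T) - R y) - of_real T * \<rho> y) / T"
      using T by (simp add: norm_divide)
    also have "\<dots> \<le> \<kappa>" using le T by (simp add: pos_divide_le_eq)
    finally show ?thesis .
  qed
  show ?thesis
  proof (rule that)
    show "(\<lambda>x. norm (?\<eta> x)) summable_on UNIV" by (rule trig_finite(2)[OF S'(1)])
    fix y
    have "h y - m y - trig ?\<eta> (\<i> * of_real y) = \<rho> y - (R (y + T) - R y) / of_real T"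
      unfolding \<eta>eq m_def \<rho>_def R_def by (simp add: diff_divide_distrib)
    then have 1: "norm (h y - m y - trig ?\<eta> (\<i> * of_real y)) \<le> \<kappa>" using small by simp
    \<comment> \<open>The error consists of \<open>\<kappa>\<close> for replacing
      \<open>h - m\<close> by the polynomial and \<open>2 * \<kappa>\<close> for replacing
      \<open>m y\<close> by the constant \<open>m 0\<close>.\<close>
    let ?z = "h y - trig ?\<eta> (\<i> * of_real y) - m 0"
    have zeq: "?z = (h y - m y - trig ?\<eta> (\<i> * of_real y)) + (m y - m 0)" by simp
    have "norm ?z \<le> \<kappa> + 2 * \<kappa>" unfolding zeq by (rule norm_triangle_mono[OF 1 mc])
    then show "\<exists>z. norm z \<le> 3 * \<kappa> \<and> trig P (\<i> * of_real y) = exp (z + trig ?\<eta> (\<i> * of_real y) + m 0)"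
      using h(1)[of y] by (intro exI[of _ ?z]) simp
  qed
qed

lemma imag_axisE: "s \<in> imag_axis \<Longrightarrow> \<exists>y. s = \<i> * of_real y"
  by (intro exI[of _ "Im s"]) (auto simp: imag_axis_def complex_eq_iff)

text \<open>The logarithm from \<open>log_approx_by_trig\<close> has an error that is small only
  uniformly. Dividing by its exponential leaves \<open>1 + F\<close> with \<open>F\<close> uniformly
  at most \<open>1/2\<close>, and \<open>wien_log_one_plus\<close> makes this an exact exponential
  within the algebra.\<close>

lemma finite_trig_exp:
  assumes S: "finite S" and P: "P = (\<lambda>x. if x \<in> S then c x else 0)"
    and Q: "wien {} UNIV Q r" and inv: "\<And>s. s \<in> imag_axis \<Longrightarrow> trig P s * Q s = 1"
    and m0: "mean_arg (\<lambda>y. trig P (\<i> * of_real y)) 0"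
  obtains \<eta> where "(\<lambda>x. norm (\<eta> x)) summable_on UNIV" "\<And>s. s \<in> imag_axis \<Longrightarrow> trig P s = exp (trig \<eta> s)"
proof -
  have "isCont exp (0::complex)" by simp
  then obtain d where d: "0 < d" "\<And>z::complex. norm z < d \<Longrightarrow> norm (exp z - 1) < 1/2"
    unfolding continuous_at_eps_delta dist_norm
    by (metis diff_zero exp_zero half_gt_zero_iff zero_less_one)
  define \<kappa> where "\<kappa> = min (1/2) (d / 4)"
  have \<kappa>: "0 < \<kappa>" "\<kappa> < 1" "3 * \<kappa> < d" using d(1) by (auto simp: \<kappa>_def)
  obtain \<eta> a where \<eta>: "(\<lambda>x. norm (\<eta> x)) summable_on UNIV"
    "\<And>y. \<exists>z. norm z \<le> 3 * \<kappa> \<and> trig P (\<i> * of_real y) = exp (z + trig \<eta> (\<i> * of_real y) + a)"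
    by (rule log_approx_by_trig[OF S P Q inv m0 \<kappa>(1,2)], assumption) (rule that; blast)
  have sP: "(\<lambda>x. norm (P x)) summable_on UNIV" unfolding P by (rule trig_finite(2)[OF S])
  let ?n = "\<Sum>\<^sub>\<infinity>x. norm (\<eta> x)"
  have w\<eta>: "wien {} UNIV (\<lambda>s. trig \<eta> s + a) (?n + norm a)"
    by (intro wien_add wien_trig \<eta> wien_const) auto
  let ?F = "\<lambda>s. trig P s * exp ((-1) * (trig \<eta> s + a)) - 1"
  have wE: "wien {} UNIV (\<lambda>s. exp ((-1) * (trig \<eta> s + a))) (exp (norm (-1::complex) * (?n + norm a)))"
    by (rule wien_exp_comp[OF wien_cmult[OF w\<eta>]]) simp
  have "\<exists>R. wien {} UNIV ?F R"
    by (rule exI, rule wien_diff[OF wien_mult[OF wien_trig[OF sP] wE] wien_const]) auto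
  then obtain R where R: "wien {} UNIV ?F R" by blast
  have le: "norm (?F s) \<le> 1/2" if s: "s \<in> imag_axis" for s
  proof -
    obtain y where y: "s = \<i> * of_real y" using imag_axisE[OF s] by blast
    obtain z where z: "norm z \<le> 3 * \<kappa>" "trig P s = exp (z + trig \<eta> s + a)" using \<eta>(2)[of y] y by blast
    have "?F s = exp z - 1" unfolding z(2) by (simp flip: exp_add)
    then show ?thesis using d(2)[of z] z(1) \<kappa>(3) by simp
  qed
  obtain l where l: "(\<lambda>x. norm (l x)) summable_on UNIV" "\<And>s. s \<in> imag_axis \<Longrightarrow> 1 + ?F s = exp (trig l s)"
    by (rule wien_log_one_plus[OF R le], assumption, simp) (rule that; blast)
  have sum: "wien {} UNIV (\<lambda>s. trig l s + (trig \<eta> s + a)) ((\<Sum>\<^sub>\<infinity>x. norm (l x)) + (?n + norm a))"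
    by (intro wien_add w\<eta> wien_trig l) auto
  obtain e where e: "(\<lambda>x. norm (e x)) summable_on UNIV" "\<And>s. s \<in> imag_axis \<Longrightarrow> trig l s + (trig \<eta> s + a) = trig e s"
    by (rule wien_ap_trig[OF sum, unfolded kernel_dom_UNIV]) (rule that; blast)
  have "trig P s = exp (trig e s)" if s: "s \<in> imag_axis" for s
  proof -
    have "trig P s * exp ((-1) * (trig \<eta> s + a)) = exp (trig l s)" using l(2)[OF s] by simp
    then have "trig P s * exp ((-1) * (trig \<eta> s + a)) * exp (trig \<eta> s + a) = exp (trig l s) * exp (trig \<eta> s + a)" by simp
    then have "trig P s * (exp ((-1) * (trig \<eta> s + a)) * exp (trig \<eta> s + a)) = exp (trig e s)"
      using e(2)[OF s] by (simp only: mult.assoc exp_add[symmetric])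
    then show ?thesis by (simp flip: exp_add)
  qed
  then show ?thesis using that e(1) by blast
qed

lemma trig_split_halves:
  assumes "(\<lambda>x. norm (\<eta> x)) summable_on UNIV"
  obtains p q where "(\<lambda>x. norm (p x)) summable_on UNIV" "\<And>x. x \<notin> {0..} \<Longrightarrow> p x = 0"
    "(\<lambda>x. norm (q x)) summable_on UNIV" "\<And>x. x \<notin> {..0} \<Longrightarrow> q x = 0"
    "\<And>s. s \<in> imag_axis \<Longrightarrow> trig \<eta> s = trig p s + trig q s"
proof
  let ?p = "\<lambda>x. if 0 \<le> x then \<eta> x else 0" and ?q = "\<lambda>x. if 0 \<le> x then 0 else \<eta> x"
  show p: "(\<lambda>x. norm (?p x)) summable_on UNIV"
    by (rule Infinite_Sum.summable_on_comparison_test[OF assms]) auto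
  show q: "(\<lambda>x. norm (?q x)) summable_on UNIV"
    by (rule Infinite_Sum.summable_on_comparison_test[OF assms]) auto
  show "trig \<eta> s = trig ?p s + trig ?q s" if "s \<in> imag_axis" for s
  proof -
    have "\<eta> = (\<lambda>x. ?p x + ?q x)" by auto
    then have "trig \<eta> s = trig (\<lambda>x. ?p x + ?q x) s" by simp
    also have "\<dots> = trig ?p s + trig ?q s"
      by (rule trig_add[OF p q]) (use that in \<open>auto simp: imag_axis_def\<close>)
    finally show ?thesis .
  qed
qed auto

lemma finite_trig_inverse_nonneg:
  assumes S: "finite S" and P: "P = (\<lambda>x. if x \<in> S then c x else 0)" and S0: "S \<subseteq> {0..}"
    and Q: "wien {} UNIV Q r" and inv: "\<And>s. s \<in> imag_axis \<Longrightarrow> trig P s * Q s = 1"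
    and m0: "mean_arg (\<lambda>y. trig P (\<i> * of_real y)) 0"
  obtains E R where "wien {} {0..} E R" "\<And>s. s \<in> imag_axis \<Longrightarrow> trig P s * E s = 1"
proof -
  obtain \<eta> where \<eta>: "(\<lambda>x. norm (\<eta> x)) summable_on UNIV" "\<And>s. s \<in> imag_axis \<Longrightarrow> trig P s = exp (trig \<eta> s)"
    by (rule finite_trig_exp[OF S P Q inv m0], assumption) (rule that; blast)
  obtain p q where pq: "(\<lambda>x. norm (p x)) summable_on UNIV" "\<And>x. x \<notin> {0..} \<Longrightarrow> p x = 0"
    "(\<lambda>x. norm (q x)) summable_on UNIV" "\<And>x. x \<notin> {..0} \<Longrightarrow> q x = 0"
    "\<And>s. s \<in> imag_axis \<Longrightarrow> trig \<eta> s = trig p s + trig q s"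
    using trig_split_halves[OF \<eta>(1)] by metis
  have sP: "(\<lambda>x. norm (P x)) summable_on UNIV" unfolding P by (rule trig_finite(2)[OF S])
  let ?E = "\<lambda>s. exp ((-1) * trig p s)"
  have E: "wien {} {0..} ?E (exp (norm (-1::complex) * (\<Sum>\<^sub>\<infinity>x. norm (p x))))"
    by (intro wien_exp_comp wien_cmult wien_trig pq(1,2)) auto
  have PE: "wien {} {0..} (\<lambda>s. trig P s * ?E s) ((\<Sum>\<^sub>\<infinity>x. norm (P x)) * exp (norm (-1::complex) * (\<Sum>\<^sub>\<infinity>x. norm (p x))))"
    by (rule wien_mult[OF wien_trig[OF sP] E]) (use S0 in \<open>auto simp: P\<close>)
  have G: "wien {} {..0} (\<lambda>s. exp (trig q s)) (exp (\<Sum>\<^sub>\<infinity>x. norm (q x)))"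
    by (intro wien_exp_comp wien_trig pq(3,4)) auto
  have eq: "trig P s * ?E s = exp (trig q s)" if s: "s \<in> imag_axis" for s
    using \<eta>(2)[OF s] pq(5)[OF s] by (simp flip: exp_add)
  obtain u where u: "(\<lambda>x. norm (u x)) summable_on UNIV" "\<And>x. x \<notin> {0..} \<Longrightarrow> u x = 0"
    "\<And>s. s \<in> kernel_dom {0..} \<Longrightarrow> trig P s * ?E s = trig u s"
    by (rule wien_ap_trig[OF PE]) (rule that; blast)
  obtain v where v: "(\<lambda>x. norm (v x)) summable_on UNIV" "\<And>x. x \<notin> {..0} \<Longrightarrow> v x = 0"
    "\<And>s. s \<in> kernel_dom {..0} \<Longrightarrow> exp (trig q s) = trig v s"
    by (rule wien_ap_trig[OF G]) (rule that; blast)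
  have uv: "u = v"
  proof (rule wev_unique(1)[of UNIV UNIV "\<lambda>x. 0" u UNIV UNIV "\<lambda>x. 0" v])
    fix y :: real
    have s: "\<i> * complex_of_real y \<in> imag_axis" by simp
    show "wev (\<lambda>x. 0) u (\<i> * of_real y) = wev (\<lambda>x. 0) v (\<i> * of_real y)"
      using u(3)[OF imag_axis_kernel_dom[OF s]] v(3)[OF imag_axis_kernel_dom[OF s]] eq[OF s] by (simp add: wev_def)
  qed (use u v in \<open>auto simp: wpair_def\<close>)
  have z: "u x = 0" if "x \<noteq> 0" for x using u(2)[of x] v(2)[of x] uv that by (cases "0 \<le> x") auto
  have const: "trig u s = u 0" for s
    unfolding trig_def by (subst infsum_single[of 0]) (auto simp: z)
  have PEu: "trig P s * ?E s = u 0" if s: "s \<in> imag_axis" for s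
    using u(3)[OF imag_axis_kernel_dom[OF s]] const by simp
  have "u 0 \<noteq> 0" using PEu[of 0] eq[of 0] by (simp add: imag_axis_def)
  then show ?thesis
    using that[OF wien_cmult[OF E, of "1 / u 0"]] PEu by (simp add: mult.left_commute)
qed

section \<open>Invertibility with vanishing index\<close>

text \<open>The building block for causal inverses of linear factors. Integrability forces
  \<open>Re z < 0\<close>, which is why the zeros will have to be located in the open left
  half-plane.\<close>

lemma exponential_transform:
  assumes z: "Re z < 0"
  defines "f \<equiv> \<lambda>t. if 0 < t then exp (z * complex_of_real t) else 0"
  shows "integrable lborel f" "0 \<le> Re s \<Longrightarrow> fourier f s = 1 / (s - z)"
proof -
  have real_int: "integrable lborel (\<lambda>t::real. indicator {0..} t * exp (- a * t))" if a: "0 < a" for a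
  proof (rule integrableI_bounded)
    have "(\<integral>\<^sup>+t. ennreal (exp (- a * t)) * indicator {0..} t \<partial>lborel) = ennreal (0 - (- (exp (- a * 0) / a)))"
    proof (rule nn_integral_FTC_atLeast)
      show "DERIV (\<lambda>t. - (exp (- a * t) / a)) x :> exp (- a * x)" for x
        using a by (auto intro!: derivative_eq_intros)
      show "((\<lambda>t. - (exp (- a * t) / a)) \<longlongrightarrow> 0) at_top" using a by real_asymp
    qed auto
    moreover have "(\<integral>\<^sup>+t. ennreal (norm (indicator {0..} t * exp (- a * t))) \<partial>lborel) = (\<integral>\<^sup>+t. ennreal (exp (- a * t)) * indicator {0..} t \<partial>lborel)"
      by (intro nn_integral_cong) (auto split: split_indicator)
    ultimately show "(\<integral>\<^sup>+t. ennreal (norm (indicator {0..} t * exp (- a * t))) \<partial>lborel) < \<infinity>" by simp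
  qed simp
  have m: "(\<lambda>t. if 0 < t then exp (w * complex_of_real t) else 0) \<in> borel_measurable lborel" for w
    by (intro measurable_If) (auto intro!: borel_measurable_continuous_onI continuous_intros)
  have int: "integrable lborel (\<lambda>t. if 0 < t then exp (w * complex_of_real t) else 0)" if "Re w < 0" for w
    by (rule Bochner_Integration.integrable_bound[OF real_int[of "- Re w"] m]) (use that in \<open>auto split: split_indicator\<close>)
  show "integrable lborel f" unfolding f_def by (rule int[OF z])
  assume s: "0 \<le> Re s"
  define w where "w = z - s"
  have w: "Re w < 0" "w \<noteq> 0" using z s by (auto simp: w_def)
  let ?g = "\<lambda>t. if 0 < t then exp (w * complex_of_real t) else 0"
  have eq: "fourier f s = (LINT t|lborel. ?g t)"
    unfolding fourier_def f_def by (intro Bochner_Integration.integral_cong) (auto simp: w_def algebra_simps exp_diff exp_minus divide_inverse)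
  have lim1: "(\<lambda>n. LINT t|lborel. indicator {0..real n} t *\<^sub>R exp (w * complex_of_real t)) \<longlonglongrightarrow> (LINT t|lborel. ?g t)"
  proof (rule integral_dominated_convergence[where w="\<lambda>t. indicator {0..} t * exp (- (- Re w) * t)"])
    have "AE t in lborel. t \<noteq> (0::real)" by (rule AE_lborel_singleton)
    then show "AE t in lborel. (\<lambda>n. indicator {0..real n} t *\<^sub>R exp (w * complex_of_real t)) \<longlonglongrightarrow> ?g t"
    proof eventually_elim
      case (elim t)
      obtain N :: nat where N: "t \<le> real N" using real_arch_simple by blast
      show ?case
        by (rule tendsto_eventually, unfold eventually_sequentially)
          (use elim N in \<open>auto intro!: exI[of _ N] split: split_indicator\<close>)
    qed
    show "integrable lborel (\<lambda>t. indicator {0..} t * exp (- (- Re w) * t))" by (rule real_int) (use w in simp)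
    show "AE t in lborel. norm (indicator {0..real n} t *\<^sub>R exp (w * complex_of_real t)) \<le> indicator {0..} t * exp (- (- Re w) * t)" for n
      by (intro AE_I2) (auto split: split_indicator)
    show "(\<lambda>t. indicator {0..real n} t *\<^sub>R exp (w * complex_of_real t)) \<in> borel_measurable lborel" for n
      by (intro borel_measurable_scaleR) (auto intro!: borel_measurable_continuous_onI continuous_intros)
  qed (rule m)
  have val: "(LINT t|lborel. indicator {0..real n} t *\<^sub>R exp (w * complex_of_real t)) = exp (w * of_real (real n)) / w - exp (w * of_real 0) / w" for n
  proof (rule integral_FTC_Icc)
    fix x
    have "((\<lambda>z. exp (w * z) / w) has_field_derivative exp (w * of_real x)) (at (of_real x))"
      using w by (auto intro!: derivative_eq_intros)
    then show "((\<lambda>x. exp (w * complex_of_real x) / w) has_vector_derivative exp (w * complex_of_real x)) (at x within {0..real n})"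
      by (rule has_vector_derivative_real_field)
  qed (auto intro!: continuous_intros)
  have lim2: "(\<lambda>n. exp (w * of_real (real n)) / w - exp (w * of_real 0) / w) \<longlonglongrightarrow> 0 / w - exp (w * of_real 0) / w"
  proof (intro tendsto_diff tendsto_divide tendsto_const)
    have "(\<lambda>n. exp (Re w * real n)) \<longlonglongrightarrow> 0" using w(1) by real_asymp
    then show "(\<lambda>n. exp (w * of_real (real n))) \<longlonglongrightarrow> 0"
      by (subst tendsto_norm_zero_iff[symmetric]) simp
  qed (use w in auto)
  have "(LINT t|lborel. ?g t) = 0 / w - exp (w * of_real 0) / w"
    by (rule LIMSEQ_unique[OF lim1]) (unfold val, rule lim2)
  also have "\<dots> = 1 / (s - z)" unfolding w_def by (simp add: minus_divide_right)
  finally show "fourier f s = 1 / (s - z)" using eq by simp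
qed

section \<open>Approximation of causal functions by exponential polynomials\<close>

text \<open>A combination of the decaying exponentials with rates \<open>1, 2, ...\<close>. The
  substitution \<open>u = exp (- t)\<close> turns it into a polynomial on the unit interval, so that
  Weierstrass approximation applies, while its transform is rational.\<close>

definition exp_poly :: "complex poly \<Rightarrow> real \<Rightarrow> complex" where
  "exp_poly p t = (if 0 < t then of_real (exp (- t)) * poly p (of_real (exp (- t))) else 0)"

lemma exp_poly_transform:
  shows "integrable lborel (exp_poly p)"
    and "0 \<le> Re s \<Longrightarrow> fourier (exp_poly p) s = (\<Sum>k\<le>Polynomial.degree p. poly.coeff p k / (s + of_nat (k + 1)))"
proof -
  let ?e = "\<lambda>k t. if 0 < t then exp (- of_nat (k + 1) * complex_of_real t) else 0"
  have R: "Re (- of_nat (k + 1)) < 0" for k by simp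
  note T = exponential_transform[OF R]
  have eq: "exp_poly p t = (\<Sum>k\<le>Polynomial.degree p. poly.coeff p k * ?e k t)" for t
  proof (cases "0 < t")
    case True
    have "of_real (exp (- t)) * complex_of_real (exp (- t)) ^ k = exp (- of_nat (k + 1) * complex_of_real t)" for k
      by (simp add: exp_of_real[symmetric] exp_of_nat_mult[symmetric] exp_add[symmetric] algebra_simps)
    then show ?thesis using True unfolding exp_poly_def poly_altdef
      by (simp add: sum_distrib_left mult.left_commute del: of_nat_Suc of_nat_add)
  qed (simp add: exp_poly_def)
  have i: "integrable lborel (\<lambda>t. poly.coeff p k * ?e k t)" for k using T(1) by (intro integrable_mult_right)
  show "integrable lborel (exp_poly p)"
    unfolding eq[abs_def] by (intro Bochner_Integration.integrable_sum i)
  assume s: "0 \<le> Re s"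
  have ki: "integrable lborel (\<lambda>t. exp (- (s * of_real t)) * (poly.coeff p k * ?e k t))" for k
    by (rule kernel_integrable(1)[OF i, where \<tau>="\<lambda>x. x" and s=s]) (use s in \<open>auto split: if_splits\<close>)
  have "fourier (exp_poly p) s = (LINT t|lborel. (\<Sum>k\<le>Polynomial.degree p. exp (- (s * of_real t)) * (poly.coeff p k * ?e k t)))"
    unfolding fourier_def eq sum_distrib_left ..
  also have "\<dots> = (\<Sum>k\<le>Polynomial.degree p. fourier (\<lambda>t. poly.coeff p k * ?e k t) s)"
    unfolding fourier_def by (rule Bochner_Integration.integral_sum) (rule ki)
  also have "\<dots> = (\<Sum>k\<le>Polynomial.degree p. poly.coeff p k / (s + of_nat (k + 1)))"
    unfolding fourier_cmult T(2)[OF s] by (simp add: algebra_simps)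
  finally show "fourier (exp_poly p) s = (\<Sum>k\<le>Polynomial.degree p. poly.coeff p k / (s + of_nat (k + 1)))" .
qed

text \<open>The induction over L^1 runs through functions on the whole line; cutting to positive
  times inside the predicate makes it usable for the half-line.\<close>

definition causal_part :: "(real \<Rightarrow> complex) \<Rightarrow> real \<Rightarrow> complex" where
  "causal_part f t = (if 0 < t then f t else 0)"

lemma causal_part_integrable: "integrable lborel f \<Longrightarrow> integrable lborel (causal_part f)"
proof -
  assume f: "integrable lborel f"
  have "causal_part f = (\<lambda>t. indicator {0<..} t *\<^sub>R f t)" by (auto simp: causal_part_def fun_eq_iff)
  then show ?thesis using integrable_mult_indicator[of "{0<..}" lborel f] f by simp
qed

lemma integral_norm_add_le:
  fixes f g :: "real \<Rightarrow> complex"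
  assumes "integrable lborel f" "integrable lborel g"
  shows "(LINT x|lborel. norm (f x + g x)) \<le> (LINT x|lborel. norm (f x)) + (LINT x|lborel. norm (g x))"
proof -
  have "(LINT x|lborel. norm (f x + g x)) \<le> (LINT x|lborel. norm (f x) + norm (g x))"
    using assms by (intro integral_mono) (auto intro: norm_triangle_ineq)
  then show ?thesis using assms by simp
qed

definition exp_approximable :: "(real \<Rightarrow> complex) \<Rightarrow> bool" where
  "exp_approximable f \<longleftrightarrow> (\<forall>e>0. \<exists>p. (LINT t|lborel. norm (causal_part f t - exp_poly p t)) \<le> e)"

lemma exp_approximable_lim:
  assumes s: "\<And>n. integrable lborel (s n)" "\<And>n. exp_approximable (s n)" and f: "integrable lborel f"
    and lim: "(\<lambda>n. LINT x|lborel. norm (causal_part (s n) x - causal_part f x)) \<longlonglongrightarrow> 0"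
  shows "exp_approximable f"
  unfolding exp_approximable_def
proof (intro allI impI)
  fix e :: real assume "e > 0"
  then obtain n where n: "(LINT x|lborel. norm (causal_part (s n) x - causal_part f x)) < e / 2"
    using order_tendstoD(2)[OF lim, of "e/2"] by (auto simp: eventually_sequentially)
  obtain p where p: "(LINT t|lborel. norm (causal_part (s n) t - exp_poly p t)) \<le> e / 2"
    using s(2)[of n] \<open>e > 0\<close> unfolding exp_approximable_def by (meson half_gt_zero)
  have "(LINT t|lborel. norm (causal_part f t - exp_poly p t))
      = (LINT t|lborel. norm ((causal_part f t - causal_part (s n) t) + (causal_part (s n) t - exp_poly p t)))" by simp
  also have "\<dots> \<le> (LINT t|lborel. norm (causal_part f t - causal_part (s n) t)) + (LINT t|lborel. norm (causal_part (s n) t - exp_poly p t))"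
    by (intro integral_norm_add_le Bochner_Integration.integrable_diff causal_part_integrable f s exp_poly_transform)
  also have "(LINT t|lborel. norm (causal_part f t - causal_part (s n) t)) = (LINT t|lborel. norm (causal_part (s n) t - causal_part f t))"
    by (simp add: norm_minus_commute)
  finally show "\<exists>p. (LINT t|lborel. norm (causal_part f t - exp_poly p t)) \<le> e" using n p by (intro exI[of _ p]) linarith
qed

text \<open>The weight \<open>exp (- t)\<close> on positive times has total mass \<open>1\<close>,
  so a polynomial uniformly within \<open>e\<close> of \<open>G\<close> yields an L^1 error of at
  most \<open>e\<close>.\<close>

lemma exp_approximable_continuous:
  fixes G :: "real \<Rightarrow> real"
  assumes G: "continuous_on {0..1} G" and f: "integrable lborel f"
    and eq: "\<And>t. 0 < t \<Longrightarrow> f t = of_real (exp (- t) * G (exp (- t)))"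
  shows "exp_approximable f"
  unfolding exp_approximable_def
proof (intro allI impI)
  fix e :: real assume "e > 0"
  obtain q where q: "real_polynomial_function q" "\<And>u. u \<in> {0..1} \<Longrightarrow> \<bar>G u - q u\<bar> < e"
    using Stone_Weierstrass_real_polynomial_function[OF compact_Icc G \<open>e > 0\<close>] by blast
  obtain a n where a: "q = (\<lambda>x. \<Sum>i\<le>n. a i * x ^ i)" using q(1) unfolding real_polynomial_function_iff_sum by blast
  define p where "p = (\<Sum>i\<le>n. Polynomial.monom (complex_of_real (a i)) i)"
  have p: "poly p (of_real u) = of_real (q u)" for u
    unfolding p_def a by (simp add: poly_sum poly_monom)
  have E: "integrable lborel (exp_poly 1)" by (rule exp_poly_transform)
  have E1: "(LINT t|lborel. norm (exp_poly 1 t)) = 1"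
  proof -
    have "complex_of_real (norm (exp_poly 1 t)) = exp (- (0 * complex_of_real t)) * exp_poly 1 t" for t
      by (simp add: exp_poly_def)
    then have "complex_of_real (LINT t|lborel. norm (exp_poly 1 t)) = fourier (exp_poly 1) 0"
      unfolding fourier_def integral_complex_of_real[symmetric] by simp
    also have "\<dots> = 1" by (subst exp_poly_transform(2)) auto
    finally show ?thesis by simp
  qed
  have "(LINT t|lborel. norm (causal_part f t - exp_poly p t)) \<le> (LINT t|lborel. e * norm (exp_poly 1 t))"
  proof (rule integral_mono)
    show "integrable lborel (\<lambda>t. norm (causal_part f t - exp_poly p t))"
      by (intro integrable_norm Bochner_Integration.integrable_diff causal_part_integrable f exp_poly_transform)
    show "integrable lborel (\<lambda>t. e * norm (exp_poly 1 t))" using E by simp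
    fix t :: real
    show "norm (causal_part f t - exp_poly p t) \<le> e * norm (exp_poly 1 t)"
    proof (cases "0 < t")
      case True
      then have "exp (- t) \<in> {0..1}" by simp
      from q(2)[OF this] have le: "\<bar>G (exp (- t)) - q (exp (- t))\<bar> \<le> e" by simp
      have "causal_part f t - exp_poly p t = of_real (exp (- t) * (G (exp (- t)) - q (exp (- t))))"
        using True by (simp only: causal_part_def exp_poly_def eq p if_True) (simp add: algebra_simps)
      then have "norm (causal_part f t - exp_poly p t) = exp (- t) * \<bar>G (exp (- t)) - q (exp (- t))\<bar>"
        by (simp only: norm_of_real abs_mult abs_exp_cancel)
      also have "\<dots> \<le> exp (- t) * e" by (intro mult_left_mono le) simp
      finally show ?thesis using True by (simp add: exp_poly_def mult.commute)
    qed (simp add: causal_part_def exp_poly_def)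
  qed
  also have "\<dots> = e" using E1 by simp
  finally show "\<exists>p. (LINT t|lborel. norm (causal_part f t - exp_poly p t)) \<le> e" by blast
qed

lemma exp_approximable_all: "integrable lborel f \<Longrightarrow> exp_approximable f"
proof (induction rule: L1_induct_intervals)
  case (add f g)
  show ?case unfolding exp_approximable_def
  proof (intro allI impI)
    fix e :: real assume "e > 0"
    then obtain p q where pq: "(LINT t|lborel. norm (causal_part f t - exp_poly p t)) \<le> e / 2" "(LINT t|lborel. norm (causal_part g t - exp_poly q t)) \<le> e / 2"
      using add(3,4) unfolding exp_approximable_def by (meson half_gt_zero)
    have "(LINT t|lborel. norm (causal_part (\<lambda>x. f x + g x) t - exp_poly (p + q) t))
        = (LINT t|lborel. norm ((causal_part f t - exp_poly p t) + (causal_part g t - exp_poly q t)))"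
      by (intro Bochner_Integration.integral_cong arg_cong[where f=norm]) (auto simp: causal_part_def exp_poly_def algebra_simps)
    also have "\<dots> \<le> (LINT t|lborel. norm (causal_part f t - exp_poly p t)) + (LINT t|lborel. norm (causal_part g t - exp_poly q t))"
      by (intro integral_norm_add_le Bochner_Integration.integrable_diff causal_part_integrable add exp_poly_transform)
    finally show "\<exists>p. (LINT t|lborel. norm (causal_part (\<lambda>x. f x + g x) t - exp_poly p t)) \<le> e"
      using pq by (intro exI[of _ "p + q"]) linarith
  qed
next
  case (cmult f c)
  show ?case unfolding exp_approximable_def
  proof (intro allI impI)
    fix e :: real assume "e > 0"
    then have "0 < e / (norm c + 1)" by (simp add: add_nonneg_pos)
    then obtain p where p: "(LINT t|lborel. norm (causal_part f t - exp_poly p t)) \<le> e / (norm c + 1)"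
      using cmult(2) unfolding exp_approximable_def by blast
    have "(LINT t|lborel. norm (causal_part (\<lambda>x. c * f x) t - exp_poly (Polynomial.smult c p) t))
        = (LINT t|lborel. norm c * norm (causal_part f t - exp_poly p t))"
      unfolding norm_mult[symmetric]
      by (intro Bochner_Integration.integral_cong arg_cong[where f=norm]) (auto simp: causal_part_def exp_poly_def algebra_simps)
    also have "\<dots> = norm c * (LINT t|lborel. norm (causal_part f t - exp_poly p t))" by simp
    also have "\<dots> \<le> (norm c + 1) * (e / (norm c + 1))"
      using p by (intro mult_mono) auto
    also have "\<dots> = e" by (simp add: add_nonneg_eq_0_iff)
    finally show "\<exists>p. (LINT t|lborel. norm (causal_part (\<lambda>x. c * f x) t - exp_poly p t)) \<le> e" by blast
  qed
next
  case (lim f s)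
  have le: "(LINT x|lborel. norm (causal_part (s n) x - causal_part f x)) \<le> (LINT x|lborel. norm (s n x - f x))" for n
  proof (rule integral_mono)
    show "integrable lborel (\<lambda>x. norm (causal_part (s n) x - causal_part f x))"
      by (intro integrable_norm Bochner_Integration.integrable_diff causal_part_integrable lim)
    show "integrable lborel (\<lambda>x. norm (s n x - f x))"
      by (intro integrable_norm Bochner_Integration.integrable_diff lim)
  qed (auto simp: causal_part_def)
  show ?case
  proof (rule exp_approximable_lim[of s])
    show "(\<lambda>n. LINT x|lborel. norm (causal_part (s n) x - causal_part f x)) \<longlonglongrightarrow> 0"
      by (rule Lim_null_comparison[OF _ lim(3)]) (use le in simp)
  qed (use lim in auto)
next
  case (interval a b)
  define \<alpha> where "\<alpha> = exp (- b)"
  define \<beta> where "\<beta> = exp (- a)"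
  have \<alpha>: "0 < \<alpha>" "\<alpha> \<le> \<beta>" using interval by (auto simp: \<alpha>_def \<beta>_def)
  \<comment> \<open>Trapezoids in the variable \<open>u = exp (- t)\<close>: they equal
    \<open>1\<close> on \<open>{\<alpha>..\<beta>}\<close>, steepen with \<open>n\<close>, and have
    slope at least \<open>2 / \<alpha>\<close>, so that they vanish for
    \<open>u \<le> \<alpha> / 2\<close>.\<close>
  define \<kappa> where "\<kappa> n u = max 0 (1 - (real n + 2 / \<alpha>) * max 0 (max (\<alpha> - u) (u - \<beta>)))" for n u
  have \<kappa>: "0 \<le> \<kappa> n u" "\<kappa> n u \<le> 1" for n u using \<alpha> by (auto simp: \<kappa>_def max_def)
  have \<kappa>0: "\<kappa> n u = 0" if "u \<le> \<alpha> / 2" for n u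
  proof -
    have "2 / \<alpha> * (\<alpha> / 2) \<le> (real n + 2 / \<alpha>) * max 0 (max (\<alpha> - u) (u - \<beta>))"
      using \<alpha> that by (intro mult_mono) auto
    then show ?thesis using \<alpha> by (simp add: \<kappa>_def)
  qed
  let ?s = "\<lambda>n t. if 0 < t then complex_of_real (\<kappa> n (exp (- t))) else 0"
  have meas: "?s n \<in> borel_measurable lborel" for n
    unfolding \<kappa>_def by measurable
  have bound: "norm (?s n t) \<le> indicator {0..b + ln 2} t" for n t
  proof (cases "0 < t \<and> b + ln 2 < t")
    case True
    then have "exp (- t) \<le> exp (- (b + ln 2))" by simp
    also have "\<dots> = \<alpha> / 2" unfolding \<alpha>_def by (simp add: exp_diff)
    finally show ?thesis using \<kappa>0 by simp
  next
    case False
    then show ?thesis using \<kappa>[of n "exp (- t)"] by (auto split: split_indicator)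
  qed
  have ii: "integrable lborel (indicator {0..b + ln 2} :: real \<Rightarrow> real)"
    by (rule integrable_real_indicator) (auto simp: emeasure_lborel_Icc_eq)
  have si: "integrable lborel (?s n)" for n
    by (rule Bochner_Integration.integrable_bound[OF ii meas]) (use bound in auto)
  have fi: "integrable lborel (\<lambda>x. indicator {a..b} x :: complex)"
  proof -
    have "integrable lborel (\<lambda>x. of_real (indicator {a..b} x) :: complex)"
      by (intro integrable_of_real integrable_real_indicator) (auto simp: emeasure_lborel_Icc_eq)
    then show ?thesis by (simp add: of_real_indicator)
  qed
  show ?case
  proof (rule exp_approximable_lim[OF si _ fi])
    show "exp_approximable (?s n)" for n
    proof (rule exp_approximable_continuous[OF _ si])
      \<comment> \<open>The weight \<open>u\<close> has to be divided out. Replacing it by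
        \<open>max u (\<alpha> / 2)\<close> keeps the quotient continuous at \<open>0\<close> and
        changes nothing where the trapezoid is nonzero.\<close>
      show "continuous_on {0..1} (\<lambda>u. \<kappa> n u / max u (\<alpha> / 2))"
        unfolding \<kappa>_def using \<alpha> by (intro continuous_intros) auto
      show "?s n t = of_real (exp (- t) * (\<kappa> n (exp (- t)) / max (exp (- t)) (\<alpha> / 2)))" if "0 < t" for t
        using that \<kappa>0[of "exp (- t)" n] by (cases "exp (- t) \<le> \<alpha> / 2") (auto simp: max_def)
    qed
    have "(\<lambda>n. LINT x|lborel. norm (?s n x - causal_part (\<lambda>x. indicator {a..b} x) x)) \<longlonglongrightarrow> 0"
    proof (rule L1_tendsto_dominated[OF si causal_part_integrable[OF fi] ii _ bound])
      fix t
      show "(\<lambda>n. ?s n t) \<longlonglongrightarrow> causal_part (\<lambda>x. indicator {a..b} x) t"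
      proof (cases "0 < t")
        case True
        let ?d = "max 0 (max (\<alpha> - exp (- t)) (exp (- t) - \<beta>))"
        show ?thesis
        proof (cases "t \<in> {a..b}")
          case T: True
          then have "?d = 0" by (auto simp: \<alpha>_def \<beta>_def)
          then show ?thesis using True T by (simp add: \<kappa>_def causal_part_def)
        next
          case F: False
          then have d: "0 < ?d" by (auto simp: \<alpha>_def \<beta>_def less_max_iff_disj)
          obtain N :: nat where N: "1 / ?d \<le> real N" using real_arch_simple by blast
          have "\<kappa> n (exp (- t)) = 0" if "n \<ge> N" for n
          proof -
            have "1 / ?d \<le> real n + 2 / \<alpha>" using N that \<alpha> by (meson add_increasing2 divide_nonneg_pos less_eq_real_def of_nat_le_iff order_trans zero_le_numeral)
            then have "1 \<le> (real n + 2 / \<alpha>) * ?d" using d by (simp add: pos_divide_le_eq)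
            then show ?thesis by (simp add: \<kappa>_def)
          qed
          then have "\<forall>\<^sub>F n in sequentially. ?s n t = causal_part (\<lambda>x. indicator {a..b} x) t"
            unfolding eventually_sequentially using F by (intro exI[of _ N]) (auto simp: causal_part_def)
          then show ?thesis by (rule tendsto_eventually)
        qed
      qed (simp add: causal_part_def)
    qed
    moreover have "causal_part (?s n) = ?s n" for n by (auto simp: causal_part_def)
    ultimately show "(\<lambda>n. LINT x|lborel. norm (causal_part (?s n) x - causal_part (\<lambda>x. indicator {a..b} x) x)) \<longlonglongrightarrow> 0" by simp
  qed
qed

section \<open>Carrying causal inverses over to nearby elements\<close>

text \<open>The values on the axis determine the norm of the representing pair, so a bound found
  with one choice of supports holds with any other in which the function has a representation at
  all.\<close>

lemma wien_transfer:
  assumes E: "wien K L E R" and G: "wien K' L' G r" and eq: "\<And>s. s \<in> imag_axis \<Longrightarrow> E s = G s"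
  shows "wien K L E r"
proof -
  obtain f \<phi> where p: "wpair K L f \<phi>" "wnorm f \<phi> \<le> R" "\<And>s. s \<in> kernel_dom L \<Longrightarrow> E s = wev f \<phi> s"
    by (rule wienE[OF E]) (rule that; blast)
  obtain g \<psi> where q: "wpair K' L' g \<psi>" "wnorm g \<psi> \<le> r" "\<And>s. s \<in> kernel_dom L' \<Longrightarrow> G s = wev g \<psi> s"
    by (rule wienE[OF G]) (rule that; blast)
  have "wnorm f \<phi> = wnorm g \<psi>"
  proof (rule wev_unique(4)[OF p(1) q(1)])
    fix y :: real
    have s: "\<i> * complex_of_real y \<in> imag_axis" by simp
    show "wev f \<phi> (\<i> * of_real y) = wev g \<psi> (\<i> * of_real y)"
      using eq[OF s] p(3)[OF imag_axis_kernel_dom[OF s]] q(3)[OF imag_axis_kernel_dom[OF s]] by simp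
  qed
  then show ?thesis using p(3) q(2) by (intro wienI[OF p(1)]) auto
qed

text \<open>The size of the perturbation is measured against the inverse in the large algebra, which is
  the same function as the inverse of \<open>G\<close> in the small one and so has the same norm.\<close>

lemma wien_inverse_close:
  assumes adm: "wadm K L" "wadm K' UNIV" "K \<subseteq> K'" and Q: "wien K' UNIV Q r" and inv: "\<And>s. s \<in> imag_axis \<Longrightarrow> F s * Q s = 1"
    and D: "wien K L (\<lambda>s. F s - G s) d" and small: "3 * r * d \<le> 1"
    and E: "wien K L E R" "\<And>s. s \<in> imag_axis \<Longrightarrow> G s * E s = 1"
  obtains E' R' where "wien K L E' R'" "\<And>s. s \<in> imag_axis \<Longrightarrow> F s * E' s = 1"
proof -
  have r: "0 \<le> r" using wien_nonneg[OF Q] .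
  \<comment> \<open>Two Neumann series are run. The first gives the inverse of \<open>G\<close> the
    bound \<open>r / (1 - r * d)\<close>, the second starts from that bound; \<open>1/3\<close>
    keeps its ratio at most \<open>1/2\<close>.\<close>
  have rd: "r * d \<le> 1/3" using small by simp
  have rd1: "r * d < 1" using rd by simp
  obtain Q' where Q': "wien K' UNIV Q' (r / (1 - r * d))" "\<And>s. s \<in> imag_axis \<Longrightarrow> G s * Q' s = 1"
    by (rule wien_inverse_perturb[OF adm(2) Q inv wien_mono[OF D adm(3) subset_UNIV] rd1], assumption)
      (rule that; blast)
  have eq: "E s = Q' s" if s: "s \<in> imag_axis" for s
    using E(2)[OF s] Q'(2)[OF s] by (metis mult.left_commute mult_1_right)
  have E3: "wien K L E (r / (1 - r * d))" by (rule wien_transfer[OF E(1) Q'(1) eq])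
  have "r / (1 - r * d) * d = (r * d) / (1 - r * d)" by simp
  also have "\<dots> < 1"
  proof -
    have "r * d < 1 - r * d" "0 < 1 - r * d" using rd by linarith+
    then show ?thesis by (simp only: divide_less_eq_1_pos)
  qed
  finally have lt: "r / (1 - r * d) * d < 1" .
  have D': "wien K L (\<lambda>s. G s - F s) d"
    using wien_cmult[OF D, of "-1"] by simp
  show ?thesis
    by (rule wien_inverse_perturb[OF adm(1) E3 E(2) D' lt], assumption) (rule that; blast)
qed

lemma ap_inverse_nonneg:
  assumes \<phi>: "(\<lambda>x. norm (\<phi> x)) summable_on UNIV" "\<And>x. x \<notin> {0..} \<Longrightarrow> \<phi> x = 0"
    and Q: "wien {} UNIV Q r" and inv: "\<And>s. s \<in> imag_axis \<Longrightarrow> trig \<phi> s * Q s = 1"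
    and m: "mean_arg (\<lambda>y. trig \<phi> (\<i> * of_real y)) 0"
  obtains E R where "wien {} {0..} E R" "\<And>s. s \<in> imag_axis \<Longrightarrow> trig \<phi> s * E s = 1"
proof -
  have r: "0 \<le> r" using wien_nonneg[OF Q] .
  \<comment> \<open>The tolerance demanded by \<open>wien_inverse_close\<close>; the summand
    \<open>1\<close> covers \<open>r = 0\<close>.\<close>
  define e where "e = 1 / (3 * (r + 1))"
  have e: "0 < e" "3 * r * e \<le> 1" using r by (auto simp: e_def field_simps)
  obtain S Q' where S: "finite S" "(\<Sum>\<^sub>\<infinity>x. norm (\<phi> x - (if x \<in> S then \<phi> x else 0))) \<le> e"
    "wien {} UNIV Q' (2 * r)" "\<And>s. s \<in> imag_axis \<Longrightarrow> trig (\<lambda>x. if x \<in> S then \<phi> x else 0) s * Q' s = 1"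
    "\<And>y. norm (trig (\<lambda>x. if x \<in> S then \<phi> x else 0) (\<i> * of_real y) / trig \<phi> (\<i> * of_real y) - 1) < 1/2"
    by (rule finite_trig_approx[OF \<phi>(1) Q inv e(1)], assumption) (rule that; blast)
  define P where "P = (\<lambda>x. if x \<in> S then \<phi> x else 0)"
  have S1: "(\<Sum>\<^sub>\<infinity>x. norm (\<phi> x - P x)) \<le> e" using S(2) by (simp add: P_def)
  note S' = S(2-5)[folded P_def]
  have sP: "(\<lambda>x. norm (P x)) summable_on UNIV" unfolding P_def by (rule trig_finite(2)[OF S(1)])
  \<comment> \<open>The finite set may contain negative frequencies, but \<open>\<phi>\<close>
    vanishes there.\<close>
  have P': "P = (\<lambda>x. if x \<in> S \<inter> {0..} then \<phi> x else 0)" using \<phi>(2) by (auto simp: P_def)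
  have fS: "finite (S \<inter> {0..})" using S(1) by simp
  have P0: "P x = 0" if "x \<notin> {0..}" for x using that unfolding P' by simp
  have mP: "mean_arg (\<lambda>y. trig P (\<i> * of_real y)) 0"
    by (rule mean_arg_perturb[OF m trig_continuous_imag[OF \<phi>(1)] trig_continuous_imag[OF sP] S'(4)])
  obtain E R where E: "wien {} {0..} E R" "\<And>s. s \<in> imag_axis \<Longrightarrow> trig P s * E s = 1"
    by (rule finite_trig_inverse_nonneg[OF fS P' Int_lower2 S'(2,3) mP], assumption) (rule that; blast)
  have D: "wien {} {0..} (\<lambda>s. trig \<phi> s - trig P s) e"
  proof (rule wien_cong[OF wien_le[OF wien_trig[OF norm_diff_summable[OF \<phi>(1) sP]] S1]])
    show "\<phi> x - P x = 0" if "x \<notin> {0..}" for x using that \<phi>(2) P0 by simp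
    fix s assume s: "s \<in> kernel_dom {0..}"
    have "wpair {} {0..} (\<lambda>x. 0) \<phi>" "wpair {} {0..} (\<lambda>x. 0) P"
      using \<phi> sP P0 by (auto simp: wpair_def)
    from wpair_diff(3)[OF this empty_subsetI s] show "trig \<phi> s - trig P s = trig (\<lambda>x. \<phi> x - P x) s" by simp
  qed
  show ?thesis
    by (rule wien_inverse_close[OF _ _ _ Q inv D e(2) E]) (simp, simp, simp, assumption, assumption, (rule that; blast))
qed

section \<open>Winding and inversion of rational factors\<close>

lemma continuous_arg_line:
  assumes a: "0 < a"
  shows "continuous_arg (\<lambda>y. Complex a (y - b)) (\<lambda>y. arctan ((y - b) / a))"
  unfolding continuous_arg_cis
proof (intro conjI allI)
  show "continuous_on UNIV (\<lambda>y. arctan ((y - b) / a))" using a by (intro continuous_intros) auto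
  fix y
  show nz: "Complex a (y - b) \<noteq> 0" using a by (auto simp: complex_eq_iff)
  let ?t = "(y - b) / a"
  have "sqrt (1 + ?t\<^sup>2) = sqrt ((a\<^sup>2 + (y - b)\<^sup>2) / a\<^sup>2)" using a by (simp add: power_divide add_divide_distrib)
  also have "\<dots> = cmod (Complex a (y - b)) / a" using a by (simp add: real_sqrt_divide cmod_def)
  finally have sq: "sqrt (1 + ?t\<^sup>2) = cmod (Complex a (y - b)) / a" .
  have c0: "cmod (Complex a (y - b)) \<noteq> 0" using nz by simp
  show "cis (arctan ?t) = Complex a (y - b) / of_real (cmod (Complex a (y - b)))"
    using a c0 by (auto simp: complex_eq_iff cos_arctan sin_arctan sq)
qed

lemma arctan_line_limits:
  assumes a: "0 < a"
  shows "((\<lambda>y. arctan ((y - b) / a)) \<longlongrightarrow> pi / 2) at_top" "((\<lambda>y. arctan ((y - b) / a)) \<longlongrightarrow> - (pi / 2)) at_bot"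
proof -
  have "filterlim (\<lambda>y. (y - b) / a) at_top at_top" using a by real_asymp
  then show "((\<lambda>y. arctan ((y - b) / a)) \<longlongrightarrow> pi / 2) at_top" by (rule filterlim_compose[OF tendsto_arctan_at_top])
  have "filterlim (\<lambda>y. (y - b) / a) at_bot at_bot" using a by real_asymp
  then show "((\<lambda>y. arctan ((y - b) / a)) \<longlongrightarrow> - (pi / 2)) at_bot" by (rule filterlim_compose[OF tendsto_arctan_at_bot])
qed

text \<open>Going up the axis, the numerator turns by \<open>pi\<close> if \<open>z\<close> lies on
  the left and by \<open>- pi\<close> if it lies on the right, while the denominator always turns by
  \<open>pi\<close>. So a product of such quotients winds minus as often as it has zeros on the
  right.\<close>

lemma wind_linear_quotient:
  assumes a: "0 < a" and z: "Re z \<noteq> 0"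
  shows "wind (\<lambda>y. (\<i> * of_real y - z) / (\<i> * of_real y + of_real a)) (if Re z < 0 then 0 else - 1)"
proof -
  have den: "continuous_arg (\<lambda>y. inverse (\<i> * complex_of_real y + of_real a)) (\<lambda>y. - arctan ((y - 0) / a))"
  proof -
    have "\<i> * complex_of_real y + of_real a = Complex a (y - 0)" for y by (simp add: complex_eq_iff)
    then show ?thesis using continuous_arg_inverse[OF continuous_arg_line[OF a, of 0]] by simp
  qed
  note dl = arctan_line_limits[OF a, of 0]
  show ?thesis
  proof (cases "Re z < 0")
    case True
    then have p: "0 < - Re z" by simp
    have "\<i> * complex_of_real y - z = Complex (- Re z) (y - Im z)" for y by (simp add: complex_eq_iff)
    then have num: "continuous_arg (\<lambda>y. \<i> * complex_of_real y - z) (\<lambda>y. arctan ((y - Im z) / (- Re z)))"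
      using continuous_arg_line[OF p, of "Im z"] by simp
    note nl = arctan_line_limits[OF p, of "Im z"]
    have "wind (\<lambda>y. (\<i> * of_real y - z) * inverse (\<i> * of_real y + of_real a)) 0"
      by (rule windI[OF continuous_arg_mult[OF num den] tendsto_add[OF nl(2) tendsto_minus[OF dl(2)]]])
        (use tendsto_add[OF nl(1) tendsto_minus[OF dl(1)]] in simp)
    then show ?thesis using True by (simp add: divide_inverse)
  next
    case False
    then have p: "0 < Re z" using z by simp
    have "\<i> * complex_of_real y - z = (- 1) * cnj (Complex (Re z) (y - Im z))" for y by (simp add: complex_eq_iff)
    moreover have c1: "continuous_arg (\<lambda>y. - 1) (\<lambda>y. pi)" by (simp add: continuous_arg_cis)
    ultimately have num: "continuous_arg (\<lambda>y. \<i> * complex_of_real y - z) (\<lambda>y. pi + - arctan ((y - Im z) / Re z))"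
      using continuous_arg_mult[OF c1 continuous_arg_cnj[OF continuous_arg_line[OF p, of "Im z"]]] by simp
    note nl = arctan_line_limits[OF p, of "Im z"]
    have "wind (\<lambda>y. (\<i> * of_real y - z) * inverse (\<i> * of_real y + of_real a)) (- 1)"
      by (rule windI[OF continuous_arg_mult[OF num den]
            tendsto_add[OF tendsto_add[OF tendsto_const tendsto_minus[OF nl(2)]] tendsto_minus[OF dl(2)]]])
        (use tendsto_add[OF tendsto_add[OF tendsto_const[of pi] tendsto_minus[OF nl(1)]] tendsto_minus[OF dl(1)]] in simp)
    then show ?thesis using False by (simp add: divide_inverse)
  qed
qed

lemma wind_prod:
  assumes "finite I" "\<And>i. i \<in> I \<Longrightarrow> wind (g i) (n i)"
  shows "wind (\<lambda>y. \<Prod>i\<in>I. g i y) (\<Sum>i\<in>I. n i)"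
  using assms
proof (induction I rule: finite_induct)
  case empty
  have "continuous_arg (\<lambda>y. 1) (\<lambda>y. 0)" by (simp add: continuous_arg_cis)
  from windI[OF this tendsto_const, of 0] show ?case by simp
next
  case (insert i I)
  then show ?case using wind_mult[of "g i" "n i"] by simp
qed

text \<open>Over the common denominator \<open>(s + 1) * ... * (s + n)\<close> the transform has a
  numerator of degree below \<open>n\<close>. Adding \<open>1\<close> makes the numerator monic of
  degree \<open>n\<close>, so its linear factors match those of the denominator one to one.\<close>

lemma exp_poly_rational:
  obtains n :: nat and z :: "nat \<Rightarrow> complex" where
    "\<And>s. 0 \<le> Re s \<Longrightarrow> 1 + fourier (exp_poly p) s = (\<Prod>i<n. (s - z i) / (s + of_real (real (i + 1))))"
proof -
  define n where "n = Polynomial.degree p + 1"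
  let ?l = "\<lambda>i. [:complex_of_real (real (i + 1)), 1:]"
  define D where "D = (\<Prod>i<n. ?l i)"
  define M where "M = (\<Sum>k<n. Polynomial.smult (poly.coeff p k) (\<Prod>i\<in>{..<n} - {k}. ?l i))"
  have dD: "Polynomial.degree D = n"
    unfolding D_def by (subst degree_prod_eq_sum_degree) auto
  have lD: "poly.coeff D n = 1"
    using lead_coeff_prod[of ?l "{..<n}"] dD by (simp add: D_def)
  have dM: "Polynomial.degree M < n"
  proof -
    have "Polynomial.degree (\<Prod>i\<in>{..<n} - {k}. ?l i) \<le> n - 1" if "k < n" for k
      using that by (subst degree_prod_eq_sum_degree) auto
    then have "Polynomial.degree M \<le> n - 1"
      unfolding M_def by (intro degree_sum_le) (auto intro: order_trans[OF degree_smult_le])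
    then show ?thesis by (simp add: n_def)
  qed
  let ?N = "D + M"
  have dN: "Polynomial.degree ?N = n" using dD dM by (simp add: degree_add_eq_left)
  have cN: "poly.coeff ?N n = 1" using lD dM by (simp add: coeff_eq_0)
  have "?N \<noteq> 0" using cN by (metis coeff_0 zero_neq_one)
  then obtain A where A: "size A = n" "?N = (\<Prod>x\<in>#A. [:- x, 1:])"
    using alg_closed_imp_factorization[of ?N] dN cN by auto
  obtain xs where xs: "mset xs = A" using ex_mset by blast
  have len: "length xs = n" using A(1) xs by auto
  have Np: "poly ?N s = (\<Prod>i<n. s - xs ! i)" for s
  proof -
    have "poly ?N s = prod_list (map (\<lambda>x. s - x) xs)"
      unfolding A(2) xs[symmetric] poly_prod_mset by (simp flip: prod_mset_prod_list)
    also have "\<dots> = (\<Prod>i<n. s - xs ! i)" by (simp add: prod.list_conv_set_nth len atLeast0LessThan)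
    finally show ?thesis .
  qed
  have "1 + fourier (exp_poly p) s = (\<Prod>i<n. (s - xs ! i) / (s + of_real (real (i + 1))))" if s: "0 \<le> Re s" for s
  proof -
    have nz: "s + of_real (real (i + 1)) \<noteq> 0" for i using s by (auto simp: complex_eq_iff)
    have Ds: "poly D s = (\<Prod>i<n. s + of_real (real (i + 1)))" unfolding D_def by (simp add: poly_prod add.commute)
    have D0: "poly D s \<noteq> 0" unfolding Ds using nz by auto
    have "poly M s = (\<Sum>k<n. poly.coeff p k / (s + of_real (real (k + 1))) * poly D s)"
      unfolding M_def poly_sum
    proof (rule sum.cong)
      fix k assume k: "k \<in> {..<n}"
      have "poly D s = (s + of_real (real (k + 1))) * (\<Prod>i\<in>{..<n} - {k}. s + of_real (real (i + 1)))"
        unfolding Ds using k by (subst prod.remove[of _ k]) auto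
      then show "poly (Polynomial.smult (poly.coeff p k) (\<Prod>i\<in>{..<n} - {k}. ?l i)) s = poly.coeff p k / (s + of_real (real (k + 1))) * poly D s"
        using nz[of k] by (simp add: poly_prod add.commute)
    qed simp
    also have "\<dots> = fourier (exp_poly p) s * poly D s"
      unfolding exp_poly_transform(2)[OF s] sum_distrib_right n_def by (simp add: lessThan_Suc_atMost)
    finally have "poly ?N s = (1 + fourier (exp_poly p) s) * poly D s" by (simp add: algebra_simps)
    then show ?thesis using D0 unfolding Np Ds prod_dividef by (simp add: field_simps)
  qed
  then show ?thesis using that by blast
qed

text \<open>Each factor contributes \<open>0\<close> or \<open>- 1\<close> to the winding, so
  nothing cancels: total winding \<open>0\<close> puts every zero into the open left
  half-plane.\<close>

lemma exp_poly_inverse_nonneg: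
  assumes nz: "\<And>s. s \<in> imag_axis \<Longrightarrow> 1 + fourier (exp_poly p) s \<noteq> 0"
    and w: "wind (\<lambda>y. 1 + fourier (exp_poly p) (\<i> * of_real y)) 0"
  obtains E R where "wien {0<..} {0..} E R" "\<And>s. s \<in> imag_axis \<Longrightarrow> (1 + fourier (exp_poly p) s) * E s = 1"
proof -
  obtain n and z :: "nat \<Rightarrow> complex" where z:
    "\<And>s. 0 \<le> Re s \<Longrightarrow> 1 + fourier (exp_poly p) s = (\<Prod>i<n. (s - z i) / (s + of_real (real (i + 1))))"
    using exp_poly_rational[of p] by blast
  have z0: "Re (z i) \<noteq> 0" if "i < n" for i
  proof
    assume "Re (z i) = 0"
    then have s: "z i \<in> imag_axis" "0 \<le> Re (z i)" by (auto simp: imag_axis_def)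
    have "1 + fourier (exp_poly p) (z i) = 0"
      unfolding z[OF s(2)] using that by (intro prod_zero) (auto intro!: bexI[of _ i])
    then show False using nz[OF s(1)] by simp
  qed
  have "wind (\<lambda>y. \<Prod>i\<in>{..<n}. (\<i> * of_real y - z i) / (\<i> * of_real y + of_real (real (i + 1)))) (\<Sum>i\<in>{..<n}. if Re (z i) < 0 then 0 else - 1)"
    by (intro wind_prod wind_linear_quotient) (auto simp: z0)
  moreover have "(\<lambda>y. \<Prod>i\<in>{..<n}. (\<i> * of_real y - z i) / (\<i> * of_real y + of_real (real (i + 1)))) = (\<lambda>y. 1 + fourier (exp_poly p) (\<i> * of_real y))"
    by (rule ext, subst z) auto
  ultimately have "(\<Sum>i<n. if Re (z i) < 0 then 0 else - 1 :: int) = 0" using w wind_unique by metis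
  then have "(\<Sum>i<n. if Re (z i) < 0 then 0 else 1 :: int) = 0"
    by (subst (asm) neg_equal_0_iff_equal[symmetric]) (simp add: sum_negf[symmetric] if_distrib cong: if_cong)
  then have neg: "Re (z i) < 0" if "i < n" for i
    using that by (subst (asm) sum_nonneg_eq_0_iff) (auto split: if_splits)
  \<comment> \<open>With \<open>a = i + 1\<close> the inverse of a factor is
    \<open>(s + a) / (s - z) = 1 + (a + z) / (s - z)\<close>, and \<open>1 / (s - z)\<close> is the
    transform of a one-sided exponential.\<close>
  define E where "E s = (\<Prod>i<n. 1 + (of_real (real (i + 1)) + z i) * fourier (\<lambda>t. if 0 < t then exp (z i * complex_of_real t) else 0) s)" for s
  have "\<exists>R. wien {0<..} {0..} E R"
    unfolding E_def
    by (rule exI, rule wien_prod, rule wien_add, rule wien_const, simp, rule wien_cmult, rule wien_fourier)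
      (auto intro: exponential_transform(1) neg)
  then obtain R where R: "wien {0<..} {0..} E R" by blast
  have "(1 + fourier (exp_poly p) s) * E s = 1" if s: "s \<in> imag_axis" for s
  proof -
    have s0: "0 \<le> Re s" using s by (simp add: imag_axis_def)
    have "(s - z i) / (s + of_real (real (i + 1))) * (1 + (of_real (real (i + 1)) + z i) * fourier (\<lambda>t. if 0 < t then exp (z i * complex_of_real t) else 0) s) = 1" if i: "i < n" for i
    proof -
      have n1: "s - z i \<noteq> 0" using neg[OF i] s0 by auto
      have n2: "s + of_real (real (i + 1)) \<noteq> 0" using s0 by (auto simp: complex_eq_iff)
      have "(s - z i) * (1 + (c + z i) * (1 / (s - z i))) = s + c" for c using n1 by (simp add: field_simps)
      then show ?thesis unfolding exponential_transform(2)[OF neg[OF i] s0]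
        by (simp only: times_divide_eq_left divide_self[OF n2])
    qed
    then show ?thesis unfolding z[OF s0] E_def prod.distrib[symmetric] by simp
  qed
  then show ?thesis using that R by blast
qed

lemma l1_inverse_nonneg:
  assumes f: "integrable lborel f" "\<And>x. x \<notin> {0<..} \<Longrightarrow> f x = 0"
    and Q: "wien UNIV UNIV Q r" and inv: "\<And>s. s \<in> imag_axis \<Longrightarrow> (1 + fourier f s) * Q s = 1"
    and w: "wind (\<lambda>y. 1 + fourier f (\<i> * of_real y)) 0"
  obtains E R where "wien {0<..} {0..} E R" "\<And>s. s \<in> imag_axis \<Longrightarrow> (1 + fourier f s) * E s = 1"
proof -
  have r: "0 \<le> r" using wien_nonneg[OF Q] .
  \<comment> \<open>This gives \<open>3 * r * e \<le> 1\<close>, needed for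
    \<open>wien_inverse_close\<close>, and also a relative change below \<open>1/2\<close>, needed
    to preserve the winding number.\<close>
  define e where "e = 1 / (3 * (r + 1))"
  have e: "0 < e" "3 * r * e \<le> 1" using r by (auto simp: e_def field_simps)
  have cf: "causal_part f = f" using f(2) by (auto simp: causal_part_def fun_eq_iff)
  obtain p where p: "(LINT t|lborel. norm (f t - exp_poly p t)) \<le> e"
    using exp_approximable_all[OF f(1)] e(1) unfolding exp_approximable_def cf by blast
  note ip = exp_poly_transform(1)[of p]
  have p0: "exp_poly p x = 0" if "x \<notin> {0<..}" for x using that by (simp add: exp_poly_def)
  have D: "wien {0<..} {0..} (\<lambda>s. (1 + fourier f s) - (1 + fourier (exp_poly p) s)) e"
  proof (rule wien_cong[OF wien_le[OF wien_fourier[of "\<lambda>t. f t - exp_poly p t"] p]])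
    show "integrable lborel (\<lambda>t. f t - exp_poly p t)" using f ip by simp
    show "f x - exp_poly p x = 0" if "x \<notin> {0<..}" for x using that f(2) p0 by simp
    fix s assume s: "s \<in> kernel_dom {0..}"
    have "wpair {0<..} {0..} f (\<lambda>x. 0)" "wpair {0<..} {0..} (exp_poly p) (\<lambda>x. 0)"
      using f ip p0 by (auto simp: wpair_def)
    from wpair_diff(2)[OF this Ioi_le_Ico s]
    show "(1 + fourier f s) - (1 + fourier (exp_poly p) s) = fourier (\<lambda>t. f t - exp_poly p t) s"
      by (simp add: wev_def trig_def)
  qed
  have near: "norm ((1 + fourier (exp_poly p) s) / (1 + fourier f s) - 1) < 1/2" if s: "s \<in> imag_axis" for s
  proof -
    have "norm ((1 + fourier f s) - (1 + fourier (exp_poly p) s)) \<le> e"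
      by (rule wien_norm_le[OF D Ioi_le_Ico imag_axis_kernel_dom[OF s]])
    moreover have "norm (Q s) \<le> r" by (rule wien_norm_le[OF Q subset_UNIV imag_axis_kernel_dom[OF s]])
    ultimately have "norm (Q s) * norm ((1 + fourier f s) - (1 + fourier (exp_poly p) s)) \<le> r * e"
      using r by (intro mult_mono) auto
    moreover have "G / F - 1 = - (q * (F - G))" if "F * q = 1" for F G q :: complex
    proof -
      have "F \<noteq> 0" using that by auto
      then show ?thesis using that by (simp add: field_simps)
    qed
    from this[OF inv[OF s]] have "(1 + fourier (exp_poly p) s) / (1 + fourier f s) - 1 = - (Q s * ((1 + fourier f s) - (1 + fourier (exp_poly p) s)))" .
    ultimately show ?thesis using e(2) by (simp only: norm_minus_cancel norm_mult)
  qed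
  have f0: "1 + fourier f s \<noteq> 0" if "s \<in> imag_axis" for s using inv[OF that] by auto
  have g0: "1 + fourier (exp_poly p) s \<noteq> 0" if "s \<in> imag_axis" for s
  proof
    assume "1 + fourier (exp_poly p) s = 0"
    then show False using near[OF that] by simp
  qed
  have cg: "continuous_on UNIV (\<lambda>y. 1 + fourier h (\<i> * of_real y))" if "integrable lborel h" for h
    by (intro continuous_on_add continuous_on_const fourier_continuous_imag that)
  have lim: "((\<lambda>y. 1 + fourier (exp_poly p) (\<i> * of_real y)) \<longlongrightarrow> 1) at_infinity"
    using tendsto_add[OF tendsto_const riemann_lebesgue[OF ip], of 1] by simp
  obtain m where m: "wind (\<lambda>y. 1 + fourier (exp_poly p) (\<i> * of_real y)) m"
    by (rule wind_ex[OF cg[OF ip] g0[OF imag_axis_i] lim])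
  \<comment> \<open>The quotient lemma with both denominators equal to \<open>1\<close>.\<close>
  have "0 = m"
    by (rule wind_quotient_perturb[of "\<lambda>y. 1 + fourier f (\<i> * of_real y)" "\<lambda>_. 1" 0
          "\<lambda>y. 1 + fourier (exp_poly p) (\<i> * of_real y)" "\<lambda>_. 1"])
      (use w m cg[OF f(1)] cg[OF ip] f0 near in auto)
  then obtain E R where E: "wien {0<..} {0..} E R" "\<And>s. s \<in> imag_axis \<Longrightarrow> (1 + fourier (exp_poly p) s) * E s = 1"
    using exp_poly_inverse_nonneg[OF g0] m by metis
  show ?thesis
    by (rule wien_inverse_close[OF _ _ _ Q inv D e(2) E]) (simp, simp, simp, assumption, assumption, (rule that; blast))
qed

section \<open>Causal inverses for vanishing index\<close>

text \<open>The transform factors as \<open>trig \<phi> * (1 + fourier k)\<close>, and the two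
  components of the index concern one factor each. The inverse given over the axis provides inverses
  of both factors in the large algebra, from which the two previous constructions start.\<close>

lemma Aplus_inverse:
  assumes p: "wpair {0<..} {0..} f \<phi>" and q: "wpair UNIV UNIV g \<psi>"
    and inv: "\<And>s. s \<in> imag_axis \<Longrightarrow> wev f \<phi> s * wev g \<psi> s = 1"
    and w: "windex f \<phi> 0 0"
  obtains E R where "wien {0<..} {0..} E R" "\<And>s. s \<in> imag_axis \<Longrightarrow> wev f \<phi> s * E s = 1"
proof -
  have pU: "wpair UNIV UNIV f \<phi>" using p by (auto simp: wpair_def)
  have f: "integrable lborel f" "\<And>x. x \<notin> {0<..} \<Longrightarrow> f x = 0"
    and \<phi>: "(\<lambda>x. norm (\<phi> x)) summable_on UNIV" "\<And>x. x \<notin> {0..} \<Longrightarrow> \<phi> x = 0"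
    and \<psi>: "(\<lambda>x. norm (\<psi> x)) summable_on UNIV"
    using p q by (auto simp: wpair_def)
  have m: "mean_arg (\<lambda>y. trig \<phi> (\<i> * of_real y)) 0"
    and n: "wind (\<lambda>y. wev f \<phi> (\<i> * of_real y) / trig \<phi> (\<i> * of_real y)) 0"
    using w by (auto simp: windex_def)
  have Q: "wien {} UNIV (trig \<psi>) (\<Sum>\<^sub>\<infinity>x. norm (\<psi> x))" by (rule wien_trig[OF \<psi>]) auto
  obtain E1 R1 where E1: "wien {} {0..} E1 R1" "\<And>s. s \<in> imag_axis \<Longrightarrow> trig \<phi> s * E1 s = 1"
    by (rule ap_inverse_nonneg[OF \<phi> Q trig_inverse[OF pU q inv] m], assumption+) (rule that; blast)
  obtain u where u: "(\<lambda>x. norm (u x)) summable_on UNIV" "\<And>x. x \<notin> {0..} \<Longrightarrow> u x = 0"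
    "\<And>s. s \<in> kernel_dom {0..} \<Longrightarrow> E1 s = trig u s"
    by (rule wien_ap_trig[OF E1(1)]) (rule that; blast)
  \<comment> \<open>\<open>k\<close> is \<open>f\<close> convolved with the point masses of the
    causal inverse; nonnegative plus positive times are positive, so \<open>k\<close> is again
    supported in \<open>{0<..}\<close>.\<close>
  obtain k where k: "integrable lborel k" "\<And>x. x \<notin> {0<..} \<Longrightarrow> k x = 0"
    "\<And>s. s \<in> kernel_dom {0..} \<Longrightarrow> s \<in> kernel_dom {0<..} \<Longrightarrow> fourier k s = trig u s * fourier f s"
    by (rule trig_fourier_mult[of u "{0..}" f "{0<..}" "{0<..}"], rule u(1), erule u(2), rule f(1), erule f(2), simp)
      (rule that; blast)
  have eq: "wev f \<phi> s = trig \<phi> s * (1 + fourier k s)" if s: "s \<in> imag_axis" for s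
  proof -
    have "trig \<phi> s * trig u s = 1" using E1(2)[OF s] u(3)[OF imag_axis_kernel_dom[OF s]] by simp
    then have "trig \<phi> s * (trig u s * fourier f s) = fourier f s" by (simp flip: mult.assoc)
    then show ?thesis using k(3)[OF imag_axis_kernel_dom[OF s] imag_axis_kernel_dom[OF s]]
      by (simp add: wev_def distrib_left add.commute)
  qed
  have wq: "wien UNIV UNIV (wev g \<psi>) (wnorm g \<psi>)" by (rule wienI[OF q]) auto
  have Q2: "wien UNIV UNIV (\<lambda>s. trig \<phi> s * wev g \<psi> s) ((\<Sum>\<^sub>\<infinity>x. norm (\<phi> x)) * wnorm g \<psi>)"
    by (intro wien_mult wien_trig \<phi>(1) wq) auto
  have inv2: "(1 + fourier k s) * (trig \<phi> s * wev g \<psi> s) = 1" if "s \<in> imag_axis" for s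
    using inv[OF that] eq[OF that] by (simp add: mult_ac)
  have "wev f \<phi> (\<i> * of_real y) / trig \<phi> (\<i> * of_real y) = 1 + fourier k (\<i> * of_real y)" for y
    using eq[OF imag_axis_i, of y] mean_arg_nonzero[OF m, of y] by simp
  then have n2: "wind (\<lambda>y. 1 + fourier k (\<i> * of_real y)) 0" using n by simp
  obtain E2 R2 where E2: "wien {0<..} {0..} E2 R2" "\<And>s. s \<in> imag_axis \<Longrightarrow> (1 + fourier k s) * E2 s = 1"
    by (rule l1_inverse_nonneg[OF k(1,2) Q2 inv2 n2], assumption+) (rule that; blast)
  have "wien {0<..} {0..} (\<lambda>s. E1 s * E2 s) (R1 * R2)"
    by (rule wien_mult[OF wien_mono[OF E1(1)] E2(1)]) auto
  moreover have "wev f \<phi> s * (E1 s * E2 s) = 1" if s: "s \<in> imag_axis" for s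
    using E1(2)[OF s] E2(2)[OF s] eq[OF s] by (simp add: mult_ac)
  ultimately show ?thesis using that by blast
qed

lemma Aplus_unit_of_index_zero:
  assumes F: "F \<in> Aplus_fun" and U: "boundary F \<in> Units A_alg" and W0: "W (boundary F) = (0, 0)"
  shows "F \<in> Units Aplus"
proof -
  obtain f \<phi> where p: "wpair {0<..} {0..} f \<phi>" "F = restrict (wev f \<phi>) right_half_plane"
    using F Aplus_fun_iff by metis
  have pU: "wpair UNIV UNIV f \<phi>" using p(1) by (auto simp: wpair_def)
  have bF: "boundary F = restrict (wev f \<phi>) imag_axis"
    unfolding boundary_def p(2) using imag_axis_subset by (auto simp: restrict_def fun_eq_iff)
  obtain G where G: "G \<in> A_fun" "(\<lambda>s\<in>imag_axis. boundary F s * G s) = (\<lambda>s\<in>imag_axis. 1)"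
    using U by (auto simp: Units_def)
  obtain g \<psi> where q: "wpair UNIV UNIV g \<psi>" "G = restrict (wev g \<psi>) imag_axis" using G A_fun_iff by metis
  have inv: "wev f \<phi> s * wev g \<psi> s = 1" if "s \<in> imag_axis" for s
    using fun_cong[OF G(2), of s] that by (simp add: bF q(2))
  obtain w n where w: "windex f \<phi> w n" by (rule windex_ex[OF pU q(1) inv])
  then have "windex f \<phi> 0 0" using W_windex[OF w] W0 bF by simp
  then obtain E R where E: "wien {0<..} {0..} E R" "\<And>s. s \<in> imag_axis \<Longrightarrow> wev f \<phi> s * E s = 1"
    using Aplus_inverse[OF p(1) q(1) inv] by metis
  obtain h ch where h: "wpair {0<..} {0..} h ch" "\<And>s. s \<in> kernel_dom {0..} \<Longrightarrow> E s = wev h ch s"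
    by (rule wienE[OF E(1)]) (rule that; blast)
  obtain k c where k: "wpair {0<..} {0..} k c" "\<And>s. s \<in> kernel_dom {0..} \<Longrightarrow> wev k c s = wev f \<phi> s * wev h ch s"
    by (rule wpair_mult[OF p(1) h(1) wadm_nonneg]) (rule that; blast)
  have "wien {0<..} {0..} (\<lambda>s. 1) (norm (1::complex))" by (rule wien_const) simp
  then obtain l d where l: "wpair {0<..} {0..} l d" "\<And>s. s \<in> kernel_dom {0..} \<Longrightarrow> 1 = wev l d s"
    by (rule wienE) (rule that; blast)
  \<comment> \<open>The product is known to be \<open>1\<close> on the axis only; comparing its pair
    with that of the constant extends the identity to the closed half-plane.\<close>
  have "wev k c s = wev l d s" if s: "s \<in> imag_axis" for s
    using k(2) l(2) h(2) E(2)[OF s] imag_axis_kernel_dom[OF s] by metis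
  from wev_eq_if_eq_imag[OF k(1) l(1) this] have "wev k c s = wev l d s" for s .
  then have one: "wev f \<phi> s * wev h ch s = 1" if "s \<in> right_half_plane" for s
    using k(2)[of s] l(2)[of s] that by (simp add: kernel_dom_nonneg)
  let ?H = "restrict (wev h ch) right_half_plane"
  have H: "?H \<in> Aplus_fun" using h(1) Aplus_fun_iff by metis
  have "(\<lambda>s\<in>right_half_plane. F s * ?H s) = (\<lambda>s\<in>right_half_plane. 1)"
    by (rule restrict_cong') (simp add: p(2) one)
  then show ?thesis
    unfolding Units_def using F H by (auto intro!: bexI[of _ ?H] simp: mult.commute cong: restrict_cong)
qed

section \<open>Damping and the index of causal units\<close>

lemma damped_tendsto_L1:
  fixes c :: "nat \<Rightarrow> 'a \<Rightarrow> complex"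
  assumes u: "integrable M u" and [measurable]: "\<And>n. c n \<in> borel_measurable M" "d \<in> borel_measurable M"
    and le: "\<And>n x. u x \<noteq> 0 \<Longrightarrow> norm (c n x) \<le> 1" and lim: "\<And>x. u x \<noteq> 0 \<Longrightarrow> (\<lambda>n. c n x) \<longlonglongrightarrow> d x"
  shows "(\<lambda>n. LINT x|M. norm (c n x * u x - d x * u x)) \<longlonglongrightarrow> 0"
proof -
  have [measurable]: "u \<in> borel_measurable M" using u by auto
  have d: "norm (d x) \<le> 1" if "u x \<noteq> 0" for x
    by (rule LIMSEQ_le_const2[OF tendsto_norm[OF lim[OF that]]]) (use le[OF that] in auto)
  have "(\<lambda>n. LINT x|M. norm (c n x * u x - d x * u x)) \<longlonglongrightarrow> (LINT x|M. 0)"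
  proof (rule integral_dominated_convergence[where w="\<lambda>x. 2 * norm (u x)"])
    show "AE x in M. (\<lambda>n. norm (c n x * u x - d x * u x)) \<longlonglongrightarrow> 0"
    proof (rule AE_I2)
      fix x
      show "(\<lambda>n. norm (c n x * u x - d x * u x)) \<longlonglongrightarrow> 0"
      proof (cases "u x = 0")
        case False
        have "(\<lambda>n. c n x * u x) \<longlonglongrightarrow> d x * u x" by (rule tendsto_mult_right[OF lim[OF False]])
        then show ?thesis by (simp add: LIM_zero tendsto_norm_zero)
      qed simp
    qed
    show "AE x in M. norm (norm (c n x * u x - d x * u x)) \<le> 2 * norm (u x)" for n
    proof (rule AE_I2)
      fix x
      show "norm (norm (c n x * u x - d x * u x)) \<le> 2 * norm (u x)"
      proof (cases "u x = 0")
        case False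
        have "norm (c n x - d x) \<le> 2" using norm_triangle_ineq4[of "c n x" "d x"] le[OF False] d[OF False] by (smt (verit))
        then show ?thesis by (simp add: norm_mult mult_right_mono flip: left_diff_distrib)
      qed simp
    qed
  qed (use u in auto)
  then show ?thesis by simp
qed

lemma damped_pair:
  fixes c :: "real \<Rightarrow> complex"
  assumes p: "wpair {0<..} {0..} f \<phi>" and [measurable]: "c \<in> borel_measurable borel" and c: "\<And>x. 0 \<le> x \<Longrightarrow> norm (c x) \<le> 1"
  shows "wpair {0<..} {0..} (\<lambda>x. c x * f x) (\<lambda>x. c x * \<phi> x)"
    and "wnorm (\<lambda>x. c x * f x) (\<lambda>x. c x * \<phi> x) \<le> wnorm f \<phi>"
proof -
  have f: "integrable lborel f" "\<And>x. \<not> 0 < x \<Longrightarrow> f x = 0"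
    and \<phi>: "(\<lambda>x. norm (\<phi> x)) summable_on UNIV" "\<And>x. \<not> 0 \<le> x \<Longrightarrow> \<phi> x = 0"
    using p by (auto simp: wpair_def)
  have [measurable]: "f \<in> borel_measurable borel" using f by auto
  have le1: "norm (c x * f x) \<le> norm (f x)" for x
    using c[of x] f(2)[of x] by (cases "0 < x") (auto simp: norm_mult mult_left_le_one_le)
  have le2: "norm (c x * \<phi> x) \<le> norm (\<phi> x)" for x
    using c[of x] \<phi>(2)[of x] by (cases "0 \<le> x") (auto simp: norm_mult mult_left_le_one_le)
  have 1: "integrable lborel (\<lambda>x. c x * f x)"
    by (rule Bochner_Integration.integrable_bound[OF f(1)]) (use le1 in auto)
  have 2: "(\<lambda>x. norm (c x * \<phi> x)) summable_on UNIV"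
    by (rule Infinite_Sum.summable_on_comparison_test[OF \<phi>(1)]) (use le2 in auto)
  show "wpair {0<..} {0..} (\<lambda>x. c x * f x) (\<lambda>x. c x * \<phi> x)"
    using 1 2 f \<phi> by (auto simp: wpair_def)
  have "(LINT x|lborel. norm (c x * f x)) \<le> (LINT x|lborel. norm (f x))"
    by (rule integral_mono) (use 1 f(1) le1 in auto)
  moreover have "(\<Sum>\<^sub>\<infinity>x. norm (c x * \<phi> x)) \<le> (\<Sum>\<^sub>\<infinity>x. norm (\<phi> x))"
    by (rule infsum_mono[OF 2 \<phi>(1) le2])
  ultimately show "wnorm (\<lambda>x. c x * f x) (\<lambda>x. c x * \<phi> x) \<le> wnorm f \<phi>" by (simp add: wnorm_def)
qed

text \<open>Multipliers bounded by \<open>1\<close> and converging pointwise suffice for convergence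
  in norm. Measurable limits are allowed because besides damping factors with varying
  \<open>\<sigma>\<close> the limit for \<open>\<sigma>\<close> tending to infinity occurs, which is
  the discontinuous indicator of \<open>0\<close>.\<close>

lemma damped_tendsto:
  fixes c :: "nat \<Rightarrow> real \<Rightarrow> complex"
  assumes p: "wpair {0<..} {0..} f \<phi>" and m: "\<And>n. c n \<in> borel_measurable borel" "d \<in> borel_measurable borel"
    and le: "\<And>n x. 0 \<le> x \<Longrightarrow> norm (c n x) \<le> 1" and lim: "\<And>x. 0 \<le> x \<Longrightarrow> (\<lambda>n. c n x) \<longlonglongrightarrow> d x"
  shows "(\<lambda>n. wnorm (\<lambda>x. c n x * f x - d x * f x) (\<lambda>x. c n x * \<phi> x - d x * \<phi> x)) \<longlonglongrightarrow> 0"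
proof -
  have f: "integrable lborel f" "\<And>x. f x \<noteq> 0 \<Longrightarrow> 0 \<le> x"
    and \<phi>: "(\<lambda>x. norm (\<phi> x)) summable_on UNIV" "\<And>x. \<phi> x \<noteq> 0 \<Longrightarrow> 0 \<le> x"
  proof -
    show "integrable lborel f" "(\<lambda>x. norm (\<phi> x)) summable_on UNIV" using p by (auto simp: wpair_def)
    show "0 \<le> x" if "f x \<noteq> 0" for x using p that by (cases "0 < x") (auto simp: wpair_def)
    show "0 \<le> x" if "\<phi> x \<noteq> 0" for x using p that by (cases "0 \<le> x") (auto simp: wpair_def)
  qed
  have d: "norm (d x) \<le> 1" if "0 \<le> x" for x
    by (rule LIMSEQ_le_const2[OF tendsto_norm[OF lim[OF that]]]) (use le[OF that] in auto)
  have 1: "(\<lambda>n. LINT x|lborel. norm (c n x * f x - d x * f x)) \<longlonglongrightarrow> 0"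
    by (rule damped_tendsto_L1) (use f m le lim in auto)
  have "(\<lambda>n. LINT x|count_space UNIV. norm (c n x * \<phi> x - d x * \<phi> x)) \<longlonglongrightarrow> 0"
    by (rule damped_tendsto_L1) (use \<phi> le lim in \<open>auto simp: abs_summable_iff_integrable\<close>)
  moreover have "(\<Sum>\<^sub>\<infinity>x. norm (c n x * \<phi> x - d x * \<phi> x)) = (LINT x|count_space UNIV. norm (c n x * \<phi> x - d x * \<phi> x))" for n
  proof (rule infsum_norm_eq_integral[OF norm_diff_summable])
    show "(\<lambda>x. norm (c n x * \<phi> x)) summable_on UNIV"
      using damped_pair(1)[OF p m(1) le] by (simp add: wpair_def)
    show "(\<lambda>x. norm (d x * \<phi> x)) summable_on UNIV"
      using damped_pair(1)[OF p m(2) d] by (simp add: wpair_def)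
  qed
  ultimately have 2: "(\<lambda>n. \<Sum>\<^sub>\<infinity>x. norm (c n x * \<phi> x - d x * \<phi> x)) \<longlonglongrightarrow> 0" by simp
  show ?thesis unfolding wnorm_def using tendsto_add[OF 1 2] by simp
qed

text \<open>The multiplier on pairs that corresponds to translating the transform to the right by
  \<open>\<sigma>\<close>.\<close>

definition damp :: "real \<Rightarrow> real \<Rightarrow> complex" where
  "damp \<sigma> x = exp (- (of_real \<sigma> * of_real x))"

lemma damp_props:
  "damp \<sigma> \<in> borel_measurable borel" "0 \<le> \<sigma> \<Longrightarrow> 0 \<le> x \<Longrightarrow> norm (damp \<sigma> x) \<le> 1"
  unfolding damp_def[abs_def] by (auto intro!: borel_measurable_continuous_onI continuous_intros)

lemma wev_damp: "wev (\<lambda>x. damp \<sigma> x * f x) (\<lambda>x. damp \<sigma> x * \<phi> x) s = wev f \<phi> (s + of_real \<sigma>)"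
proof -
  have e: "exp (- ((s + of_real \<sigma>) * of_real x)) = exp (- (s * of_real x)) * damp \<sigma> x" for x
    unfolding damp_def by (simp add: algebra_simps exp_diff exp_minus divide_inverse)
  show ?thesis unfolding wev_def fourier_def trig_def e by (simp add: mult_ac)
qed

lemma connected_nonneg_reals: "connected {0::real..}"
  by (intro convex_connected) auto

text \<open>Translating \<open>F\<close> to the right keeps it invertible and moves it continuously from its boundary
  values to the constant \<open>F \<infinity>\<close>, whose index vanishes.\<close>

lemma index_zero_of_Aplus_inverse:
  assumes p: "wpair {0<..} {0..} f \<phi>" and q: "wpair {0<..} {0..} g \<psi>"
    and inv: "\<And>s. s \<in> right_half_plane \<Longrightarrow> wev f \<phi> s * wev g \<psi> s = 1"
  shows "windex f \<phi> 0 0"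
proof -
  let ?f = "\<lambda>\<sigma> x. damp \<sigma> x * f x" and ?\<phi> = "\<lambda>\<sigma> x. damp \<sigma> x * \<phi> x"
  let ?g = "\<lambda>\<sigma> x. damp \<sigma> x * g x" and ?\<psi> = "\<lambda>\<sigma> x. damp \<sigma> x * \<psi> x"
  have widen: "wpair {0<..} {0..} f \<phi> \<Longrightarrow> wpair UNIV UNIV f \<phi>" for f \<phi> by (auto simp: wpair_def)
  note dp = damped_pair[OF p damp_props(1,2)] and dq = damped_pair[OF q damp_props(1,2)]
  have inv\<sigma>: "wev (?f \<sigma>) (?\<phi> \<sigma>) s * wev (?g \<sigma>) (?\<psi> \<sigma>) s = 1" if "0 \<le> \<sigma>" "s \<in> imag_axis" for \<sigma> s
    unfolding wev_damp using that by (intro inv) (auto simp: imag_axis_def right_half_plane_def)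
  have "\<exists>w n. windex (?f \<sigma>) (?\<phi> \<sigma>) w n" if "0 \<le> \<sigma>" for \<sigma>
    using windex_ex[OF widen[OF dp(1)] widen[OF dq(1)] inv\<sigma>] that by metis
  then obtain w n where wn: "\<And>\<sigma>. 0 \<le> \<sigma> \<Longrightarrow> windex (?f \<sigma>) (?\<phi> \<sigma>) (w \<sigma>) (n \<sigma>)" by metis
  define V where "V \<sigma> = (w \<sigma>, n \<sigma>)" for \<sigma>
  \<comment> \<open>The damped pairs depend continuously on \<open>\<sigma>\<close> in norm, and the
    inverse at \<open>\<tau>\<close> contributes a fixed factor, so \<open>windex_perturb\<close>
    applies near \<open>\<tau>\<close>. Connectedness then makes the index constant.\<close>
  have loc: "\<forall>\<^sub>F \<sigma> in at \<tau> within {0..}. V \<tau> = V \<sigma>" if \<tau>: "\<tau> \<in> {0..}" for \<tau>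
  proof -
    let ?d = "\<lambda>\<sigma>. wnorm (\<lambda>x. ?f \<sigma> x - ?f \<tau> x) (\<lambda>x. ?\<phi> \<sigma> x - ?\<phi> \<tau> x)"
    have "(?d \<longlongrightarrow> 0) (at \<tau> within {0..})"
      unfolding tendsto_at_iff_sequentially o_def
    proof (intro allI impI)
      fix r assume r: "\<forall>i. r i \<in> {0..} - {\<tau>}" "r \<longlonglongrightarrow> \<tau>"
      show "(\<lambda>i. ?d (r i)) \<longlonglongrightarrow> 0"
      proof (rule damped_tendsto[OF p])
        show "(\<lambda>n. damp (r n) x) \<longlonglongrightarrow> damp \<tau> x" for x
          unfolding damp_def by (intro tendsto_intros r)
      qed (use r damp_props in auto)
    qed
    then have "((\<lambda>\<sigma>. ?d \<sigma> * wnorm (?g \<tau>) (?\<psi> \<tau>)) \<longlongrightarrow> 0) (at \<tau> within {0..})" by (rule tendsto_mult_left_zero)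
    then have "\<forall>\<^sub>F \<sigma> in at \<tau> within {0..}. ?d \<sigma> * wnorm (?g \<tau>) (?\<psi> \<tau>) < 1/2" by (rule order_tendstoD) simp
    moreover have "\<forall>\<^sub>F \<sigma> in at \<tau> within {0..}. \<sigma> \<in> {0..}" by (simp add: eventually_at_filter)
    ultimately show ?thesis
    proof eventually_elim
      case (elim \<sigma>)
      have t0: "0 \<le> \<tau>" "0 \<le> \<sigma>" using \<tau> elim by auto
      show ?case unfolding V_def
        using windex_perturb[OF wn[OF t0(1)] wn[OF t0(2)] widen[OF dq(1)[OF t0(1)]] inv\<sigma>[OF t0(1)] elim(1)] by simp
    qed
  qed
  have const: "V \<sigma> = V 0" if "0 \<le> \<sigma>" for \<sigma>
    by (rule connected_local_const[OF connected_nonneg_reals, of \<sigma> 0 V]) (use that loc in auto)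
  \<comment> \<open>The pointwise limit of the damping factors. Only the point mass at
    \<open>0\<close> survives, and since \<open>f 0 = 0\<close> the function part vanishes
    identically, so the limiting pair represents the constant \<open>\<phi> 0\<close>.\<close>
  let ?e = "\<lambda>x::real. if x = 0 then 1 else (0::complex)"
  have em: "?e \<in> borel_measurable borel" by measurable
  have far: "(\<lambda>k. damp (real k) x) \<longlonglongrightarrow> ?e x" if "0 \<le> x" for x
  proof (cases "x = 0")
    case True then show ?thesis by (simp add: damp_def)
  next
    case False
    then have "0 < x" using that by simp
    then have "(\<lambda>k. exp (- (real k * x))) \<longlonglongrightarrow> 0" by real_asymp
    then have "(\<lambda>k. damp (real k) x) \<longlonglongrightarrow> 0"
      by (subst tendsto_norm_zero_iff[symmetric]) (simp add: damp_def)
    then show ?thesis using False by simp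
  qed
  have f0: "f 0 = 0" "g 0 = 0" using p q by (auto simp: wpair_def)
  have tr: "trig (\<lambda>x. ?e x * \<phi> x) s = \<phi> 0" for s and \<phi> :: "real \<Rightarrow> complex"
    unfolding trig_def by (subst infsum_single[of 0]) auto
  have we: "wev (\<lambda>x. ?e x * f x) (\<lambda>x. ?e x * \<phi> x) s = \<phi> 0" if "f 0 = 0" for s and f \<phi> :: "real \<Rightarrow> complex"
  proof -
    have "(\<lambda>x. ?e x * f x) = (\<lambda>x. 0)" using that by auto
    then show ?thesis unfolding wev_def tr by (simp add: fourier_def)
  qed
  have le1: "norm (?e x) \<le> 1" for x by simp
  \<comment> \<open>The value at \<open>real k\<close> is the value at \<open>0\<close> of the
    damped transform, so convergence in norm gives the limit. For both factors together this yields
    \<open>\<phi> 0 * \<psi> 0 = 1\<close>, so that the limiting constant is invertible.\<close>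
  have lim0: "(\<lambda>k. wev f \<phi> (of_real (real k))) \<longlonglongrightarrow> \<phi> 0" if p: "wpair {0<..} {0..} f \<phi>" "f 0 = 0" for f \<phi>
  proof (rule LIM_zero_cancel, rule Lim_null_comparison)
    show "(\<lambda>k. wnorm (\<lambda>x. damp (real k) x * f x - ?e x * f x) (\<lambda>x. damp (real k) x * \<phi> x - ?e x * \<phi> x)) \<longlonglongrightarrow> 0"
      by (rule damped_tendsto[OF p(1) damp_props(1) em _ far]) (auto intro: damp_props(2))
    have "norm (wev f \<phi> (of_real (real k)) - \<phi> 0) \<le> wnorm (\<lambda>x. damp (real k) x * f x - ?e x * f x) (\<lambda>x. damp (real k) x * \<phi> x - ?e x * \<phi> x)" for k
    proof -
      have a: "wpair {0<..} {0..} (\<lambda>x. damp (real k) x * f x) (\<lambda>x. damp (real k) x * \<phi> x)"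
        by (rule damped_pair(1)[OF p(1) damp_props(1)]) (rule damp_props(2); simp)
      have b: "wpair {0<..} {0..} (\<lambda>x. ?e x * f x) (\<lambda>x. ?e x * \<phi> x)"
        by (rule damped_pair(1)[OF p(1) em]) simp
      have z: "(0::complex) \<in> kernel_dom {0..}" by (simp add: kernel_dom_def)
      note d = wpair_diff[OF a b Ioi_le_Ico]
      have "wev (\<lambda>x. damp (real k) x * f x - ?e x * f x) (\<lambda>x. damp (real k) x * \<phi> x - ?e x * \<phi> x) 0 = wev f \<phi> (0 + of_real (real k)) - \<phi> 0"
        using d(2)[OF z] we[of f \<phi> 0, OF p(2)] by (simp add: wev_damp)
      then show ?thesis using norm_wev_le[OF d(1) Ioi_le_Ico z] by simp
    qed
    then show "\<forall>\<^sub>F k in sequentially. norm (wev f \<phi> (of_real (real k)) - \<phi> 0) \<le> wnorm (\<lambda>x. damp (real k) x * f x - ?e x * f x) (\<lambda>x. damp (real k) x * \<phi> x - ?e x * \<phi> x)"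
      by simp
  qed
  have "(\<lambda>k. wev f \<phi> (of_real (real k)) * wev g \<psi> (of_real (real k))) \<longlonglongrightarrow> \<phi> 0 * \<psi> 0"
    by (intro tendsto_mult lim0 p q f0)
  moreover have "wev f \<phi> (of_real (real k)) * wev g \<psi> (of_real (real k)) = 1" for k
    by (rule inv) (simp add: right_half_plane_def)
  ultimately have c1: "\<phi> 0 * \<psi> 0 = 1" by (simp add: LIMSEQ_const_iff)
  then have c0: "\<phi> 0 \<noteq> 0" by auto
  have bp: "wpair UNIV UNIV (\<lambda>x. ?e x * f x) (\<lambda>x. ?e x * \<phi> x)" "wpair UNIV UNIV (\<lambda>x. ?e x * g x) (\<lambda>x. ?e x * \<psi> x)"
    by (intro widen damped_pair(1)[OF _ em le1] p q)+
  have base: "windex (\<lambda>x. ?e x * f x) (\<lambda>x. ?e x * \<phi> x) 0 0"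
    unfolding windex_def tr we[of f, OF f0(1)]
  proof (intro conjI bp)
    have ca: "continuous_arg (\<lambda>y. \<phi> 0) (\<lambda>y. Arg (\<phi> 0))"
      using c0 by (auto simp: continuous_arg_def rcis_cmod_Arg)
    show "mean_arg (\<lambda>y. \<phi> 0) 0" by (rule mean_arg_bounded_arg[OF ca order_refl])
    have "continuous_arg (\<lambda>y. 1) (\<lambda>y. 0)" by (simp add: continuous_arg_cis)
    from windI[OF this tendsto_const, of 0] show "wind (\<lambda>y. \<phi> 0 / \<phi> 0) 0" using c0 by simp
  qed
  \<comment> \<open>The constant is the centre of the perturbation: for large \<open>k\<close> the
    damped pair is so close to it that both have the same index.\<close>
  have "(\<lambda>k. wnorm (\<lambda>x. damp (real k) x * f x - ?e x * f x) (\<lambda>x. damp (real k) x * \<phi> x - ?e x * \<phi> x)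
      * wnorm (\<lambda>x. ?e x * g x) (\<lambda>x. ?e x * \<psi> x)) \<longlonglongrightarrow> 0"
    by (rule tendsto_mult_left_zero[OF damped_tendsto[OF p damp_props(1) em _ far]]) (auto intro: damp_props(2))
  then have "\<forall>\<^sub>F k in sequentially. wnorm (\<lambda>x. damp (real k) x * f x - ?e x * f x) (\<lambda>x. damp (real k) x * \<phi> x - ?e x * \<phi> x)
      * wnorm (\<lambda>x. ?e x * g x) (\<lambda>x. ?e x * \<psi> x) < 1/2"
    by (rule order_tendstoD) simp
  then obtain k where k: "wnorm (\<lambda>x. damp (real k) x * f x - ?e x * f x) (\<lambda>x. damp (real k) x * \<phi> x - ?e x * \<phi> x)
      * wnorm (\<lambda>x. ?e x * g x) (\<lambda>x. ?e x * \<psi> x) < 1/2"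
    by (auto simp: eventually_sequentially)
  have "0 = w (real k) \<and> 0 = n (real k)"
    by (rule windex_perturb[OF base wn bp(2) _ k]) (simp_all add: we f0 c1)
  then have "V 0 = (0, 0)" using const[of "real k"] by (simp add: V_def)
  moreover have "?f 0 = f" "?\<phi> 0 = \<phi>" by (auto simp: damp_def)
  ultimately show ?thesis using wn[of 0] by (simp add: V_def)
qed

lemma index_zero_of_Aplus_unit:
  assumes "F \<in> Units Aplus" shows "W (boundary F) = (0, 0)"
proof -
  obtain G where FG: "F \<in> Aplus_fun" "G \<in> Aplus_fun" "(\<lambda>s\<in>right_half_plane. F s * G s) = (\<lambda>s\<in>right_half_plane. 1)"
    using assms by (auto simp: Units_def)
  obtain f \<phi> where p: "wpair {0<..} {0..} f \<phi>" "F = restrict (wev f \<phi>) right_half_plane"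
    using FG Aplus_fun_iff by metis
  obtain g \<psi> where q: "wpair {0<..} {0..} g \<psi>" "G = restrict (wev g \<psi>) right_half_plane"
    using FG Aplus_fun_iff by metis
  have "wev f \<phi> s * wev g \<psi> s = 1" if "s \<in> right_half_plane" for s
    using fun_cong[OF FG(3), of s] that p(2) q(2) by simp
  from index_zero_of_Aplus_inverse[OF p(1) q(1) this] have "windex f \<phi> 0 0" .
  moreover have "boundary F = restrict (wev f \<phi>) imag_axis"
    unfolding boundary_def p(2) using imag_axis_subset by (auto simp: restrict_def fun_eq_iff)
  ultimately show ?thesis using W_windex by simp
qed

theorem lemma5p8:
  fixes R :: "(complex \<Rightarrow> complex) set"
  assumes R: "full_subring R Aplus"
  shows "domain (Aplus\<lparr>carrier := R\<rparr>) \<and>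
         (comm_complex_banach_algebra A_alg A_norm \<and>
          semisimple_cring A_alg \<and>
          algebra_involution A_alg A_star \<and>
          boundary \<in> ring_hom (Aplus\<lparr>carrier := R\<rparr>) A_alg \<and>
          inj_on boundary R) \<and>
         ((\<forall>a\<in>Units A_alg. \<forall>b\<in>Units A_alg. W (a \<otimes>\<^bsub>A_alg\<^esub> b) = W a + W b) \<and>
          (\<forall>a\<in>Units A_alg. W (A_star a) = - W a) \<and>
          continuous_map
            (subtopology (Metric_space.mtopology (carrier A_alg) (norm_dist A_alg A_norm))
              (Units A_alg))
            (discrete_topology UNIV) W) \<and>
         (\<forall>x\<in>R. boundary x \<in> Units A_alg \<longrightarrow>
            (x \<in> Units (Aplus\<lparr>carrier := R\<rparr>) \<longleftrightarrow> W (boundary x) = (0, 0)))"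
proof -
  have sub: "subring R Aplus" and full: "\<And>x. x \<in> R \<Longrightarrow> x \<in> Units Aplus \<Longrightarrow> x \<in> Units (Aplus\<lparr>carrier := R\<rparr>)"
    using R by (auto simp: full_subring_def)
  have RA: "R \<subseteq> Aplus_fun" using subringE(1)[OF sub] by simp
  have units: "x \<in> Units Aplus" if "x \<in> Units (Aplus\<lparr>carrier := R\<rparr>)" for x
    using that RA by (auto simp: Units_def)
  \<comment> \<open>An inverse in \<open>R\<close> is one in \<open>Aplus\<close>; conversely,
    vanishing index produces an inverse in \<open>Aplus\<close>, and fullness brings it back to
    \<open>R\<close>.\<close>
  have "x \<in> Units (Aplus\<lparr>carrier := R\<rparr>) \<longleftrightarrow> W (boundary x) = (0, 0)"
    if "x \<in> R" "boundary x \<in> Units A_alg" for x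
    using that RA units full index_zero_of_Aplus_unit Aplus_unit_of_index_zero by blast
  then show ?thesis
    using domain.subring_is_domain[OF Aplus_domain sub] A_banach A_semisimple A_star_involution
      boundary_hom[OF RA] inj_on_subset[OF boundary_inj RA] W_mult W_star W_continuous
    by blast
qed

end
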